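(* Let $V_0$ be an operator system, and $S$ a self-adjoint spanning set for $V_0$ containing the unit. Then $$h^{\mathrm{top}}(V_0)=\sup_{\epsilon>0,\,E}\ \inf_{\delta,F}\ \limsup_{N\to\infty}\frac{1}{N^2}\log K^{\mathrm{orb}}_{E,\epsilon}\big(\Gamma^{(N,\mathrm{top})}(S,F,\delta),\|\cdot\|\big),$$ where $E$ ranges over finite subsets of $S$, $\delta>0$, and $F$ ranges over finite subsets of the disjoint union, over $m\ge1$, of the sets of finitely supported tuples in $M_m(\mathbb{C})^S$.
   Context: An operator system is a subspace $V_0$ of a unital $C^*$-algebra containing the unit and closed under $*$. $C^*_{\max}(V_0)$ is the universal (maximal) $C^*$-algebra of $V_0$: it is generated by a completely order isomorphic unital copy of $V_0$, and every u.c.p. map $V_0\to B(\mathscr{H})$ extends uniquely to a $*$-homomorphism $C^*_{\max}(V_0)\to B(\mathscr{H})$. By definition $h^{\mathrm{top}}(V_0):=h^{\mathrm{top}}(C^*_{\max}(V_0))$. Topological $1$-bounded entropy of a unital $C^*$-algebra $\mathscr{A}$: let $a=(a_i)_{i\in I}$ generate $\mathscr{A}$ as a unital $C^*$-algebra with $\|a_i\|\le C$ for all $i$. Let $\mathbb{C}^*\langle T_i\mid i\in I\rangle$ be the $*$-algebra of noncommutative complex polynomials in $T_i$ and formal adjoints. For finite $Q\subset\mathbb{C}^*\langle T_i\mid i\in I\rangle$ and $\delta>0$, $\Gamma_C^{(N,\mathrm{top})}(a;Q,\delta)=\{A\in M_N(\mathbb{C})^I:\|A_i\|\le C\ \forall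 i,\ \|P(A)\|\le\|P(a)\|+\delta\ \forall P\in Q\}$ (operator norm). For $\Omega\subset M_N(\mathbb{C})^I$, $E\subset I$ finite, $\epsilon>0$, $K^{\mathrm{orb}}_{E,\epsilon}(\Omega,\|\cdot\|)$ is the minimal cardinality of $\Omega_0\subset\Omega$ such that for each $D\in\Omega$ there are $B\in\Omega_0$ and a unitary $U\in U(N)$ with $\|D_i-UB_iU^*\|<\epsilon$ for all $i\in E$ (operator norm). Then $h^{\mathrm{top}}(\mathscr{A})=\sup_{\epsilon,E}\inf_{\delta,Q}\limsup_{N\to\infty}\frac1{N^2}\log K^{\mathrm{orb}}_{E,\epsilon}(\Gamma_C^{(N,\mathrm{top})}(a;Q,\delta),\|\cdot\|)$, with $\log0=-\infty$; it does not depend on the choice of $C$ and $a$. Operator system microstates: for $F$ and $\delta>0$ as in the claim, $\Gamma^{(N,\mathrm{top})}(S,F,\delta)$ is the set of tuples $(A_x)_{x\in S}$ of $N\times N$ complex matrices with $A_1=I_N$ such that $$\Big\|B_1\otimes 1+\sum_{x\in S\setminus\{1\}}B_x\otimes A_x\Big\|\le\delta+\Big\|B_1\otimes1+\sum_{x\in S\setminus\{1\}}B_x\otimes x\Big\|$$ for every $(B_x)_{x\in S}\in F$; the left norm is the operator norm on $M_m(\mathbb{C})\otimes M_N(\mathbb{C})$, the right norm is the norm on $M_m(V_0)$, where $(B_x)\in M_m(\mathbb{C})^S$. *)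

theory Defs
  imports
    "HOL-Analysis.Analysis"
    "HOL-Library.Poly_Mapping"
    "HOL-Library.Extended_Nat"
    "Jordan_Normal_Form.Matrix"
    "Jordan_Normal_Form.Schur_Decomposition"
begin

text \<open>HOL-Analysis has no complex vector spaces; compatibility of \<open>scaleC\<close> with \<open>scaleR\<close>
  supplies the remaining vector space law \<open>scaleC 1 x = x\<close>.\<close>

class unital_cstar_algebra = real_normed_algebra_1 + banach +
  fixes scaleC :: "complex \<Rightarrow> 'a \<Rightarrow> 'a"  (infixr "*\<^sub>C" 75)
    and adj :: "'a \<Rightarrow> 'a"
  assumes scaleC_add_right: "c *\<^sub>C (x + y) = c *\<^sub>C x + c *\<^sub>C y"
    and scaleC_add_left: "(c + d) *\<^sub>C x = c *\<^sub>C x + d *\<^sub>C x"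
    and scaleC_scaleC: "c *\<^sub>C (d *\<^sub>C x) = (c * d) *\<^sub>C x"
    and scaleC_of_real: "complex_of_real r *\<^sub>C x = scaleR r x"
    and scaleC_mult_left: "(c *\<^sub>C x) * y = c *\<^sub>C (x * y)"
    and scaleC_mult_right: "x * (c *\<^sub>C y) = c *\<^sub>C (x * y)"
    and norm_scaleC: "norm (c *\<^sub>C x) = cmod c * norm x"
    and adj_adj: "adj (adj x) = x"
    and adj_add: "adj (x + y) = adj x + adj y"
    and adj_scaleC: "adj (c *\<^sub>C x) = cnj c *\<^sub>C adj x"
    and adj_mult: "adj (x * y) = adj y * adj x"
    and cstar_identity: "norm (adj x * x) = (norm x)\<^sup>2"

lemma vector_space_scaleC:
  "vector_space (scaleC :: complex \<Rightarrow> 'a::unital_cstar_algebra \<Rightarrow> 'a)"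
proof
  fix x :: 'a
  show "1 *\<^sub>C x = x"
    using scaleC_of_real[of 1 x] by simp
qed (simp_all add: scaleC_add_right scaleC_add_left scaleC_scaleC)

abbreviation csubspace :: "'a::unital_cstar_algebra set \<Rightarrow> bool" where
  "csubspace \<equiv> Modules.module.subspace scaleC"

abbreviation cspan :: "'a::unital_cstar_algebra set \<Rightarrow> 'a set" where
  "cspan \<equiv> Modules.module.span scaleC"

definition cstar_subalgebra :: "'a::unital_cstar_algebra set \<Rightarrow> bool" where
  "cstar_subalgebra B \<longleftrightarrow> csubspace B \<and> closed B \<and> 1 \<in> B \<and>
     (\<forall>x\<in>B. \<forall>y\<in>B. x * y \<in> B) \<and> (\<forall>x\<in>B. adj x \<in> B)"

definition cstar_generates :: "'a::unital_cstar_algebra set \<Rightarrow> bool" where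
  "cstar_generates G \<longleftrightarrow> cstar_subalgebra hull G = UNIV"

definition operator_system :: "'a::unital_cstar_algebra set \<Rightarrow> bool" where
  "operator_system V \<longleftrightarrow> csubspace V \<and> 1 \<in> V \<and> (\<forall>x\<in>V. adj x \<in> V)"


subsection \<open>Matrices over a C*-algebra\<close>

definition star_mat :: "'a::unital_cstar_algebra mat \<Rightarrow> 'a mat" where
  "star_mat X = mat (dim_col X) (dim_row X) (\<lambda>(i, j). adj (X $$ (j, i)))"

definition mats_over :: "nat \<Rightarrow> 'a set \<Rightarrow> 'a mat set" where
  "mats_over n V = {X \<in> carrier_mat n n. elements_mat X \<subseteq> V}"

definition positive_mat :: "nat \<Rightarrow> 'a::unital_cstar_algebra mat \<Rightarrow> bool" where
  "positive_mat n X \<longleftrightarrow> (\<exists>Y \<in> carrier_mat n n. X = star_mat Y * Y)"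

text \<open>The C*-norm of \<open>M\<^sub>m(A)\<close>, realised as the operator norm of left multiplication by \<open>X\<close> on the
  Hilbert module \<open>A\<^sup>m\<close> of column vectors, with \<open>\<langle>b, c\<rangle> = \<Sum>\<^sub>j adj (b\<^sub>j) c\<^sub>j\<close>.\<close>

definition module_norm :: "'a::unital_cstar_algebra vec \<Rightarrow> real" where
  "module_norm b = sqrt (norm (\<Sum>j<dim_vec b. adj (b $ j) * (b $ j)))"

definition cstar_mat_norm :: "'a::unital_cstar_algebra mat \<Rightarrow> real" where
  "cstar_mat_norm X =
     Sup {module_norm (X *\<^sub>v b) | b. b \<in> carrier_vec (dim_col X) \<and> module_norm b \<le> 1}"


subsection \<open>Hilbert spaces and bounded operators\<close>

text \<open>Hilbert spaces are taken in the form \<open>\<ell>\<^sup>2(J)\<close>, with vectors extended by zero outside \<open>J\<close>;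
  operators are extended by zero outside \<open>\<ell>\<^sup>2(J)\<close>, so that equality of operators is equality
  of functions.\<close>

definition ell2 :: "'k set \<Rightarrow> ('k \<Rightarrow> complex) set" where
  "ell2 J = {\<xi>. (\<forall>k. k \<notin> J \<longrightarrow> \<xi> k = 0) \<and> (\<lambda>k. (cmod (\<xi> k))\<^sup>2) summable_on J}"

definition ell2_inner :: "'k set \<Rightarrow> ('k \<Rightarrow> complex) \<Rightarrow> ('k \<Rightarrow> complex) \<Rightarrow> complex" where
  "ell2_inner J \<xi> \<eta> = (\<Sum>\<^sub>\<infinity>k\<in>J. \<xi> k * cnj (\<eta> k))"

definition ell2_norm :: "'k set \<Rightarrow> ('k \<Rightarrow> complex) \<Rightarrow> real" where
  "ell2_norm J \<xi> = sqrt (\<Sum>\<^sub>\<infinity>k\<in>J. (cmod (\<xi> k))\<^sup>2)"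

type_synonym 'k op = "('k \<Rightarrow> complex) \<Rightarrow> ('k \<Rightarrow> complex)"

definition bounded_ops :: "'k set \<Rightarrow> 'k op set" where
  "bounded_ops J = {T.
     (\<forall>\<xi>. \<xi> \<notin> ell2 J \<longrightarrow> T \<xi> = (\<lambda>k. 0)) \<and>
     (\<forall>\<xi>\<in>ell2 J. T \<xi> \<in> ell2 J) \<and>
     (\<forall>\<xi>\<in>ell2 J. \<forall>\<eta>\<in>ell2 J. T (\<lambda>k. \<xi> k + \<eta> k) = (\<lambda>k. T \<xi> k + T \<eta> k)) \<and>
     (\<forall>c. \<forall>\<xi>\<in>ell2 J. T (\<lambda>k. c * \<xi> k) = (\<lambda>k. c * T \<xi> k)) \<and>
     (\<exists>K. \<forall>\<xi>\<in>ell2 J. ell2_norm J (T \<xi>) \<le> K * ell2_norm J \<xi>)}"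

definition id_op :: "'k set \<Rightarrow> 'k op" where
  "id_op J = (\<lambda>\<xi>. if \<xi> \<in> ell2 J then \<xi> else (\<lambda>k. 0))"

definition linear_to_ops ::
    "'a::unital_cstar_algebra set \<Rightarrow> 'k set \<Rightarrow> ('a \<Rightarrow> 'k op) \<Rightarrow> bool" where
  "linear_to_ops V J \<phi> \<longleftrightarrow>
     (\<forall>x\<in>V. \<phi> x \<in> bounded_ops J) \<and>
     (\<forall>x\<in>V. \<forall>y\<in>V. \<phi> (x + y) = (\<lambda>\<xi> k. \<phi> x \<xi> k + \<phi> y \<xi> k)) \<and>
     (\<forall>c. \<forall>x\<in>V. \<phi> (c *\<^sub>C x) = (\<lambda>\<xi> k. c * \<phi> x \<xi> k))"

definition positive_op_mat :: "'k set \<Rightarrow> 'k op mat \<Rightarrow> bool" where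
  "positive_op_mat J X \<longleftrightarrow>
     (\<forall>\<xi> \<in> {..<dim_col X} \<rightarrow> ell2 J.
        (\<Sum>i<dim_row X. \<Sum>j<dim_col X. ell2_inner J ((X $$ (i, j)) (\<xi> j)) (\<xi> i)) \<in> \<real>\<^sub>\<ge>\<^sub>0)"

definition ucp_to_ops ::
    "'a::unital_cstar_algebra set \<Rightarrow> 'k set \<Rightarrow> ('a \<Rightarrow> 'k op) \<Rightarrow> bool" where
  "ucp_to_ops V J \<phi> \<longleftrightarrow> linear_to_ops V J \<phi> \<and> \<phi> 1 = id_op J \<and>
     (\<forall>n. \<forall>X \<in> mats_over n V. positive_mat n X \<longrightarrow> positive_op_mat J (map_mat \<phi> X))"

definition star_hom_to_ops :: "'k set \<Rightarrow> ('b::unital_cstar_algebra \<Rightarrow> 'k op) \<Rightarrow> bool" where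
  "star_hom_to_ops J \<pi> \<longleftrightarrow> linear_to_ops UNIV J \<pi> \<and>
     (\<forall>x y. \<pi> (x * y) = \<pi> x \<circ> \<pi> y) \<and>
     (\<forall>x. \<forall>\<xi>\<in>ell2 J. \<forall>\<eta>\<in>ell2 J. ell2_inner J (\<pi> x \<xi>) \<eta> = ell2_inner J \<xi> (\<pi> (adj x) \<eta>))"


subsection \<open>The maximal C*-algebra of an operator system\<close>

definition unital_complete_order_embedding ::
    "'a::unital_cstar_algebra set \<Rightarrow> ('a \<Rightarrow> 'b::unital_cstar_algebra) \<Rightarrow> bool" where
  "unital_complete_order_embedding V \<iota> \<longleftrightarrow>
     (\<forall>x\<in>V. \<forall>y\<in>V. \<iota> (x + y) = \<iota> x + \<iota> y) \<and>
     (\<forall>c. \<forall>x\<in>V. \<iota> (c *\<^sub>C x) = c *\<^sub>C \<iota> x) \<and>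
     inj_on \<iota> V \<and> \<iota> 1 = 1 \<and>
     (\<forall>n. \<forall>X \<in> mats_over n V. positive_mat n (map_mat \<iota> X) \<longleftrightarrow> positive_mat n X)"

text \<open>\<open>is_cstar_max V \<iota>\<close>: the C*-algebra \<open>'b\<close>, together with \<open>\<iota> : V \<rightarrow> 'b\<close>, is the maximal
  C*-algebra of \<open>V\<close>.

  HOL cannot quantify over Hilbert spaces of unbounded dimension inside a formula, so the test
  spaces are the \<open>\<ell>\<^sup>2(J)\<close> with \<open>J\<close> a set of elements of the C*-algebra containing \<open>V\<close>. This loses
  nothing: for a ucp map \<open>\<phi>\<close> into operators on an arbitrary Hilbert space \<open>H\<close>, \<open>H\<close> is an orthogonal
  sum of subspaces cyclic for the C*-algebra generated by \<open>\<phi>(V)\<close>, each of dimension at most the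
  cardinality of \<open>V\<close>, and \<open>\<phi>\<close> extends as soon as its compressions to these subspaces do.\<close>

definition is_cstar_max ::
    "'a::unital_cstar_algebra set \<Rightarrow> ('a \<Rightarrow> 'b::unital_cstar_algebra) \<Rightarrow> bool" where
  "is_cstar_max V \<iota> \<longleftrightarrow>
     unital_complete_order_embedding V \<iota> \<and>
     cstar_generates (\<iota> ` V) \<and>
     (\<forall>(J :: 'a set) \<phi>. ucp_to_ops V J \<phi> \<longrightarrow>
        (\<exists>!\<pi>. star_hom_to_ops J \<pi> \<and> (\<forall>x\<in>V. \<pi> (\<iota> x) = \<phi> x)))"


subsection \<open>Complex matrices\<close>

definition op_norm :: "complex mat \<Rightarrow> real" where
  "op_norm A = Sup {L2_set (\<lambda>i. cmod ((A *\<^sub>v v) $ i)) {..<dim_row A} | v.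
     v \<in> carrier_vec (dim_col A) \<and> L2_set (\<lambda>j. cmod (v $ j)) {..<dim_col A} \<le> 1}"

definition unitary_mats :: "nat \<Rightarrow> complex mat set" where
  "unitary_mats N =
     {U \<in> carrier_mat N N. U * mat_adjoint U = 1\<^sub>m N \<and> mat_adjoint U * U = 1\<^sub>m N}"

definition kronecker :: "complex mat \<Rightarrow> complex mat \<Rightarrow> complex mat" where
  "kronecker B A = mat (dim_row B * dim_row A) (dim_col B * dim_col A)
     (\<lambda>(i, j). B $$ (i div dim_row A, j div dim_col A) * A $$ (i mod dim_row A, j mod dim_col A))"


subsection \<open>Orbital covering numbers\<close>

text \<open>The infimum over the empty set is \<open>\<infinity>\<close>, the value when no finite \<open>\<Omega>\<^sub>0\<close> exists.\<close>

definition orbit_covering_number ::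
    "nat \<Rightarrow> 'i set \<Rightarrow> real \<Rightarrow> ('i \<Rightarrow> complex mat) set \<Rightarrow> enat" where
  "orbit_covering_number N E \<epsilon> \<Omega> = Inf {enat (card \<Omega>\<^sub>0) | \<Omega>\<^sub>0. finite \<Omega>\<^sub>0 \<and> \<Omega>\<^sub>0 \<subseteq> \<Omega> \<and>
     (\<forall>D\<in>\<Omega>. \<exists>B\<in>\<Omega>\<^sub>0. \<exists>U\<in>unitary_mats N. \<forall>i\<in>E. op_norm (D i - U * B i * mat_adjoint U) < \<epsilon>)}"

definition log_enat :: "enat \<Rightarrow> ereal" where
  "log_enat k = (case k of enat n \<Rightarrow> if n = 0 then -\<infinity> else ereal (ln (real n)) | \<infinity> \<Rightarrow> \<infinity>)"

definition orbit_entropy_rate ::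
    "'i set \<Rightarrow> real \<Rightarrow> (nat \<Rightarrow> ('i \<Rightarrow> complex mat) set) \<Rightarrow> ereal" where
  "orbit_entropy_rate E \<epsilon> \<Omega> =
     limsup (\<lambda>N. ereal (1 / (real N)\<^sup>2) * log_enat (orbit_covering_number N E \<epsilon> (\<Omega> N)))"


subsection \<open>Topological 1-bounded entropy of a C*-algebra\<close>

datatype 'i letter = Gen 'i | Gen_adj 'i

text \<open>Noncommutative *-polynomials are finitely supported families of coefficients indexed by
  words in the generators and their formal adjoints.\<close>

type_synonym 'i star_poly = "'i letter list \<Rightarrow>\<^sub>0 complex"

definition star_polys :: "'i set \<Rightarrow> 'i star_poly set" where
  "star_polys I = {P. \<forall>w \<in> Poly_Mapping.keys P. set w \<subseteq> Gen ` I \<union> Gen_adj ` I}"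

fun eval_letter :: "('i \<Rightarrow> 'b::unital_cstar_algebra) \<Rightarrow> 'i letter \<Rightarrow> 'b" where
  "eval_letter a (Gen i) = a i"
| "eval_letter a (Gen_adj i) = adj (a i)"

definition eval_poly :: "('i \<Rightarrow> 'b::unital_cstar_algebra) \<Rightarrow> 'i star_poly \<Rightarrow> 'b" where
  "eval_poly a P = (\<Sum>w\<in>Poly_Mapping.keys P.
     Poly_Mapping.lookup P w *\<^sub>C prod_list (map (eval_letter a) w))"

fun eval_letter_mat :: "('i \<Rightarrow> complex mat) \<Rightarrow> 'i letter \<Rightarrow> complex mat" where
  "eval_letter_mat A (Gen i) = A i"
| "eval_letter_mat A (Gen_adj i) = mat_adjoint (A i)"

definition eval_word_mat :: "nat \<Rightarrow> ('i \<Rightarrow> complex mat) \<Rightarrow> 'i letter list \<Rightarrow> complex mat" where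
  "eval_word_mat N A w = foldr (\<lambda>l X. eval_letter_mat A l * X) w (1\<^sub>m N)"

definition eval_poly_mat :: "nat \<Rightarrow> ('i \<Rightarrow> complex mat) \<Rightarrow> 'i star_poly \<Rightarrow> complex mat" where
  "eval_poly_mat N A P = mat N N (\<lambda>(i, j). \<Sum>w\<in>Poly_Mapping.keys P.
     Poly_Mapping.lookup P w * eval_word_mat N A w $$ (i, j))"

definition microstates ::
    "'i set \<Rightarrow> ('i \<Rightarrow> 'b::unital_cstar_algebra) \<Rightarrow> real \<Rightarrow> 'i star_poly set \<Rightarrow> real \<Rightarrow> nat
      \<Rightarrow> ('i \<Rightarrow> complex mat) set" where
  "microstates I a C Q \<delta> N = {A \<in> I \<rightarrow>\<^sub>E carrier_mat N N.
     (\<forall>i\<in>I. op_norm (A i) \<le> C) \<and>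
     (\<forall>P\<in>Q. op_norm (eval_poly_mat N A P) \<le> norm (eval_poly a P) + \<delta>)}"

text \<open>\<open>h\<^sup>t\<^sup>o\<^sup>p\<close> of the C*-algebra \<open>'b\<close>, computed from a generating tuple \<open>a\<close> bounded by \<open>C\<close>.\<close>

definition htop ::
    "'i set \<Rightarrow> ('i \<Rightarrow> 'b::unital_cstar_algebra) \<Rightarrow> real \<Rightarrow> ereal" where
  "htop I a C =
     (SUP (\<epsilon>, E) \<in> {0<..} \<times> {E. finite E \<and> E \<subseteq> I}.
      INF (\<delta>, Q) \<in> {0<..} \<times> {Q. finite Q \<and> Q \<subseteq> star_polys I}.
        orbit_entropy_rate E \<epsilon> (microstates I a C Q \<delta>))"


subsection \<open>Operator system microstates\<close>

definition matrix_tuples :: "'a set \<Rightarrow> (nat \<times> ('a \<Rightarrow> complex mat)) set" where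
  "matrix_tuples S = {(m, B). m \<ge> 1 \<and> B \<in> S \<rightarrow>\<^sub>E carrier_mat m m \<and>
     finite {x \<in> S. B x \<noteq> 0\<^sub>m m m}}"

text \<open>\<open>B\<^sub>1 \<otimes> 1 + \<Sum>\<^sub>x B\<^sub>x \<otimes> A\<^sub>x\<close> in \<open>M\<^sub>m\<^sub>N(\<complex>)\<close> and \<open>B\<^sub>1 \<otimes> 1 + \<Sum>\<^sub>x B\<^sub>x \<otimes> x\<close> in \<open>M\<^sub>m(V)\<close>, with
  the sums, over \<open>x \<in> S\<close> different from the unit, restricted to the finite support of \<open>B\<close>.\<close>

definition pencil_mat ::
    "'a::unital_cstar_algebra set \<Rightarrow> nat \<Rightarrow> nat \<Rightarrow> ('a \<Rightarrow> complex mat) \<Rightarrow> ('a \<Rightarrow> complex mat)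
      \<Rightarrow> complex mat" where
  "pencil_mat S m N B A = mat (m * N) (m * N) (\<lambda>(i, j).
     kronecker (B 1) (1\<^sub>m N) $$ (i, j) +
     (\<Sum>x\<in>{x \<in> S - {1}. B x \<noteq> 0\<^sub>m m m}. kronecker (B x) (A x) $$ (i, j)))"

definition pencil_sys ::
    "'a::unital_cstar_algebra set \<Rightarrow> nat \<Rightarrow> ('a \<Rightarrow> complex mat) \<Rightarrow> 'a mat" where
  "pencil_sys S m B = mat m m (\<lambda>(i, j).
     (B 1 $$ (i, j)) *\<^sub>C 1 +
     (\<Sum>x\<in>{x \<in> S - {1}. B x \<noteq> 0\<^sub>m m m}. (B x $$ (i, j)) *\<^sub>C x))"

definition system_microstates ::
    "'a::unital_cstar_algebra set \<Rightarrow> (nat \<times> ('a \<Rightarrow> complex mat)) set \<Rightarrow> real \<Rightarrow> nat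
      \<Rightarrow> ('a \<Rightarrow> complex mat) set" where
  "system_microstates S F \<delta> N = {A \<in> S \<rightarrow>\<^sub>E carrier_mat N N.
     A 1 = 1\<^sub>m N \<and>
     (\<forall>(m, B)\<in>F. op_norm (pencil_mat S m N B A) \<le> \<delta> + cstar_mat_norm (pencil_sys S m B))}"

end

theory Submission
  imports Defs
begin

text \<open>
  Both sides are suprema over \<open>(\<epsilon>, E)\<close> of infima, over a directed family of spaces of matrix tuples,
  of the same orbital covering rate. On the left the tuples model the generators \<open>a\<close> of the maximal
  C*-algebra, on the right they model the elements \<open>\<iota> x\<close> for \<open>x \<in> S\<close>, which generate the same algebra.
  Two generating tuples \<open>a\<close> and \<open>b\<close> are related by noncommutative *-polynomials, \<open>b\<^sub>j \<approx> p\<^sub>j(a)\<close> and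
  \<open>a\<^sub>i \<approx> q\<^sub>i(b)\<close>, and a covering of the tuples \<open>p(A)\<close> yields one of the tuples \<open>A\<close>. Therefore each
  of the two inequalities holds (\<open>entropy_le_of_approximants\<close>) as soon as

  \<^item> every *-polynomial \<open>t\<close> satisfies \<open>\<parallel>t(A)\<parallel> \<le> \<parallel>t(a)\<parallel> + \<eta>\<close> on the source microstates for good parameters,
    uniformly in the matrix size;
  \<^item> \<open>p(A)\<close> is a target microstate whenever \<open>A\<close> is a good source microstate.

  For the microstates of a C*-algebra the first condition is the definition, and the second one amounts
  to composing polynomials (\<open>poly_states_target\<close>). For the microstates of an operator system they
  are the two halves of the universal property of the maximal C*-algebra.

  \<^emph>\<open>Norm bounds\<close> (\<open>sys_state_bound\<close>). In a fixed matrix size \<open>d\<close>, suppose that \<open>\<parallel>t(A)\<parallel> > \<parallel>t(\<iota>)\<parallel> + \<eta>\<close> for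
  arbitrarily good microstates. By compactness they cluster at a map \<open>G\<close> from \<open>S\<close> to the \<open>d \<times> d\<close> matrices
  that increases the norm of no pencil. Such a map extends to a unital completely contractive, hence
  completely positive, map on the operator system, hence to a *-homomorphism \<open>\<pi>\<close> of its maximal
  C*-algebra, and \<open>\<parallel>t(G)\<parallel> = \<parallel>\<pi>(t(\<iota>))\<parallel> \<le> \<parallel>t(\<iota>)\<parallel>\<close>, a contradiction. The bound becomes uniform in the matrix
  size because the computation of \<open>t(A) u\<close> for one vector \<open>u\<close> only passes through a number of vectors
  bounded in terms of \<open>t\<close>: compressing \<open>A\<close> to their span preserves \<open>t(A) u\<close>, and compressions of
  operator system microstates are again microstates for the same parameters.

  \<^emph>\<open>Target condition\<close> (\<open>pencil_approximation\<close>). If a pencil \<open>P\<close> over the operator system has norm less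
  than \<open>c\<close>, the block matrix with rows \<open>(c, P)\<close> and \<open>(P*, c)\<close> is positive. The complete order embedding
  \<open>\<iota>\<close> turns it into \<open>y* y\<close> with a matrix \<open>y\<close> over the maximal C*-algebra. Replacing \<open>y\<close> and the
  elements \<open>\<iota> x\<close> by polynomials in \<open>a\<close> makes this identity a statement about finitely many polynomials
  of small norm. Their values at a good microstate \<open>A\<close> are small, so the corresponding block matrix
  over \<open>A\<close> is almost positive, which bounds the norm of the pencil evaluated at \<open>p(A)\<close>.

  The C*-algebraic facts behind this (square roots, positivity of \<open>y* y\<close>, Cauchy--Schwarz in the
  Hilbert module of column vectors) are derived from the C*-identity and a
  square root iteration.
\<close>

section \<open>The order of a C*-algebra\<close>

interpretation cvec: vector_space "scaleC :: complex \<Rightarrow> 'a::unital_cstar_algebra \<Rightarrow> 'a"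
  by (rule vector_space_scaleC)

lemma adj_zero [simp]: "adj (0::'a::unital_cstar_algebra) = 0"
  using adj_add[of "0::'a" 0] by simp

lemma adj_one [simp]: "adj (1::'a::unital_cstar_algebra) = 1"
  using adj_mult[of "1::'a" "adj 1"] by (simp add: adj_adj)

lemma adj_uminus: "adj (- (x::'a::unital_cstar_algebra)) = - adj x"
  using adj_add[of x "-x"] by (simp add: eq_neg_iff_add_eq_0 add.commute)

lemma adj_diff: "adj (x - (y::'a::unital_cstar_algebra)) = adj x - adj y"
  using adj_add[of x "-y"] by (simp add: adj_uminus)

lemma adj_scaleR: "adj (r *\<^sub>R (x::'a::unital_cstar_algebra)) = r *\<^sub>R adj x"
  using adj_scaleC[of "complex_of_real r" x] by (simp add: scaleC_of_real)

lemma adj_of_real [simp]: "adj (of_real r :: 'a::unital_cstar_algebra) = of_real r"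
  by (simp add: of_real_def adj_scaleR)

lemma adj_sum: "adj (sum f A) = (\<Sum>i\<in>A. adj (f i :: 'a::unital_cstar_algebra))"
  by (induction A rule: infinite_finite_induct) (simp_all add: adj_add)

lemma norm_adj [simp]: "norm (adj (x::'a::unital_cstar_algebra)) = norm x"
proof -
  have le: "norm y \<le> norm (adj y)" for y :: 'a
  proof (cases "y = 0")
    case False
    have "(norm y)\<^sup>2 \<le> norm (adj y) * norm y"
      using cstar_identity[of y] norm_mult_ineq[of "adj y" y] by simp
    with False show ?thesis by (simp add: power2_eq_square)
  qed simp
  show ?thesis using le[of x] le[of "adj x"] by (simp add: adj_adj)
qed

lemma norm_square_selfadjoint:
  "adj (h::'a::unital_cstar_algebra) = h \<Longrightarrow> norm (h * h) = (norm h)\<^sup>2"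
  using cstar_identity[of h] by simp

lemma bounded_linear_adj: "bounded_linear (adj :: 'a::unital_cstar_algebra \<Rightarrow> 'a)"
  by (rule bounded_linear_intro[where K = 1]) (simp_all add: adj_add adj_scaleR)

lemma continuous_adj: "(f \<longlongrightarrow> (l::'a::unital_cstar_algebra)) F \<Longrightarrow> ((\<lambda>x. adj (f x)) \<longlongrightarrow> adj l) F"
  by (rule bounded_linear.tendsto[OF bounded_linear_adj])

lemma adj_mult_eq_0: "adj x * x = 0 \<Longrightarrow> (x::'a::unital_cstar_algebra) = 0"
  using cstar_identity[of x] by simp

text \<open>The real model of the iteration \<open>u \<mapsto> (z + u\<^sup>2)/2\<close> with \<open>\<parallel>z\<parallel> \<le> 1\<close>. It increases to \<open>1\<close>, and it majorises the
  norms and the increments of that iteration, which therefore converges in any Banach algebra, even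
  for \<open>\<parallel>z\<parallel> = 1\<close>. The limit \<open>w\<close> satisfies \<open>(1 - w)\<^sup>2 = 1 - z\<close>.\<close>
definition half_square_seq :: "nat \<Rightarrow> real" where
  "half_square_seq = rec_nat 0 (\<lambda>_ r. (1 + r * r) / 2)"

lemma half_square_seq_simps [simp]:
  "half_square_seq 0 = 0"
  "half_square_seq (Suc n) = (1 + half_square_seq n * half_square_seq n) / 2"
  by (simp_all add: half_square_seq_def)

lemma half_square_seq_bounds: "0 \<le> half_square_seq n" "half_square_seq n \<le> 1"
proof (induction n)
  case (Suc n)
  have "half_square_seq n * half_square_seq n \<le> 1 * 1"
    using Suc by (intro mult_mono) auto
  with Suc show "0 \<le> half_square_seq (Suc n)" "half_square_seq (Suc n) \<le> 1" by auto
qed auto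

lemma half_square_seq_mono: "half_square_seq n \<le> half_square_seq (Suc n)"
  using sum_squares_ge_zero[of "1 - half_square_seq n" 0]
  by (simp add: algebra_simps)

lemma summable_half_square_seq:
  "summable (\<lambda>n. half_square_seq (Suc n) - half_square_seq n)"
proof -
  have "convergent half_square_seq"
    by (rule Bseq_mono_convergent)
      (auto intro!: BseqI'[of _ 1] half_square_seq_bounds incseq_SucI half_square_seq_mono
        simp: abs_if not_less half_square_seq_bounds simp del: half_square_seq_simps
        dest: order.strict_trans1[OF half_square_seq_bounds(1)] intro: incseqD)
  then show ?thesis
    by (metis convergent_def telescope_summable)
qed

lemma convergent_of_half_square_majorant:
  fixes u :: "nat \<Rightarrow> 'a::banach"
  assumes "\<And>n. norm (u (Suc n) - u n) \<le> half_square_seq (Suc n) - half_square_seq n"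
  shows "convergent u"
proof -
  have "summable (\<lambda>n. norm (u (Suc n) - u n))"
    by (rule summable_comparison_test'[OF summable_half_square_seq]) (use assms in simp)
  then have "summable (\<lambda>n. u (Suc n) - u n)"
    by (rule summable_norm_cancel)
  then have "convergent (\<lambda>n. \<Sum>i<n. u (Suc i) - u i)"
    by (simp add: summable_iff_convergent)
  then have "convergent (\<lambda>n. u n - u 0)"
    by (simp add: sum_lessThan_telescope)
  then show ?thesis
    using convergent_add[OF _ convergent_const[of "u 0"]] by force
qed

text \<open>The square root is \<open>1 - w\<close> for the limit \<open>w\<close> of the iteration with \<open>z = 1 - h\<close>. The iterates are polynomials
  in \<open>h\<close>, which gives the commutation property.\<close>
lemma sqrt_unit_ball_exists:
  fixes h :: "'a::unital_cstar_algebra"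
  assumes h: "norm (1 - h) \<le> 1" and sa: "adj h = h"
  shows "\<exists>s. adj s = s \<and> s * s = h \<and> norm (1 - s) \<le> 1 \<and> (\<forall>y. y * h = h * y \<longrightarrow> y * s = s * y)"
proof -
  define z where "z = 1 - h"
  define u where "u = rec_nat (0::'a) (\<lambda>_ u. (1/2) *\<^sub>R (z + u * u))"
  have u0: "u 0 = 0" and uS: "\<And>n. u (Suc n) = (1/2) *\<^sub>R (z + u n * u n)"
    by (simp_all add: u_def)
  have z: "norm z \<le> 1" "adj z = z" using h sa by (simp_all add: z_def adj_diff)
  have nu: "norm (u n) \<le> half_square_seq n" for n
  proof (induction n)
    case (Suc n)
    have "norm (z + u n * u n) \<le> 1 + half_square_seq n * half_square_seq n"
      using z Suc half_square_seq_bounds[of n]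
      by (intro norm_triangle_mono norm_mult_ineq[THEN order_trans] mult_mono) auto
    then show ?case by (simp add: uS)
  qed (simp add: u0)
  have comm: "y * u n = u n * y" if "y * z = z * y" for y n
  proof (induction n)
    case (Suc n)
    have "y * (u n * u n) = (u n * u n) * y"
      using Suc by (metis mult.assoc)
    then show ?case using that by (simp add: uS distrib_left distrib_right)
  qed (simp add: u0)
  have cu: "u m * u n = u n * u m" for m n
    by (metis comm)
  have du: "norm (u (Suc n) - u n) \<le> half_square_seq (Suc n) - half_square_seq n" for n
  proof (induction n)
    case 0 then show ?case using z by (simp add: uS u0)
  next
    case (Suc n)
    let ?r = half_square_seq
    have "u (Suc (Suc n)) - u (Suc n) = (1/2) *\<^sub>R ((u (Suc n) - u n) * (u (Suc n) + u n))"
      unfolding uS[of "Suc n"] uS[of n, symmetric]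
      by (subst (3) uS) (simp add: algebra_simps cu[of "Suc n" n])
    then have "norm (u (Suc (Suc n)) - u (Suc n)) \<le> (1/2) * (norm (u (Suc n) - u n) * norm (u (Suc n) + u n))"
      by (simp add: norm_mult_ineq)
    also have "\<dots> \<le> (1/2) * ((?r (Suc n) - ?r n) * (?r (Suc n) + ?r n))"
      using Suc nu[of n] nu[of "Suc n"] half_square_seq_mono[of n]
      by (intro mult_left_mono mult_mono norm_triangle_mono) auto
    also have "\<dots> = ?r (Suc (Suc n)) - ?r (Suc n)"
      unfolding half_square_seq_simps(2)[of "Suc n"] by (subst (5) half_square_seq_simps(2)) (simp add: field_simps)
    finally show ?case .
  qed
  obtain w where w: "u \<longlonglongrightarrow> w"
    using convergent_of_half_square_majorant[OF du] by (auto simp: convergent_def)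
  have weq: "w = (1/2) *\<^sub>R (z + w * w)"
  proof (rule LIMSEQ_unique[OF LIMSEQ_Suc[OF w]])
    show "(\<lambda>n. u (Suc n)) \<longlonglongrightarrow> (1/2) *\<^sub>R (z + w * w)"
      unfolding uS by (intro tendsto_intros w)
  qed
  have nw: "norm w \<le> 1"
    by (rule LIMSEQ_le_const2[OF tendsto_norm[OF w]])
      (use nu half_square_seq_bounds(2) order_trans in blast)
  have cw: "y * w = w * y" if "y * z = z * y" for y
  proof (rule LIMSEQ_unique)
    show "(\<lambda>n. y * u n) \<longlonglongrightarrow> y * w" by (intro tendsto_intros w)
    show "(\<lambda>n. y * u n) \<longlonglongrightarrow> w * y" unfolding comm[OF that] by (intro tendsto_intros w)
  qed
  have "adj (u n) = u n" for n
    by (induction n) (simp_all add: u0 uS adj_scaleR adj_add adj_mult z)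
  then have sw: "adj w = w"
    using LIMSEQ_unique[OF continuous_adj[OF w]] w by simp
  have "2 *\<^sub>R w = z + w * w" using arg_cong[OF weq, of "\<lambda>x. 2 *\<^sub>R x"] by simp
  then have "(1 - w) * (1 - w) = h"
    by (simp add: algebra_simps z_def scaleR_2)
  moreover have "y * (1 - w) = (1 - w) * y" if "y * h = h * y" for y
    using cw[of y] that by (simp add: algebra_simps z_def)
  moreover have "adj (1 - w) = 1 - w" by (simp add: adj_diff sw)
  moreover have "norm (1 - (1 - w)) \<le> 1" using nw by simp
  ultimately show ?thesis by blast
qed

text \<open>The condition says that the spectrum of \<open>h\<close> lies in \<open>[0, 2 t]\<close>. In this form closure under sums is the
  triangle inequality, and after scaling by \<open>t\<close> the square root lemma applies directly.\<close>
definition cstar_pos :: "'a::unital_cstar_algebra \<Rightarrow> bool" where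
  "cstar_pos h \<longleftrightarrow> adj h = h \<and> (\<exists>t\<ge>0. norm (of_real t - h) \<le> t)"

lemma cstar_pos_selfadjoint: "cstar_pos h \<Longrightarrow> adj h = h"
  by (simp add: cstar_pos_def)

lemma cstar_pos_0 [simp]: "cstar_pos 0"
  by (auto simp: cstar_pos_def intro: exI[of _ 0])

lemma cstar_pos_add: "cstar_pos h \<Longrightarrow> cstar_pos k \<Longrightarrow> cstar_pos (h + k)"
proof -
  assume "cstar_pos h" "cstar_pos k"
  then obtain s t where st: "s \<ge> 0" "t \<ge> 0" "norm (of_real s - h) \<le> s" "norm (of_real t - k) \<le> t"
    and sa: "adj h = h" "adj k = k"
    by (auto simp: cstar_pos_def)
  have "norm (of_real (s + t) - (h + k)) \<le> s + t"
    using norm_triangle_mono[OF st(3,4)] by (simp add: algebra_simps)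
  then show ?thesis using st sa by (auto simp: cstar_pos_def adj_add intro!: exI[of _ "s + t"])
qed

lemma cstar_pos_scaleR: "cstar_pos h \<Longrightarrow> c \<ge> 0 \<Longrightarrow> cstar_pos (c *\<^sub>R h)"
proof -
  assume "cstar_pos h" and c: "c \<ge> 0"
  then obtain t where t: "t \<ge> 0" "norm (of_real t - h) \<le> t" and sa: "adj h = h"
    by (auto simp: cstar_pos_def)
  have "of_real (c * t) - c *\<^sub>R h = c *\<^sub>R (of_real t - h)"
    by (simp add: of_real_def scaleR_diff_right)
  then have "norm (of_real (c * t) - c *\<^sub>R h) \<le> c * t"
    using t c by (simp add: mult_left_mono)
  then show ?thesis using t sa c by (auto simp: cstar_pos_def adj_scaleR intro!: exI[of _ "c * t"])
qed

lemma cstar_pos_sum: "(\<And>i. i \<in> A \<Longrightarrow> cstar_pos (f i)) \<Longrightarrow> cstar_pos (sum f A)"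
  by (induction A rule: infinite_finite_induct) (simp_all add: cstar_pos_add)

lemma cstar_pos_of_norm_le:
  assumes "adj k = k" "norm k \<le> t"
  shows "cstar_pos (of_real t - k)" "cstar_pos (of_real t + k)"
proof -
  have "t \<ge> 0" using assms(2) norm_ge_zero order_trans by blast
  then show "cstar_pos (of_real t - k)" "cstar_pos (of_real t + k)"
    using assms by (auto simp: cstar_pos_def adj_diff adj_add intro!: exI[of _ t])
qed

lemma cstar_pos_sqrt:
  assumes "cstar_pos h"
  shows "\<exists>s. cstar_pos s \<and> s * s = h \<and> (\<forall>y. y * h = h * y \<longrightarrow> y * s = s * y)"
proof -
  obtain t where t: "t \<ge> 0" "norm (of_real t - h) \<le> t" and sa: "adj h = h"
    using assms by (auto simp: cstar_pos_def)
  show ?thesis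
  proof (cases "t = 0")
    case True
    then show ?thesis using t by (intro exI[of _ 0]) auto
  next
    case False
    then have tp: "t > 0" using t by simp
    define k where "k = (1/t) *\<^sub>R h"
    have "1 - k = (1/t) *\<^sub>R (of_real t - h)"
      using tp by (simp add: k_def of_real_def scaleR_diff_right)
    then have "norm (1 - k) \<le> 1" using t tp by (simp add: divide_le_eq)
    moreover have "adj k = k" by (simp add: k_def adj_scaleR sa)
    ultimately obtain s where s: "adj s = s" "s * s = k" "norm (1 - s) \<le> 1"
      "\<And>y. y * k = k * y \<Longrightarrow> y * s = s * y"
      using sqrt_unit_ball_exists by metis
    have "cstar_pos s" using s(1,3) by (auto simp: cstar_pos_def intro!: exI[of _ 1])
    then have "cstar_pos (sqrt t *\<^sub>R s)" using tp by (simp add: cstar_pos_scaleR)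
    moreover have "(sqrt t *\<^sub>R s) * (sqrt t *\<^sub>R s) = h"
      using tp by (simp add: s(2)) (simp add: k_def)
    moreover have "y * (sqrt t *\<^sub>R s) = (sqrt t *\<^sub>R s) * y" if "y * h = h * y" for y
      using s(4)[of y] that by (simp add: k_def)
    ultimately show ?thesis by blast
  qed
qed

text \<open>Normalise \<open>s\<close> to \<open>x\<close> with \<open>\<parallel>x\<parallel> = 1\<close> and let \<open>r\<^sup>2 = 1 - x\<^sup>2\<close>. Then \<open>u = r + \<i> x\<close> satisfies \<open>u* u = 1\<close>, so
  its real part \<open>r\<close> is a contraction and \<open>\<parallel>1 - x\<^sup>2\<parallel> = \<parallel>r\<parallel>\<^sup>2 \<le> 1\<close>.\<close>
lemma cstar_pos_square:
  assumes sa: "adj (s::'a::unital_cstar_algebra) = s"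
  shows "cstar_pos (s * s)"
proof (cases "s = 0")
  case False
  define x where "x = (1 / norm s) *\<^sub>R s"
  have x: "adj x = x" "norm x = 1" using False by (simp_all add: x_def adj_scaleR sa)
  define k where "k = 1 - x * x"
  have "norm (1 - k) \<le> 1" "adj k = k"
    using x by (simp_all add: k_def norm_square_selfadjoint adj_diff adj_mult)
  then obtain r where r: "adj r = r" "r * r = k" "\<And>y. y * k = k * y \<Longrightarrow> y * r = r * y"
    using sqrt_unit_ball_exists[of k] by metis
  have "x * k = k * x" by (simp add: k_def algebra_simps)
  then have xr: "x * r = r * x" by (rule r)
  define u where "u = r + \<i> *\<^sub>C x"
  have au: "adj u = r - \<i> *\<^sub>C x"
    by (simp add: u_def adj_add adj_scaleC r(1) x)
  have "adj u * u = r * r + x * x"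
    unfolding au by (simp add: u_def algebra_simps scaleC_mult_left scaleC_mult_right xr scaleC_scaleC)
  then have "adj u * u = 1" by (simp add: r(2) k_def)
  then have "(norm u)\<^sup>2 = 1" using cstar_identity[of u] by simp
  then have nu: "norm u = 1" using norm_ge_zero[of u] by (simp add: power2_eq_1_iff)
  have "2 *\<^sub>R r = u + adj u" unfolding au by (simp add: u_def scaleR_2)
  then have "norm (2 *\<^sub>R r) \<le> 2" using norm_triangle_ineq[of u "adj u"] nu by simp
  then have "norm r \<le> 1" by simp
  then have "norm (1 - x * x) \<le> 1"
    using norm_square_selfadjoint[OF r(1)] by (simp add: r(2) k_def power_le_one)
  then have "cstar_pos (x * x)"
    using x by (auto simp: cstar_pos_def adj_mult intro!: exI[of _ 1])
  then have "cstar_pos ((norm s)\<^sup>2 *\<^sub>R (x * x))" by (rule cstar_pos_scaleR) simp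
  then show ?thesis using False by (simp add: x_def power2_eq_square)
qed simp

text \<open>With \<open>a\<^sup>2 = t - h\<close> and \<open>b\<^sup>2 = t + h\<close> the element \<open>u = a + \<i> b\<close> satisfies \<open>u* u = 2 t\<close> and
  \<open>u\<^sup>2 + (u*)\<^sup>2 = -4 h\<close>, so \<open>4 \<parallel>h\<parallel> \<le> 2 \<parallel>u\<parallel>\<^sup>2 = 4 t\<close>.\<close>
lemma norm_le_of_cstar_pos:
  assumes m: "cstar_pos (of_real t - h)" and p: "cstar_pos (of_real t + h)"
  shows "norm (h::'a::unital_cstar_algebra) \<le> t"
proof -
  obtain a where a: "cstar_pos a" "a * a = of_real t - h" "\<And>y. y * (of_real t - h) = (of_real t - h) * y \<Longrightarrow> y * a = a * y"
    using cstar_pos_sqrt[OF m] by metis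
  obtain b where b: "cstar_pos b" "b * b = of_real t + h" "\<And>y. y * (of_real t + h) = (of_real t + h) * y \<Longrightarrow> y * b = b * y"
    using cstar_pos_sqrt[OF p] by metis
  have h: "h = of_real t - a * a" using a(2) by simp
  have "a * (of_real t + h) = (of_real t + h) * a"
    unfolding h by (simp add: of_real_def algebra_simps)
  then have ab: "a * b = b * a" by (rule b)
  define u where "u = a + \<i> *\<^sub>C b"
  have au: "adj u = a - \<i> *\<^sub>C b"
    by (simp add: u_def adj_add adj_scaleC cstar_pos_selfadjoint a(1) b(1))
  have "adj u * u = a * a + b * b"
    unfolding au by (simp add: u_def algebra_simps scaleC_mult_left scaleC_mult_right ab scaleC_scaleC)
  also have "\<dots> = of_real t + of_real t" unfolding a(2) b(2) by simp
  also have "\<dots> = (of_real (2 * t) :: 'a)" by (simp only: of_real_add[symmetric] mult_2)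
  finally have "norm (adj u * u) = \<bar>2 * t\<bar>" by (simp only: norm_of_real)
  then have nu2: "(norm u)\<^sup>2 = \<bar>2 * t\<bar>" by (simp only: cstar_identity)
  have "u * u + adj u * adj u = 2 *\<^sub>R (a * a - b * b)"
    unfolding au by (simp add: u_def algebra_simps scaleC_mult_left scaleC_mult_right ab scaleC_scaleC scaleR_2)
  also have "\<dots> = - 4 *\<^sub>R h" unfolding a(2) b(2) by (simp add: algebra_simps flip: scaleR_add_left)
  finally have "4 * norm h = norm (u * u + adj u * adj u)" by simp
  also have "\<dots> \<le> norm u * norm u + norm u * norm u"
    using norm_mult_ineq[of u u] norm_mult_ineq[of "adj u" "adj u"] by (intro norm_triangle_mono) auto
  also have "\<dots> = 4 * \<bar>t\<bar>" using nu2 by (simp add: power2_eq_square abs_mult)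
  finally have "norm h \<le> \<bar>t\<bar>" by simp
  moreover have "t \<ge> 0"
  proof (rule ccontr)
    assume "\<not> t \<ge> 0"
    have "of_real t - h + (of_real t + h) = of_real t + of_real t" by simp
    also have "\<dots> = (of_real (2 * t) :: 'a)" by (simp only: of_real_add[symmetric] mult_2)
    finally have "cstar_pos (of_real (2 * t) :: 'a)"
      using cstar_pos_add[OF m p] by (simp only:)
    then obtain r where r: "r \<ge> 0" "norm (of_real r - of_real (2 * t) :: 'a) \<le> r"
      by (auto simp: cstar_pos_def)
    have "norm (of_real r - of_real (2 * t) :: 'a) = \<bar>r - 2 * t\<bar>"
      by (simp only: of_real_diff[symmetric] norm_of_real)
    then show False using r \<open>\<not> t \<ge> 0\<close> by linarith
  qed
  ultimately show ?thesis by simp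
qed

lemma norm_mono_cstar_pos:
  assumes h: "cstar_pos h" and k: "cstar_pos (k - h)"
  shows "norm h \<le> norm k"
proof (rule norm_le_of_cstar_pos)
  have sa: "adj h = h" using h by (rule cstar_pos_selfadjoint)
  have "adj k = k" using cstar_pos_selfadjoint[OF k] sa by (simp add: adj_diff)
  then have "cstar_pos (of_real (norm k) - k)" by (rule cstar_pos_of_norm_le) simp
  from cstar_pos_add[OF this k] show "cstar_pos (of_real (norm k) - h)" by simp
  have "cstar_pos (of_real (norm k) :: 'a)"
    using cstar_pos_of_norm_le[of "0::'a" "norm k"] by simp
  from cstar_pos_add[OF this h] show "cstar_pos (of_real (norm k) + h)" .
qed

text \<open>Otherwise normalise \<open>z\<close> to \<open>y\<close> with \<open>\<parallel>y\<parallel> = 1\<close>, so that \<open>p = y y*\<close> is positive of norm \<open>1\<close>. From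
  \<open>p + p\<^sup>2 = y (1 + y* y) y*\<close> and \<open>0 \<le> 1 + y* y \<le> 1\<close> the norm of \<open>p + p\<^sup>2\<close> is at most \<open>1\<close>. But \<open>p \<le> 1\<close> gives
  \<open>2 p\<^sup>2 \<le> p + p\<^sup>2\<close>, and \<open>\<parallel>2 p\<^sup>2\<parallel> = 2\<close>.\<close>
lemma eq_0_of_opposite_pos:
  assumes p: "cstar_pos (z * adj z)" and k: "cstar_pos (- (adj z * z))"
  shows "z = (0::'a::unital_cstar_algebra)"
proof (rule ccontr)
  assume "z \<noteq> 0"
  define y where "y = (1 / norm z) *\<^sub>R z"
  define p where "p = y * adj y"
  have ny: "norm y = 1" using \<open>z \<noteq> 0\<close> by (simp add: y_def)
  have sc: "p = (1 / (norm z)\<^sup>2) *\<^sub>R (z * adj z)" "- (adj y * y) = (1 / (norm z)\<^sup>2) *\<^sub>R (- (adj z * z))"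
    by (simp_all add: p_def y_def adj_scaleR power2_eq_square)
  have pp: "cstar_pos p" and kk: "cstar_pos (- (adj y * y))"
    unfolding sc by (rule cstar_pos_scaleR[OF p], simp, rule cstar_pos_scaleR[OF k], simp)
  have np: "norm p = 1" using cstar_identity[of "adj y"] ny by (simp add: p_def adj_adj)
  have sp: "adj p = p" using pp by (rule cstar_pos_selfadjoint)
  have n1: "norm (1 + adj y * y) \<le> 1"
  proof (rule norm_le_of_cstar_pos)
    show "cstar_pos (of_real 1 - (1 + adj y * y))" using kk by simp
    have "cstar_pos (of_real 1 + adj y * y)"
      by (rule cstar_pos_of_norm_le) (simp_all add: adj_mult adj_adj cstar_identity ny)
    moreover have "cstar_pos (of_real 1 :: 'a)" using cstar_pos_of_norm_le[of "0::'a" 1] by simp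
    ultimately show "cstar_pos (of_real 1 + (1 + adj y * y))"
      using cstar_pos_add by fastforce
  qed
  have "p + p * p = y * ((1 + adj y * y) * adj y)"
    by (simp add: p_def algebra_simps)
  then have "norm (p + p * p) = norm (y * ((1 + adj y * y) * adj y))" by simp
  then have "norm (p + p * p) \<le> norm y * (norm (1 + adj y * y) * norm (adj y))"
    using norm_mult_ineq[of y "(1 + adj y * y) * adj y"]
      mult_left_mono[OF norm_mult_ineq[of "1 + adj y * y" "adj y"] norm_ge_zero[of y]] by linarith
  then have le1: "norm (p + p * p) \<le> 1" using n1 ny by simp
  have "cstar_pos (1 - p)" using cstar_pos_of_norm_le(1)[OF sp, of 1] np by simp
  then obtain r where r: "cstar_pos r" "r * r = 1 - p" "\<And>y. y * (1 - p) = (1 - p) * y \<Longrightarrow> y * r = r * y"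
    using cstar_pos_sqrt by metis
  obtain q where q: "cstar_pos q" "q * q = p" "\<And>y. y * p = p * y \<Longrightarrow> y * q = q * y"
    using cstar_pos_sqrt[OF pp] by metis
  have "q * (1 - p) = (1 - p) * q" by (simp add: q(2)[symmetric] algebra_simps)
  then have qr: "q * r = r * q" by (rule r)
  have "(q * r) * (q * r) = q * (r * q) * r" by (simp only: mult.assoc)
  also have "\<dots> = (q * q) * (r * r)" by (simp only: qr[symmetric] mult.assoc)
  also have "\<dots> = (p + p * p) - 2 *\<^sub>R (p * p)" by (simp add: q(2) r(2) algebra_simps scaleR_2)
  finally have "cstar_pos ((p + p * p) - 2 *\<^sub>R (p * p))"
    using cstar_pos_square[of "q * r"] q(1) r(1) qr
    by (simp add: adj_mult cstar_pos_selfadjoint)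
  moreover have "cstar_pos (2 *\<^sub>R (p * p))" using sp by (intro cstar_pos_scaleR cstar_pos_square) auto
  ultimately have "norm (2 *\<^sub>R (p * p)) \<le> 1" using norm_mono_cstar_pos le1 order_trans by blast
  then show False using norm_square_selfadjoint[OF sp] np by simp
qed

text \<open>Kaplansky's theorem. Let \<open>m = \<bar>h\<bar>\<close> for \<open>h = y* y\<close>, and let \<open>v = m - h\<close> be twice the negative part of \<open>h\<close>. For
  \<open>z = y v\<close> the element \<open>- z* z = v\<^sup>2 m\<close> is positive, and \<open>z z* = (a\<^sup>2 + b\<^sup>2)/2 - z* z\<close>, with \<open>a\<close> and \<open>b\<close> twice the
  real and (up to sign) the imaginary part of \<open>z\<close>, is positive too. Hence \<open>z = 0\<close>, which forces \<open>v = 0\<close>.\<close>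
theorem cstar_pos_adj_mult: "cstar_pos (adj y * (y::'a::unital_cstar_algebra))"
proof -
  define h where "h = adj y * y"
  have sh: "adj h = h" by (simp add: h_def adj_mult adj_adj)
  obtain m where m: "cstar_pos m" "m * m = h * h" "\<And>y. y * (h * h) = (h * h) * y \<Longrightarrow> y * m = m * y"
    using cstar_pos_sqrt[OF cstar_pos_square[OF sh]] by metis
  obtain s where s: "cstar_pos s" "s * s = m" "\<And>y. y * m = m * y \<Longrightarrow> y * s = s * y"
    using cstar_pos_sqrt[OF m(1)] by metis
  have hm: "h * m = m * h" by (rule m) (simp add: mult.assoc)
  then have hs: "h * s = s * h" by (rule s)
  define v where "v = m - h"
  have sv: "adj v = v" using m(1) sh by (simp add: v_def adj_diff cstar_pos_selfadjoint)
  have vs: "v * s = s * v" using hs by (simp add: v_def algebra_simps s(2)[symmetric])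
  have vz: "v * (m + h) = 0" by (simp add: v_def algebra_simps m(2) hm)
  have vh: "v * h = - (v * m)" using vz by (simp add: distrib_left eq_neg_iff_add_eq_0 add.commute)
  define z where "z = y * v"
  have mv: "m * v = v * m" by (simp add: v_def algebra_simps hm)
  have zz: "adj z * z = - (v * s * (v * s))"
  proof -
    have "adj z * z = v * h * v" by (simp add: z_def adj_mult sv h_def mult.assoc)
    also have "\<dots> = - (v * v * m)" by (simp add: vh mult.assoc mv)
    also have "v * v * m = v * (v * s) * s" by (simp only: s(2)[symmetric] mult.assoc)
    also have "\<dots> = v * (s * v) * s" by (simp only: vs)
    also have "\<dots> = v * s * (v * s)" by (simp only: mult.assoc)
    finally show ?thesis .
  qed
  have ss: "adj (v * s) = v * s" using s(1) by (simp add: adj_mult sv vs cstar_pos_selfadjoint)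
  then have k: "cstar_pos (- (adj z * z))" unfolding zz using cstar_pos_square by simp
  define a where "a = z + adj z"
  define b where "b = \<i> *\<^sub>C (z - adj z)"
  have sab: "adj a = a" "adj b = b"
    by (simp_all add: a_def b_def adj_add adj_scaleC adj_diff adj_adj add.commute cvec.scale_right_diff_distrib)
  have "z * adj z = (1/2) *\<^sub>R (a * a + b * b) + (- (adj z * z))"
  proof -
    have "a * a + b * b = 2 *\<^sub>R (z * adj z + adj z * z)"
      by (simp add: a_def b_def scaleC_mult_left scaleC_mult_right scaleC_scaleC algebra_simps scaleR_2)
    then show ?thesis by simp
  qed
  moreover have "cstar_pos ((1/2) *\<^sub>R (a * a + b * b) + (- (adj z * z)))"
    by (intro cstar_pos_add cstar_pos_scaleR cstar_pos_square sab k) simp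
  ultimately have "cstar_pos (z * adj z)" by simp
  then have "z = 0" using k by (rule eq_0_of_opposite_pos)
  then have "v * h * v = 0" by (simp add: z_def h_def mult.assoc)
  have "v * v * v = v * v * m - v * v * h" by (simp add: v_def algebra_simps)
  also have "v * v * h = - (v * v * m)" by (metis vh mult.assoc mult_minus_right)
  also have "v * v * m = - (v * h * v)" by (simp add: vh mult.assoc mv)
  finally have "v * v * v = 0" using \<open>v * h * v = 0\<close> by simp
  then have "adj (v * v) * (v * v) = 0" by (simp add: adj_mult sv mult.assoc)
  then have "v * v = 0" by (rule adj_mult_eq_0)
  then have "v = 0" using adj_mult_eq_0[of v] sv by simp
  then show ?thesis using m(1) by (simp add: v_def h_def)
qed

lemma cstar_pos_conj: "cstar_pos h \<Longrightarrow> cstar_pos (adj y * h * y)"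
proof -
  assume "cstar_pos h"
  then obtain s where s: "cstar_pos s" "s * s = h" using cstar_pos_sqrt by blast
  have "adj y * h * y = adj (s * y) * (s * y)"
    using s by (simp add: adj_mult cstar_pos_selfadjoint mult.assoc flip: s(2))
  then show ?thesis by (simp add: cstar_pos_adj_mult)
qed

lemma cstar_pos_norm_bound: "cstar_pos (of_real ((norm y)\<^sup>2) - adj y * (y::'a::unital_cstar_algebra))"
  by (rule cstar_pos_of_norm_le) (simp_all add: adj_mult adj_adj cstar_identity)

section \<open>Matrices over a C*-algebra\<close>

text \<open>Column vectors over the C*-algebra are functions on \<open>nat\<close> of which only the first \<open>n\<close> values count, and matrices
  are binary such functions. This keeps block decompositions free of dimension side conditions.\<close>
definition mip :: "nat \<Rightarrow> (nat \<Rightarrow> 'a::unital_cstar_algebra) \<Rightarrow> (nat \<Rightarrow> 'a) \<Rightarrow> 'a" where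
  "mip n b c = (\<Sum>i<n. adj (b i) * c i)"

definition mnorm :: "nat \<Rightarrow> (nat \<Rightarrow> 'a::unital_cstar_algebra) \<Rightarrow> real" where
  "mnorm n b = sqrt (norm (mip n b b))"

lemma mip_add_right: "mip n b (\<lambda>i. c i + d i) = mip n b c + mip n b d"
  by (simp add: mip_def distrib_left sum.distrib)

lemma mip_diff_right: "mip n b (\<lambda>i. c i - d i) = mip n b c - mip n b d"
  by (simp add: mip_def right_diff_distrib sum_subtractf)

lemma mip_add_left: "mip n (\<lambda>i. c i + d i) b = mip n c b + mip n d b"
  by (simp add: mip_def distrib_right sum.distrib adj_add)

lemma mip_diff_left: "mip n (\<lambda>i. c i - d i) b = mip n c b - mip n d b"
  by (simp add: mip_def left_diff_distrib sum_subtractf adj_diff)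

lemma mip_mult_right: "mip n b (\<lambda>i. c i * x) = mip n b c * x"
  by (simp add: mip_def sum_distrib_right mult.assoc)

lemma mip_mult_left: "mip n (\<lambda>i. c i * x) b = adj x * mip n c b"
  by (simp add: mip_def sum_distrib_left mult.assoc adj_mult)

lemma adj_mip: "adj (mip n b c) = mip n c b"
  by (simp add: mip_def adj_sum adj_mult adj_adj)

lemma mip_pos: "cstar_pos (mip n b b)"
  by (simp add: mip_def cstar_pos_sum cstar_pos_adj_mult)

lemma mnorm_nonneg [simp]: "0 \<le> mnorm n b"
  by (simp add: mnorm_def)

lemma mnorm_square: "(mnorm n b)\<^sup>2 = norm (mip n b b)"
  by (simp add: mnorm_def)

lemma norm_component_le_mnorm: "i < n \<Longrightarrow> norm (b i) \<le> mnorm n b"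
proof -
  assume i: "i < n"
  have "cstar_pos (mip n b b - adj (b i) * b i)"
    using i by (simp add: mip_def sum.remove[of "{..<n}" i] cstar_pos_sum cstar_pos_adj_mult)
  then have "norm (adj (b i) * b i) \<le> norm (mip n b b)"
    by (rule norm_mono_cstar_pos[OF cstar_pos_adj_mult])
  then show ?thesis
    by (simp add: cstar_identity mnorm_def real_le_rsqrt)
qed

text \<open>As for scalars: with \<open>x = \<langle>a, b\<rangle>\<close> and \<open>t = \<parallel>\<langle>a, a\<rangle>\<parallel>\<close>, expand \<open>\<langle>a x - t b, a x - t b\<rangle> \<ge> 0\<close> and use
  \<open>x* \<langle>a, a\<rangle> x \<le> t x* x\<close> to get \<open>x* x \<le> t \<langle>b, b\<rangle>\<close>.\<close>
lemma mip_Cauchy_Schwarz: "norm (mip n a b) \<le> mnorm n a * mnorm n b"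
proof (cases "mip n a a = 0")
  case True
  then have "a i = 0" if "i < n" for i
    using norm_component_le_mnorm[OF that, of a] by (simp add: mnorm_def)
  then show ?thesis by (simp add: mip_def)
next
  case False
  define t where "t = norm (mip n a a)"
  have t: "t > 0" using False by (simp add: t_def)
  define x where "x = mip n a b"
  have ax: "mip n b a = adj x" by (simp add: x_def adj_mip)
  define w where "w = (\<lambda>i. a i * x - b i * of_real t)"
  have "mip n w w = adj x * mip n a a * x - (2 * t) *\<^sub>R (adj x * x) + (t * t) *\<^sub>R mip n b b"
    unfolding w_def
    by (simp add: mip_diff_left mip_diff_right mip_mult_left mip_mult_right ax x_def[symmetric]
        mult.assoc) (simp add: of_real_def algebra_simps scaleR_add_left[symmetric])
  moreover have "cstar_pos (adj x * (of_real t - mip n a a) * x)"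
    by (intro cstar_pos_conj cstar_pos_of_norm_le adj_mip) (simp add: t_def)
  ultimately have "cstar_pos (adj x * (of_real t - mip n a a) * x
      + (adj x * mip n a a * x - (2 * t) *\<^sub>R (adj x * x) + (t * t) *\<^sub>R mip n b b))"
    using mip_pos[of n w] by (metis cstar_pos_add)
  also have "adj x * (of_real t - mip n a a) * x
      + (adj x * mip n a a * x - (2 * t) *\<^sub>R (adj x * x) + (t * t) *\<^sub>R mip n b b)
      = t *\<^sub>R (t *\<^sub>R mip n b b - adj x * x)"
    by (simp add: of_real_def algebra_simps) (simp add: scaleR_add_left[symmetric])
  finally have "cstar_pos ((1/t) *\<^sub>R (t *\<^sub>R (t *\<^sub>R mip n b b - adj x * x)))"
    by (rule cstar_pos_scaleR) (use t in simp)
  then have "cstar_pos (t *\<^sub>R mip n b b - adj x * x)" using t by simp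
  then have "norm (adj x * x) \<le> norm (t *\<^sub>R mip n b b)"
    by (rule norm_mono_cstar_pos[OF cstar_pos_adj_mult])
  then have "(norm x)\<^sup>2 \<le> (mnorm n a * mnorm n b)\<^sup>2"
    using t by (simp add: cstar_identity power_mult_distrib mnorm_square t_def)
  then show ?thesis
    unfolding x_def by (rule power2_le_imp_le) simp
qed

lemma mnorm_triangle: "mnorm n (\<lambda>i. b i + c i) \<le> mnorm n b + mnorm n c"
proof (rule power2_le_imp_le)
  have "mip n (\<lambda>i. b i + c i) (\<lambda>i. b i + c i) = mip n b b + mip n b c + (mip n c b + mip n c c)"
    by (simp add: mip_add_left mip_add_right)
  then have "(mnorm n (\<lambda>i. b i + c i))\<^sup>2 \<le> norm (mip n b b) + norm (mip n b c) + (norm (mip n c b) + norm (mip n c c))"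
    unfolding mnorm_square by (simp only:) (rule norm_triangle_mono[OF norm_triangle_ineq norm_triangle_ineq])
  also have "\<dots> \<le> (mnorm n b)\<^sup>2 + mnorm n b * mnorm n c + (mnorm n c * mnorm n b + (mnorm n c)\<^sup>2)"
    by (intro add_mono mip_Cauchy_Schwarz) (simp_all add: mnorm_square)
  also have "\<dots> = (mnorm n b + mnorm n c)\<^sup>2"
    by (simp add: power2_eq_square algebra_simps)
  finally show "(mnorm n (\<lambda>i. b i + c i))\<^sup>2 \<le> (mnorm n b + mnorm n c)\<^sup>2" .
qed simp

lemma mnorm_scaleR: "mnorm n (\<lambda>i. r *\<^sub>R b i) = \<bar>r\<bar> * mnorm n b"
proof -
  have "mip n (\<lambda>i. r *\<^sub>R b i) (\<lambda>i. r *\<^sub>R b i) = (r * r) *\<^sub>R mip n b b"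
    by (simp add: mip_def adj_scaleR scaleR_sum_right)
  then show ?thesis by (simp add: mnorm_def abs_mult real_sqrt_mult)
qed

lemma mnorm_cong: "(\<And>i. i < n \<Longrightarrow> b i = c i) \<Longrightarrow> mnorm n b = mnorm n c"
  by (simp add: mnorm_def mip_def)

definition mv :: "nat \<Rightarrow> (nat \<Rightarrow> nat \<Rightarrow> 'a::semiring_0) \<Rightarrow> (nat \<Rightarrow> 'a) \<Rightarrow> nat \<Rightarrow> 'a" where
  "mv n X b = (\<lambda>i. \<Sum>k<n. X i k * b k)"

definition mm :: "nat \<Rightarrow> (nat \<Rightarrow> nat \<Rightarrow> 'a::semiring_0) \<Rightarrow> (nat \<Rightarrow> nat \<Rightarrow> 'a) \<Rightarrow> nat \<Rightarrow> nat \<Rightarrow> 'a" where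
  "mm n X Y = (\<lambda>i j. \<Sum>k<n. X i k * Y k j)"

definition mstar :: "(nat \<Rightarrow> nat \<Rightarrow> 'a::unital_cstar_algebra) \<Rightarrow> nat \<Rightarrow> nat \<Rightarrow> 'a" where
  "mstar X = (\<lambda>i j. adj (X j i))"

text \<open>An upper bound for the operator norm on the Hilbert module. Working with bounds instead of the norm itself,
  which is a supremum, makes the algebra of estimates additive and multiplicative without
  attainment arguments.\<close>
definition mbound :: "nat \<Rightarrow> (nat \<Rightarrow> nat \<Rightarrow> 'a::unital_cstar_algebra) \<Rightarrow> real \<Rightarrow> bool" where
  "mbound n X c \<longleftrightarrow> 0 \<le> c \<and> (\<forall>b. mnorm n (mv n X b) \<le> c * mnorm n b)"

lemma mv_mm: "mv n (mm n X Y) b = mv n X (mv n Y b)"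
proof
  fix i
  have "(\<Sum>k<n. (\<Sum>l<n. X i l * Y l k) * b k) = (\<Sum>k<n. \<Sum>l<n. X i l * (Y l k * b k))"
    by (simp add: sum_distrib_right mult.assoc)
  also have "\<dots> = (\<Sum>l<n. X i l * (\<Sum>k<n. Y l k * b k))"
    by (subst sum.swap) (simp add: sum_distrib_left)
  finally show "mv n (mm n X Y) b i = mv n X (mv n Y b) i" by (simp add: mv_def mm_def)
qed

lemma mm_assoc: "mm n (mm n X Y) Z = mm n X (mm n Y Z)"
  using mv_mm[of n X Y "\<lambda>k. Z k _"] by (auto simp: mm_def mv_def fun_eq_iff)

lemma mip_mv: "mip n a (mv n X b) = mip n (mv n (mstar X) a) b"
proof -
  have "mip n a (mv n X b) = (\<Sum>i<n. \<Sum>k<n. adj (a i) * X i k * b k)"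
    by (simp add: mip_def mv_def sum_distrib_left mult.assoc)
  also have "\<dots> = (\<Sum>k<n. (\<Sum>i<n. adj (a i) * X i k) * b k)"
    by (subst sum.swap) (simp add: sum_distrib_right)
  also have "\<dots> = mip n (mv n (mstar X) a) b"
    by (simp add: mip_def mv_def mstar_def adj_sum adj_mult adj_adj)
  finally show ?thesis .
qed

lemma mboundD: "mbound n X c \<Longrightarrow> mnorm n (mv n X b) \<le> c * mnorm n b"
  and mbound_nonneg: "mbound n X c \<Longrightarrow> 0 \<le> c"
  by (auto simp: mbound_def)

lemma mbound_add: "mbound n X c \<Longrightarrow> mbound n Y d \<Longrightarrow> mbound n (\<lambda>i j. X i j + Y i j) (c + d)"
  unfolding mbound_def
proof (intro conjI allI)
  fix b
  assume XY: "0 \<le> c \<and> (\<forall>b. mnorm n (mv n X b) \<le> c * mnorm n b)"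
    "0 \<le> d \<and> (\<forall>b. mnorm n (mv n Y b) \<le> d * mnorm n b)"
  have "mv n (\<lambda>i j. X i j + Y i j) b = (\<lambda>i. mv n X b i + mv n Y b i)"
    by (simp add: mv_def distrib_right sum.distrib)
  then have "mnorm n (mv n (\<lambda>i j. X i j + Y i j) b) \<le> mnorm n (mv n X b) + mnorm n (mv n Y b)"
    by (simp add: mnorm_triangle)
  also have "\<dots> \<le> c * mnorm n b + d * mnorm n b" using XY by (intro add_mono) auto
  finally show "mnorm n (mv n (\<lambda>i j. X i j + Y i j) b) \<le> (c + d) * mnorm n b"
    by (simp add: distrib_right)
qed auto

lemma mbound_scaleR: "mbound n X c \<Longrightarrow> mbound n (\<lambda>i j. r *\<^sub>R X i j) (\<bar>r\<bar> * c)"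
proof -
  assume X: "mbound n X c"
  have "mv n (\<lambda>i j. r *\<^sub>R X i j) b = (\<lambda>i. r *\<^sub>R mv n X b i)" for b
    by (simp add: mv_def scaleR_sum_right)
  then show ?thesis
    using X by (auto simp: mbound_def mnorm_scaleR mult.assoc mult_left_mono)
qed

lemma mbound_mult: "mbound n X c \<Longrightarrow> mbound n Y d \<Longrightarrow> mbound n (mm n X Y) (c * d)"
  unfolding mbound_def mv_mm
  by (metis (no_types, opaque_lifting) mult.assoc mult_left_mono mult_nonneg_nonneg order_trans)

lemma mbound_mono: "mbound n X c \<Longrightarrow> c \<le> d \<Longrightarrow> mbound n X d"
  unfolding mbound_def by (meson mnorm_nonneg mult_right_mono order_trans)

lemma mbound_zero: "mbound n (\<lambda>i j. 0) 0"
  by (simp add: mbound_def mv_def mnorm_def mip_def)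

lemma mnorm_unit: "j < n \<Longrightarrow> mnorm n (\<lambda>k. if k = j then 1 else 0) = 1"
proof -
  assume j: "j < n"
  have "mip n (\<lambda>k. if k = j then 1 else 0) (\<lambda>k. if k = j then 1 else (0::'a))
      = (\<Sum>k<n. if k = j then 1 else 0)"
    unfolding mip_def by (rule sum.cong) auto
  then show ?thesis using j by (simp add: mnorm_def)
qed

lemma norm_entry_le_mbound:
  assumes X: "mbound n X c" and ij: "i < n" "j < n"
  shows "norm (X i j) \<le> c"
proof -
  let ?e = "\<lambda>k. if k = j then 1 else (0::'a)"
  have "mv n X ?e i = (\<Sum>k<n. if k = j then X i k else 0)"
    unfolding mv_def by (rule sum.cong) auto
  then have "norm (X i j) = norm (mv n X ?e i)" using ij by simp
  also have "\<dots> \<le> mnorm n (mv n X ?e)" by (rule norm_component_le_mnorm[OF ij(1)])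
  also have "\<dots> \<le> c" using mboundD[OF X, of ?e] ij by (simp add: mnorm_unit)
  finally show ?thesis .
qed

lemma mbound_mstar:
  assumes X: "mbound n X c" shows "mbound n (mstar X) c"
  unfolding mbound_def
proof (intro conjI allI)
  fix b
  let ?y = "mv n (mstar X) b"
  have "(mnorm n ?y)\<^sup>2 = norm (mip n b (mv n X ?y))" by (simp add: mnorm_square mip_mv)
  also have "\<dots> \<le> mnorm n b * (c * mnorm n ?y)"
    using mip_Cauchy_Schwarz[of n b "mv n X ?y"] mult_left_mono[OF mboundD[OF X, of ?y] mnorm_nonneg[of n b]]
    by linarith
  finally have "mnorm n ?y * mnorm n ?y \<le> (c * mnorm n b) * mnorm n ?y"
    by (simp add: power2_eq_square ac_simps)
  then show "mnorm n ?y \<le> c * mnorm n b"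
    by (cases "mnorm n ?y = 0") (use mbound_nonneg[OF X] in \<open>simp_all add: mult_le_cancel_right\<close>,
        metis mnorm_nonneg linorder_not_le order_antisym)
qed (rule mbound_nonneg[OF X])

text \<open>The iteration of \<open>sqrt_unit_ball_exists\<close> run in the matrix algebra, with the operator norm replaced by
  \<open>mbound\<close>; entries are dominated by the operator norm, so the iterates converge entrywise.\<close>
lemma half_square_fixpoint_exists:
  fixes z :: "nat \<Rightarrow> nat \<Rightarrow> 'a::unital_cstar_algebra"
  assumes z: "mbound n z 1" and sz: "mstar z = z"
  shows "\<exists>w. mstar w = w \<and> (\<forall>i<n. \<forall>j<n. 2 *\<^sub>R w i j = z i j + mm n w w i j)"
proof -
  let ?r = half_square_seq
  define u where "u = rec_nat (\<lambda>i j. 0::'a) (\<lambda>_ u i j. (1/2) *\<^sub>R (z i j + mm n u u i j))"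
  have u0: "u 0 = (\<lambda>i j. 0)" and uS: "\<And>m. u (Suc m) = (\<lambda>i j. (1/2) *\<^sub>R (z i j + mm n (u m) (u m) i j))"
    by (simp_all add: u_def)
  have bu: "mbound n (u m) (?r m)" for m
  proof (induction m)
    case (Suc m)
    have "mbound n (\<lambda>i j. (1/2) *\<^sub>R (z i j + mm n (u m) (u m) i j)) (\<bar>1/2\<bar> * (1 + ?r m * ?r m))"
      by (intro mbound_scaleR mbound_add z mbound_mult Suc)
    then show ?case by (simp add: uS)
  qed (simp add: u0 mbound_zero)
  have comm: "mm n y (u m) = mm n (u m) y" if "mm n y z = mm n z y" for y m
  proof (induction m)
    case (Suc m)
    have "mm n y (mm n (u m) (u m)) = mm n (mm n (u m) (u m)) y"
      using Suc by (metis mm_assoc)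
    with that show ?case
      by (simp add: uS mm_def fun_eq_iff distrib_left distrib_right sum.distrib scaleR_sum_right[symmetric])
  qed (simp add: u0 mm_def)
  have cu: "mm n (u l) (u m) = mm n (u m) (u l)" for l m
    by (intro comm comm[symmetric]) simp
  have bdu: "mbound n (\<lambda>i j. u (Suc m) i j - u m i j) (?r (Suc m) - ?r m)" for m
  proof (induction m)
    case 0
    have "mbound n (\<lambda>i j. (1/2) *\<^sub>R z i j) (\<bar>1/2\<bar> * 1)" by (intro mbound_scaleR z)
    then show ?case by (simp add: uS u0 mm_def)
  next
    case (Suc m)
    let ?d = "\<lambda>i j. u (Suc m) i j - u m i j" and ?s = "\<lambda>i j. u (Suc m) i j + u m i j"
    have "mm n ?d ?s i j = mm n (u (Suc m)) (u (Suc m)) i j - mm n (u m) (u m) i j" for i j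
      using fun_cong[OF fun_cong[OF cu[of "Suc m" m], of i], of j]
      by (simp add: mm_def algebra_simps sum.distrib sum_subtractf)
    then have eq: "(\<lambda>i j. u (Suc (Suc m)) i j - u (Suc m) i j) = (\<lambda>i j. (1/2) *\<^sub>R mm n ?d ?s i j)"
      unfolding uS[of "Suc m"] by (simp add: fun_eq_iff) (simp add: uS algebra_simps)
    have "mbound n (\<lambda>i j. (1/2) *\<^sub>R mm n ?d ?s i j) (\<bar>1/2\<bar> * ((?r (Suc m) - ?r m) * (?r (Suc m) + ?r m)))"
      by (intro mbound_scaleR mbound_mult Suc mbound_add bu)
    also have "\<bar>1/2\<bar> * ((?r (Suc m) - ?r m) * (?r (Suc m) + ?r m)) = ?r (Suc (Suc m)) - ?r (Suc m)"
      unfolding half_square_seq_simps(2)[of "Suc m"] by (subst (5) half_square_seq_simps(2)) (simp add: field_simps)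
    finally show ?case unfolding eq .
  qed
  have conv: "convergent (\<lambda>m. u m i j)" if "i < n" "j < n" for i j
    by (rule convergent_of_half_square_majorant) (rule norm_entry_le_mbound[OF bdu that])
  \<comment> \<open>Zero outside the block, so that self-adjointness holds as an equation of functions.\<close>
  define w where "w = (\<lambda>i j. if i < n \<and> j < n then lim (\<lambda>m. u m i j) else 0)"
  have lw: "(\<lambda>m. u m i j) \<longlonglongrightarrow> w i j" if "i < n" "j < n" for i j
    using conv[OF that] that by (simp add: w_def convergent_LIMSEQ_iff)
  have su: "mstar (u m) = u m" for m
  proof (induction m)
    case (Suc m)
    have "mstar (mm n (u m) (u m)) = mm n (u m) (u m)"
      using Suc by (simp add: mstar_def mm_def adj_sum adj_mult fun_eq_iff)
    with sz show ?case
      by (simp add: mstar_def uS adj_scaleR adj_add fun_eq_iff)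
  qed (simp add: u0 mstar_def)
  have "adj (w j i) = w i j" for i j
  proof (cases "i < n \<and> j < n")
    case True
    then have "(\<lambda>m. adj (u m j i)) \<longlonglongrightarrow> adj (w j i)" by (intro continuous_adj lw) auto
    moreover have "(\<lambda>m. adj (u m j i)) = (\<lambda>m. u m i j)"
      using su by (simp add: mstar_def fun_eq_iff)
    ultimately show ?thesis using lw[of i j] True LIMSEQ_unique by metis
  qed (auto simp: w_def)
  then have "mstar w = w" by (simp add: mstar_def)
  moreover have "2 *\<^sub>R w i j = z i j + mm n w w i j" if ij: "i < n" "j < n" for i j
  proof (rule LIMSEQ_unique)
    show "(\<lambda>m. 2 *\<^sub>R u (Suc m) i j) \<longlonglongrightarrow> 2 *\<^sub>R w i j"
      by (intro tendsto_intros LIMSEQ_Suc lw ij)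
    show "(\<lambda>m. 2 *\<^sub>R u (Suc m) i j) \<longlonglongrightarrow> z i j + mm n w w i j"
      unfolding uS mm_def by simp (intro tendsto_intros lw ij; simp)
  qed
  ultimately show ?thesis by blast
qed

lemma mat_sqrt_one_minus:
  fixes z :: "nat \<Rightarrow> nat \<Rightarrow> 'a::unital_cstar_algebra"
  assumes z: "mbound n z 1" and sz: "mstar z = z"
  obtains d where "mstar d = d" "\<And>i j. i < n \<Longrightarrow> j < n \<Longrightarrow> mm n d d i j = (if i = j then 1 else 0) - z i j"
proof -
  obtain w where w: "mstar w = w" "\<And>i j. i < n \<Longrightarrow> j < n \<Longrightarrow> 2 *\<^sub>R w i j = z i j + mm n w w i j"
    using half_square_fixpoint_exists[OF z sz] by metis
  define d where "d = (\<lambda>i j. (if i = j then 1 else 0) - w i j)"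
  have "mstar d = d" using w(1) by (auto simp: mstar_def d_def adj_diff fun_eq_iff)
  moreover have "mm n d d i j = (if i = j then 1 else 0) - z i j" if ij: "i < n" "j < n" for i j
  proof -
    have "mm n d d i j = (\<Sum>k<n. (if k = i then (if i = j then 1 else 0) else 0) - (if k = i then w i j else 0)
        - (if k = j then w i j else 0) + w i k * w k j)"
      unfolding mm_def d_def by (intro sum.cong) (auto simp: algebra_simps)
    also have "\<dots> = (if i = j then 1 else 0) - 2 *\<^sub>R w i j + mm n w w i j"
      using ij by (simp add: sum.distrib sum_subtractf mm_def scaleR_2)
    finally show ?thesis using w(2)[OF ij] by simp
  qed
  ultimately show ?thesis using that by blast
qed

text \<open>The operator inequality \<open>(\<Sum> c\<^sub>j)* (\<Sum> c\<^sub>j) \<le> n \<Sum> c\<^sub>j* c\<^sub>j\<close>: the difference is the sum of \<open>(c\<^sub>j - c\<^sub>k)* (c\<^sub>j - c\<^sub>k)\<close> over all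
  pairs \<open>j < k\<close>, and each step of the induction adds the pairs containing the new index.\<close>
lemma adj_sum_mult_sum_le:
  "cstar_pos (real n *\<^sub>R (\<Sum>j<n. adj (c j) * c j) - adj (\<Sum>j<n. c j) * (\<Sum>j<n. (c j :: 'a::unital_cstar_algebra)))"
proof (induction n)
  case (Suc n)
  let ?S = "\<Sum>j<n. adj (c j) * c j" and ?s = "\<Sum>j<n. c j" and ?x = "c n"
  have "cstar_pos (\<Sum>j<n. adj (c j - ?x) * (c j - ?x))"
    by (intro cstar_pos_sum cstar_pos_adj_mult)
  also have "(\<Sum>j<n. adj (c j - ?x) * (c j - ?x)) = ?S - adj ?x * ?s - adj ?s * ?x + real n *\<^sub>R (adj ?x * ?x)"
  proof -
    have "(\<Sum>j<n. adj (c j - ?x) * (c j - ?x))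
        = (\<Sum>j<n. adj (c j) * c j - adj ?x * c j - adj (c j) * ?x + adj ?x * ?x)"
      by (rule sum.cong) (simp_all add: adj_diff algebra_simps)
    also have "\<dots> = ?S - adj ?x * ?s - (\<Sum>j<n. adj (c j)) * ?x + (\<Sum>j<n. adj ?x * ?x)"
      by (simp only: sum.distrib sum_subtractf sum_distrib_left sum_distrib_right)
    finally show ?thesis by (simp only: adj_sum sum_constant_scaleR card_lessThan)
  qed
  finally have *: "cstar_pos ((real n *\<^sub>R ?S - adj ?s * ?s) + (?S - adj ?x * ?s - adj ?s * ?x + real n *\<^sub>R (adj ?x * ?x)))"
    by (rule cstar_pos_add[OF Suc])
  have "(real n *\<^sub>R ?S - adj ?s * ?s) + (?S - adj ?x * ?s - adj ?s * ?x + real n *\<^sub>R (adj ?x * ?x))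
      = real (Suc n) *\<^sub>R (\<Sum>j<Suc n. adj (c j) * c j) - adj (\<Sum>j<Suc n. c j) * (\<Sum>j<Suc n. c j)"
    by (simp add: adj_add algebra_simps)
  with * show ?case by (simp only:)
qed simp

text \<open>Boundedness of \<open>X\<close> in the strong form \<open>\<langle>X b, X b\<rangle> \<le> K \<langle>b, b\<rangle>\<close>, an inequality in the C*-algebra and not only
  between norms, as needed in \<open>mbound_scalar_minus_square\<close>.\<close>
lemma mip_mv_order_bound:
  "\<exists>K\<ge>0. \<forall>b. cstar_pos (K *\<^sub>R mip n b b - mip n (mv n X b) (mv n X (b :: nat \<Rightarrow> 'a::unital_cstar_algebra)))"
proof -
  define M where "M = (\<Sum>i<n. \<Sum>j<n. (norm (X i j))\<^sup>2)"
  have M: "(norm (X i j))\<^sup>2 \<le> M" if "i < n" "j < n" for i j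
  proof -
    have "(norm (X i j))\<^sup>2 \<le> (\<Sum>j<n. (norm (X i j))\<^sup>2)" using that by (intro member_le_sum) auto
    also have "\<dots> \<le> M" unfolding M_def using that by (intro member_le_sum) (auto intro: sum_nonneg)
    finally show ?thesis .
  qed
  have M0: "M \<ge> 0" by (simp add: M_def sum_nonneg)
  have "cstar_pos ((real n * real n * M) *\<^sub>R mip n b b - mip n (mv n X b) (mv n X b))" for b
  proof -
    have row: "cstar_pos ((real n * M) *\<^sub>R mip n b b - adj (mv n X b i) * mv n X b i)" if i: "i < n" for i
    proof -
      let ?c = "\<lambda>j. X i j * b j"
      have "cstar_pos (M *\<^sub>R (adj (b j) * b j) - adj (?c j) * ?c j)" if j: "j < n" for j
      proof -
        have "cstar_pos (adj (b j) * (of_real ((norm (X i j))\<^sup>2) - adj (X i j) * X i j) * b j)"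
          by (intro cstar_pos_conj cstar_pos_norm_bound)
        moreover have "cstar_pos ((M - (norm (X i j))\<^sup>2) *\<^sub>R (adj (b j) * b j))"
          using M[OF i j] by (intro cstar_pos_scaleR cstar_pos_adj_mult) simp
        ultimately have "cstar_pos (adj (b j) * (of_real ((norm (X i j))\<^sup>2) - adj (X i j) * X i j) * b j
            + (M - (norm (X i j))\<^sup>2) *\<^sub>R (adj (b j) * b j))" by (rule cstar_pos_add)
        then show ?thesis by (simp add: of_real_def adj_mult algebra_simps)
      qed
      then have "cstar_pos (\<Sum>j<n. M *\<^sub>R (adj (b j) * b j) - adj (?c j) * ?c j)"
        by (intro cstar_pos_sum) auto
      then have "cstar_pos (real n *\<^sub>R (\<Sum>j<n. M *\<^sub>R (adj (b j) * b j) - adj (?c j) * ?c j))"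
        by (rule cstar_pos_scaleR) simp
      from cstar_pos_add[OF this adj_sum_mult_sum_le[of n ?c]]
      show ?thesis
        by (simp add: mip_def mv_def sum_subtractf scaleR_sum_right[symmetric] scaleR_diff_right)
    qed
    have "cstar_pos (\<Sum>i<n. (real n * M) *\<^sub>R mip n b b - adj (mv n X b i) * mv n X b i)"
      by (intro cstar_pos_sum row) simp
    also have "(\<Sum>i<n. (real n * M) *\<^sub>R mip n b b - adj (mv n X b i) * mv n X b i)
        = (real n * real n * M) *\<^sub>R mip n b b - mip n (mv n X b) (mv n X b)"
      by (simp add: sum_subtractf sum_constant_scaleR mult.assoc del: sum_constant) (simp add: mip_def)
    finally show ?thesis .
  qed
  then show ?thesis using M0 by (intro exI[of _ "real n * real n * M"]) auto
qed

lemma mbound_exists: "\<exists>c. mbound n (X :: nat \<Rightarrow> nat \<Rightarrow> 'a::unital_cstar_algebra) c"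
proof -
  obtain K where K: "K \<ge> 0" "\<And>b. cstar_pos (K *\<^sub>R mip n b b - mip n (mv n X b) (mv n X b))"
    using mip_mv_order_bound by metis
  have "mnorm n (mv n X b) \<le> sqrt K * mnorm n b" for b
    using norm_mono_cstar_pos[OF mip_pos K(2)[of b]] K(1)
    by (simp add: mnorm_def real_sqrt_mult[symmetric])
  then show ?thesis using K(1) by (intro exI[of _ "sqrt K"]) (simp add: mbound_def)
qed

text \<open>Positive operators have \<open>\<parallel>r - p\<parallel> \<le> r\<close> for large \<open>r\<close>. With \<open>p = Y* Y\<close> this is the computation
  \<open>\<langle>(r - p) b, (r - p) b\<rangle> = r\<^sup>2 \<langle>b, b\<rangle> - 2 r \<langle>Y b, Y b\<rangle> + \<langle>p b, p b\<rangle>\<close>, where \<open>\<langle>p b, p b\<rangle> \<le> r \<langle>Y b, Y b\<rangle>\<close> by the choice of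
  \<open>r\<close> for \<open>Y*\<close>. This turns positivity of a matrix into a norm bound, to which complete
  contractivity can be applied.\<close>
lemma mbound_scalar_minus_square:
  "\<exists>r\<ge>0. mbound n (\<lambda>i j. (if i = j then of_real r else 0) - mm n (mstar Y) Y i j) (r::real)"
  for Y :: "nat \<Rightarrow> nat \<Rightarrow> 'a::unital_cstar_algebra"
proof -
  obtain r where r: "r \<ge> 0" "\<And>b. cstar_pos (r *\<^sub>R mip n b b - mip n (mv n (mstar Y) b) (mv n (mstar Y) b))"
    using mip_mv_order_bound by metis
  let ?X = "\<lambda>i j. (if i = j then of_real r else 0) - mm n (mstar Y) Y i j"
  have "mnorm n (mv n ?X b) \<le> r * mnorm n b" for b
  proof -
    let ?c = "mv n Y b"
    let ?d = "mv n (mstar Y) ?c"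
    have X: "mv n ?X b i = r *\<^sub>R b i - ?d i" if "i < n" for i
    proof -
      have "mv n ?X b i = (\<Sum>k<n. (if k = i then r *\<^sub>R b i else 0) - mm n (mstar Y) Y i k * b k)"
        unfolding mv_def by (rule sum.cong) (auto simp: left_diff_distrib of_real_def)
      also have "\<dots> = r *\<^sub>R b i - mv n (mm n (mstar Y) Y) b i" using that by (simp add: sum_subtractf mv_def)
      finally show ?thesis by (simp add: mv_mm)
    qed
    have bd: "mip n b ?d = mip n ?c ?c"
      by (simp add: mip_mv mstar_def adj_adj)
    then have db: "mip n ?d b = mip n ?c ?c" by (metis adj_mip)
    have sc: "mip n (\<lambda>i. r *\<^sub>R b i) y = r *\<^sub>R mip n b y" "mip n y (\<lambda>i. r *\<^sub>R b i) = r *\<^sub>R mip n y b" for y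
      by (simp_all add: mip_def adj_scaleR scaleR_sum_right)
    have e: "mip n (\<lambda>i. r *\<^sub>R b i - ?d i) (\<lambda>i. r *\<^sub>R b i - ?d i)
        = (r * r) *\<^sub>R mip n b b - (2 * r) *\<^sub>R mip n ?c ?c + mip n ?d ?d"
      by (simp add: mip_diff_left mip_diff_right sc bd db)
        (simp add: algebra_simps scaleR_add_left[symmetric])
    have "cstar_pos (r *\<^sub>R mip n ?c ?c + (r *\<^sub>R mip n ?c ?c - mip n ?d ?d))"
      by (intro cstar_pos_add cstar_pos_scaleR mip_pos r)
    also have "r *\<^sub>R mip n ?c ?c + (r *\<^sub>R mip n ?c ?c - mip n ?d ?d) = (r * r) *\<^sub>R mip n b b - mip n (\<lambda>i. r *\<^sub>R b i - ?d i) (\<lambda>i. r *\<^sub>R b i - ?d i)"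
      unfolding e by (simp add: algebra_simps scaleR_add_left[symmetric])
    finally have "norm (mip n (\<lambda>i. r *\<^sub>R b i - ?d i) (\<lambda>i. r *\<^sub>R b i - ?d i)) \<le> norm ((r * r) *\<^sub>R mip n b b)"
      by (rule norm_mono_cstar_pos[OF mip_pos])
    then have "mnorm n (\<lambda>i. r *\<^sub>R b i - ?d i) \<le> sqrt (r * r * norm (mip n b b))"
      using r(1) by (simp add: mnorm_def)
    also have "\<dots> = r * mnorm n b" using r(1) by (simp add: mnorm_def real_sqrt_mult)
    finally show ?thesis using mnorm_cong[of n "mv n ?X b" "\<lambda>i. r *\<^sub>R b i - ?d i"] X by simp
  qed
  then show ?thesis using r(1) by (intro exI[of _ r]) (auto simp: mbound_def)
qed

lemma module_norm_eq: "module_norm b = mnorm (dim_vec b) (\<lambda>i. b $ i)"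
  by (simp add: module_norm_def mnorm_def mip_def)

lemma mult_mat_vec_eq_mv:
  assumes "X \<in> carrier_mat n n" "b \<in> carrier_vec n" "i < n"
  shows "(X *\<^sub>v b) $ i = mv n (\<lambda>i j. X $$ (i, j)) (\<lambda>i. b $ i) i"
  using assms by (simp add: mv_def scalar_prod_def lessThan_atLeast0)

lemma module_norm_mult_mat_vec:
  assumes "X \<in> carrier_mat n n" "b \<in> carrier_vec n"
  shows "module_norm (X *\<^sub>v b) = mnorm n (mv n (\<lambda>i j. X $$ (i, j)) (\<lambda>i. b $ i))"
  unfolding module_norm_eq using assms mult_mat_vec_eq_mv[OF assms]
  by (auto intro!: mnorm_cong simp del: index_mult_mat_vec)

lemma cstar_mat_norm_eq:
  assumes "X \<in> carrier_mat n n"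
  shows "cstar_mat_norm X = Sup {mnorm n (mv n (\<lambda>i j. X $$ (i, j)) b) | b. mnorm n b \<le> 1}"
proof -
  have "{module_norm (X *\<^sub>v b) | b. b \<in> carrier_vec (dim_col X) \<and> module_norm b \<le> 1}
    = {mnorm n (mv n (\<lambda>i j. X $$ (i, j)) b) | b. mnorm n b \<le> 1}" (is "?A = ?B")
  proof (intro equalityI subsetI)
    fix t assume "t \<in> ?A"
    then obtain b where "t = module_norm (X *\<^sub>v b)" "b \<in> carrier_vec n" "module_norm b \<le> 1"
      using assms by auto
    then show "t \<in> ?B"
      using module_norm_mult_mat_vec[OF assms] by (auto simp: module_norm_eq)
  next
    fix t assume "t \<in> ?B"
    then obtain b where b: "t = mnorm n (mv n (\<lambda>i j. X $$ (i, j)) b)" "mnorm n b \<le> 1" by auto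
    have "mnorm n (\<lambda>i. vec n b $ i) = mnorm n b" by (rule mnorm_cong) simp
    moreover have "mv n (\<lambda>i j. X $$ (i, j)) (\<lambda>i. vec n b $ i) = mv n (\<lambda>i j. X $$ (i, j)) b"
      by (simp add: mv_def)
    ultimately have "module_norm (vec n b) \<le> 1" "t = module_norm (X *\<^sub>v vec n b)"
      using b module_norm_mult_mat_vec[OF assms, of "vec n b"] by (simp_all add: module_norm_eq)
    then show "t \<in> ?A" using assms by auto
  qed
  then show ?thesis by (simp add: cstar_mat_norm_def)
qed

lemma cstar_mat_norm_le:
  assumes "X \<in> carrier_mat n n" "mbound n (\<lambda>i j. X $$ (i, j)) c"
  shows "cstar_mat_norm X \<le> c"
  unfolding cstar_mat_norm_eq[OF assms(1)]
proof (rule cSup_least)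
  show "{mnorm n (mv n (\<lambda>i j. X $$ (i, j)) b) | b. mnorm n b \<le> 1} \<noteq> {}"
    by (auto intro!: exI[of _ "\<lambda>_. 0"] simp: mnorm_def mip_def)
next
  fix x assume "x \<in> {mnorm n (mv n (\<lambda>i j. X $$ (i, j)) b) | b. mnorm n b \<le> 1}"
  then obtain b where "x = mnorm n (mv n (\<lambda>i j. X $$ (i, j)) b)" "mnorm n b \<le> 1" by auto
  then show "x \<le> c"
    using mboundD[OF assms(2), of b] mbound_nonneg[OF assms(2)]
    by (metis mult_left_le order_trans)
qed

lemma mbound_cstar_mat_norm:
  assumes X: "X \<in> carrier_mat n n"
  shows "mbound n (\<lambda>i j. X $$ (i, j)) (cstar_mat_norm X)"
proof -
  let ?X = "\<lambda>i j. X $$ (i, j)"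
  let ?B = "{mnorm n (mv n ?X b) | b. mnorm n b \<le> 1}"
  obtain c where c: "mbound n ?X c" using mbound_exists by blast
  have bdd: "bdd_above ?B"
  proof (rule bdd_aboveI)
    fix x assume "x \<in> ?B"
    then show "x \<le> c"
      using mboundD[OF c] mbound_nonneg[OF c] by (auto intro: order_trans mult_left_le)
  qed
  have up: "mnorm n (mv n ?X b) \<le> cstar_mat_norm X" if "mnorm n b \<le> 1" for b
    unfolding cstar_mat_norm_eq[OF X] using that by (intro cSup_upper bdd) auto
  have "mnorm n (mv n ?X b) \<le> cstar_mat_norm X * mnorm n b" for b
  proof (cases "mnorm n b = 0")
    case True
    then show ?thesis using mboundD[OF c, of b] by simp
  next
    case False
    then have p: "mnorm n b > 0" using mnorm_nonneg[of n b] by linarith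
    let ?b = "\<lambda>i. (1 / mnorm n b) *\<^sub>R b i"
    have "mnorm n (mv n ?X ?b) \<le> cstar_mat_norm X" using p by (intro up) (simp add: mnorm_scaleR)
    moreover have "mv n ?X ?b = (\<lambda>i. (1 / mnorm n b) *\<^sub>R mv n ?X b i)"
      by (simp add: mv_def scaleR_sum_right)
    ultimately have "mnorm n (mv n ?X b) / mnorm n b \<le> cstar_mat_norm X"
      using p by (simp add: mnorm_scaleR)
    then show ?thesis using p by (simp add: divide_le_eq)
  qed
  moreover have "cstar_mat_norm X \<ge> 0"
    using up[of "\<lambda>_. 0"] by (simp add: mv_def) (simp add: mnorm_def mip_def)
  ultimately show ?thesis by (simp add: mbound_def)
qed

lemma positive_mat_iff:
  "positive_mat n X \<longleftrightarrow> X \<in> carrier_mat n n \<and> (\<exists>y. \<forall>i<n. \<forall>j<n. X $$ (i, j) = mm n (mstar y) y i j)"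
proof
  assume "positive_mat n X"
  then obtain Y where "Y \<in> carrier_mat n n" "X = star_mat Y * Y" by (auto simp: positive_mat_def)
  then show "X \<in> carrier_mat n n \<and> (\<exists>y. \<forall>i<n. \<forall>j<n. X $$ (i, j) = mm n (mstar y) y i j)"
    by (auto simp: mm_def mstar_def star_mat_def scalar_prod_def lessThan_atLeast0
        intro!: exI[of _ "\<lambda>i j. Y $$ (i, j)"] sum.cong)
next
  assume "X \<in> carrier_mat n n \<and> (\<exists>y. \<forall>i<n. \<forall>j<n. X $$ (i, j) = mm n (mstar y) y i j)"
  then obtain y where X: "X \<in> carrier_mat n n" and y: "\<And>i j. i < n \<Longrightarrow> j < n \<Longrightarrow> X $$ (i, j) = mm n (mstar y) y i j"
    by auto
  have "X = star_mat (mat n n (\<lambda>(i, j). y i j)) * mat n n (\<lambda>(i, j). y i j)"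
    using X y by (intro eq_matI) (auto simp: star_mat_def scalar_prod_def mm_def mstar_def lessThan_atLeast0)
  then show "positive_mat n X" by (auto simp: positive_mat_def)
qed

lemma sum_two_halves:
  fixes f :: "nat \<Rightarrow> 'c::comm_monoid_add"
  shows "(\<Sum>k<2*m. f k) = (\<Sum>k<m. f k) + (\<Sum>k<m. f (m + k))"
proof -
  have "(\<Sum>k<2*m. f k) = (\<Sum>k<m. f k) + (\<Sum>k=m..<m + m. f k)"
    using sum.atLeastLessThan_concat[of 0 m "m + m" f] by (simp add: lessThan_atLeast0 mult_2)
  also have "(\<Sum>k=m..<m + m. f k) = (\<Sum>k<m. f (m + k))"
    using sum.shift_bounds_nat_ivl[of f 0 m m] by (simp add: lessThan_atLeast0 add.commute)
  finally show ?thesis .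
qed

text \<open>For \<open>x = X/c\<close> of norm at most \<open>1\<close>, the matrix is \<open>y* y\<close> for the upper triangular \<open>y\<close> with rows \<open>(1, x)\<close> and
  \<open>(0, (1 - x* x)\<^sup>1\<^sup>/\<^sup>2)\<close>, times \<open>c\<^sup>1\<^sup>/\<^sup>2\<close>. This encodes a norm bound as a positivity statement, which a complete order
  embedding preserves.\<close>
lemma positive_mat_two_by_two:
  fixes X :: "nat \<Rightarrow> nat \<Rightarrow> 'a::unital_cstar_algebra"
  assumes X: "mbound m X c" and c: "c > 0"
  shows "positive_mat (2 * m) (mat (2 * m) (2 * m) (\<lambda>(i, j).
     if i < m then (if j < m then (if i = j then of_real c else 0) else X i (j - m))
     else (if j < m then adj (X j (i - m)) else (if i = j then of_real c else 0))))"
proof -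
  define x where "x = (\<lambda>i j. (1/c) *\<^sub>R X i j)"
  have x: "mbound m x 1" using mbound_scaleR[OF X, of "1/c"] c by (simp add: x_def)
  define z where "z = mm m (mstar x) x"
  have z1: "mbound m z 1" using mbound_mult[OF mbound_mstar[OF x] x] by (simp add: z_def)
  have z2: "mstar z = z" by (simp add: z_def mstar_def mm_def adj_sum adj_mult adj_adj)
  obtain d where d: "mstar d = d" "\<And>i j. i < m \<Longrightarrow> j < m \<Longrightarrow> mm m d d i j = (if i = j then 1 else 0) - z i j"
    using mat_sqrt_one_minus[OF z1 z2] by metis
  define y where "y = (\<lambda>i j. sqrt c *\<^sub>R (if i < m then (if j < m then (if i = j then 1 else 0) else x i (j - m))
     else (if j < m then 0 else d (i - m) (j - m))))"
  have P: "mm (2*m) (mstar y) y i j = (\<Sum>k<m. adj (y k i) * y k j) + (\<Sum>k<m. adj (y (m + k) i) * y (m + k) j)" for i j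
    by (simp add: mm_def mstar_def sum_two_halves)
  have da: "adj (d k i) = d i k" for i k using fun_cong[OF fun_cong[OF d(1)], of i k] by (simp add: mstar_def)
  have 1: "mm (2*m) (mstar y) y i j = (if i = j then of_real c else 0)" if "i < m" "j < m" for i j
  proof -
    have "mm (2*m) (mstar y) y i j = (\<Sum>k<m. adj (y k i) * y k j)"
      unfolding P using that by (simp add: y_def)
    also have "\<dots> = (\<Sum>k<m. if k = i then (if i = j then of_real c else 0) else 0)"
      by (rule sum.cong) (use that c in \<open>auto simp: y_def adj_scaleR of_real_def\<close>)
    finally show ?thesis using that by simp
  qed
  have 2: "mm (2*m) (mstar y) y i (m + j) = X i j" if "i < m" "j < m" for i j
  proof -
    have "mm (2*m) (mstar y) y i (m + j) = (\<Sum>k<m. adj (y k i) * y k (m + j))"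
      unfolding P using that by (simp add: y_def)
    also have "\<dots> = (\<Sum>k<m. if k = i then c *\<^sub>R x i j else 0)"
      by (rule sum.cong) (use that c in \<open>auto simp: y_def adj_scaleR\<close>)
    finally show ?thesis using that c by (simp add: x_def)
  qed
  have sq: "adj (mm (2*m) (mstar y) y i j) = mm (2*m) (mstar y) y j i" for i j
    by (simp add: mm_def mstar_def adj_sum adj_mult adj_adj)
  have 3: "mm (2*m) (mstar y) y (m + i) j = adj (X j i)" if "i < m" "j < m" for i j
    using sq[of j "m + i"] 2[of j i] that by simp
  have 4: "mm (2*m) (mstar y) y (m + i) (m + j) = (if i = j then of_real c else 0)" if "i < m" "j < m" for i j
  proof -
    have "mm (2*m) (mstar y) y (m + i) (m + j) = c *\<^sub>R (z i j) + c *\<^sub>R (mm m d d i j)"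
      unfolding P using that c
      by (simp add: y_def adj_scaleR z_def mm_def mstar_def da scaleR_sum_right)
    then show ?thesis using d(2)[OF that] by (simp add: of_real_def scaleR_diff_right)
  qed
  show ?thesis
    unfolding positive_mat_iff
  proof (intro conjI exI[of _ y] allI impI)
    fix i j assume ij: "i < 2 * m" "j < 2 * m"
    show "mat (2 * m) (2 * m) (\<lambda>(i, j).
     if i < m then (if j < m then (if i = j then of_real c else 0) else X i (j - m))
     else (if j < m then adj (X j (i - m)) else (if i = j then of_real c else 0))) $$ (i, j)
      = mm (2*m) (mstar y) y i j"
      using ij 1[of i j] 2[of i "j - m"] 3[of "i - m" j] 4[of "i - m" "j - m"]
      by auto
  qed simp
qed

section \<open>Operator norms of complex matrices\<close>

definition cip :: "nat \<Rightarrow> (nat \<Rightarrow> complex) \<Rightarrow> (nat \<Rightarrow> complex) \<Rightarrow> complex" where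
  "cip n u v = (\<Sum>i<n. u i * cnj (v i))"

definition cnorm :: "nat \<Rightarrow> (nat \<Rightarrow> complex) \<Rightarrow> real" where
  "cnorm n u = L2_set (\<lambda>i. cmod (u i)) {..<n}"

definition act :: "nat \<Rightarrow> complex mat \<Rightarrow> (nat \<Rightarrow> complex) \<Rightarrow> nat \<Rightarrow> complex" where
  "act n A u = (\<lambda>i. \<Sum>k<n. A $$ (i, k) * u k)"

lemma cnorm_nonneg [simp]: "0 \<le> cnorm n u"
  by (simp add: cnorm_def)

lemma cnorm_square: "(cnorm n u)\<^sup>2 = (\<Sum>i<n. (cmod (u i))\<^sup>2)"
  by (simp add: cnorm_def L2_set_def sum_nonneg)

lemma cip_self: "cip n u u = of_real ((cnorm n u)\<^sup>2)"
  by (simp add: cip_def cnorm_square complex_mult_cnj cmod_power2 del: of_real_power)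

lemma cip_commute: "cip n v u = cnj (cip n u v)"
  by (simp add: cip_def mult.commute)

lemma cmod_cip_le: "cmod (cip n u v) \<le> cnorm n u * cnorm n v"
proof -
  have "cmod (cip n u v) \<le> (\<Sum>i<n. \<bar>cmod (u i)\<bar> * \<bar>cmod (v i)\<bar>)"
    unfolding cip_def by (rule order_trans[OF norm_sum]) (simp add: norm_mult)
  also have "\<dots> \<le> cnorm n u * cnorm n v"
    unfolding cnorm_def by (rule L2_set_mult_ineq)
  finally show ?thesis .
qed

lemma cnorm_cong: "(\<And>i. i < n \<Longrightarrow> u i = v i) \<Longrightarrow> cnorm n u = cnorm n v"
  by (simp add: cnorm_def L2_set_def)

lemma cip_cong: "(\<And>i. i < n \<Longrightarrow> u i = u' i) \<Longrightarrow> (\<And>i. i < n \<Longrightarrow> v i = v' i) \<Longrightarrow> cip n u v = cip n u' v'"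
  by (simp add: cip_def)

lemma cnorm_triangle: "cnorm n (\<lambda>i. u i + v i) \<le> cnorm n u + cnorm n v"
proof -
  have "cnorm n (\<lambda>i. u i + v i) \<le> L2_set (\<lambda>i. cmod (u i) + cmod (v i)) {..<n}"
    unfolding cnorm_def by (rule L2_set_mono) (auto simp: norm_triangle_ineq)
  also have "\<dots> \<le> cnorm n u + cnorm n v"
    unfolding cnorm_def by (rule L2_set_triangle_ineq)
  finally show ?thesis .
qed

lemma cnorm_scale: "cnorm n (\<lambda>i. c * u i) = cmod c * cnorm n u"
  by (simp add: cnorm_def L2_set_right_distrib norm_mult)

lemma cnorm_zero [simp]: "cnorm n (\<lambda>i. 0) = 0"
  by (simp add: cnorm_def L2_set_def)

lemma cnorm_component: "i < n \<Longrightarrow> cmod (u i) \<le> cnorm n u"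
  unfolding cnorm_def by (rule member_le_L2_set) auto

lemma cnorm_eq_0: "cnorm n u = 0 \<Longrightarrow> i < n \<Longrightarrow> u i = 0"
  using cnorm_component[of i n u] by simp

lemma act_cong: "(\<And>k. k < n \<Longrightarrow> u k = v k) \<Longrightarrow> act n A u = act n A v"
  by (simp add: act_def)

lemma cnorm_act_le_sum: "cnorm n (act n A u) \<le> (\<Sum>i<n. \<Sum>k<n. cmod (A $$ (i, k))) * cnorm n u"
proof -
  have "cnorm n (act n A u) \<le> (\<Sum>i<n. cmod (act n A u i))"
    unfolding cnorm_def by (rule L2_set_le_sum) simp
  also have "\<dots> \<le> (\<Sum>i<n. \<Sum>k<n. cmod (A $$ (i, k)) * cnorm n u)"
    unfolding act_def
    by (intro sum_mono order_trans[OF norm_sum]) (auto simp: norm_mult intro!: mult_left_mono cnorm_component)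
  finally show ?thesis by (simp add: sum_distrib_right)
qed

lemma op_norm_eq:
  assumes "A \<in> carrier_mat n n"
  shows "op_norm A = Sup {cnorm n (act n A u) | u. cnorm n u \<le> 1}"
proof -
  have eq: "L2_set (\<lambda>i. cmod ((A *\<^sub>v v) $ i)) {..<dim_row A} = cnorm n (act n A (\<lambda>i. v $ i))"
    if "v \<in> carrier_vec n" for v
    using assms that by (auto simp: cnorm_def act_def scalar_prod_def lessThan_atLeast0 intro!: L2_set_cong)
  have "{L2_set (\<lambda>i. cmod ((A *\<^sub>v v) $ i)) {..<dim_row A} | v.
     v \<in> carrier_vec (dim_col A) \<and> L2_set (\<lambda>j. cmod (v $ j)) {..<dim_col A} \<le> 1}
    = {cnorm n (act n A u) | u. cnorm n u \<le> 1}" (is "?A = ?B")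
  proof (intro equalityI subsetI)
    fix t assume "t \<in> ?A"
    then obtain v where "t = L2_set (\<lambda>i. cmod ((A *\<^sub>v v) $ i)) {..<dim_row A}" "v \<in> carrier_vec n"
      "cnorm n (\<lambda>i. v $ i) \<le> 1"
      using assms by (auto simp: cnorm_def)
    then show "t \<in> ?B" using eq by auto
  next
    fix t assume "t \<in> ?B"
    then obtain u where u: "t = cnorm n (act n A u)" "cnorm n u \<le> 1" by auto
    have "cnorm n (\<lambda>i. vec n u $ i) = cnorm n u" by (rule cnorm_cong) simp
    moreover have "act n A (\<lambda>i. vec n u $ i) = act n A u" by (rule act_cong) simp
    ultimately have "L2_set (\<lambda>i. cmod (vec n u $ i)) {..<n} \<le> 1"
      "t = L2_set (\<lambda>i. cmod ((A *\<^sub>v vec n u) $ i)) {..<dim_row A}"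
      using u eq[of "vec n u"] by (simp_all add: cnorm_def)
    then show "t \<in> ?A" using assms by (auto intro!: exI[of _ "vec n u"])
  qed
  then show ?thesis by (simp add: op_norm_def)
qed

lemma op_norm_le:
  assumes A: "A \<in> carrier_mat n n" and c: "0 \<le> c" and le: "\<And>u. cnorm n (act n A u) \<le> c * cnorm n u"
  shows "op_norm A \<le> c"
  unfolding op_norm_eq[OF A]
proof (rule cSup_least)
  show "{cnorm n (act n A u) | u. cnorm n u \<le> 1} \<noteq> {}" by (auto intro!: exI[of _ "\<lambda>_. 0"])
next
  fix x assume "x \<in> {cnorm n (act n A u) | u. cnorm n u \<le> 1}"
  then obtain u where u: "x = cnorm n (act n A u)" "cnorm n u \<le> 1" by auto
  have "c * cnorm n u \<le> c" using u(2) c by (simp add: mult_left_le)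
  then show "x \<le> c" using le[of u] u by linarith
qed

lemma cnorm_act_le:
  assumes A: "A \<in> carrier_mat n n"
  shows "cnorm n (act n A u) \<le> op_norm A * cnorm n u"
proof -
  let ?K = "\<Sum>i<n. \<Sum>k<n. cmod (A $$ (i, k))"
  have bdd: "bdd_above {cnorm n (act n A u) | u. cnorm n u \<le> 1}"
  proof (rule bdd_aboveI)
    fix x assume "x \<in> {cnorm n (act n A u) | u. cnorm n u \<le> 1}"
    then obtain u where u: "x = cnorm n (act n A u)" "cnorm n u \<le> 1" by auto
    have "?K * cnorm n u \<le> ?K" using u(2) by (intro mult_left_le sum_nonneg) auto
    then show "x \<le> ?K" using cnorm_act_le_sum[of n A u] u by linarith
  qed
  have up: "cnorm n (act n A u) \<le> op_norm A" if "cnorm n u \<le> 1" for u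
    unfolding op_norm_eq[OF A] using that by (intro cSup_upper bdd) auto
  show ?thesis
  proof (cases "cnorm n u = 0")
    case True
    then show ?thesis using cnorm_act_le_sum[of n A u] by simp
  next
    case False
    then have p: "cnorm n u > 0" using cnorm_nonneg[of n u] by linarith
    let ?c = "of_real (1 / cnorm n u) :: complex"
    have "cnorm n (\<lambda>i. ?c * u i) = cmod ?c * cnorm n u" by (rule cnorm_scale)
    also have "\<dots> = 1" using p by (simp add: norm_divide)
    finally have 1: "cnorm n (act n A (\<lambda>i. ?c * u i)) \<le> op_norm A" by (intro up) simp
    have "act n A (\<lambda>i. ?c * u i) = (\<lambda>i. ?c * act n A u i)"
      by (simp add: act_def sum_distrib_left ac_simps)
    then have "cnorm n (act n A (\<lambda>i. ?c * u i)) = cmod ?c * cnorm n (act n A u)"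
      by (simp only: cnorm_scale)
    also have "cmod ?c = 1 / cnorm n u" using p by (simp add: norm_divide)
    finally show ?thesis using 1 p by (simp add: divide_le_eq)
  qed
qed

lemma op_norm_nonneg: "A \<in> carrier_mat n n \<Longrightarrow> 0 \<le> op_norm A"
proof -
  assume A: "A \<in> carrier_mat n n"
  show ?thesis
  proof (cases "n = 0")
    case True
    then have "cnorm n u = 0" for u by (simp add: cnorm_def)
    then show ?thesis unfolding op_norm_eq[OF A] by simp
  next
    case False
    let ?e = "\<lambda>i. if i = 0 then 1 else (0::complex)"
    have "cnorm n ?e > 0" using cnorm_component[of 0 n ?e] False by auto
    moreover have "0 \<le> op_norm A * cnorm n ?e"
      using cnorm_act_le[OF A, of ?e] cnorm_nonneg order_trans by blast
    ultimately show ?thesis by (simp add: zero_le_mult_iff)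
  qed
qed

lemma op_norm_le_sum: "A \<in> carrier_mat n n \<Longrightarrow> op_norm A \<le> (\<Sum>i<n. \<Sum>k<n. cmod (A $$ (i, k)))"
  by (rule op_norm_le) (auto intro!: sum_nonneg cnorm_act_le_sum)

lemma cmod_cip_act_le:
  assumes A: "A \<in> carrier_mat n n"
  shows "cmod (cip n (act n A u) v) \<le> op_norm A * (cnorm n u * cnorm n v)"
  using order_trans[OF cmod_cip_le mult_right_mono[OF cnorm_act_le[OF A]]] by (simp add: mult.assoc)

text \<open>Testing with forms instead of vectors, because forms pass through block decompositions, compressions and
  limits.\<close>
lemma op_norm_le_form:
  assumes A: "A \<in> carrier_mat n n" and c: "0 \<le> c"
    and le: "\<And>u v. cmod (cip n (act n A u) v) \<le> c * (cnorm n u * cnorm n v)"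
  shows "op_norm A \<le> c"
proof (rule op_norm_le[OF A c])
  fix u
  let ?v = "act n A u"
  have "(cnorm n ?v)\<^sup>2 \<le> c * (cnorm n u * cnorm n ?v)"
    using le[of u ?v] by (simp add: cip_self norm_power)
  then have "cnorm n ?v * cnorm n ?v \<le> (c * cnorm n u) * cnorm n ?v"
    by (simp add: power2_eq_square ac_simps)
  then show "cnorm n ?v \<le> c * cnorm n u"
    using mult_right_le_imp_le[of "cnorm n ?v" "cnorm n ?v" "c * cnorm n u"] cnorm_nonneg[of n ?v]
      mult_nonneg_nonneg[OF c cnorm_nonneg[of n u]] by linarith
qed

lemma cmod_entry_le_op_norm:
  assumes A: "A \<in> carrier_mat n n" and ij: "i < n" "j < n"
  shows "cmod (A $$ (i, j)) \<le> op_norm A"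
proof -
  let ?e = "\<lambda>k. if k = j then 1 else (0::complex)"
  have "act n A ?e i = (\<Sum>k<n. if k = j then A $$ (i, k) else 0)"
    unfolding act_def by (rule sum.cong) auto
  then have "cmod (A $$ (i, j)) = cmod (act n A ?e i)" using ij by simp
  also have "\<dots> \<le> cnorm n (act n A ?e)" by (rule cnorm_component[OF ij(1)])
  also have "\<dots> \<le> op_norm A * cnorm n ?e" by (rule cnorm_act_le[OF A])
  also have "cnorm n ?e = 1"
  proof -
    have "(cnorm n ?e)\<^sup>2 = (\<Sum>k<n. if k = j then 1 else 0)"
      unfolding cnorm_square by (rule sum.cong) auto
    then show ?thesis using ij cnorm_nonneg[of n ?e] by (simp add: power2_eq_1_iff)
  qed
  finally show ?thesis by simp
qed

lemma act_plus: "A \<in> carrier_mat n n \<Longrightarrow> B \<in> carrier_mat n n \<Longrightarrow> i < n \<Longrightarrow> act n (A + B) u i = act n A u i + act n B u i"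
  by (simp add: act_def distrib_right sum.distrib)

lemma act_minus: "A \<in> carrier_mat n n \<Longrightarrow> B \<in> carrier_mat n n \<Longrightarrow> i < n \<Longrightarrow> act n (A - B) u i = act n A u i - act n B u i"
  by (simp add: act_def left_diff_distrib sum_subtractf)

lemma act_mult: "A \<in> carrier_mat n n \<Longrightarrow> B \<in> carrier_mat n n \<Longrightarrow> i < n \<Longrightarrow> act n (A * B) u i = act n A (act n B u) i"
proof -
  assume AB: "A \<in> carrier_mat n n" "B \<in> carrier_mat n n" "i < n"
  have "act n (A * B) u i = (\<Sum>k<n. (\<Sum>l<n. A $$ (i, l) * B $$ (l, k)) * u k)"
    using AB by (simp add: act_def scalar_prod_def lessThan_atLeast0)
  also have "\<dots> = (\<Sum>k<n. \<Sum>l<n. A $$ (i, l) * (B $$ (l, k) * u k))"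
    by (simp add: sum_distrib_right mult.assoc)
  also have "\<dots> = act n A (act n B u) i"
    unfolding act_def by (subst sum.swap) (simp add: sum_distrib_left)
  finally show ?thesis .
qed

lemma act_scalar: "i < n \<Longrightarrow> act n (c \<cdot>\<^sub>m 1\<^sub>m n) u i = c * u i"
proof -
  assume i: "i < n"
  have "act n (c \<cdot>\<^sub>m 1\<^sub>m n) u i = (\<Sum>k<n. if k = i then c * u i else 0)"
    unfolding act_def using i by (intro sum.cong) auto
  then show ?thesis using i by simp
qed

lemma mat_adjoint_dim [simp]:
  "dim_row (mat_adjoint A) = dim_col A" "dim_col (mat_adjoint A) = dim_row A"
  by (simp_all add: mat_adjoint_def mat_of_rows_def)

lemma mat_adjoint_carrier: "A \<in> carrier_mat n n \<Longrightarrow> mat_adjoint A \<in> carrier_mat n n"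
  by auto

lemma mat_adjoint_index [simp]:
  "i < dim_col A \<Longrightarrow> j < dim_row A \<Longrightarrow> mat_adjoint A $$ (i, j) = cnj (A $$ (j, i))"
  by (simp add: mat_adjoint_def mat_of_rows_def)

lemma cip_act_adjoint:
  assumes A: "A \<in> carrier_mat n n"
  shows "cip n (act n A u) v = cip n u (act n (mat_adjoint A) v)"
proof -
  have "cip n (act n A u) v = (\<Sum>i<n. \<Sum>k<n. A $$ (i, k) * u k * cnj (v i))"
    by (simp add: cip_def act_def sum_distrib_right)
  also have "\<dots> = (\<Sum>k<n. \<Sum>i<n. u k * (A $$ (i, k) * cnj (v i)))"
    by (subst sum.swap) (simp add: ac_simps)
  also have "\<dots> = cip n u (act n (mat_adjoint A) v)"
    using A by (simp add: cip_def act_def sum_distrib_left)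
  finally show ?thesis .
qed

lemma mat_adjoint_mult:
  fixes A B :: "complex mat"
  assumes "A \<in> carrier_mat n n" "B \<in> carrier_mat n n"
  shows "mat_adjoint (A * B) = mat_adjoint B * mat_adjoint A"
  using assms by (intro eq_matI) (auto simp: scalar_prod_def mult.commute)

lemma mat_adjoint_adjoint [simp]: "mat_adjoint (mat_adjoint A) = (A :: complex mat)"
  by (intro eq_matI) auto

lemma mat_adjoint_plus:
  fixes A :: "complex mat"
  assumes "A \<in> carrier_mat n n" "B \<in> carrier_mat n n"
  shows "mat_adjoint (A + B) = mat_adjoint A + mat_adjoint B"
  using assms by (intro eq_matI) auto

lemma mat_adjoint_scalar: "mat_adjoint (c \<cdot>\<^sub>m 1\<^sub>m n) = cnj c \<cdot>\<^sub>m (1\<^sub>m n :: complex mat)"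
  by (intro eq_matI) auto

lemma square_mat_assoc:
  fixes A :: "complex mat"
  assumes "A \<in> carrier_mat n n" "B \<in> carrier_mat n n" "C \<in> carrier_mat n n"
  shows "A * B * C = A * (B * C)"
  using assms by (rule assoc_mult_mat)

lemma op_norm_plus:
  assumes "A \<in> carrier_mat n n" "B \<in> carrier_mat n n"
  shows "op_norm (A + B) \<le> op_norm A + op_norm B"
proof (rule op_norm_le[where n = n])
  fix u
  have "cnorm n (act n (A + B) u) = cnorm n (\<lambda>i. act n A u i + act n B u i)"
    by (rule cnorm_cong) (simp add: act_plus assms)
  also have "\<dots> \<le> cnorm n (act n A u) + cnorm n (act n B u)" by (rule cnorm_triangle)
  also have "\<dots> \<le> op_norm A * cnorm n u + op_norm B * cnorm n u"
    by (intro add_mono cnorm_act_le assms)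
  finally show "cnorm n (act n (A + B) u) \<le> (op_norm A + op_norm B) * cnorm n u"
    by (simp add: distrib_right)
qed (use assms op_norm_nonneg[OF assms(1)] op_norm_nonneg[OF assms(2)] in auto)

lemma op_norm_mult:
  assumes "A \<in> carrier_mat n n" "B \<in> carrier_mat n n"
  shows "op_norm (A * B) \<le> op_norm A * op_norm B"
proof (rule op_norm_le[where n = n])
  fix u
  have "cnorm n (act n (A * B) u) = cnorm n (act n A (act n B u))"
    by (rule cnorm_cong) (simp add: act_mult assms)
  also have "\<dots> \<le> op_norm A * cnorm n (act n B u)" by (intro cnorm_act_le assms)
  also have "\<dots> \<le> op_norm A * (op_norm B * cnorm n u)"
    by (intro mult_left_mono cnorm_act_le op_norm_nonneg[of A n] assms)
  finally show "cnorm n (act n (A * B) u) \<le> op_norm A * op_norm B * cnorm n u"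
    by (simp add: mult.assoc)
qed (use assms op_norm_nonneg[OF assms(1)] op_norm_nonneg[OF assms(2)] in auto)

lemma op_norm_adjoint:
  assumes A: "A \<in> carrier_mat n n"
  shows "op_norm (mat_adjoint A) \<le> op_norm A"
proof (rule op_norm_le_form[where n = n])
  fix u v
  have "cip n (act n (mat_adjoint A) u) v = cnj (cip n (act n A v) u)"
    unfolding cip_act_adjoint[OF A] by (rule cip_commute)
  then show "cmod (cip n (act n (mat_adjoint A) u) v) \<le> op_norm A * (cnorm n u * cnorm n v)"
    using cmod_cip_act_le[OF A, of v u] by (simp add: mult.commute)
qed (use A op_norm_nonneg[OF A] in auto)

lemma op_norm_scalar: "op_norm (c \<cdot>\<^sub>m 1\<^sub>m n) \<le> cmod c"
proof (rule op_norm_le[where n = n])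
  fix u
  have "cnorm n (act n (c \<cdot>\<^sub>m 1\<^sub>m n) u) = cnorm n (\<lambda>i. c * u i)"
    by (rule cnorm_cong) (simp add: act_scalar)
  then show "cnorm n (act n (c \<cdot>\<^sub>m 1\<^sub>m n) u) \<le> cmod c * cnorm n u" by (simp add: cnorm_scale)
qed auto

lemma op_norm_zero: "op_norm (0\<^sub>m n n) = 0"
proof -
  have "op_norm (0\<^sub>m n n) \<le> 0"
    by (rule op_norm_le[where n = n]) (auto simp: act_def cnorm_def L2_set_def)
  then show ?thesis using op_norm_nonneg[of "0\<^sub>m n n" n] by simp
qed

lemma op_norm_minus_commute:
  assumes A: "A \<in> carrier_mat n n" and B: "B \<in> carrier_mat n n"
  shows "op_norm (A - B) = op_norm (B - A)"
proof -
  have le: "op_norm (A - B) \<le> op_norm (B - A)" if A: "A \<in> carrier_mat n n" and B: "B \<in> carrier_mat n n" for A B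
  proof (rule op_norm_le[where n = n])
    fix u
    have "cnorm n (act n (A - B) u) = cnorm n (\<lambda>i. (-1) * act n (B - A) u i)"
      by (rule cnorm_cong) (simp add: act_minus A B)
    also have "\<dots> = cnorm n (act n (B - A) u)" unfolding cnorm_scale by simp
    also have "\<dots> \<le> op_norm (B - A) * cnorm n u" by (rule cnorm_act_le) (use A B in auto)
    finally show "cnorm n (act n (A - B) u) \<le> op_norm (B - A) * cnorm n u" .
  qed (use A B op_norm_nonneg[of "B - A" n] in \<open>auto simp: minus_carrier_mat\<close>)
  show ?thesis using le[OF A B] le[OF B A] by simp
qed

lemma op_norm_triangle_diff:
  assumes "A \<in> carrier_mat n n" "B \<in> carrier_mat n n" "D \<in> carrier_mat n n"
  shows "op_norm (A - D) \<le> op_norm (A - B) + op_norm (B - D)"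
proof -
  have "A - D = (A - B) + (B - D)" using assms by (intro eq_matI) auto
  then show ?thesis using op_norm_plus[of "A - B" n "B - D"] assms by (simp add: minus_carrier_mat)
qed

lemma unitary_carrier: "U \<in> unitary_mats n \<Longrightarrow> U \<in> carrier_mat n n"
  by (simp add: unitary_mats_def)

lemma unitary_adjoint: "U \<in> unitary_mats n \<Longrightarrow> mat_adjoint U \<in> unitary_mats n"
  by (auto simp: unitary_mats_def)

lemma unitary_mult: "U \<in> unitary_mats n \<Longrightarrow> V \<in> unitary_mats n \<Longrightarrow> U * V \<in> unitary_mats n"
proof -
  assume "U \<in> unitary_mats n" "V \<in> unitary_mats n"
  then have c: "U \<in> carrier_mat n n" "V \<in> carrier_mat n n"
    and e: "U * mat_adjoint U = 1\<^sub>m n" "mat_adjoint U * U = 1\<^sub>m n" "V * mat_adjoint V = 1\<^sub>m n" "mat_adjoint V * V = 1\<^sub>m n"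
    by (auto simp: unitary_mats_def)
  note ca = mat_adjoint_carrier[OF c(1)] mat_adjoint_carrier[OF c(2)]
  have "U * V * (mat_adjoint V * mat_adjoint U) = U * ((V * mat_adjoint V) * mat_adjoint U)"
    using square_mat_assoc[OF c mult_carrier_mat[OF ca(2,1)]] square_mat_assoc[OF c(2) ca(2,1)] by simp
  also have "\<dots> = 1\<^sub>m n" using c ca e by simp
  finally have 1: "U * V * (mat_adjoint V * mat_adjoint U) = 1\<^sub>m n" .
  have "mat_adjoint V * mat_adjoint U * (U * V) = mat_adjoint V * ((mat_adjoint U * U) * V)"
    using square_mat_assoc[OF ca(2,1) mult_carrier_mat[OF c]] square_mat_assoc[OF ca(1) c] by simp
  also have "\<dots> = 1\<^sub>m n" using c ca e by simp
  finally have 2: "mat_adjoint V * mat_adjoint U * (U * V) = 1\<^sub>m n" .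
  show ?thesis using c ca 1 2 by (simp add: unitary_mats_def mat_adjoint_mult[OF c])
qed

lemma cnorm_unitary:
  assumes U: "U \<in> unitary_mats n" shows "cnorm n (act n U u) = cnorm n u"
proof -
  have c: "U \<in> carrier_mat n n" and e: "mat_adjoint U * U = 1\<^sub>m n" using U by (auto simp: unitary_mats_def)
  have "cip n (act n U u) (act n U u) = cip n u (act n (mat_adjoint U) (act n U u))"
    by (rule cip_act_adjoint[OF c])
  also have "\<dots> = cip n u u"
  proof (rule cip_cong)
    fix i assume i: "i < n"
    have "(1 :: complex) \<cdot>\<^sub>m 1\<^sub>m n = 1\<^sub>m n" by (intro eq_matI) auto
    then show "act n (mat_adjoint U) (act n U u) i = u i"
      using act_mult[OF mat_adjoint_carrier[OF c] c i, of u] act_scalar[OF i, of 1 u] e by simp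
  qed simp
  finally have "(cnorm n (act n U u))\<^sup>2 = (cnorm n u)\<^sup>2"
    unfolding cip_self using of_real_eq_iff by blast
  then show ?thesis by (simp add: power2_eq_iff_nonneg)
qed

lemma op_norm_unitary_conj:
  assumes U: "U \<in> unitary_mats n" and A: "A \<in> carrier_mat n n"
  shows "op_norm (U * A * mat_adjoint U) \<le> op_norm A"
proof (rule op_norm_le[where n = n])
  note c = unitary_carrier[OF U]
  note ca = mat_adjoint_carrier[OF c]
  show "U * A * mat_adjoint U \<in> carrier_mat n n" by (rule mult_carrier_mat[OF mult_carrier_mat[OF c A] ca])
  fix u
  have "cnorm n (act n (U * A * mat_adjoint U) u) = cnorm n (act n U (act n A (act n (mat_adjoint U) u)))"
  proof (rule cnorm_cong)
    fix i assume i: "i < n"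
    have "act n (U * A * mat_adjoint U) u i = act n (U * A) (act n (mat_adjoint U) u) i"
      using act_mult[OF mult_carrier_mat[OF c A] ca i] .
    also have "\<dots> = act n U (act n A (act n (mat_adjoint U) u)) i"
      using act_mult[OF c A i] .
    finally show "act n (U * A * mat_adjoint U) u i = act n U (act n A (act n (mat_adjoint U) u)) i" .
  qed
  also have "\<dots> = cnorm n (act n A (act n (mat_adjoint U) u))" by (rule cnorm_unitary[OF U])
  also have "\<dots> \<le> op_norm A * cnorm n (act n (mat_adjoint U) u)" by (rule cnorm_act_le[OF A])
  also have "\<dots> = op_norm A * cnorm n u" by (simp add: cnorm_unitary[OF unitary_adjoint[OF U]])
  finally show "cnorm n (act n (U * A * mat_adjoint U) u) \<le> op_norm A * cnorm n u" .
qed (rule op_norm_nonneg[OF A])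

section \<open>Noncommutative *-polynomials as expressions\<close>

text \<open>Expressions instead of coefficient families: evaluation, substitution and the estimates below are then plain structural
  recursions, and the size of an expression bounds the number of vectors met when it acts on a
  vector.\<close>
datatype 'i star_expr = Var 'i | Var_adj 'i | Scal complex
  | Plus "'i star_expr" "'i star_expr" | Times "'i star_expr" "'i star_expr"

primrec vars :: "'i star_expr \<Rightarrow> 'i set" where
  "vars (Var i) = {i}"
| "vars (Var_adj i) = {i}"
| "vars (Scal c) = {}"
| "vars (Plus s t) = vars s \<union> vars t"
| "vars (Times s t) = vars s \<union> vars t"

primrec star :: "'i star_expr \<Rightarrow> 'i star_expr" where
  "star (Var i) = Var_adj i"
| "star (Var_adj i) = Var i"
| "star (Scal c) = Scal (cnj c)"
| "star (Plus s t) = Plus (star s) (star t)"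
| "star (Times s t) = Times (star t) (star s)"

primrec subst :: "('i \<Rightarrow> 'j star_expr) \<Rightarrow> 'i star_expr \<Rightarrow> 'j star_expr" where
  "subst p (Var i) = p i"
| "subst p (Var_adj i) = star (p i)"
| "subst p (Scal c) = Scal c"
| "subst p (Plus s t) = Plus (subst p s) (subst p t)"
| "subst p (Times s t) = Times (subst p s) (subst p t)"

primrec ev :: "('i \<Rightarrow> 'b::unital_cstar_algebra) \<Rightarrow> 'i star_expr \<Rightarrow> 'b" where
  "ev a (Var i) = a i"
| "ev a (Var_adj i) = adj (a i)"
| "ev a (Scal c) = c *\<^sub>C 1"
| "ev a (Plus s t) = ev a s + ev a t"
| "ev a (Times s t) = ev a s * ev a t"

primrec evm :: "nat \<Rightarrow> ('i \<Rightarrow> complex mat) \<Rightarrow> 'i star_expr \<Rightarrow> complex mat" where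
  "evm N A (Var i) = A i"
| "evm N A (Var_adj i) = mat_adjoint (A i)"
| "evm N A (Scal c) = c \<cdot>\<^sub>m 1\<^sub>m N"
| "evm N A (Plus s t) = evm N A s + evm N A t"
| "evm N A (Times s t) = evm N A s * evm N A t"

lemma finite_vars [simp]: "finite (vars t)"
  by (induction t) auto

lemma vars_star [simp]: "vars (star t) = vars t"
  by (induction t) auto

lemma vars_subst: "vars (subst p t) \<subseteq> (\<Union>i\<in>vars t. vars (p i))"
  by (induction t) auto

lemma ev_star: "ev a (star t) = adj (ev a t)"
  by (induction t) (simp_all add: adj_adj adj_scaleC adj_add adj_mult)

lemma ev_subst: "ev a (subst p t) = ev (\<lambda>i. ev a (p i)) t"
  by (induction t) (simp_all add: ev_star)

lemma evm_carrier [intro]: "(\<And>i. i \<in> vars t \<Longrightarrow> A i \<in> carrier_mat N N) \<Longrightarrow> evm N A t \<in> carrier_mat N N"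
  by (induction t) auto

lemma evm_star: "(\<And>i. i \<in> vars t \<Longrightarrow> A i \<in> carrier_mat N N) \<Longrightarrow> evm N A (star t) = mat_adjoint (evm N A t)"
proof (induction t)
  case (Plus s t)
  then show ?case by (simp add: mat_adjoint_plus[OF evm_carrier evm_carrier])
next
  case (Times s t)
  then show ?case by (simp add: mat_adjoint_mult[OF evm_carrier evm_carrier])
qed (simp_all add: mat_adjoint_scalar)

lemma evm_subst:
  "(\<And>i j. i \<in> vars t \<Longrightarrow> j \<in> vars (p i) \<Longrightarrow> A j \<in> carrier_mat N N) \<Longrightarrow>
     evm N A (subst p t) = evm N (\<lambda>i. evm N A (p i)) t"
proof (induction t)
  case (Plus s t)
  have "evm N A (subst p s) = evm N (\<lambda>i. evm N A (p i)) s" by (rule Plus.IH(1)) (use Plus.prems in auto)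
  moreover have "evm N A (subst p t) = evm N (\<lambda>i. evm N A (p i)) t" by (rule Plus.IH(2)) (use Plus.prems in auto)
  ultimately show ?case by simp
next
  case (Times s t)
  have "evm N A (subst p s) = evm N (\<lambda>i. evm N A (p i)) s" by (rule Times.IH(1)) (use Times.prems in auto)
  moreover have "evm N A (subst p t) = evm N (\<lambda>i. evm N A (p i)) t" by (rule Times.IH(2)) (use Times.prems in auto)
  ultimately show ?case by simp
qed (simp_all add: evm_star)

lemma evm_cong: "(\<And>i. i \<in> vars t \<Longrightarrow> A i = B i) \<Longrightarrow> evm N A t = evm N B t"
  by (induction t) auto

lemma evm_unitary:
  assumes U: "U \<in> unitary_mats N"
  shows "(\<And>i. i \<in> vars t \<Longrightarrow> A i \<in> carrier_mat N N) \<Longrightarrow>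
    evm N (\<lambda>i. U * A i * mat_adjoint U) t = U * evm N A t * mat_adjoint U"
proof (induction t)
  case (Var i)
  then show ?case by simp
next
  case (Var_adj i)
  note c = unitary_carrier[OF U] and ca = mat_adjoint_carrier[OF unitary_carrier[OF U]]
  have A: "A i \<in> carrier_mat N N" using Var_adj by simp
  have "mat_adjoint (U * A i * mat_adjoint U) = U * (mat_adjoint (A i) * mat_adjoint U)"
    by (simp add: mat_adjoint_mult[OF mult_carrier_mat[OF c A] ca] mat_adjoint_mult[OF c A])
  then show ?case by (simp add: square_mat_assoc[OF c mat_adjoint_carrier[OF A] ca])
next
  case (Scal k)
  note c = unitary_carrier[OF U] and ca = mat_adjoint_carrier[OF unitary_carrier[OF U]]
  have "U * (k \<cdot>\<^sub>m 1\<^sub>m N) = k \<cdot>\<^sub>m U" using c by (subst mult_smult_distrib[OF c]) auto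
  then have "U * (k \<cdot>\<^sub>m 1\<^sub>m N) * mat_adjoint U = k \<cdot>\<^sub>m (U * mat_adjoint U)"
    using c ca by (simp add: mult_smult_assoc_mat[OF c ca])
  then show ?case using U by (simp add: unitary_mats_def)
next
  case (Plus s t)
  note c = unitary_carrier[OF U] and ca = mat_adjoint_carrier[OF unitary_carrier[OF U]]
  have st: "evm N A s \<in> carrier_mat N N" "evm N A t \<in> carrier_mat N N" using Plus.prems by (auto intro!: evm_carrier)
  then show ?case using Plus
    by (simp add: mult_add_distrib_mat[OF c st] add_mult_distrib_mat[OF mult_carrier_mat[OF c st(1)] mult_carrier_mat[OF c st(2)] ca])
next
  case (Times s t)
  note c = unitary_carrier[OF U] and ca = mat_adjoint_carrier[OF unitary_carrier[OF U]]
  have st: "evm N A s \<in> carrier_mat N N" "evm N A t \<in> carrier_mat N N" using Times.prems by (auto intro!: evm_carrier)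
  let ?S = "evm N A s" and ?T = "evm N A t" and ?V = "mat_adjoint U"
  have "U * ?S * ?V * (U * ?T * ?V) = U * ?S * (?V * (U * ?T * ?V))"
    by (rule square_mat_assoc[OF mult_carrier_mat[OF c st(1)] ca mult_carrier_mat[OF mult_carrier_mat[OF c st(2)] ca]])
  also have "?V * (U * ?T * ?V) = ?V * (U * (?T * ?V))"
    by (simp only: square_mat_assoc[OF c st(2) ca])
  also have "\<dots> = ?V * U * (?T * ?V)"
    by (rule square_mat_assoc[OF ca c mult_carrier_mat[OF st(2) ca], symmetric])
  also have "\<dots> = ?T * ?V"
    using U left_mult_one_mat[OF mult_carrier_mat[OF st(2) ca]] by (simp add: unitary_mats_def)
  also have "U * ?S * (?T * ?V) = U * (?S * (?T * ?V))"
    by (rule square_mat_assoc[OF c st(1) mult_carrier_mat[OF st(2) ca]])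
  also have "\<dots> = U * (?S * ?T * ?V)"
    by (simp only: square_mat_assoc[OF st ca])
  also have "\<dots> = U * (?S * ?T) * ?V"
    by (rule square_mat_assoc[OF c mult_carrier_mat[OF st] ca, symmetric])
  finally show ?case using Times by simp
qed

text \<open>\<open>bnd R t\<close> and \<open>lip R t\<close> bound the value and the Lipschitz constant of \<open>t\<close> on the ball of radius \<open>R\<close>, both in the
  C*-algebra and in matrices of any size. The independence of the size is what makes the covering
  estimates uniform in \<open>N\<close>.\<close>
primrec bnd :: "real \<Rightarrow> 'i star_expr \<Rightarrow> real" where
  "bnd R (Var i) = R"
| "bnd R (Var_adj i) = R"
| "bnd R (Scal c) = cmod c"
| "bnd R (Plus s t) = bnd R s + bnd R t"
| "bnd R (Times s t) = bnd R s * bnd R t"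

primrec lip :: "real \<Rightarrow> 'i star_expr \<Rightarrow> real" where
  "lip R (Var i) = 1"
| "lip R (Var_adj i) = 1"
| "lip R (Scal c) = 0"
| "lip R (Plus s t) = lip R s + lip R t"
| "lip R (Times s t) = lip R s * bnd R t + bnd R s * lip R t"

lemma bnd_nonneg: "0 \<le> R \<Longrightarrow> 0 \<le> bnd R t"
  by (induction t) auto

lemma lip_nonneg: "0 \<le> R \<Longrightarrow> 0 \<le> lip R t"
  by (induction t) (auto simp: bnd_nonneg)

lemma norm_ev_le: "0 \<le> R \<Longrightarrow> (\<And>i. i \<in> vars t \<Longrightarrow> norm (a i) \<le> R) \<Longrightarrow> norm (ev a t) \<le> bnd R t"
proof (induction t)
  case (Plus s t)
  then show ?case by (auto intro!: norm_triangle_mono)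
next
  case (Times s t)
  then have "norm (ev a s) * norm (ev a t) \<le> bnd R s * bnd R t"
    by (intro mult_mono) (auto simp: bnd_nonneg)
  then show ?case using norm_mult_ineq[of "ev a s" "ev a t"] by simp
qed (auto simp: norm_scaleC)

lemma norm_ev_diff_le:
  assumes R: "0 \<le> R" and e: "0 \<le> e"
  shows "(\<And>i. i \<in> vars t \<Longrightarrow> norm (a i) \<le> R \<and> norm (b i) \<le> R \<and> norm (a i - b i) \<le> e)
    \<Longrightarrow> norm (ev a t - ev b t) \<le> lip R t * e"
proof (induction t)
  case (Var_adj i)
  then show ?case by (simp flip: adj_diff)
next
  case (Plus s t)
  have "ev a (Plus s t) - ev b (Plus s t) = (ev a s - ev b s) + (ev a t - ev b t)" by simp
  moreover have "norm (\<dots>) \<le> lip R s * e + lip R t * e" using Plus by (intro norm_triangle_mono) auto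
  ultimately show ?case by (simp only: lip.simps distrib_right)
next
  case (Times s t)
  have eq: "ev a (Times s t) - ev b (Times s t) = (ev a s - ev b s) * ev a t + ev b s * (ev a t - ev b t)"
    by (simp add: left_diff_distrib right_diff_distrib)
  have "norm ((ev a s - ev b s) * ev a t) \<le> lip R s * e * bnd R t"
    using Times R e by (intro order_trans[OF norm_mult_ineq] mult_mono norm_ev_le) (auto simp: lip_nonneg)
  moreover have "norm (ev b s * (ev a t - ev b t)) \<le> bnd R s * (lip R t * e)"
    using Times R e by (intro order_trans[OF norm_mult_ineq] mult_mono norm_ev_le) (auto simp: bnd_nonneg)
  ultimately have "norm (ev a (Times s t) - ev b (Times s t)) \<le> lip R s * e * bnd R t + bnd R s * (lip R t * e)"
    unfolding eq by (rule norm_triangle_mono)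
  then show ?case by (simp add: algebra_simps)
qed (use e in auto)

lemma op_norm_evm_le:
  "0 \<le> R \<Longrightarrow> (\<And>i. i \<in> vars t \<Longrightarrow> A i \<in> carrier_mat N N \<and> op_norm (A i) \<le> R) \<Longrightarrow> op_norm (evm N A t) \<le> bnd R t"
proof (induction t)
  case (Var_adj i)
  then show ?case using op_norm_adjoint[of "A i" N] by force
next
  case (Scal c)
  then show ?case using op_norm_scalar by simp
next
  case (Plus s t)
  have "op_norm (evm N A s + evm N A t) \<le> op_norm (evm N A s) + op_norm (evm N A t)"
    using Plus.prems by (intro op_norm_plus[where n = N] evm_carrier) auto
  then show ?case using Plus by force
next
  case (Times s t)
  have c: "evm N A s \<in> carrier_mat N N" "evm N A t \<in> carrier_mat N N"
    using Times.prems by (auto intro!: evm_carrier)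
  have "op_norm (evm N A s * evm N A t) \<le> op_norm (evm N A s) * op_norm (evm N A t)"
    by (rule op_norm_mult[OF c])
  also have "\<dots> \<le> bnd R s * bnd R t"
    using Times op_norm_nonneg[OF c(1)] op_norm_nonneg[OF c(2)] by (intro mult_mono) (auto simp: bnd_nonneg)
  finally show ?case by simp
qed auto

lemma op_norm_evm_diff_le:
  assumes R: "0 \<le> R" and e: "0 \<le> e"
  shows "(\<And>i. i \<in> vars t \<Longrightarrow> A i \<in> carrier_mat N N \<and> B i \<in> carrier_mat N N \<and>
      op_norm (A i) \<le> R \<and> op_norm (B i) \<le> R \<and> op_norm (A i - B i) \<le> e)
    \<Longrightarrow> op_norm (evm N A t - evm N B t) \<le> lip R t * e"
proof (induction t)
  case (Var_adj i)
  then have c: "A i \<in> carrier_mat N N" "B i \<in> carrier_mat N N" by auto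
  have "mat_adjoint (A i) - mat_adjoint (B i) = mat_adjoint (A i - B i)"
    using c by (intro eq_matI) auto
  then show ?case using op_norm_adjoint[of "A i - B i" N] Var_adj by (force simp: minus_carrier_mat)
next
  case (Scal c)
  have "c \<cdot>\<^sub>m 1\<^sub>m N - c \<cdot>\<^sub>m 1\<^sub>m N = 0\<^sub>m N N" by (intro eq_matI) auto
  then show ?case by (simp only: evm.simps lip.simps op_norm_zero mult_zero_left order_refl)
next
  case (Plus s t)
  have c: "evm N A s \<in> carrier_mat N N" "evm N A t \<in> carrier_mat N N"
    "evm N B s \<in> carrier_mat N N" "evm N B t \<in> carrier_mat N N"
    using Plus.prems by (auto intro!: evm_carrier)
  have "evm N A (Plus s t) - evm N B (Plus s t) = (evm N A s - evm N B s) + (evm N A t - evm N B t)"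
    using c by (intro eq_matI) auto
  then have "op_norm (evm N A (Plus s t) - evm N B (Plus s t)) \<le> op_norm (evm N A s - evm N B s) + op_norm (evm N A t - evm N B t)"
    using op_norm_plus[OF minus_carrier_mat[OF c(3)] minus_carrier_mat[OF c(4)]] by simp
  then show ?case using Plus by (fastforce simp: distrib_right)
next
  case (Times s t)
  have c: "evm N A s \<in> carrier_mat N N" "evm N A t \<in> carrier_mat N N"
    "evm N B s \<in> carrier_mat N N" "evm N B t \<in> carrier_mat N N"
    using Times.prems by (auto intro!: evm_carrier)
  note d = minus_carrier_mat[OF c(3), of "evm N A s"] minus_carrier_mat[OF c(4), of "evm N A t"]
  have "(evm N A s - evm N B s) * evm N A t + evm N B s * (evm N A t - evm N B t)
      = (evm N A s * evm N A t - evm N B s * evm N A t) + (evm N B s * evm N A t - evm N B s * evm N B t)"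
    by (simp add: minus_mult_distrib_mat[OF c(1,3,2)] mult_minus_distrib_mat[OF c(3,2,4)])
  also have "\<dots> = evm N A (Times s t) - evm N B (Times s t)"
    using c by (intro eq_matI) auto
  finally have eq: "evm N A (Times s t) - evm N B (Times s t) = (evm N A s - evm N B s) * evm N A t + evm N B s * (evm N A t - evm N B t)" ..
  have "op_norm ((evm N A s - evm N B s) * evm N A t) \<le> lip R s * e * bnd R t"
    using Times R e op_norm_nonneg[OF d(1)] op_norm_nonneg[OF c(2)]
    by (intro order_trans[OF op_norm_mult[OF d(1) c(2)]] mult_mono op_norm_evm_le) (auto simp: lip_nonneg)
  moreover have "op_norm (evm N B s * (evm N A t - evm N B t)) \<le> bnd R s * (lip R t * e)"
    using Times R e op_norm_nonneg[OF d(2)] op_norm_nonneg[OF c(3)]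
    by (intro order_trans[OF op_norm_mult[OF c(3) d(2)]] mult_mono op_norm_evm_le) (auto simp: bnd_nonneg)
  ultimately have "op_norm (evm N A (Times s t) - evm N B (Times s t)) \<le> lip R s * e * bnd R t + bnd R s * (lip R t * e)"
    unfolding eq using op_norm_plus[OF mult_carrier_mat[OF d(1) c(2)] mult_carrier_mat[OF c(3) d(2)]] by linarith
  then show ?case by (simp add: algebra_simps)
qed (use e in auto)

text \<open>The closure of the set of values is a C*-subalgebra that contains the generators.\<close>
lemma star_expr_dense:
  fixes a :: "'i \<Rightarrow> 'b::unital_cstar_algebra"
  assumes gen: "cstar_generates (a ` I)" and e: "e > 0"
  shows "\<exists>t. vars t \<subseteq> I \<and> norm (ev a t - x) < e"
proof -
  define E where "E = {ev a t | t. vars t \<subseteq> I}"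
  have E: "0 \<in> E" "1 \<in> E" "\<And>x y. x \<in> E \<Longrightarrow> y \<in> E \<Longrightarrow> x + y \<in> E" "\<And>x y. x \<in> E \<Longrightarrow> y \<in> E \<Longrightarrow> x * y \<in> E"
    "\<And>c x. x \<in> E \<Longrightarrow> c *\<^sub>C x \<in> E" "\<And>x. x \<in> E \<Longrightarrow> adj x \<in> E"
  proof -
    show "0 \<in> E" unfolding E_def by (auto intro!: exI[of _ "Scal 0"])
    show "1 \<in> E" unfolding E_def by (auto intro!: exI[of _ "Scal 1"])
    fix x y :: 'b and c assume "x \<in> E" "y \<in> E"
    then obtain s t where st: "x = ev a s" "y = ev a t" "vars s \<subseteq> I" "vars t \<subseteq> I" by (auto simp: E_def)
    show "x + y \<in> E" unfolding E_def using st by (auto intro!: exI[of _ "Plus s t"])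
    show "x * y \<in> E" unfolding E_def using st by (auto intro!: exI[of _ "Times s t"])
  next
    fix x :: 'b and c assume "x \<in> E"
    then obtain s where st: "x = ev a s" "vars s \<subseteq> I" by (auto simp: E_def)
    show "c *\<^sub>C x \<in> E" unfolding E_def
      using st by (auto intro!: exI[of _ "Times (Scal c) s"] simp: scaleC_mult_left)
    show "adj x \<in> E" unfolding E_def using st by (auto intro!: exI[of _ "star s"] simp: ev_star)
  qed
  have "cstar_subalgebra (closure E)"
    unfolding cstar_subalgebra_def
  proof (intro conjI ballI)
    show "csubspace (closure E)"
    proof (rule cvec.subspaceI)
      show "0 \<in> closure E" using E(1) closure_subset by blast
    next
      fix x y assume "x \<in> closure E" "y \<in> closure E"
      then obtain f g where "\<And>n. f n \<in> E" "\<And>n. g n \<in> E" "f \<longlonglongrightarrow> x" "g \<longlonglongrightarrow> y"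
        unfolding closure_sequential by metis
      then show "x + y \<in> closure E"
        unfolding closure_sequential by (intro exI[of _ "\<lambda>n. f n + g n"]) (auto intro: E tendsto_add)
    next
      fix c x assume "x \<in> closure E"
      then obtain f where f: "\<And>n. f n \<in> E" "f \<longlonglongrightarrow> x"
        unfolding closure_sequential by metis
      have "(\<lambda>n. (c *\<^sub>C 1) * f n) \<longlonglongrightarrow> (c *\<^sub>C 1) * x" by (intro tendsto_intros f)
      then have "(\<lambda>n. c *\<^sub>C f n) \<longlonglongrightarrow> c *\<^sub>C x" by (simp add: scaleC_mult_left)
      then show "c *\<^sub>C x \<in> closure E"
        unfolding closure_sequential using f by (intro exI[of _ "\<lambda>n. c *\<^sub>C f n"]) (auto intro: E)
    qed
    show "1 \<in> closure E" using E(2) closure_subset by blast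
  next
    fix x y assume "x \<in> closure E" "y \<in> closure E"
    then obtain f g where "\<And>n. f n \<in> E" "\<And>n. g n \<in> E" "f \<longlonglongrightarrow> x" "g \<longlonglongrightarrow> y"
      unfolding closure_sequential by metis
    then show "x * y \<in> closure E"
      unfolding closure_sequential by (intro exI[of _ "\<lambda>n. f n * g n"]) (auto intro: E tendsto_mult)
  next
    fix x assume "x \<in> closure E"
    then obtain f where "\<And>n. f n \<in> E" "f \<longlonglongrightarrow> x"
      unfolding closure_sequential by metis
    then show "adj x \<in> closure E"
      unfolding closure_sequential by (intro exI[of _ "\<lambda>n. adj (f n)"]) (auto intro: E continuous_adj)
  qed simp
  moreover have "a ` I \<subseteq> closure E"
  proof -
    have "a ` I \<subseteq> E"
    proof
      fix x assume "x \<in> a ` I"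
      then obtain i where "x = a i" "i \<in> I" by auto
      then show "x \<in> E" unfolding E_def by (auto intro!: exI[of _ "Var i"])
    qed
    then show ?thesis using closure_subset by blast
  qed
  ultimately have "UNIV \<subseteq> closure E"
    using hull_minimal[of "a ` I" "closure E" cstar_subalgebra] gen by (simp add: cstar_generates_def)
  then have "x \<in> closure E" by blast
  then obtain y where "y \<in> E" "dist y x < e" using e by (auto simp: closure_approachable)
  then show ?thesis by (auto simp: E_def dist_norm)
qed

text \<open>The scaling \<open>s\<close> is a parameter so that one proof serves evaluation in the C*-algebra and, entrywise, in matrices.\<close>
lemma keys_sum_plus:
  fixes s :: "complex \<Rightarrow> 'm \<Rightarrow> 'm::ab_group_add"
  assumes add: "\<And>c d x. s (c + d) x = s c x + s d x"
  shows "(\<Sum>w\<in>Poly_Mapping.keys (P + Q). s (Poly_Mapping.lookup (P + Q) w) (g w))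
    = (\<Sum>w\<in>Poly_Mapping.keys P. s (Poly_Mapping.lookup P w) (g w)) + (\<Sum>w\<in>Poly_Mapping.keys Q. s (Poly_Mapping.lookup Q w) (g w))"
proof -
  have s0: "s 0 x = 0" for x using add[of 0 0 x] by simp
  let ?K = "Poly_Mapping.keys P \<union> Poly_Mapping.keys Q"
  have ext: "(\<Sum>w\<in>Poly_Mapping.keys R. s (Poly_Mapping.lookup R w) (g w)) = (\<Sum>w\<in>?K. s (Poly_Mapping.lookup R w) (g w))"
    if "Poly_Mapping.keys R \<subseteq> ?K" for R
    using that by (intro sum.mono_neutral_left) (auto simp: s0 in_keys_iff)
  show ?thesis
    unfolding ext[OF Poly_Mapping.keys_add] ext[of P, OF Un_upper1] ext[of Q, OF Un_upper2]
    by (simp add: lookup_add add sum.distrib)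
qed

lemma eval_poly_plus: "eval_poly a (P + Q) = eval_poly a P + eval_poly a Q"
  unfolding eval_poly_def by (rule keys_sum_plus) (rule scaleC_add_left)

lemma eval_poly_mat_plus:
  "i < N \<Longrightarrow> j < N \<Longrightarrow> eval_poly_mat N A (P + Q) $$ (i, j) = eval_poly_mat N A P $$ (i, j) + eval_poly_mat N A Q $$ (i, j)"
  unfolding eval_poly_mat_def by (simp add: keys_sum_plus[where s = "(*)"] distrib_right)

lemma eval_poly_single: "eval_poly a (Poly_Mapping.single w c) = c *\<^sub>C prod_list (map (eval_letter a) w)"
  by (simp add: eval_poly_def)

lemma eval_poly_mat_single:
  "i < N \<Longrightarrow> j < N \<Longrightarrow> eval_poly_mat N A (Poly_Mapping.single w c) $$ (i, j) = c * eval_word_mat N A w $$ (i, j)"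
  by (simp add: eval_poly_mat_def)

lemma eval_poly_zero: "eval_poly a 0 = 0"
  by (simp add: eval_poly_def)

lemma eval_poly_mat_zero: "i < N \<Longrightarrow> j < N \<Longrightarrow> eval_poly_mat N A 0 $$ (i, j) = 0"
  by (simp add: eval_poly_mat_def)

lemma eval_poly_sum: "eval_poly a (sum f K) = (\<Sum>k\<in>K. eval_poly a (f k))"
  by (induction K rule: infinite_finite_induct) (simp_all add: eval_poly_zero eval_poly_plus)

lemma eval_poly_mat_sum:
  "i < N \<Longrightarrow> j < N \<Longrightarrow> eval_poly_mat N A (sum f K) $$ (i, j) = (\<Sum>k\<in>K. eval_poly_mat N A (f k) $$ (i, j))"
  by (induction K rule: infinite_finite_induct) (simp_all add: eval_poly_mat_zero eval_poly_mat_plus)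

lemma eval_poly_mat_carrier [simp]: "eval_poly_mat N A P \<in> carrier_mat N N"
  by (simp add: eval_poly_mat_def)

lemma eval_poly_mat_dim [simp]: "dim_row (eval_poly_mat N A P) = N" "dim_col (eval_poly_mat N A P) = N"
  by (simp_all add: eval_poly_mat_def)

lemma eval_word_mat_carrier:
  "(\<And>l. l \<in> set w \<Longrightarrow> eval_letter_mat A l \<in> carrier_mat N N) \<Longrightarrow> eval_word_mat N A w \<in> carrier_mat N N"
  by (induction w) (auto simp: eval_word_mat_def intro!: mult_carrier_mat[where n = N])

lemma eval_word_mat_append:
  "(\<And>l. l \<in> set u \<union> set v \<Longrightarrow> eval_letter_mat A l \<in> carrier_mat N N) \<Longrightarrow>
    eval_word_mat N A (u @ v) = eval_word_mat N A u * eval_word_mat N A v"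
proof (induction u)
  case Nil
  then show ?case using eval_word_mat_carrier[of v A N] by (simp add: eval_word_mat_def)
next
  case (Cons l u)
  have c: "eval_letter_mat A l \<in> carrier_mat N N" "eval_word_mat N A u \<in> carrier_mat N N" "eval_word_mat N A v \<in> carrier_mat N N"
    using Cons.prems by (auto intro!: eval_word_mat_carrier)
  have "eval_word_mat N A ((l # u) @ v) = eval_letter_mat A l * eval_word_mat N A (u @ v)"
    by (simp add: eval_word_mat_def)
  also have "\<dots> = eval_letter_mat A l * eval_word_mat N A u * eval_word_mat N A v"
    using Cons square_mat_assoc[OF c] by simp
  finally show ?case by (simp add: eval_word_mat_def)
qed

lemma eval_letter_mat_carrier:
  "l \<in> Gen ` I \<union> Gen_adj ` I \<Longrightarrow> (\<And>i. i \<in> I \<Longrightarrow> A i \<in> carrier_mat N N) \<Longrightarrow> eval_letter_mat A l \<in> carrier_mat N N"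
  by (elim UnE imageE) (simp_all add: mat_adjoint_carrier)

lemma star_expr_to_poly:
  fixes t :: "'i star_expr"
  assumes "vars t \<subseteq> I"
  shows "\<exists>P\<in>star_polys I. (\<forall>a :: 'i \<Rightarrow> 'b::unital_cstar_algebra. eval_poly a P = ev a t) \<and>
    (\<forall>N A. (\<forall>i\<in>I. A i \<in> carrier_mat N N) \<longrightarrow> eval_poly_mat N A P = evm N A t)"
  using assms
proof (induction t)
  case (Var i)
  show ?case
    using Var by (intro bexI[of _ "Poly_Mapping.single [Gen i] 1"])
      (auto simp: eval_poly_single star_polys_def eval_word_mat_def eval_poly_mat_single
        intro!: eq_matI simp: eval_poly_mat_def)
next
  case (Var_adj i)
  show ?case
    using Var_adj by (intro bexI[of _ "Poly_Mapping.single [Gen_adj i] 1"])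
      (auto simp: eval_poly_single star_polys_def eval_word_mat_def eval_poly_mat_single
        intro!: eq_matI simp: eval_poly_mat_def)
next
  case (Scal c)
  show ?case
    by (intro bexI[of _ "Poly_Mapping.single [] c"])
      (auto simp: eval_poly_single star_polys_def eval_word_mat_def eval_poly_mat_single
        intro!: eq_matI simp: eval_poly_mat_def)
next
  case (Plus s t)
  have "\<exists>P\<in>star_polys I. (\<forall>a :: 'i \<Rightarrow> 'b. eval_poly a P = ev a s) \<and>
      (\<forall>N A. (\<forall>i\<in>I. A i \<in> carrier_mat N N) \<longrightarrow> eval_poly_mat N A P = evm N A s)"
    by (rule Plus.IH(1)) (use Plus.prems in simp)
  then obtain P where P: "P \<in> star_polys I" "\<And>a :: 'i \<Rightarrow> 'b. eval_poly a P = ev a s"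
      "\<And>N A. (\<forall>i\<in>I. A i \<in> carrier_mat N N) \<Longrightarrow> eval_poly_mat N A P = evm N A s"
    by blast
  have "\<exists>P\<in>star_polys I. (\<forall>a :: 'i \<Rightarrow> 'b. eval_poly a P = ev a t) \<and>
      (\<forall>N A. (\<forall>i\<in>I. A i \<in> carrier_mat N N) \<longrightarrow> eval_poly_mat N A P = evm N A t)"
    by (rule Plus.IH(2)) (use Plus.prems in simp)
  then obtain Q where Q: "Q \<in> star_polys I" "\<And>a :: 'i \<Rightarrow> 'b. eval_poly a Q = ev a t"
      "\<And>N A. (\<forall>i\<in>I. A i \<in> carrier_mat N N) \<Longrightarrow> eval_poly_mat N A Q = evm N A t"
    by blast
  have "P + Q \<in> star_polys I" using P(1) Q(1) Poly_Mapping.keys_add[of P Q] by (auto simp: star_polys_def)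
  moreover have "eval_poly_mat N A (P + Q) = evm N A (Plus s t)" if A: "\<forall>i\<in>I. A i \<in> carrier_mat N N" for N A
  proof (rule eq_matI)
    note c = eval_poly_mat_carrier[of N A P] eval_poly_mat_carrier[of N A Q]
    fix i j assume "i < dim_row (evm N A (Plus s t))" "j < dim_col (evm N A (Plus s t))"
    then show "eval_poly_mat N A (P + Q) $$ (i, j) = evm N A (Plus s t) $$ (i, j)"
      using c by (simp add: eval_poly_mat_plus P(3)[OF A, symmetric] Q(3)[OF A, symmetric])
  qed (use eval_poly_mat_carrier[of N A "P + Q"] eval_poly_mat_carrier[of N A P] eval_poly_mat_carrier[of N A Q]
      in \<open>auto simp: P(3)[OF A, symmetric] Q(3)[OF A, symmetric]\<close>)
  moreover have "eval_poly a (P + Q) = ev a (Plus s t)" for a :: "'i \<Rightarrow> 'b"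
    by (simp add: eval_poly_plus P(2) Q(2))
  ultimately show ?case by blast
next
  case (Times s t)
  have "\<exists>P\<in>star_polys I. (\<forall>a :: 'i \<Rightarrow> 'b. eval_poly a P = ev a s) \<and>
      (\<forall>N A. (\<forall>i\<in>I. A i \<in> carrier_mat N N) \<longrightarrow> eval_poly_mat N A P = evm N A s)"
    by (rule Times.IH(1)) (use Times.prems in simp)
  then obtain P where P: "P \<in> star_polys I" "\<And>a :: 'i \<Rightarrow> 'b. eval_poly a P = ev a s"
      "\<And>N A. (\<forall>i\<in>I. A i \<in> carrier_mat N N) \<Longrightarrow> eval_poly_mat N A P = evm N A s"
    by blast
  have "\<exists>P\<in>star_polys I. (\<forall>a :: 'i \<Rightarrow> 'b. eval_poly a P = ev a t) \<and>
      (\<forall>N A. (\<forall>i\<in>I. A i \<in> carrier_mat N N) \<longrightarrow> eval_poly_mat N A P = evm N A t)"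
    by (rule Times.IH(2)) (use Times.prems in simp)
  then obtain Q where Q: "Q \<in> star_polys I" "\<And>a :: 'i \<Rightarrow> 'b. eval_poly a Q = ev a t"
      "\<And>N A. (\<forall>i\<in>I. A i \<in> carrier_mat N N) \<Longrightarrow> eval_poly_mat N A Q = evm N A t"
    by blast
  define R where "R = (\<Sum>u\<in>Poly_Mapping.keys P. \<Sum>v\<in>Poly_Mapping.keys Q.
    Poly_Mapping.single (u @ v) (Poly_Mapping.lookup P u * Poly_Mapping.lookup Q v))"
  have sp: "sum f K \<in> star_polys I" if "\<And>k. k \<in> K \<Longrightarrow> f k \<in> star_polys I" for f :: "'i letter list \<Rightarrow> 'i star_poly" and K
    using that
  proof (induction K rule: infinite_finite_induct)
    case (insert k K)
    then have "f k \<in> star_polys I" "sum f K \<in> star_polys I" by auto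
    then have "f k + sum f K \<in> star_polys I"
      using Poly_Mapping.keys_add[of "f k" "sum f K"] by (auto simp: star_polys_def)
    with insert show ?case by simp
  qed (auto simp: star_polys_def)
  have "R \<in> star_polys I"
    unfolding R_def using P(1) Q(1) by (intro sp) (auto simp: star_polys_def split: if_splits)
  moreover have "eval_poly a R = ev a (Times s t)" for a :: "'i \<Rightarrow> 'b"
  proof -
    have "eval_poly a R = eval_poly a P * eval_poly a Q"
      by (simp add: R_def eval_poly_sum eval_poly_single)
        (simp add: eval_poly_def sum_product scaleC_mult_left scaleC_mult_right scaleC_scaleC mult.commute)
    then show ?thesis by (simp add: P(2) Q(2))
  qed
  moreover have "eval_poly_mat N A R = evm N A (Times s t)" if A: "\<forall>i\<in>I. A i \<in> carrier_mat N N" for N A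
  proof (rule eq_matI)
    note c = eval_poly_mat_carrier[of N A P] eval_poly_mat_carrier[of N A Q]
    fix i j assume "i < dim_row (evm N A (Times s t))" "j < dim_col (evm N A (Times s t))"
    then have ij: "i < N" "j < N" by (auto simp: P(3)[OF A, symmetric] Q(3)[OF A, symmetric] eval_poly_mat_def)
    have cw: "eval_word_mat N A u \<in> carrier_mat N N" if "u \<in> Poly_Mapping.keys P \<union> Poly_Mapping.keys Q" for u
    proof (rule eval_word_mat_carrier)
      fix l assume "l \<in> set u"
      with that P(1) Q(1) have "l \<in> Gen ` I \<union> Gen_adj ` I" by (auto simp: star_polys_def)
      then show "eval_letter_mat A l \<in> carrier_mat N N" using A by (intro eval_letter_mat_carrier) auto
    qed
    have ap: "eval_word_mat N A (u @ v) $$ (i, j) = (\<Sum>k<N. eval_word_mat N A u $$ (i, k) * eval_word_mat N A v $$ (k, j))"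
      if uv: "u \<in> Poly_Mapping.keys P" "v \<in> Poly_Mapping.keys Q" for u v
    proof -
      have "eval_word_mat N A (u @ v) = eval_word_mat N A u * eval_word_mat N A v"
      proof (rule eval_word_mat_append)
        fix l assume "l \<in> set u \<union> set v"
        with uv P(1) Q(1) have "l \<in> Gen ` I \<union> Gen_adj ` I" by (auto simp: star_polys_def)
        then show "eval_letter_mat A l \<in> carrier_mat N N" using A by (intro eval_letter_mat_carrier) auto
      qed
      then show ?thesis using cw[of u] cw[of v] uv ij by (simp add: scalar_prod_def lessThan_atLeast0)
    qed
    have "eval_poly_mat N A R $$ (i, j) = (\<Sum>u\<in>Poly_Mapping.keys P. \<Sum>v\<in>Poly_Mapping.keys Q. \<Sum>k<N.
        (Poly_Mapping.lookup P u * eval_word_mat N A u $$ (i, k)) * (Poly_Mapping.lookup Q v * eval_word_mat N A v $$ (k, j)))"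
      using ij by (simp add: R_def eval_poly_mat_sum eval_poly_mat_single ap sum_distrib_left ac_simps)
    also have "\<dots> = (\<Sum>u\<in>Poly_Mapping.keys P. \<Sum>k<N. \<Sum>v\<in>Poly_Mapping.keys Q.
        (Poly_Mapping.lookup P u * eval_word_mat N A u $$ (i, k)) * (Poly_Mapping.lookup Q v * eval_word_mat N A v $$ (k, j)))"
      by (rule sum.cong[OF refl], rule sum.swap)
    also have "\<dots> = (\<Sum>k<N. \<Sum>u\<in>Poly_Mapping.keys P. \<Sum>v\<in>Poly_Mapping.keys Q.
        (Poly_Mapping.lookup P u * eval_word_mat N A u $$ (i, k)) * (Poly_Mapping.lookup Q v * eval_word_mat N A v $$ (k, j)))"
      by (rule sum.swap)
    also have "\<dots> = (\<Sum>k<N. eval_poly_mat N A P $$ (i, k) * eval_poly_mat N A Q $$ (k, j))"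
      using ij by (simp add: eval_poly_mat_def sum_product)
    also have "\<dots> = (eval_poly_mat N A P * eval_poly_mat N A Q) $$ (i, j)"
      using ij c by (simp add: scalar_prod_def lessThan_atLeast0)
    finally show "eval_poly_mat N A R $$ (i, j) = evm N A (Times s t) $$ (i, j)"
      by (simp add: P(3)[OF A] Q(3)[OF A])
  qed (use eval_poly_mat_carrier[of N A R] eval_poly_mat_carrier[of N A P] eval_poly_mat_carrier[of N A Q]
      in \<open>auto simp: P(3)[OF A, symmetric] Q(3)[OF A, symmetric]\<close>)
  ultimately show ?case by blast
qed

text \<open>Existence of one expression for a finite sum avoids choosing an enumeration of the index set.\<close>
lemma star_expr_sum:
  fixes f :: "'k \<Rightarrow> 'i star_expr"
  assumes "finite K"
  obtains t where "vars t \<subseteq> (\<Union>k\<in>K. vars (f k))"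
    "\<And>a :: 'i \<Rightarrow> 'b::unital_cstar_algebra. ev a t = (\<Sum>k\<in>K. ev a (f k))"
    "\<And>N A i j. (\<forall>k\<in>K. \<forall>x\<in>vars (f k). A x \<in> carrier_mat N N) \<Longrightarrow> i < N \<Longrightarrow> j < N \<Longrightarrow>
       evm N A t $$ (i, j) = (\<Sum>k\<in>K. evm N A (f k) $$ (i, j))"
  using assms
proof (induction K rule: finite_induct)
  case empty
  show ?case by (rule empty[of "Scal 0"]) auto
next
  case (insert k K)
  show ?case
  proof (rule insert.IH)
    fix t
    assume t: "vars t \<subseteq> (\<Union>k\<in>K. vars (f k))"
      "\<And>a :: 'i \<Rightarrow> 'b. ev a t = (\<Sum>k\<in>K. ev a (f k))"
      "\<And>N A i j. (\<forall>k\<in>K. \<forall>x\<in>vars (f k). A x \<in> carrier_mat N N) \<Longrightarrow> i < N \<Longrightarrow> j < N \<Longrightarrow>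
         evm N A t $$ (i, j) = (\<Sum>k\<in>K. evm N A (f k) $$ (i, j))"
    show ?case
    proof (rule insert.prems[of "Plus (f k) t"])
      show "vars (Plus (f k) t) \<subseteq> (\<Union>k\<in>insert k K. vars (f k))" using t(1) by auto
      show "ev a (Plus (f k) t) = (\<Sum>k\<in>insert k K. ev a (f k))" for a :: "'i \<Rightarrow> 'b"
        using insert.hyps by (simp add: t(2))
      fix N and A :: "'i \<Rightarrow> complex mat" and i j :: nat
      assume A: "\<forall>k\<in>insert k K. \<forall>x\<in>vars (f k). A x \<in> carrier_mat N N" and ij: "i < N" "j < N"
      have c: "evm N A t \<in> carrier_mat N N" using A t(1) by (intro evm_carrier) auto
      have "evm N A t $$ (i, j) = (\<Sum>k\<in>K. evm N A (f k) $$ (i, j))" using A ij by (intro t(3)) auto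
      then show "evm N A (Plus (f k) t) $$ (i, j) = (\<Sum>k\<in>insert k K. evm N A (f k) $$ (i, j))"
        using ij insert.hyps c by simp
    qed
  qed
qed

lemma star_poly_to_expr:
  fixes P :: "'i star_poly"
  assumes P: "P \<in> star_polys I"
  shows "\<exists>t. vars t \<subseteq> I \<and> (\<forall>a :: 'i \<Rightarrow> 'b::unital_cstar_algebra. eval_poly a P = ev a t) \<and>
    (\<forall>N A. (\<forall>i\<in>I. A i \<in> carrier_mat N N) \<longrightarrow> eval_poly_mat N A P = evm N A t)"
proof -
  define le :: "'i letter \<Rightarrow> 'i star_expr" where "le = (\<lambda>l. case l of Gen i \<Rightarrow> Var i | Gen_adj i \<Rightarrow> Var_adj i)"
  define we where "we = (\<lambda>w. foldr (\<lambda>l t. Times (le l) t) w (Scal 1))"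
  have 1: "ev a (we w) = prod_list (map (eval_letter a) w)" for a :: "'i \<Rightarrow> 'b" and w
    by (induction w) (auto simp: we_def le_def split: letter.splits)
  have 2: "evm N A (we w) = eval_word_mat N A w" for N A w
  proof (induction w)
    case Nil
    have "1 \<cdot>\<^sub>m 1\<^sub>m N = (1\<^sub>m N :: complex mat)" by (intro eq_matI) auto
    then show ?case by (simp add: we_def eval_word_mat_def)
  qed (auto simp: we_def le_def eval_word_mat_def split: letter.splits)
  have 3: "vars (we w) \<subseteq> I" if "set w \<subseteq> Gen ` I \<union> Gen_adj ` I" for w
    using that by (induction w) (auto simp: we_def le_def)
  let ?f = "\<lambda>w. Times (Scal (Poly_Mapping.lookup P w)) (we w)"
  obtain t where t: "vars t \<subseteq> (\<Union>k\<in>Poly_Mapping.keys P. vars (?f k))"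
    "\<And>a :: 'i \<Rightarrow> 'b. ev a t = (\<Sum>k\<in>Poly_Mapping.keys P. ev a (?f k))"
    "\<And>N A i j. (\<forall>k\<in>Poly_Mapping.keys P. \<forall>x\<in>vars (?f k). A x \<in> carrier_mat N N) \<Longrightarrow> i < N \<Longrightarrow> j < N \<Longrightarrow>
       evm N A t $$ (i, j) = (\<Sum>k\<in>Poly_Mapping.keys P. evm N A (?f k) $$ (i, j))"
    using that by (rule star_expr_sum[OF finite_keys[of P], where f = ?f and 'b = 'b])
  have vP: "vars (?f k) \<subseteq> I" if "k \<in> Poly_Mapping.keys P" for k
    using 3[of k] that P by (auto simp: star_polys_def)
  have vt: "vars t \<subseteq> I" using t(1) vP by blast
  have "eval_poly_mat N A P = evm N A t" if A: "\<forall>i\<in>I. A i \<in> carrier_mat N N" for N A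
  proof (rule eq_matI)
    have ct: "evm N A t \<in> carrier_mat N N" using A vt by (intro evm_carrier) auto
    then show "dim_row (eval_poly_mat N A P) = dim_row (evm N A t)" "dim_col (eval_poly_mat N A P) = dim_col (evm N A t)"
      by (auto simp: eval_poly_mat_def)
    fix i j assume "i < dim_row (evm N A t)" "j < dim_col (evm N A t)"
    then have ij: "i < N" "j < N" using ct by auto
    have "evm N A t $$ (i, j) = (\<Sum>k\<in>Poly_Mapping.keys P. evm N A (?f k) $$ (i, j))"
      using A vP ij by (intro t(3)) auto
    also have "\<dots> = (\<Sum>w\<in>Poly_Mapping.keys P. Poly_Mapping.lookup P w * eval_word_mat N A w $$ (i, j))"
    proof (rule sum.cong)
      fix w assume w: "w \<in> Poly_Mapping.keys P"
      have cw: "eval_word_mat N A w \<in> carrier_mat N N"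
        unfolding 2[symmetric] using A vP[OF w] by (intro evm_carrier) auto
      have "(Poly_Mapping.lookup P w \<cdot>\<^sub>m 1\<^sub>m N) * eval_word_mat N A w = Poly_Mapping.lookup P w \<cdot>\<^sub>m eval_word_mat N A w"
        using cw by (subst mult_smult_assoc_mat[OF one_carrier_mat cw]) simp
      then show "evm N A (?f w) $$ (i, j) = Poly_Mapping.lookup P w * eval_word_mat N A w $$ (i, j)"
        using cw ij by (simp add: 2)
    qed simp
    finally show "eval_poly_mat N A P $$ (i, j) = evm N A t $$ (i, j)"
      using ij by (simp add: eval_poly_mat_def)
  qed
  moreover have "eval_poly a P = ev a t" for a :: "'i \<Rightarrow> 'b"
    by (simp add: t(2) eval_poly_def 1 scaleC_mult_left)
  ultimately show ?thesis using vt by blast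
qed

section \<open>Comparison of orbital entropies\<close>

definition Minus :: "'i star_expr \<Rightarrow> 'i star_expr \<Rightarrow> 'i star_expr" where
  "Minus s t = Plus s (Times (Scal (-1)) t)"

lemma vars_Minus [simp]: "vars (Minus s t) = vars s \<union> vars t"
  by (simp add: Minus_def)

lemma ev_Minus [simp]: "ev a (Minus s t) = ev a s - ev a t"
  using scaleC_of_real[of "-1" "ev a t"] by (simp add: Minus_def scaleC_mult_left)

lemma evm_Minus:
  assumes "evm N A s \<in> carrier_mat N N" "evm N A t \<in> carrier_mat N N"
  shows "evm N A (Minus s t) = evm N A s - evm N A t"
proof -
  have "((-1) \<cdot>\<^sub>m 1\<^sub>m N) * evm N A t = (-1) \<cdot>\<^sub>m evm N A t"
    using assms(2) by (subst mult_smult_assoc_mat[OF one_carrier_mat assms(2)]) simp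
  then show ?thesis using assms by (intro eq_matI) (auto simp: Minus_def)
qed

text \<open>Pull back an \<open>\<epsilon>'\<close>-covering \<open>Z\<close> of \<open>\<Omega>'\<close>: for each centre that is close to some \<open>f D\<close> select one such \<open>D\<close> as a
  centre in \<open>\<Omega>\<close>. Going from \<open>f D\<close> to the old centre and from there to the new one costs \<open>2 \<epsilon>'\<close>, hence
  the factor in the hypothesis.\<close>
lemma orbit_covering_number_le:
  fixes \<Omega> :: "('i \<Rightarrow> complex mat) set" and \<Omega>' :: "('j \<Rightarrow> complex mat) set"
  assumes f: "\<And>D. D \<in> \<Omega> \<Longrightarrow> f D \<in> \<Omega>'"
    and car: "\<And>D j. D \<in> \<Omega>' \<Longrightarrow> j \<in> E' \<Longrightarrow> D j \<in> carrier_mat N N"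
    and key: "\<And>D D' U. D \<in> \<Omega> \<Longrightarrow> D' \<in> \<Omega> \<Longrightarrow> U \<in> unitary_mats N \<Longrightarrow>
      (\<And>j. j \<in> E' \<Longrightarrow> op_norm (f D j - U * f D' j * mat_adjoint U) < 2 * \<epsilon>') \<Longrightarrow>
      \<forall>i\<in>E. op_norm (D i - U * D' i * mat_adjoint U) < \<epsilon>"
  shows "orbit_covering_number N E \<epsilon> \<Omega> \<le> orbit_covering_number N E' \<epsilon>' \<Omega>'"
proof -
  define cov where "cov = (\<lambda>B D. \<exists>U\<in>unitary_mats N. \<forall>j\<in>E'. op_norm (f D j - U * B j * mat_adjoint U) < \<epsilon>')"
  show ?thesis
    unfolding orbit_covering_number_def[of N E' \<epsilon>' \<Omega>']
  proof (rule Inf_greatest)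
    fix k assume "k \<in> {enat (card \<Omega>\<^sub>0) | \<Omega>\<^sub>0. finite \<Omega>\<^sub>0 \<and> \<Omega>\<^sub>0 \<subseteq> \<Omega>' \<and>
       (\<forall>D\<in>\<Omega>'. \<exists>B\<in>\<Omega>\<^sub>0. \<exists>U\<in>unitary_mats N. \<forall>i\<in>E'. op_norm (D i - U * B i * mat_adjoint U) < \<epsilon>')}"
    then obtain Z where k: "k = enat (card Z)" and Z: "finite Z" "Z \<subseteq> \<Omega>'"
      "\<And>D. D \<in> \<Omega>' \<Longrightarrow> \<exists>B\<in>Z. \<exists>U\<in>unitary_mats N. \<forall>i\<in>E'. op_norm (D i - U * B i * mat_adjoint U) < \<epsilon>'"
      by blast
    define C where "C = {B \<in> Z. \<exists>D\<in>\<Omega>. cov B D}"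
    define g where "g = (\<lambda>B. SOME D. D \<in> \<Omega> \<and> cov B D)"
    have g: "g B \<in> \<Omega> \<and> cov B (g B)" if "B \<in> C" for B
    proof -
      have "\<exists>D. D \<in> \<Omega> \<and> cov B D" using that unfolding C_def by blast
      from someI_ex[OF this] show ?thesis unfolding g_def .
    qed
    have fC: "finite C" using Z(1) by (simp add: C_def)
    have "\<exists>B\<in>g ` C. \<exists>U\<in>unitary_mats N. \<forall>i\<in>E. op_norm (D i - U * B i * mat_adjoint U) < \<epsilon>" if D: "D \<in> \<Omega>" for D
    proof -
      obtain B U where B: "B \<in> Z" and U: "U \<in> unitary_mats N"
        and BU: "\<And>j. j \<in> E' \<Longrightarrow> op_norm (f D j - U * B j * mat_adjoint U) < \<epsilon>'"
        using Z(3)[OF f[OF D]] by blast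
      have BC: "B \<in> C" unfolding C_def cov_def using B U BU D by blast
      then obtain V where V: "V \<in> unitary_mats N"
        and BV: "\<And>j. j \<in> E' \<Longrightarrow> op_norm (f (g B) j - V * B j * mat_adjoint V) < \<epsilon>'"
        using g[OF BC] unfolding cov_def by blast
      let ?W = "U * mat_adjoint V"
      have W: "?W \<in> unitary_mats N" by (intro unitary_mult U unitary_adjoint V)
      note cU = unitary_carrier[OF U] and cV = unitary_carrier[OF V] and cW = unitary_carrier[OF W]
      note aU = mat_adjoint_carrier[OF cU] and aV = mat_adjoint_carrier[OF cV] and aW = mat_adjoint_carrier[OF cW]
      have "op_norm (f D j - ?W * f (g B) j * mat_adjoint ?W) < 2 * \<epsilon>'" if j: "j \<in> E'" for j
      proof -
        have c: "B j \<in> carrier_mat N N" "f D j \<in> carrier_mat N N" "f (g B) j \<in> carrier_mat N N"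
          using B Z(2) f[OF D] f[of "g B"] g[OF BC] by (auto intro!: car[OF _ j])
        let ?X = "f (g B) j - V * B j * mat_adjoint V"
        have cVB: "V * B j * mat_adjoint V \<in> carrier_mat N N"
          by (rule mult_carrier_mat[OF mult_carrier_mat[OF cV c(1)] aV])
        have cUB: "U * B j * mat_adjoint U \<in> carrier_mat N N"
          by (rule mult_carrier_mat[OF mult_carrier_mat[OF cU c(1)] aU])
        have cX: "?X \<in> carrier_mat N N" using cVB by (rule minus_carrier_mat)
        have WV: "?W * V = U"
          using V square_mat_assoc[OF cU aV cV] cU by (simp add: unitary_mats_def)
        then have VW: "mat_adjoint V * mat_adjoint ?W = mat_adjoint U"
          using mat_adjoint_mult[OF cW cV] by simp
        have "?W * (V * B j * mat_adjoint V) * mat_adjoint ?W = U * B j * mat_adjoint U"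
        proof -
          have "?W * (V * B j * mat_adjoint V) = ?W * (V * B j) * mat_adjoint V"
            using square_mat_assoc[OF cW mult_carrier_mat[OF cV c(1)] aV] by simp
          also have "?W * (V * B j) = U * B j"
            using square_mat_assoc[OF cW cV c(1)] WV by simp
          finally show ?thesis
            using square_mat_assoc[OF mult_carrier_mat[OF cU c(1)] aV aW] VW by simp
        qed
        moreover have "?W * ?X * mat_adjoint ?W = ?W * f (g B) j * mat_adjoint ?W - ?W * (V * B j * mat_adjoint V) * mat_adjoint ?W"
          using mult_minus_distrib_mat[OF cW c(3) cVB]
            minus_mult_distrib_mat[OF mult_carrier_mat[OF cW c(3)] mult_carrier_mat[OF cW cVB] aW] by simp
        ultimately have eq: "U * B j * mat_adjoint U - ?W * f (g B) j * mat_adjoint ?W = - (?W * ?X * mat_adjoint ?W)"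
          using cUB mult_carrier_mat[OF mult_carrier_mat[OF cW c(3)] aW]
          by (intro eq_matI) auto
        have cG: "?W * f (g B) j * mat_adjoint ?W \<in> carrier_mat N N"
          by (rule mult_carrier_mat[OF mult_carrier_mat[OF cW c(3)] aW])
        have "op_norm (U * B j * mat_adjoint U - ?W * f (g B) j * mat_adjoint ?W) = op_norm (?W * f (g B) j * mat_adjoint ?W - U * B j * mat_adjoint U)"
          by (rule op_norm_minus_commute[OF cUB cG])
        also have "?W * f (g B) j * mat_adjoint ?W - U * B j * mat_adjoint U = ?W * ?X * mat_adjoint ?W"
          using \<open>?W * ?X * mat_adjoint ?W = _ - _\<close> \<open>?W * (V * B j * mat_adjoint V) * mat_adjoint ?W = _\<close> by simp
        also have "op_norm (?W * ?X * mat_adjoint ?W) \<le> op_norm ?X"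
          by (rule op_norm_unitary_conj[OF W cX])
        also have "\<dots> < \<epsilon>'" by (rule BV[OF j])
        finally show ?thesis
          using op_norm_triangle_diff[OF c(2) cUB cG] BU[OF j] by linarith
      qed
      then have "\<forall>i\<in>E. op_norm (D i - ?W * g B i * mat_adjoint ?W) < \<epsilon>"
        using g[OF BC] by (intro key[OF D _ W]) auto
      then show ?thesis using BC W by blast
    qed
    moreover have "g ` C \<subseteq> \<Omega>" using g by blast
    ultimately have "orbit_covering_number N E \<epsilon> \<Omega> \<le> enat (card (g ` C))"
      unfolding orbit_covering_number_def using fC by (intro Inf_lower) blast
    also have "\<dots> \<le> enat (card Z)"
      using card_image_le[OF fC, of g] card_mono[OF Z(1), of C] by (simp add: C_def)
    finally show "orbit_covering_number N E \<epsilon> \<Omega> \<le> k" by (simp add: k)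
  qed
qed

lemma log_enat_mono: "k \<le> l \<Longrightarrow> log_enat k \<le> log_enat l"
  by (cases k; cases l) (auto simp: log_enat_def)

lemma orbit_entropy_rate_mono:
  assumes "\<And>N. N \<ge> 1 \<Longrightarrow> orbit_covering_number N E \<epsilon> (\<Omega> N) \<le> orbit_covering_number N E' \<epsilon>' (\<Omega>' N)"
  shows "orbit_entropy_rate E \<epsilon> \<Omega> \<le> orbit_entropy_rate E' \<epsilon>' \<Omega>'"
  unfolding orbit_entropy_rate_def
proof (rule Limsup_mono)
  show "\<forall>\<^sub>F N in sequentially. ereal (1 / (real N)\<^sup>2) * log_enat (orbit_covering_number N E \<epsilon> (\<Omega> N))
     \<le> ereal (1 / (real N)\<^sup>2) * log_enat (orbit_covering_number N E' \<epsilon>' (\<Omega>' N))"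
    using eventually_ge_at_top[of 1]
    by eventually_elim (intro ereal_mult_left_mono log_enat_mono assms, auto)
qed

text \<open>A directed family of spaces \<open>\<Omega> \<theta> N\<close> of matrix tuples on which the norm of every *-polynomial is eventually at most
  its norm at \<open>c\<close>, uniformly in \<open>N\<close>. Both kinds of microstate spaces have this property, and it is
  all that the comparison of entropies uses about the source.\<close>
definition norm_controlled ::
    "'s set \<Rightarrow> ('s \<Rightarrow> 'b::unital_cstar_algebra) \<Rightarrow> 'p set \<Rightarrow> ('p \<Rightarrow> nat \<Rightarrow> ('s \<Rightarrow> complex mat) set) \<Rightarrow> bool" where
  "norm_controlled S c \<Theta> \<Omega> \<longleftrightarrow> \<Theta> \<noteq> {} \<and>
     (\<forall>\<theta>\<in>\<Theta>. \<forall>N. \<forall>A\<in>\<Omega> \<theta> N. \<forall>x\<in>S. A x \<in> carrier_mat N N) \<and>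
     (\<forall>\<theta>1\<in>\<Theta>. \<forall>\<theta>2\<in>\<Theta>. \<exists>\<theta>\<in>\<Theta>. \<forall>N. \<Omega> \<theta> N \<subseteq> \<Omega> \<theta>1 N \<inter> \<Omega> \<theta>2 N) \<and>
     (\<forall>t \<eta>. vars t \<subseteq> S \<longrightarrow> \<eta> > 0 \<longrightarrow> (\<exists>\<theta>\<in>\<Theta>. \<forall>N. \<forall>A\<in>\<Omega> \<theta> N. op_norm (evm N A t) \<le> norm (ev c t) + \<eta>))"

lemma norm_controlled_finite:
  assumes nc: "norm_controlled S c \<Theta> \<Omega>" and X: "finite X" "\<forall>(t, \<zeta>)\<in>X. vars t \<subseteq> S \<and> \<zeta> > 0"
  shows "\<exists>\<theta>\<in>\<Theta>. \<forall>N. \<forall>A\<in>\<Omega> \<theta> N. \<forall>(t, \<zeta>)\<in>X. op_norm (evm N A t) \<le> norm (ev c t) + \<zeta>"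
  using X
proof (induction X rule: finite_induct)
  case empty
  then show ?case using nc by (auto simp: norm_controlled_def)
next
  case (insert x X)
  obtain t \<zeta> where x: "x = (t, \<zeta>)" by (cases x)
  have tz: "vars t \<subseteq> S" "\<zeta> > 0" using insert.prems x by auto
  have "\<exists>\<theta>\<in>\<Theta>. \<forall>N. \<forall>A\<in>\<Omega> \<theta> N. \<forall>(t, \<zeta>)\<in>X. op_norm (evm N A t) \<le> norm (ev c t) + \<zeta>"
    by (rule insert.IH) (use insert.prems in simp)
  then obtain \<theta>1 where 1: "\<theta>1 \<in> \<Theta>" "\<forall>N. \<forall>A\<in>\<Omega> \<theta>1 N. \<forall>(t, \<zeta>)\<in>X. op_norm (evm N A t) \<le> norm (ev c t) + \<zeta>"
    by (elim bexE)
  have "\<exists>\<theta>\<in>\<Theta>. \<forall>N. \<forall>A\<in>\<Omega> \<theta> N. op_norm (evm N A t) \<le> norm (ev c t) + \<zeta>"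
    using nc tz unfolding norm_controlled_def by (elim conjE) simp
  then obtain \<theta>2 where 2: "\<theta>2 \<in> \<Theta>" "\<forall>N. \<forall>A\<in>\<Omega> \<theta>2 N. op_norm (evm N A t) \<le> norm (ev c t) + \<zeta>"
    by (elim bexE)
  have "\<exists>\<theta>\<in>\<Theta>. \<forall>N. \<Omega> \<theta> N \<subseteq> \<Omega> \<theta>1 N \<inter> \<Omega> \<theta>2 N"
    using nc 1(1) 2(1) unfolding norm_controlled_def by (elim conjE) simp
  then obtain \<theta> where th: "\<theta> \<in> \<Theta>" "\<forall>N. \<Omega> \<theta> N \<subseteq> \<Omega> \<theta>1 N \<inter> \<Omega> \<theta>2 N"
    by (elim bexE)
  show ?case
  proof (intro bexI[OF _ th(1)] allI ballI)
    fix N A y assume A: "A \<in> \<Omega> \<theta> N" and y: "y \<in> insert x X"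
    have A12: "A \<in> \<Omega> \<theta>1 N" "A \<in> \<Omega> \<theta>2 N" using th(2)[THEN spec, of N] A by auto
    show "case y of (t, \<zeta>) \<Rightarrow> op_norm (evm N A t) \<le> norm (ev c t) + \<zeta>"
      using 1(2)[THEN spec, of N] 2(2)[THEN spec, of N] A12 y x by auto
  qed
qed

text \<open>For \<open>A\<close> in a good source space, \<open>p(A)\<close> is a target microstate and \<open>q\<^sub>i(p(A))\<close> is close to \<open>A\<^sub>i\<close>, because the
  norm of the polynomial \<open>q\<^sub>i(p) - T\<^sub>i\<close> is small at \<open>a\<close>. Since \<open>q\<^sub>i\<close> is Lipschitz uniformly in \<open>N\<close> and
  commutes with unitary conjugation, orbits that are \<open>2 \<epsilon>'\<close>-close after applying \<open>p\<close> are \<open>\<epsilon>\<close>-close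
  before. Conjugation by \<open>U\<close> moves the error terms without changing them, so the total error is
  at most three times \<open>\<epsilon>/4\<close>.\<close>
theorem entropy_le_of_approximants:
  fixes a :: "'i \<Rightarrow> 'b::unital_cstar_algebra" and b :: "'j \<Rightarrow> 'b"
    and \<Omega> :: "'p \<Rightarrow> nat \<Rightarrow> ('i \<Rightarrow> complex mat) set" and \<Omega>' :: "'q \<Rightarrow> nat \<Rightarrow> ('j \<Rightarrow> complex mat) set"
  assumes nc: "norm_controlled I a \<Theta> \<Omega>"
    and car': "\<And>\<theta> N A j. \<theta> \<in> \<Theta>' \<Longrightarrow> A \<in> \<Omega>' \<theta> N \<Longrightarrow> j \<in> J \<Longrightarrow> A j \<in> carrier_mat N N"
    and dense: "\<And>x e. e > 0 \<Longrightarrow> \<exists>t. vars t \<subseteq> J \<and> norm (ev b t - x) < e"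
    and target: "\<And>\<theta>' J1 \<eta>. \<theta>' \<in> \<Theta>' \<Longrightarrow> finite J1 \<Longrightarrow> J1 \<subseteq> J \<Longrightarrow> \<eta> > 0 \<Longrightarrow>
      \<exists>p. \<exists>\<theta>\<in>\<Theta>. (\<forall>j\<in>J1. vars (p j) \<subseteq> I \<and> norm (ev a (p j) - b j) < \<eta>) \<and>
        (\<forall>N\<ge>1. \<forall>A\<in>\<Omega> \<theta> N. \<exists>A'\<in>\<Omega>' \<theta>' N. \<forall>j\<in>J1. A' j = evm N A (p j))"
  shows "(SUP (\<epsilon>, E) \<in> {0<..} \<times> {E. finite E \<and> E \<subseteq> I}. INF \<theta>\<in>\<Theta>. orbit_entropy_rate E \<epsilon> (\<Omega> \<theta>))
    \<le> (SUP (\<epsilon>, E) \<in> {0<..} \<times> {E. finite E \<and> E \<subseteq> J}. INF \<theta>\<in>\<Theta>'. orbit_entropy_rate E \<epsilon> (\<Omega>' \<theta>))"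
proof (rule SUP_least)
  have car: "A i \<in> carrier_mat N N" if "\<theta> \<in> \<Theta>" "A \<in> \<Omega> \<theta> N" "i \<in> I" for \<theta> N A i
    using nc that unfolding norm_controlled_def by blast
  fix x :: "real \<times> 'i set" assume "x \<in> {0<..} \<times> {E. finite E \<and> E \<subseteq> I}"
  then obtain \<epsilon> :: real and E where x: "x = (\<epsilon>, E)" and eps: "\<epsilon> > 0" and E: "finite E" "E \<subseteq> I" by auto
  have "\<forall>i. \<exists>t. vars t \<subseteq> J \<and> norm (ev b t - a i) < \<epsilon> / 16" using eps by (intro allI dense) simp
  then obtain q where q: "\<And>i. vars (q i) \<subseteq> J" "\<And>i. norm (ev b (q i) - a i) < \<epsilon> / 16" by metis
  define E' where "E' = (\<Union>i\<in>E. vars (q i))"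
  have E': "finite E'" "E' \<subseteq> J" using E q by (auto simp: E'_def)
  define R where "R = 1 + (\<Sum>j\<in>E'. norm (b j))"
  have R: "norm (b j) + 1 \<le> R" if "j \<in> E'" for j
    using member_le_sum[OF that, of "\<lambda>j. norm (b j)"] E' by (auto simp: R_def)
  have R0: "R \<ge> 0" by (simp add: R_def add_nonneg_nonneg sum_nonneg)
  define L where "L = 1 + (\<Sum>i\<in>E. lip R (q i))"
  have L: "lip R (q i) \<le> L" if "i \<in> E" for i
    using member_le_sum[OF that, of "\<lambda>i. lip R (q i)"] E R0 by (auto simp: L_def lip_nonneg)
  have L1: "L \<ge> 1" using R0 by (simp add: L_def sum_nonneg lip_nonneg)
  define \<epsilon>' where "\<epsilon>' = \<epsilon> / (8 * L)"
  have eps': "\<epsilon>' > 0" using eps L1 by (simp add: \<epsilon>'_def)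
  have "(INF \<theta>\<in>\<Theta>. orbit_entropy_rate E \<epsilon> (\<Omega> \<theta>)) \<le> (INF \<theta>\<in>\<Theta>'. orbit_entropy_rate E' \<epsilon>' (\<Omega>' \<theta>))"
  proof (rule INF_greatest)
    fix \<theta>' assume th': "\<theta>' \<in> \<Theta>'"
    define \<eta> where "\<eta> = min (1/2) (\<epsilon> / (16 * L))"
    have eta: "\<eta> > 0" "\<eta> \<le> 1/2" "\<eta> \<le> \<epsilon> / (16 * L)" using eps L1 by (auto simp: \<eta>_def)
    from target[OF th' E' eta(1)] obtain p \<theta>0 where th0: "\<theta>0 \<in> \<Theta>"
      and p': "\<forall>j\<in>E'. vars (p j) \<subseteq> I \<and> norm (ev a (p j) - b j) < \<eta>"
      and ex': "\<forall>N\<ge>1. \<forall>A\<in>\<Omega> \<theta>0 N. \<exists>A'\<in>\<Omega>' \<theta>' N. \<forall>j\<in>E'. A' j = evm N A (p j)"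
      by (elim exE bexE conjE)
    note p = p'[rule_format]
    have ex: "\<exists>A'\<in>\<Omega>' \<theta>' N. \<forall>j\<in>E'. A' j = evm N A (p j)" if "N \<ge> 1" "A \<in> \<Omega> \<theta>0 N" for N A
      using ex' that by (elim allE impE ballE) auto
    \<comment> \<open>The error polynomials of the reconstruction of \<open>A\<^sub>i\<close> from \<open>p(A)\<close>.\<close>
    define r where "r = (\<lambda>i. Minus (subst p (q i)) (Var i))"
    have vsub: "vars (subst p (q i)) \<subseteq> I" if "i \<in> E" for i
      using vars_subst[of p "q i"] p that by (auto simp: E'_def)
    define T where "T = p ` E' \<union> r ` E"
    define \<zeta> where "\<zeta> = min (1/2) (\<epsilon>/8)"
    have "finite ((\<lambda>t. (t, \<zeta>)) ` T)" using E E' by (simp add: T_def)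
    moreover have "\<forall>(t, \<zeta>')\<in>(\<lambda>t. (t, \<zeta>)) ` T. vars t \<subseteq> I \<and> \<zeta>' > 0"
    proof -
      have "vars t \<subseteq> I" if "t \<in> T" for t
        using that unfolding T_def
      proof
        assume "t \<in> p ` E'"
        then show ?thesis using p by auto
      next
        assume "t \<in> r ` E"
        then obtain i where i: "i \<in> E" "t = r i" by auto
        then show ?thesis using vsub[OF i(1)] E(2) unfolding r_def by auto
      qed
      then show ?thesis using eps by (auto simp: \<zeta>_def)
    qed
    ultimately have "\<exists>\<theta>\<in>\<Theta>. \<forall>N. \<forall>A\<in>\<Omega> \<theta> N. \<forall>(t, \<zeta>')\<in>(\<lambda>t. (t, \<zeta>)) ` T. op_norm (evm N A t) \<le> norm (ev a t) + \<zeta>'"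
      by (rule norm_controlled_finite[OF nc])
    then obtain \<theta>1 where th1: "\<theta>1 \<in> \<Theta>"
      and bd1: "\<forall>N. \<forall>A\<in>\<Omega> \<theta>1 N. \<forall>(t, \<zeta>')\<in>(\<lambda>t. (t, \<zeta>)) ` T. op_norm (evm N A t) \<le> norm (ev a t) + \<zeta>'"
      by (elim bexE)
    have "\<exists>\<theta>\<in>\<Theta>. \<forall>N. \<Omega> \<theta> N \<subseteq> \<Omega> \<theta>0 N \<inter> \<Omega> \<theta>1 N"
      using nc th0 th1 unfolding norm_controlled_def by (elim conjE) simp
    then obtain \<theta> where th: "\<theta> \<in> \<Theta>" and sub0: "\<forall>N. \<Omega> \<theta> N \<subseteq> \<Omega> \<theta>0 N \<inter> \<Omega> \<theta>1 N"
      by (elim bexE)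
    have sub: "A \<in> \<Omega> \<theta>0 N" if "A \<in> \<Omega> \<theta> N" for N A
      using sub0 that by blast
    have bdT: "op_norm (evm N A t) \<le> norm (ev a t) + \<zeta>" if A: "A \<in> \<Omega> \<theta> N" and t: "t \<in> T" for N A t
    proof -
      have "A \<in> \<Omega> \<theta>1 N" using sub0 A by blast
      then have "\<forall>(t, \<zeta>')\<in>(\<lambda>t. (t, \<zeta>)) ` T. op_norm (evm N A t) \<le> norm (ev a t) + \<zeta>'" using bd1 by blast
      then show ?thesis using t by simp
    qed
    have bdp: "op_norm (evm N A (p j)) \<le> norm (ev a (p j)) + min (1/2) (\<epsilon>/8)"
      if "A \<in> \<Omega> \<theta> N" "j \<in> E'" for N A j
      using bdT[OF that(1), of "p j"] that(2) by (simp add: T_def \<zeta>_def)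
    have bdr: "op_norm (evm N A (r i)) \<le> norm (ev a (r i)) + min (1/2) (\<epsilon>/8)"
      if "A \<in> \<Omega> \<theta> N" "i \<in> E" for N A i
      using bdT[OF that(1), of "r i"] that(2) by (simp add: T_def \<zeta>_def)
    have nr: "norm (ev a (r i)) \<le> \<epsilon> / 8" if i: "i \<in> E" for i
    proof -
      have "norm (ev (\<lambda>j. ev a (p j)) (q i) - ev b (q i)) \<le> lip R (q i) * \<eta>"
      proof (rule norm_ev_diff_le[OF R0])
        fix j assume "j \<in> vars (q i)"
        then have j: "j \<in> E'" using i by (auto simp: E'_def)
        have "norm (ev a (p j)) \<le> norm (b j) + norm (ev a (p j) - b j)" by (rule norm_triangle_sub)
        then show "norm (ev a (p j)) \<le> R \<and> norm (b j) \<le> R \<and> norm (ev a (p j) - b j) \<le> \<eta>"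
          using R[OF j] p[OF j] eta by auto
      qed (use eta in simp)
      also have "\<dots> \<le> L * (\<epsilon> / (16 * L))" using L[OF i] eta L1 by (intro mult_mono) auto
      also have "\<dots> = \<epsilon> / 16" using L1 by simp
      finally have "norm (ev (\<lambda>j. ev a (p j)) (q i) - ev b (q i)) \<le> \<epsilon> / 16" .
      then have "norm ((ev (\<lambda>j. ev a (p j)) (q i) - ev b (q i)) + (ev b (q i) - a i)) \<le> \<epsilon>/16 + \<epsilon>/16"
        using q(2)[of i] by (intro norm_triangle_mono) auto
      then show ?thesis by (simp add: r_def ev_subst)
    qed
    have "orbit_entropy_rate E \<epsilon> (\<Omega> \<theta>) \<le> orbit_entropy_rate E' \<epsilon>' (\<Omega>' \<theta>')"
    proof (rule orbit_entropy_rate_mono)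
      fix N :: nat assume N: "N \<ge> 1"
      define f where "f = (\<lambda>A. SOME A'. A' \<in> \<Omega>' \<theta>' N \<and> (\<forall>j\<in>E'. A' j = evm N A (p j)))"
      have f: "f A \<in> \<Omega>' \<theta>' N \<and> (\<forall>j\<in>E'. f A j = evm N A (p j))" if "A \<in> \<Omega> \<theta> N" for A
      proof -
        have "\<exists>A'. A' \<in> \<Omega>' \<theta>' N \<and> (\<forall>j\<in>E'. A' j = evm N A (p j))"
          using ex[OF N sub[OF that]] by blast
        from someI_ex[OF this] show ?thesis unfolding f_def .
      qed
      have cA: "A i \<in> carrier_mat N N" if "A \<in> \<Omega> \<theta> N" "i \<in> I" for A i using car[OF th that] .
      have cp: "evm N A (p j) \<in> carrier_mat N N" if "A \<in> \<Omega> \<theta> N" "j \<in> E'" for A j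
        using cA[OF that(1)] p[OF that(2)] by (intro evm_carrier) auto
      have bp: "op_norm (evm N A (p j)) \<le> R" if "A \<in> \<Omega> \<theta> N" "j \<in> E'" for A j
      proof -
        have "norm (ev a (p j)) \<le> norm (b j) + norm (ev a (p j) - b j)" by (rule norm_triangle_sub)
        then show ?thesis using bdp[OF that] R[OF that(2)] p[OF that(2)] eta by auto
      qed
      have rec: "op_norm (evm N (\<lambda>j. evm N A (p j)) (q i) - A i) \<le> \<epsilon> / 4" if A: "A \<in> \<Omega> \<theta> N" and i: "i \<in> E" for A i
      proof -
        have s: "evm N A (subst p (q i)) = evm N (\<lambda>j. evm N A (p j)) (q i)"
        proof (rule evm_subst)
          fix j k assume "j \<in> vars (q i)" "k \<in> vars (p j)"
          then show "A k \<in> carrier_mat N N" using i p[of j] cA[OF A] by (auto simp: E'_def)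
        qed
        have "evm N A (subst p (q i)) \<in> carrier_mat N N" using vsub[OF i] cA[OF A] by (intro evm_carrier) auto
        moreover have "A i \<in> carrier_mat N N" using cA[OF A] i E by auto
        ultimately have "evm N A (r i) = evm N (\<lambda>j. evm N A (p j)) (q i) - A i"
          by (simp add: r_def evm_Minus s)
        then show ?thesis using bdr[OF A i] nr[OF i] by simp
      qed
      show "orbit_covering_number N E \<epsilon> (\<Omega> \<theta> N) \<le> orbit_covering_number N E' \<epsilon>' (\<Omega>' \<theta>' N)"
      proof (rule orbit_covering_number_le[where f = f])
        show "f D \<in> \<Omega>' \<theta>' N" if "D \<in> \<Omega> \<theta> N" for D using f[OF that] by simp
        show "D j \<in> carrier_mat N N" if "D \<in> \<Omega>' \<theta>' N" "j \<in> E'" for D j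
          using car'[OF th' that(1)] that(2) E' by auto
        fix D D' U
        assume D: "D \<in> \<Omega> \<theta> N" "D' \<in> \<Omega> \<theta> N" and U: "U \<in> unitary_mats N"
          and close: "\<And>j. j \<in> E' \<Longrightarrow> op_norm (f D j - U * f D' j * mat_adjoint U) < 2 * \<epsilon>'"
        note cU = unitary_carrier[OF U] and aU = mat_adjoint_carrier[OF unitary_carrier[OF U]]
        show "\<forall>i\<in>E. op_norm (D i - U * D' i * mat_adjoint U) < \<epsilon>"
        proof
          fix i assume i: "i \<in> E"
          have vE: "vars (q i) \<subseteq> E'" using i by (auto simp: E'_def)
          let ?P = "\<lambda>j. evm N D (p j)" and ?P' = "\<lambda>j. evm N D' (p j)"
          let ?X = "evm N ?P (q i)" and ?X' = "evm N ?P' (q i)"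
          have cD: "D i \<in> carrier_mat N N" "D' i \<in> carrier_mat N N" using cA D i E by auto
          have cX: "?X \<in> carrier_mat N N" "?X' \<in> carrier_mat N N"
            by (rule evm_carrier, rule cp[OF D(1)], use vE in blast, rule evm_carrier, rule cp[OF D(2)], use vE in blast)
          have cc: "U * Z * mat_adjoint U \<in> carrier_mat N N" if "Z \<in> carrier_mat N N" for Z
            by (rule mult_carrier_mat[OF mult_carrier_mat[OF cU that] aU])
          have "op_norm (?X - evm N (\<lambda>j. U * ?P' j * mat_adjoint U) (q i)) \<le> lip R (q i) * (2 * \<epsilon>')"
          proof (rule op_norm_evm_diff_le[OF R0])
            fix j assume "j \<in> vars (q i)"
            then have j: "j \<in> E'" using vE by auto
            have "op_norm (U * ?P' j * mat_adjoint U) \<le> R"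
              using op_norm_unitary_conj[OF U cp[OF D(2) j]] bp[OF D(2) j] by simp
            then show "?P j \<in> carrier_mat N N \<and> U * ?P' j * mat_adjoint U \<in> carrier_mat N N \<and>
              op_norm (?P j) \<le> R \<and> op_norm (U * ?P' j * mat_adjoint U) \<le> R \<and>
              op_norm (?P j - U * ?P' j * mat_adjoint U) \<le> 2 * \<epsilon>'"
              using cp[OF D(1) j] cc[OF cp[OF D(2) j]] bp[OF D(1) j] close[OF j] f[OF D(1)] f[OF D(2)] j by auto
          qed (use eps' in simp)
          also have "evm N (\<lambda>j. U * ?P' j * mat_adjoint U) (q i) = U * ?X' * mat_adjoint U"
            by (rule evm_unitary[OF U], rule cp[OF D(2)], use vE in blast)
          also have "lip R (q i) * (2 * \<epsilon>') \<le> L * (2 * \<epsilon>')" using L[OF i] eps' by (intro mult_right_mono) auto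
          also have "\<dots> = \<epsilon> / 4" using L1 by (simp add: \<epsilon>'_def)
          finally have 1: "op_norm (?X - U * ?X' * mat_adjoint U) \<le> \<epsilon> / 4" .
          have 2: "op_norm (D i - ?X) \<le> \<epsilon> / 4"
            using rec[OF D(1) i] op_norm_minus_commute[OF cD(1) cX(1)] by simp
          have "U * ?X' * mat_adjoint U - U * D' i * mat_adjoint U = U * (?X' - D' i) * mat_adjoint U"
            using mult_minus_distrib_mat[OF cU cX(2) cD(2)]
              minus_mult_distrib_mat[OF mult_carrier_mat[OF cU cX(2)] mult_carrier_mat[OF cU cD(2)] aU] by simp
          then have 3: "op_norm (U * ?X' * mat_adjoint U - U * D' i * mat_adjoint U) \<le> \<epsilon> / 4"
            using op_norm_unitary_conj[OF U minus_carrier_mat[OF cD(2), of ?X']] rec[OF D(2) i] by simp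
          have "op_norm (D i - U * D' i * mat_adjoint U) \<le> op_norm (D i - ?X) + op_norm (?X - U * D' i * mat_adjoint U)"
            by (rule op_norm_triangle_diff[OF cD(1) cX(1) cc[OF cD(2)]])
          also have "op_norm (?X - U * D' i * mat_adjoint U) \<le> op_norm (?X - U * ?X' * mat_adjoint U) + op_norm (U * ?X' * mat_adjoint U - U * D' i * mat_adjoint U)"
            by (rule op_norm_triangle_diff[OF cX(1) cc[OF cX(2)] cc[OF cD(2)]])
          finally show "op_norm (D i - U * D' i * mat_adjoint U) < \<epsilon>" using 1 2 3 eps by linarith
        qed
      qed
    qed
    then show "(INF \<theta>\<in>\<Theta>. orbit_entropy_rate E \<epsilon> (\<Omega> \<theta>)) \<le> orbit_entropy_rate E' \<epsilon>' (\<Omega>' \<theta>')"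
      by (rule INF_lower2[OF th])
  qed
  also have "\<dots> \<le> (SUP (\<epsilon>, E) \<in> {0<..} \<times> {E. finite E \<and> E \<subseteq> J}. INF \<theta>\<in>\<Theta>'. orbit_entropy_rate E \<epsilon> (\<Omega>' \<theta>))"
  proof (rule SUP_upper2)
    show "(\<epsilon>', E') \<in> {0<..} \<times> {E. finite E \<and> E \<subseteq> J}" using eps' E' by simp
  qed (simp only: prod.case order_refl)
  finally show "(case x of (\<epsilon>, E) \<Rightarrow> INF \<theta>\<in>\<Theta>. orbit_entropy_rate E \<epsilon> (\<Omega> \<theta>))
    \<le> (SUP (\<epsilon>, E) \<in> {0<..} \<times> {E. finite E \<and> E \<subseteq> J}. INF \<theta>\<in>\<Theta>'. orbit_entropy_rate E \<epsilon> (\<Omega>' \<theta>))"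
    unfolding x prod.case .
qed

section \<open>Sesquilinear forms of matrix pencils\<close>

lemma sum_blocks:
  fixes f :: "nat \<Rightarrow> 'c::comm_monoid_add"
  shows "(\<Sum>k<m * N. f k) = (\<Sum>i<m. \<Sum>p<N. f (i * N + p))"
proof -
  have "(\<Sum>k<m * N. f k) = (\<Sum>i<m. sum f {i * N..<i * N + N})"
    by (simp add: sum.nat_group)
  also have "\<dots> = (\<Sum>i<m. \<Sum>p<N. f (i * N + p))"
  proof (rule sum.cong[OF refl])
    fix i
    show "sum f {i * N..<i * N + N} = (\<Sum>p<N. f (i * N + p))"
      using sum.shift_bounds_nat_ivl[of f 0 "i * N" N] by (simp add: lessThan_atLeast0 add.commute)
  qed
  finally show ?thesis .
qed

text \<open>\<open>\<complex>\<^sup>m \<otimes> \<complex>\<^sup>N\<close> is identified with \<open>\<complex>\<^sup>m\<^sup>N\<close> in the order of the Kronecker product, the first factor being the outer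
  index.\<close>
definition flat :: "nat \<Rightarrow> (nat \<Rightarrow> nat \<Rightarrow> complex) \<Rightarrow> nat \<Rightarrow> complex" where
  "flat N \<xi> = (\<lambda>k. \<xi> (k div N) (k mod N))"

lemma flat_index: "p < N \<Longrightarrow> flat N \<xi> (i * N + p) = \<xi> i p"
  by (simp add: flat_def)

definition bnorm :: "nat \<Rightarrow> nat \<Rightarrow> (nat \<Rightarrow> nat \<Rightarrow> complex) \<Rightarrow> real" where
  "bnorm m N \<xi> = sqrt (\<Sum>i<m. (cnorm N (\<xi> i))\<^sup>2)"

definition bform :: "nat \<Rightarrow> nat \<Rightarrow> (nat \<Rightarrow> nat \<Rightarrow> nat \<Rightarrow> nat \<Rightarrow> complex) \<Rightarrow>
    (nat \<Rightarrow> nat \<Rightarrow> complex) \<Rightarrow> (nat \<Rightarrow> nat \<Rightarrow> complex) \<Rightarrow> complex" where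
  "bform m N W \<xi> \<eta> = (\<Sum>i<m. \<Sum>j<m. \<Sum>p<N. \<Sum>q<N. W i j p q * \<xi> j q * cnj (\<eta> i p))"

lemma bnorm_nonneg [simp]: "0 \<le> bnorm m N \<xi>"
  by (simp add: bnorm_def sum_nonneg)

lemma bnorm_square: "(bnorm m N \<xi>)\<^sup>2 = (\<Sum>i<m. (cnorm N (\<xi> i))\<^sup>2)"
  by (simp add: bnorm_def sum_nonneg)

lemma cnorm_flat: "cnorm (m * N) (flat N \<xi>) = bnorm m N \<xi>"
proof -
  have "(cnorm (m * N) (flat N \<xi>))\<^sup>2 = (bnorm m N \<xi>)\<^sup>2"
    unfolding cnorm_square bnorm_square sum_blocks by (simp add: flat_index)
  then show ?thesis by (simp add: power2_eq_iff_nonneg)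
qed

lemma cip_act_flat:
  assumes "\<And>i j p q. i < m \<Longrightarrow> j < m \<Longrightarrow> p < N \<Longrightarrow> q < N \<Longrightarrow> M $$ (i * N + p, j * N + q) = W i j p q"
  shows "cip (m * N) (act (m * N) M (flat N \<xi>)) (flat N \<eta>) = bform m N W \<xi> \<eta>"
proof -
  have "cip (m * N) (act (m * N) M (flat N \<xi>)) (flat N \<eta>)
    = (\<Sum>i<m. \<Sum>p<N. (\<Sum>j<m. \<Sum>q<N. W i j p q * \<xi> j q) * cnj (\<eta> i p))"
    unfolding cip_def act_def sum_blocks by (intro sum.cong refl) (simp add: flat_index assms)
  also have "\<dots> = (\<Sum>i<m. \<Sum>p<N. \<Sum>j<m. \<Sum>q<N. W i j p q * \<xi> j q * cnj (\<eta> i p))"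
    by (simp add: sum_distrib_right)
  also have "\<dots> = bform m N W \<xi> \<eta>"
    unfolding bform_def by (rule sum.cong[OF refl], rule sum.swap)
  finally show ?thesis .
qed

text \<open>The entry of the evaluated pencil in block \<open>(i, j)\<close> at position \<open>(p, q)\<close>.\<close>
definition blk :: "'a::unital_cstar_algebra set \<Rightarrow> nat \<Rightarrow> ('a \<Rightarrow> complex mat) \<Rightarrow> ('a \<Rightarrow> complex mat)
    \<Rightarrow> nat \<Rightarrow> nat \<Rightarrow> nat \<Rightarrow> nat \<Rightarrow> complex" where
  "blk S m B A i j p q = B 1 $$ (i, j) * (if p = q then 1 else 0)
     + (\<Sum>x\<in>{x \<in> S - {1}. B x \<noteq> 0\<^sub>m m m}. B x $$ (i, j) * A x $$ (p, q))"

lemma block_index_less: "i < m \<Longrightarrow> p < N \<Longrightarrow> i * N + p < m * (N::nat)"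
proof -
  assume "i < m" "p < N"
  then have "i * N + p < Suc i * N" by simp
  also have "\<dots> \<le> m * N" using \<open>i < m\<close> by (intro mult_le_mono1) simp
  finally show ?thesis .
qed

lemma pencil_mat_carrier: "pencil_mat S m N B A \<in> carrier_mat (m * N) (m * N)"
  by (simp add: pencil_mat_def)

lemma pencil_mat_index:
  assumes B: "B \<in> S \<rightarrow>\<^sub>E carrier_mat m m" and A: "\<forall>x\<in>S. A x \<in> carrier_mat N N" and 1: "1 \<in> S"
    and ij: "i < m" "j < m" and pq: "p < N" "q < N"
  shows "pencil_mat S m N B A $$ (i * N + p, j * N + q) = blk S m B A i j p q"
proof -
  have B1: "B 1 \<in> carrier_mat m m" using B 1 by (rule PiE_mem)
  have "kronecker (B x) (A x) $$ (i * N + p, j * N + q) = B x $$ (i, j) * A x $$ (p, q)" if "x \<in> S" for x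
  proof -
    have "B x \<in> carrier_mat m m" using B that by (rule PiE_mem)
    moreover have "A x \<in> carrier_mat N N" using A that by blast
    ultimately show ?thesis using ij pq by (simp add: kronecker_def block_index_less)
  qed
  moreover have "kronecker (B 1) (1\<^sub>m N) $$ (i * N + p, j * N + q) = B 1 $$ (i, j) * (if p = q then 1 else 0)"
    using B1 ij pq by (simp add: kronecker_def block_index_less)
  ultimately show ?thesis
    using ij pq by (simp add: pencil_mat_def block_index_less blk_def)
qed

lemma cip_act_pencil:
  assumes B: "B \<in> S \<rightarrow>\<^sub>E carrier_mat m m" and A: "\<forall>x\<in>S. A x \<in> carrier_mat N N" and 1: "1 \<in> S"
  shows "cip (m * N) (act (m * N) (pencil_mat S m N B A) (flat N \<xi>)) (flat N \<eta>) = bform m N (blk S m B A) \<xi> \<eta>"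
  by (rule cip_act_flat) (rule pencil_mat_index[OF B A 1])

lemma bform_pencil_le:
  assumes B: "B \<in> S \<rightarrow>\<^sub>E carrier_mat m m" and A: "\<forall>x\<in>S. A x \<in> carrier_mat N N" and 1: "1 \<in> S"
  shows "cmod (bform m N (blk S m B A) \<xi> \<eta>) \<le> op_norm (pencil_mat S m N B A) * (bnorm m N \<xi> * bnorm m N \<eta>)"
  using cmod_cip_act_le[OF pencil_mat_carrier, of m N S B A "flat N \<xi>" "flat N \<eta>"]
  unfolding cip_act_pencil[OF B A 1] cnorm_flat .

lemma op_norm_pencil_le:
  assumes B: "B \<in> S \<rightarrow>\<^sub>E carrier_mat m m" and A: "\<forall>x\<in>S. A x \<in> carrier_mat N N" and 1: "1 \<in> S"
    and c: "0 \<le> c" and le: "\<And>\<xi> \<eta>. cmod (bform m N (blk S m B A) \<xi> \<eta>) \<le> c * (bnorm m N \<xi> * bnorm m N \<eta>)"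
  shows "op_norm (pencil_mat S m N B A) \<le> c"
proof (rule op_norm_le_form[OF pencil_mat_carrier c])
  fix u v :: "nat \<Rightarrow> complex"
  let ?\<xi> = "\<lambda>j q. u (j * N + q)" and ?\<eta> = "\<lambda>j q. v (j * N + q)"
  have u: "flat N ?\<xi> = u" "flat N ?\<eta> = v" by (simp_all add: flat_def)
  show "cmod (cip (m * N) (act (m * N) (pencil_mat S m N B A) u) v) \<le> c * (cnorm (m * N) u * cnorm (m * N) v)"
    using le[of ?\<xi> ?\<eta>] cip_act_pencil[OF B A 1, of ?\<xi> ?\<eta>]
    by (simp only: cnorm_flat[symmetric] u)
qed

lemma finite_matrix_tuples_support: "(m, B) \<in> matrix_tuples S \<Longrightarrow> finite {x \<in> S - {1}. B x \<noteq> 0\<^sub>m m m}"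
  by (rule finite_subset[of _ "{x \<in> S. B x \<noteq> 0\<^sub>m m m}"]) (auto simp: matrix_tuples_def)

section \<open>Unital complete contractions into matrix algebras\<close>

text \<open>Tychonoff's theorem for a filter base of sets \<open>T \<theta>\<close> with coordinates \<open>h A z\<close>. Each coordinate is bounded only for
  sufficiently good parameters, so the coordinates are first truncated to fixed discs; along the
  filter base the truncation has no effect on any given finite set of coordinates.\<close>
lemma exists_cluster_point:
  fixes T :: "'p \<Rightarrow> 's set" and h :: "'s \<Rightarrow> 'z \<Rightarrow> complex"
  assumes ne: "\<Theta> \<noteq> {}" "\<And>\<theta>. \<theta> \<in> \<Theta> \<Longrightarrow> T \<theta> \<noteq> {}"
    and dir: "\<And>\<theta>1 \<theta>2. \<theta>1 \<in> \<Theta> \<Longrightarrow> \<theta>2 \<in> \<Theta> \<Longrightarrow> \<exists>\<theta>\<in>\<Theta>. T \<theta> \<subseteq> T \<theta>1 \<inter> T \<theta>2"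
    and bdd: "\<And>z. z \<in> Z \<Longrightarrow> \<exists>\<theta>\<in>\<Theta>. \<exists>R. \<forall>A\<in>T \<theta>. cmod (h A z) \<le> R"
  shows "\<exists>g. \<forall>\<theta>\<in>\<Theta>. \<forall>K e. finite K \<longrightarrow> K \<subseteq> Z \<longrightarrow> e > 0 \<longrightarrow> (\<exists>A\<in>T \<theta>. \<forall>z\<in>K. cmod (h A z - g z) < e)"
proof -
  have "\<forall>z. \<exists>R. z \<in> Z \<longrightarrow> (\<exists>\<theta>\<in>\<Theta>. \<forall>A\<in>T \<theta>. cmod (h A z) \<le> R)" using bdd by blast
  then obtain R where R: "\<And>z. z \<in> Z \<Longrightarrow> \<exists>\<theta>\<in>\<Theta>. \<forall>A\<in>T \<theta>. cmod (h A z) \<le> R z" by metis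
  define cl where "cl = (\<lambda>A z. if cmod (h A z) \<le> R z then h A z else 0)"
  have clR: "cl A \<in> PiE UNIV (\<lambda>z. cball 0 \<bar>R z\<bar>)" for A by (auto simp: cl_def)
  have "compactin (product_topology (\<lambda>_. euclidean) UNIV) (PiE UNIV (\<lambda>z. cball (0::complex) \<bar>R z\<bar>))"
    by (simp add: compactin_PiE)
  then have comp: "compact (PiE UNIV (\<lambda>z. cball (0::complex) \<bar>R z\<bar>))"
    by (simp add: euclidean_product_topology)
  have dirf: "\<exists>\<theta>\<in>\<Theta>. \<forall>\<theta>'\<in>F. T \<theta> \<subseteq> T \<theta>'" if "finite F" "F \<subseteq> \<Theta>" for F
    using that
  proof (induction F rule: finite_induct)
    case empty then show ?case using ne by auto
  next
    case (insert \<theta>1 F)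
    then obtain \<theta>2 where 2: "\<theta>2 \<in> \<Theta>" "\<forall>\<theta>'\<in>F. T \<theta>2 \<subseteq> T \<theta>'" by auto
    have "\<theta>1 \<in> \<Theta>" using insert.prems by simp
    from dir[OF this 2(1)] obtain \<theta> where "\<theta> \<in> \<Theta>" "T \<theta> \<subseteq> T \<theta>1 \<inter> T \<theta>2" by (elim bexE)
    then show ?case using 2(2) by (intro bexI[of _ \<theta>]) auto
  qed
  have "(PiE UNIV (\<lambda>z. cball (0::complex) \<bar>R z\<bar>)) \<inter> \<Inter>((\<lambda>\<theta>. closure (cl ` T \<theta>)) ` \<Theta>) \<noteq> {}"
  proof (rule compact_imp_fip[OF comp])
    fix G assume G: "finite G" "G \<subseteq> (\<lambda>\<theta>. closure (cl ` T \<theta>)) ` \<Theta>"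
    from finite_subset_image[OF G] obtain F where F: "F \<subseteq> \<Theta>" "finite F" "G = (\<lambda>\<theta>. closure (cl ` T \<theta>)) ` F"
      by (elim exE conjE)
    obtain \<theta> where th: "\<theta> \<in> \<Theta>" "\<forall>\<theta>'\<in>F. T \<theta> \<subseteq> T \<theta>'" using dirf[OF F(2,1)] by blast
    obtain A where A: "A \<in> T \<theta>" using ne(2)[OF th(1)] by blast
    have "cl A \<in> closure (cl ` T \<theta>')" if "\<theta>' \<in> F" for \<theta>'
      using th(2) A that closure_subset by blast
    then show "PiE UNIV (\<lambda>z. cball (0::complex) \<bar>R z\<bar>) \<inter> \<Inter>G \<noteq> {}"
      using clR[of A] F(3) by blast
  qed auto
  then obtain g where g: "\<And>\<theta>. \<theta> \<in> \<Theta> \<Longrightarrow> g \<in> closure (cl ` T \<theta>)" by blast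
  have "\<exists>A\<in>T \<theta>. \<forall>z\<in>K. cmod (h A z - g z) < e"
    if th: "\<theta> \<in> \<Theta>" and K: "finite K" "K \<subseteq> Z" and e: "e > 0" for \<theta> K e
  proof -
    have "\<exists>\<theta>'\<in>\<Theta>. T \<theta>' \<subseteq> T \<theta> \<and> (\<forall>z\<in>K. \<forall>A\<in>T \<theta>'. cmod (h A z) \<le> R z)"
      using K
    proof (induction K rule: finite_induct)
      case empty then show ?case using th by auto
    next
      case (insert z K)
      then obtain \<theta>1 where 1: "\<theta>1 \<in> \<Theta>" "T \<theta>1 \<subseteq> T \<theta>" "\<forall>z\<in>K. \<forall>A\<in>T \<theta>1. cmod (h A z) \<le> R z" by auto
      obtain \<theta>2 where 2: "\<theta>2 \<in> \<Theta>" "\<forall>A\<in>T \<theta>2. cmod (h A z) \<le> R z" using R[of z] insert.prems by blast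
      obtain \<theta>3 where "\<theta>3 \<in> \<Theta>" "T \<theta>3 \<subseteq> T \<theta>1 \<inter> T \<theta>2" using dir[OF 1(1) 2(1)] by blast
      then show ?case using 1 2 by (intro bexI[of _ \<theta>3]) auto
    qed
    then obtain \<theta>' where th': "\<theta>' \<in> \<Theta>" "T \<theta>' \<subseteq> T \<theta>" "\<And>z A. z \<in> K \<Longrightarrow> A \<in> T \<theta>' \<Longrightarrow> cmod (h A z) \<le> R z"
      by blast
    define U where "U = (\<Inter>z\<in>K. (\<lambda>f::'z \<Rightarrow> complex. f z) -` ball (g z) e)"
    have "open U"
      unfolding U_def using K(1)
      by (intro open_INT) (auto intro!: open_vimage continuous_on_product_coordinates)
    moreover have "g \<in> U" using e by (auto simp: U_def)
    ultimately have "cl ` T \<theta>' \<inter> U \<noteq> {}"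
      using g[OF th'(1)] by (meson closure_iff_nhds_not_empty order_refl)
    then obtain A where A: "A \<in> T \<theta>'" "cl A \<in> U" by blast
    have "cmod (h A z - g z) < e" if "z \<in> K" for z
      using A that th'(3)[OF that A(1)] by (auto simp: U_def cl_def dist_norm norm_minus_commute)
    then show ?thesis using A th'(2) by blast
  qed
  then show ?thesis by blast
qed

text \<open>The limit \<open>\<delta> \<rightarrow> 0\<close>, \<open>F \<rightarrow> matrix_tuples S\<close> of the conditions that define operator system microstates.\<close>
definition contractive_on :: "'a::unital_cstar_algebra set \<Rightarrow> nat \<Rightarrow> ('a \<Rightarrow> complex mat) \<Rightarrow> bool" where
  "contractive_on S d G \<longleftrightarrow> (\<forall>x\<in>S. G x \<in> carrier_mat d d) \<and> G 1 = 1\<^sub>m d \<and>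
     (\<forall>(m, B)\<in>matrix_tuples S. \<forall>\<xi> \<eta>. cmod (bform m d (blk S m B G) \<xi> \<eta>)
        \<le> cstar_mat_norm (pencil_sys S m B) * (bnorm m d \<xi> * bnorm m d \<eta>))"

text \<open>Pencils single out the unit coefficient and restrict the other ones to the support; the sum over any finite set that
  contains the support is the same.\<close>
lemma sum_split_unit:
  fixes f :: "'a::one \<Rightarrow> complex \<Rightarrow> 'c::comm_monoid_add"
  assumes one: "1 \<in> S" and t: "finite t" "t \<subseteq> S" and f0: "\<And>x. f x 0 = 0"
    and b: "\<And>x. x \<in> S \<Longrightarrow> x \<notin> t \<Longrightarrow> b x = 0" "\<And>x. x \<in> S \<Longrightarrow> \<not> nz x \<Longrightarrow> b x = 0"
    and nz: "\<And>x. x \<in> S \<Longrightarrow> nz x \<Longrightarrow> x \<in> t"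
  shows "f 1 (b 1) + (\<Sum>x\<in>{x \<in> S - {1}. nz x}. f x (b x)) = (\<Sum>s\<in>t. f s (b s))"
proof -
  have "(\<Sum>s\<in>t. f s (b s)) = (\<Sum>s\<in>insert 1 t. f s (b s))"
    using one f0 t(1) b(1) by (intro sum.mono_neutral_left) auto
  also have "\<dots> = f 1 (b 1) + (\<Sum>s\<in>t - {1}. f s (b s))"
    using t(1) by (simp add: sum.insert_remove)
  also have "(\<Sum>s\<in>t - {1}. f s (b s)) = (\<Sum>x\<in>{x \<in> S - {1}. nz x}. f x (b x))"
  proof (rule sum.mono_neutral_right)
    show "\<forall>i\<in>t - {1} - {x \<in> S - {1}. nz x}. f i (b i) = 0"
    proof
      fix i assume "i \<in> t - {1} - {x \<in> S - {1}. nz x}"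
      then have "b i = 0" using t b(2)[of i] by blast
      then show "f i (b i) = 0" by (simp add: f0)
    qed
  qed (use t nz in auto)
  finally show ?thesis by simp
qed

lemma contractive_onD:
  assumes G: "contractive_on S d G" and one: "1 \<in> S" and t: "finite t" "t \<subseteq> S" and m: "m \<ge> 1"
    and bd: "mbound m (\<lambda>i j. \<Sum>s\<in>t. c i j s *\<^sub>C s) K"
  shows "cmod (bform m d (\<lambda>i j p q. \<Sum>s\<in>t. c i j s * G s $$ (p, q)) \<xi> \<eta>) \<le> K * (bnorm m d \<xi> * bnorm m d \<eta>)"
proof -
  define B where "B = (\<lambda>s\<in>S. if s \<in> t then mat m m (\<lambda>(i, j). c i j s) else 0\<^sub>m m m)"
  let ?D = "{x \<in> S - {1}. B x \<noteq> 0\<^sub>m m m}"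
  have Bt: "B s = mat m m (\<lambda>(i, j). c i j s)" if "s \<in> t" for s using that t by (auto simp: B_def)
  have BS: "B s = 0\<^sub>m m m" if "s \<in> S" "s \<notin> t" for s using that by (auto simp: B_def)
  have "{x \<in> S. B x \<noteq> 0\<^sub>m m m} \<subseteq> t" using BS by auto
  then have "finite {x \<in> S. B x \<noteq> 0\<^sub>m m m}" using t(1) by (rule finite_subset)
  moreover have "B \<in> S \<rightarrow>\<^sub>E carrier_mat m m" by (auto simp: B_def)
  ultimately have mB: "(m, B) \<in> matrix_tuples S"
    unfolding matrix_tuples_def using m by simp
  have B0: "B x $$ (i, j) = 0" if "x \<in> S" "x \<notin> t \<or> B x = 0\<^sub>m m m" "i < m" "j < m" for x i j
    using that BS by auto
  have inD: "x \<in> t" if "x \<in> S" "B x \<noteq> 0\<^sub>m m m" for x using that BS by blast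
  have "bform m d (blk S m B G) \<xi> \<eta> = bform m d (\<lambda>i j p q. \<Sum>s\<in>t. c i j s * G s $$ (p, q)) \<xi> \<eta>"
    unfolding bform_def
  proof (intro sum.cong refl)
    fix i j p q assume *: "i \<in> {..<m}" "j \<in> {..<m}" "p \<in> {..<d}" "q \<in> {..<d}"
    have "G 1 $$ (p, q) = (if p = q then 1 else 0)" using G * by (simp add: contractive_on_def)
    then have "blk S m B G i j p q = B 1 $$ (i, j) * G 1 $$ (p, q) + (\<Sum>x\<in>?D. B x $$ (i, j) * G x $$ (p, q))"
      by (simp only: blk_def)
    also have "\<dots> = (\<Sum>s\<in>t. B s $$ (i, j) * G s $$ (p, q))"
      by (rule sum_split_unit[OF one t, of "\<lambda>x z. z * G x $$ (p, q)" "\<lambda>x. B x $$ (i, j)"])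
        (use B0 inD * in auto)
    also have "\<dots> = (\<Sum>s\<in>t. c i j s * G s $$ (p, q))"
      using Bt * by (intro sum.cong) auto
    finally have "blk S m B G i j p q = (\<Sum>s\<in>t. c i j s * G s $$ (p, q))" .
    then show "blk S m B G i j p q * \<xi> j q * cnj (\<eta> i p) = (\<Sum>s\<in>t. c i j s * G s $$ (p, q)) * \<xi> j q * cnj (\<eta> i p)"
      by simp
  qed
  moreover have "cmod (bform m d (blk S m B G) \<xi> \<eta>) \<le> cstar_mat_norm (pencil_sys S m B) * (bnorm m d \<xi> * bnorm m d \<eta>)"
    using G mB unfolding contractive_on_def by blast
  moreover have "cstar_mat_norm (pencil_sys S m B) \<le> K"
  proof (rule cstar_mat_norm_le)
    show "pencil_sys S m B \<in> carrier_mat m m" by (simp add: pencil_sys_def)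
    have "pencil_sys S m B $$ (i, j) = (\<Sum>s\<in>t. c i j s *\<^sub>C s)" if "i < m" "j < m" for i j
    proof -
      have "pencil_sys S m B $$ (i, j) = B 1 $$ (i, j) *\<^sub>C 1 + (\<Sum>x\<in>?D. B x $$ (i, j) *\<^sub>C x)"
        using that by (simp add: pencil_sys_def)
      also have "\<dots> = (\<Sum>s\<in>t. B s $$ (i, j) *\<^sub>C s)"
        by (rule sum_split_unit[OF one t, of "\<lambda>x z. z *\<^sub>C x" "\<lambda>x. B x $$ (i, j)"])
          (use B0 inD that in auto)
      also have "\<dots> = (\<Sum>s\<in>t. c i j s *\<^sub>C s)"
        using Bt that by (intro sum.cong) auto
      finally show ?thesis .
    qed
    then have "mv m (\<lambda>i j. pencil_sys S m B $$ (i, j)) b k = mv m (\<lambda>i j. \<Sum>s\<in>t. c i j s *\<^sub>C s) b k" if "k < m" for b k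
      using that by (simp add: mv_def)
    then have "mnorm m (mv m (\<lambda>i j. pencil_sys S m B $$ (i, j)) b) = mnorm m (mv m (\<lambda>i j. \<Sum>s\<in>t. c i j s *\<^sub>C s) b)" for b
      by (rule mnorm_cong)
    then show "mbound m (\<lambda>i j. pencil_sys S m B $$ (i, j)) K" using bd by (simp add: mbound_def)
  qed
  ultimately show ?thesis
    by (smt (verit, best) bnorm_nonneg mult_nonneg_nonneg mult_right_mono)
qed

lemma mbound_cong:
  "(\<And>i j. i < n \<Longrightarrow> j < n \<Longrightarrow> X i j = Y i j) \<Longrightarrow> mbound n X c = mbound n Y c"
proof -
  assume eq: "\<And>i j. i < n \<Longrightarrow> j < n \<Longrightarrow> X i j = Y i j"
  have "mnorm n (mv n X b) = mnorm n (mv n Y b)" for b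
    by (rule mnorm_cong) (simp add: mv_def eq)
  then show ?thesis by (simp add: mbound_def)
qed

lemma bform_1: "bform 1 N W \<xi> \<eta> = (\<Sum>p<N. \<Sum>q<N. W 0 0 p q * \<xi> 0 q * cnj (\<eta> 0 p))"
  by (simp add: bform_def lessThan_Suc)

text \<open>A relation among elements of \<open>S\<close> is a \<open>1 \<times> 1\<close> pencil of norm \<open>0\<close>. This makes the linear extension of \<open>G\<close> well
  defined, although \<open>S\<close> may be linearly dependent.\<close>
lemma contractive_relation:
  assumes G: "contractive_on S d G" and one: "1 \<in> S" and t: "finite t" "t \<subseteq> S"
    and rel: "(\<Sum>s\<in>t. r s *\<^sub>C s) = 0" and pq: "p < d" "q < d"
  shows "(\<Sum>s\<in>t. r s * G s $$ (p, q)) = 0"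
proof -
  let ?w = "\<Sum>s\<in>t. r s * G s $$ (p, q)"
  let ?u = "\<lambda>k i. if i = k then 1 else (0::complex)"
  have "mbound 1 (\<lambda>i j. \<Sum>s\<in>t. r s *\<^sub>C s) 0"
    unfolding rel by (rule mbound_zero)
  then have "cmod (bform 1 d (\<lambda>i j p q. \<Sum>s\<in>t. r s * G s $$ (p, q)) (\<lambda>_. ?u q) (\<lambda>_. ?u p)) \<le> 0 * (bnorm 1 d (\<lambda>_. ?u q) * bnorm 1 d (\<lambda>_. ?u p))"
    by (intro contractive_onD[OF G one t, of 1 "\<lambda>i j s. r s" 0]) simp
  moreover have "bform 1 d (\<lambda>i j p q. \<Sum>s\<in>t. r s * G s $$ (p, q)) (\<lambda>_. ?u q) (\<lambda>_. ?u p) = ?w"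
  proof -
    have "bform 1 d (\<lambda>i j p q. \<Sum>s\<in>t. r s * G s $$ (p, q)) (\<lambda>_. ?u q) (\<lambda>_. ?u p)
      = (\<Sum>p'<d. \<Sum>q'<d. if q' = q then (if p' = p then ?w else 0) else 0)"
      unfolding bform_1 by (intro sum.cong refl) auto
    also have "\<dots> = ?w" using pq by simp
    finally show ?thesis .
  qed
  ultimately show ?thesis by simp
qed

lemma contractive_linear_extension:
  assumes G: "contractive_on S d G" and one: "1 \<in> S" and span: "cspan S = V"
  obtains \<psi> where "\<And>x. x \<in> V \<Longrightarrow> \<psi> x \<in> carrier_mat d d"
    "\<And>x y p q. x \<in> V \<Longrightarrow> y \<in> V \<Longrightarrow> p < d \<Longrightarrow> q < d \<Longrightarrow> \<psi> (x + y) $$ (p, q) = \<psi> x $$ (p, q) + \<psi> y $$ (p, q)"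
    "\<And>c x p q. x \<in> V \<Longrightarrow> p < d \<Longrightarrow> q < d \<Longrightarrow> \<psi> (c *\<^sub>C x) $$ (p, q) = c * \<psi> x $$ (p, q)"
    "\<And>s. s \<in> S \<Longrightarrow> \<psi> s = G s"
    "\<And>m X K \<xi> \<eta>. m \<ge> 1 \<Longrightarrow> \<forall>i<m. \<forall>j<m. X i j \<in> V \<Longrightarrow> mbound m X K \<Longrightarrow>
      cmod (bform m d (\<lambda>i j p q. \<psi> (X i j) $$ (p, q)) \<xi> \<eta>) \<le> K * (bnorm m d \<xi> * bnorm m d \<eta>)"
proof -
  have "\<exists>t r. finite t \<and> t \<subseteq> S \<and> x = (\<Sum>s\<in>t. r s *\<^sub>C s)" if "x \<in> V" for x
    using that span[symmetric] unfolding cvec.span_explicit by blast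
  then have "\<forall>x. \<exists>t r. x \<in> V \<longrightarrow> finite t \<and> t \<subseteq> S \<and> x = (\<Sum>s\<in>t. r s *\<^sub>C s)" by blast
  then obtain tt rr where "\<forall>x. x \<in> V \<longrightarrow> finite (tt x) \<and> tt x \<subseteq> S \<and> x = (\<Sum>s\<in>tt x. rr x s *\<^sub>C s)"
    by metis
  then have tt: "finite (tt x)" "tt x \<subseteq> S" and rr: "(\<Sum>s\<in>tt x. rr x s *\<^sub>C s) = x" if "x \<in> V" for x
    using that by auto
  define \<psi> where "\<psi> = (\<lambda>x. mat d d (\<lambda>(p, q). \<Sum>s\<in>tt x. rr x s * G s $$ (p, q)))"
  have ext: "(\<Sum>s\<in>t. f (r s) s) = (\<Sum>s\<in>u. f (if s \<in> t then r s else 0) s)"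
    if "finite u" "t \<subseteq> u" "\<And>s. f 0 s = 0" for t u and r :: "'a \<Rightarrow> complex" and f :: "complex \<Rightarrow> 'a \<Rightarrow> complex"
    using that by (intro sum.mono_neutral_cong_left) auto
  have ext': "(\<Sum>s\<in>t. r s *\<^sub>C s) = (\<Sum>s\<in>u. (if s \<in> t then r s else 0) *\<^sub>C s)"
    if "finite u" "t \<subseteq> u" for t u and r :: "'a \<Rightarrow> complex"
    using that by (intro sum.mono_neutral_cong_left) auto
  have indep: "\<psi> x $$ (p, q) = (\<Sum>s\<in>t. r s * G s $$ (p, q))"
    if x: "x \<in> V" and t: "finite t" "t \<subseteq> S" "(\<Sum>s\<in>t. r s *\<^sub>C s) = x" and pq: "p < d" "q < d" for x t r p q
  proof -
    let ?u = "t \<union> tt x"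
    let ?r = "\<lambda>s. (if s \<in> t then r s else 0) - (if s \<in> tt x then rr x s else 0)"
    have u: "finite ?u" "?u \<subseteq> S" using t tt[OF x] by auto
    have "(\<Sum>s\<in>?u. ?r s *\<^sub>C s) = (\<Sum>s\<in>t. r s *\<^sub>C s) - (\<Sum>s\<in>tt x. rr x s *\<^sub>C s)"
      unfolding cvec.scale_left_diff_distrib sum_subtractf
      using ext'[OF u(1), of t r] ext'[OF u(1), of "tt x" "rr x"] by simp
    also have "\<dots> = 0" using t(3) rr[OF x] by simp
    finally have "(\<Sum>s\<in>?u. ?r s * G s $$ (p, q)) = 0" by (rule contractive_relation[OF G one u _ pq])
    then have "(\<Sum>s\<in>t. r s * G s $$ (p, q)) = (\<Sum>s\<in>tt x. rr x s * G s $$ (p, q))"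
      unfolding left_diff_distrib sum_subtractf
      using ext[OF u(1), of t "\<lambda>z s. z * G s $$ (p, q)" r] ext[OF u(1), of "tt x" "\<lambda>z s. z * G s $$ (p, q)" "rr x"] by simp
    then show ?thesis using pq by (simp add: \<psi>_def)
  qed
  have Vadd: "x + y \<in> V" and Vsc: "c *\<^sub>C x \<in> V" if "x \<in> V" "y \<in> V" for x y c
    using that cvec.span_add[of x S y] cvec.span_scale[of x S c] unfolding span by auto
  show thesis
  proof
    show "\<psi> x \<in> carrier_mat d d" for x by (simp add: \<psi>_def)
    show "\<psi> (x + y) $$ (p, q) = \<psi> x $$ (p, q) + \<psi> y $$ (p, q)" if x: "x \<in> V" and y: "y \<in> V" and pq: "p < d" "q < d" for x y p q
    proof -
      let ?u = "tt x \<union> tt y"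
      let ?r = "\<lambda>s. (if s \<in> tt x then rr x s else 0) + (if s \<in> tt y then rr y s else 0)"
      have u: "finite ?u" "?u \<subseteq> S" using tt[OF x] tt[OF y] by auto
      have "(\<Sum>s\<in>?u. ?r s *\<^sub>C s) = x + y"
        unfolding cvec.scale_left_distrib sum.distrib
        using ext'[OF u(1), of "tt x" "rr x"] ext'[OF u(1), of "tt y" "rr y"] rr[OF x] rr[OF y] by simp
      then have "\<psi> (x + y) $$ (p, q) = (\<Sum>s\<in>?u. ?r s * G s $$ (p, q))"
        by (rule indep[OF Vadd[OF x y] u _ pq])
      also have "\<dots> = (\<Sum>s\<in>tt x. rr x s * G s $$ (p, q)) + (\<Sum>s\<in>tt y. rr y s * G s $$ (p, q))"
        unfolding distrib_right sum.distrib
        using ext[OF u(1), of "tt x" "\<lambda>z s. z * G s $$ (p, q)" "rr x"] ext[OF u(1), of "tt y" "\<lambda>z s. z * G s $$ (p, q)" "rr y"] by simp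
      finally show ?thesis using pq by (simp add: \<psi>_def)
    qed
    show "\<psi> (c *\<^sub>C x) $$ (p, q) = c * \<psi> x $$ (p, q)" if x: "x \<in> V" and pq: "p < d" "q < d" for c x p q
    proof -
      have "(\<Sum>s\<in>tt x. (c * rr x s) *\<^sub>C s) = c *\<^sub>C x"
        unfolding scaleC_scaleC[symmetric] cvec.scale_sum_right[symmetric] rr[OF x] ..
      then have "\<psi> (c *\<^sub>C x) $$ (p, q) = (\<Sum>s\<in>tt x. c * rr x s * G s $$ (p, q))"
        by (rule indep[OF Vsc[OF x x] tt[OF x] _ pq])
      then show ?thesis using pq by (simp add: \<psi>_def sum_distrib_left mult.assoc)
    qed
    show "\<psi> s = G s" if s: "s \<in> S" for s
    proof -
      have sV: "s \<in> V" using s cvec.span_base[of s S] span by simp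
      have Gs: "G s \<in> carrier_mat d d" using G s by (simp add: contractive_on_def)
      have e: "(\<Sum>s'\<in>{s}. 1 *\<^sub>C s') = s" by simp
      have "\<psi> s $$ (p, q) = G s $$ (p, q)" if "p < d" "q < d" for p q
        using indep[OF sV _ _ e that] s by simp
      then show ?thesis using Gs by (intro eq_matI) (auto simp: \<psi>_def)
    qed
    show "cmod (bform m d (\<lambda>i j p q. \<psi> (X i j) $$ (p, q)) \<xi> \<eta>) \<le> K * (bnorm m d \<xi> * bnorm m d \<eta>)"
      if m: "m \<ge> 1" and X': "\<forall>i<m. \<forall>j<m. X i j \<in> V" and bd: "mbound m X K" for m X K \<xi> \<eta>
    proof -
      have X: "X i j \<in> V" if "i < m" "j < m" for i j using X' that by blast
      define u where "u = (\<Union>i<m. \<Union>j<m. tt (X i j))"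
      define c where "c = (\<lambda>i j s. if s \<in> tt (X i j) then rr (X i j) s else 0)"
      have u: "finite u" "u \<subseteq> S" using tt X by (auto simp: u_def)
      have sub: "tt (X i j) \<subseteq> u" if "i < m" "j < m" for i j using that by (auto simp: u_def)
      have "mbound m (\<lambda>i j. \<Sum>s\<in>u. c i j s *\<^sub>C s) K = mbound m X K"
      proof (rule mbound_cong)
        fix i j assume ij: "i < m" "j < m"
        show "(\<Sum>s\<in>u. c i j s *\<^sub>C s) = X i j"
          unfolding c_def using ext'[OF u(1) sub[OF ij], of "rr (X i j)"] rr[OF X[OF ij]] by simp
      qed
      then have "cmod (bform m d (\<lambda>i j p q. \<Sum>s\<in>u. c i j s * G s $$ (p, q)) \<xi> \<eta>) \<le> K * (bnorm m d \<xi> * bnorm m d \<eta>)"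
        using bd by (intro contractive_onD[OF G one u m]) simp
      moreover have "bform m d (\<lambda>i j p q. \<Sum>s\<in>u. c i j s * G s $$ (p, q)) \<xi> \<eta> = bform m d (\<lambda>i j p q. \<psi> (X i j) $$ (p, q)) \<xi> \<eta>"
        unfolding bform_def
      proof (intro sum.cong refl)
        fix i j p q assume *: "i \<in> {..<m}" "j \<in> {..<m}" "p \<in> {..<d}" "q \<in> {..<d}"
        then have ij: "i < m" "j < m" by auto
        have "(\<Sum>s\<in>u. c i j s * G s $$ (p, q)) = \<psi> (X i j) $$ (p, q)"
          unfolding c_def using ext[OF u(1) sub[OF ij], of "\<lambda>z s. z * G s $$ (p, q)" "rr (X i j)"] * by (simp add: \<psi>_def)
        then show "(\<Sum>s\<in>u. c i j s * G s $$ (p, q)) * \<xi> j q * cnj (\<eta> i p) = \<psi> (X i j) $$ (p, q) * \<xi> j q * cnj (\<eta> i p)"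
          by simp
      qed
      ultimately show ?thesis by simp
    qed
  qed
qed

lemma bform_add: "bform m d (\<lambda>i j p q. W i j p q + W' i j p q) \<xi> \<eta> = bform m d W \<xi> \<eta> + bform m d W' \<xi> \<eta>"
  by (simp add: bform_def distrib_right sum.distrib)

lemma bform_scale: "bform m d (\<lambda>i j p q. c * W i j p q) \<xi> \<eta> = c * bform m d W \<xi> \<eta>"
  by (simp add: bform_def sum_distrib_left mult.assoc)

lemma bform_cong:
  "(\<And>i j p q. i < m \<Longrightarrow> j < m \<Longrightarrow> p < d \<Longrightarrow> q < d \<Longrightarrow> W i j p q = W' i j p q) \<Longrightarrow> bform m d W \<xi> \<eta> = bform m d W' \<xi> \<eta>"
  unfolding bform_def by (intro sum.cong refl) auto

lemma bform_delta:
  "bform m d (\<lambda>i j p q. if i = j \<and> p = q then 1 else 0) \<xi> \<xi> = of_real ((bnorm m d \<xi>)\<^sup>2)"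
proof -
  have inner: "(\<Sum>p<d. \<Sum>q<d. (if i = j \<and> p = q then 1 else 0) * \<xi> j q * cnj (\<xi> i p))
      = (if j = i then cip d (\<xi> i) (\<xi> i) else 0)" for i j
  proof (cases "j = i")
    case True
    have "(\<Sum>q<d. (if i = i \<and> p = q then 1 else 0) * \<xi> i q * cnj (\<xi> i p)) = \<xi> i p * cnj (\<xi> i p)" if "p < d" for p
    proof -
      have "(\<Sum>q<d. (if i = i \<and> p = q then 1 else 0) * \<xi> i q * cnj (\<xi> i p))
          = (\<Sum>q<d. if q = p then \<xi> i p * cnj (\<xi> i p) else 0)"
        by (rule sum.cong) auto
      then show ?thesis using that by simp
    qed
    then show ?thesis using True by (simp add: cip_def)
  qed simp
  have "bform m d (\<lambda>i j p q. if i = j \<and> p = q then 1 else 0) \<xi> \<xi> = (\<Sum>i<m. cip d (\<xi> i) (\<xi> i))"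
    unfolding bform_def inner by simp
  also have "\<dots> = of_real ((bnorm m d \<xi>)\<^sup>2)"
    by (simp add: cip_self bnorm_square)
  finally show ?thesis .
qed

text \<open>For self-adjoint \<open>X\<close> the cross terms of \<open>\<parallel>X b + \<i> \<tau> b\<parallel>\<^sup>2\<close> cancel.\<close>
lemma mbound_selfadjoint_plus_imaginary:
  assumes X: "mbound n X c" and sa: "\<And>i j. i < n \<Longrightarrow> j < n \<Longrightarrow> adj (X j i) = X i j"
  shows "mbound n (\<lambda>i j. X i j + (if i = j then (\<i> * of_real \<tau>) *\<^sub>C 1 else 0)) (sqrt (c\<^sup>2 + \<tau>\<^sup>2))"
  unfolding mbound_def
proof (intro conjI allI)
  fix b :: "nat \<Rightarrow> 'a"
  let ?k = "\<i> * complex_of_real \<tau>"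
  let ?Y = "\<lambda>i j. X i j + (if i = j then ?k *\<^sub>C 1 else 0)"
  let ?y = "mv n X b"
  have Y: "mv n ?Y b i = ?y i + ?k *\<^sub>C b i" if "i < n" for i
  proof -
    have "mv n ?Y b i = (\<Sum>k<n. X i k * b k + (if k = i then ?k *\<^sub>C b i else 0))"
      unfolding mv_def by (rule sum.cong) (auto simp: distrib_right scaleC_mult_left)
    then show ?thesis using that by (simp add: sum.distrib mv_def)
  qed
  have "mip n ?y b = mip n b ?y"
  proof -
    have "mip n b ?y = mip n (mv n (mstar X) b) b" by (rule mip_mv)
    moreover have "mv n (mstar X) b i = ?y i" if "i < n" for i
      unfolding mv_def mstar_def using sa[OF that] by (intro sum.cong) auto
    ultimately show ?thesis by (simp add: mip_def)
  qed
  moreover have "mip n (\<lambda>i. ?k *\<^sub>C b i) z = cnj ?k *\<^sub>C mip n b z" "mip n z (\<lambda>i. ?k *\<^sub>C b i) = ?k *\<^sub>C mip n z b" for z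
    by (simp_all add: mip_def adj_scaleC scaleC_mult_left scaleC_mult_right cvec.scale_sum_right)
  ultimately have "mip n (\<lambda>i. ?y i + ?k *\<^sub>C b i) (\<lambda>i. ?y i + ?k *\<^sub>C b i)
      = mip n ?y ?y + (?k + cnj ?k) *\<^sub>C mip n b ?y + (cnj ?k * ?k) *\<^sub>C mip n b b"
    by (simp only: mip_add_left mip_add_right scaleC_add_left scaleC_scaleC scaleC_add_right ac_simps)
  moreover have "?k + cnj ?k = 0" by (simp add: complex_eq_iff)
  moreover have "cnj ?k * ?k = of_real (\<tau>\<^sup>2)" by (simp add: complex_eq_iff power2_eq_square)
  ultimately have "mip n (\<lambda>i. ?y i + ?k *\<^sub>C b i) (\<lambda>i. ?y i + ?k *\<^sub>C b i) = mip n ?y ?y + of_real (\<tau>\<^sup>2) * mip n b b"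
    by (simp only: scaleC_of_real cvec.scale_zero_left add_0_right scaleR_conv_of_real)
  then have "(mnorm n (mv n ?Y b))\<^sup>2 \<le> (mnorm n ?y)\<^sup>2 + \<tau>\<^sup>2 * (mnorm n b)\<^sup>2"
    using mnorm_cong[of n "mv n ?Y b" "\<lambda>i. ?y i + ?k *\<^sub>C b i"] Y norm_triangle_ineq[of "mip n ?y ?y" "of_real (\<tau>\<^sup>2) * mip n b b"]
    by (simp add: mnorm_square of_real_def)
  also have "(mnorm n ?y)\<^sup>2 \<le> (c * mnorm n b)\<^sup>2"
    by (intro power_mono mboundD[OF X]) simp
  finally have "(mnorm n (mv n ?Y b))\<^sup>2 \<le> (c\<^sup>2 + \<tau>\<^sup>2) * (mnorm n b)\<^sup>2"
    by (simp add: power_mult_distrib algebra_simps)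
  then have "mnorm n (mv n ?Y b) \<le> sqrt ((c\<^sup>2 + \<tau>\<^sup>2) * (mnorm n b)\<^sup>2)"
    by (rule real_le_rsqrt)
  then show "mnorm n (mv n ?Y b) \<le> sqrt (c\<^sup>2 + \<tau>\<^sup>2) * mnorm n b"
    by (simp add: real_sqrt_mult)
qed simp

text \<open>The first bound gives \<open>Re z \<ge> 0\<close>. In the second one the terms \<open>\<tau>\<^sup>2 n\<^sup>2\<close> cancel after squaring, and letting \<open>\<tau>\<close> tend
  to \<open>\<plusminus>\<infinity>\<close> leaves \<open>Im z = 0\<close>.\<close>
lemma nonneg_of_two_bounds:
  fixes z :: complex
  assumes 1: "cmod (of_real (r * n) - z) \<le> r * n"
    and 2: "\<And>\<tau>. cmod (z + \<i> * of_real (\<tau> * n)) \<le> sqrt (c\<^sup>2 + \<tau>\<^sup>2) * n" and n: "n \<ge> 0"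
  shows "z \<in> \<real>\<^sub>\<ge>\<^sub>0"
proof -
  have "r * n - Re z \<le> r * n" using abs_Re_le_cmod[of "of_real (r * n) - z"] 1 by auto
  then have re: "Re z \<ge> 0" by simp
  have lin: "2 * \<tau> * n * Im z \<le> c\<^sup>2 * n\<^sup>2" for \<tau>
  proof -
    have "(cmod (z + \<i> * of_real (\<tau> * n)))\<^sup>2 \<le> (sqrt (c\<^sup>2 + \<tau>\<^sup>2) * n)\<^sup>2" by (rule power_mono[OF 2]) simp
    then have "(Re z)\<^sup>2 + (Im z + \<tau> * n)\<^sup>2 \<le> (c\<^sup>2 + \<tau>\<^sup>2) * n\<^sup>2"
      by (simp add: cmod_power2 power_mult_distrib)
    then have "(Re z)\<^sup>2 + (Im z)\<^sup>2 + 2 * \<tau> * n * Im z \<le> c\<^sup>2 * n\<^sup>2"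
      by (simp add: power2_eq_square algebra_simps)
    then show ?thesis using zero_le_power2[of "Re z"] zero_le_power2[of "Im z"] by linarith
  qed
  have "Im z = 0"
  proof (cases "n = 0")
    case True
    then show ?thesis using 2[of 0] by simp
  next
    case False
    show ?thesis
    proof (rule ccontr)
      assume im: "Im z \<noteq> 0"
      have "2 * ((c\<^sup>2 * n\<^sup>2 + 1) / (2 * n * Im z)) * n * Im z = c\<^sup>2 * n\<^sup>2 + 1"
        using im False by (simp add: field_simps)
      with lin[of "(c\<^sup>2 * n\<^sup>2 + 1) / (2 * n * Im z)"] show False by simp
    qed
  qed
  with re show ?thesis by (simp add: complex_nonneg_Reals_iff)
qed

lemma ell2_finite: "finite J \<Longrightarrow> ell2 J = {\<xi>. \<forall>k. k \<notin> J \<longrightarrow> \<xi> k = 0}"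
  by (simp add: ell2_def)

text \<open>A \<open>d \<times> d\<close> matrix as an operator on \<open>\<ell>\<^sup>2(J)\<close>, where \<open>e\<close> enumerates the \<open>d\<close> elements of \<open>J\<close>.\<close>
definition mat_op :: "'k set \<Rightarrow> (nat \<Rightarrow> 'k) \<Rightarrow> nat \<Rightarrow> complex mat \<Rightarrow> 'k op" where
  "mat_op J e d M = (\<lambda>\<xi>. if \<xi> \<in> ell2 J then
     (\<lambda>y. if y \<in> J then act d M (\<lambda>q. \<xi> (e q)) (inv_into {..<d} e y) else 0) else (\<lambda>y. 0))"

context
  fixes J :: "'k set" and e :: "nat \<Rightarrow> 'k" and d :: nat
  assumes bij: "bij_betw e {..<d} J"
begin

lemma fin_J: "finite J"
  using bij bij_betw_finite by blast

lemma e_in: "q < d \<Longrightarrow> e q \<in> J"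
  using bij by (auto simp: bij_betw_def)

lemma inv_e: "q < d \<Longrightarrow> inv_into {..<d} e (e q) = q"
  using bij by (simp add: bij_betw_def)

lemma e_inv: "y \<in> J \<Longrightarrow> e (inv_into {..<d} e y) = y" "y \<in> J \<Longrightarrow> inv_into {..<d} e y < d"
  using bij bij_betw_inv_into_right[OF bij] bij_betw_apply[OF bij_betw_inv_into[OF bij]] by auto

lemma ell2_inner_eq: "ell2_inner J \<xi> \<eta> = cip d (\<lambda>q. \<xi> (e q)) (\<lambda>q. \<eta> (e q))"
  unfolding ell2_inner_def cip_def infsum_finite[OF fin_J]
  by (rule sum.reindex_bij_betw[OF bij, symmetric])

lemma ell2_norm_eq: "ell2_norm J \<xi> = cnorm d (\<lambda>q. \<xi> (e q))"
  unfolding ell2_norm_def cnorm_def L2_set_def infsum_finite[OF fin_J]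
  by (subst sum.reindex_bij_betw[OF bij, symmetric]) simp

lemma mat_op_in_ell2: "mat_op J e d M \<xi> \<in> ell2 J"
  by (simp add: mat_op_def ell2_finite[OF fin_J])

lemma mat_op_index: "\<xi> \<in> ell2 J \<Longrightarrow> q < d \<Longrightarrow> mat_op J e d M \<xi> (e q) = act d M (\<lambda>q. \<xi> (e q)) q"
  by (simp add: mat_op_def e_in inv_e)

lemma ell2_eqI: "\<xi> \<in> ell2 J \<Longrightarrow> \<eta> \<in> ell2 J \<Longrightarrow> (\<And>q. q < d \<Longrightarrow> \<xi> (e q) = \<eta> (e q)) \<Longrightarrow> \<xi> = \<eta>"
proof
  fix y assume *: "\<xi> \<in> ell2 J" "\<eta> \<in> ell2 J" "\<And>q. q < d \<Longrightarrow> \<xi> (e q) = \<eta> (e q)"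
  show "\<xi> y = \<eta> y"
  proof (cases "y \<in> J")
    case True
    then show ?thesis using *(3)[OF e_inv(2)[OF True]] by (simp add: e_inv)
  qed (use * in \<open>simp add: ell2_finite[OF fin_J]\<close>)
qed

lemma mat_op_bounded: "mat_op J e d M \<in> bounded_ops J"
  unfolding bounded_ops_def
proof (intro CollectI conjI ballI allI impI)
  fix \<xi> assume "\<xi> \<notin> ell2 J" then show "mat_op J e d M \<xi> = (\<lambda>k. 0)" by (simp add: mat_op_def)
next
  fix \<xi> show "mat_op J e d M \<xi> \<in> ell2 J" by (rule mat_op_in_ell2)
next
  fix \<xi> \<eta> assume x: "\<xi> \<in> ell2 J" "\<eta> \<in> ell2 J"
  then have "(\<lambda>k. \<xi> k + \<eta> k) \<in> ell2 J" by (simp add: ell2_finite[OF fin_J])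
  with x show "mat_op J e d M (\<lambda>k. \<xi> k + \<eta> k) = (\<lambda>k. mat_op J e d M \<xi> k + mat_op J e d M \<eta> k)"
    by (auto simp: mat_op_def act_def fun_eq_iff distrib_left sum.distrib)
next
  fix c \<xi> assume x: "\<xi> \<in> ell2 J"
  then have "(\<lambda>k. c * \<xi> k) \<in> ell2 J" by (simp add: ell2_finite[OF fin_J])
  with x show "mat_op J e d M (\<lambda>k. c * \<xi> k) = (\<lambda>k. c * mat_op J e d M \<xi> k)"
    by (auto simp: mat_op_def act_def fun_eq_iff sum_distrib_left ac_simps)
next
  show "\<exists>K. \<forall>\<xi>\<in>ell2 J. ell2_norm J (mat_op J e d M \<xi>) \<le> K * ell2_norm J \<xi>"
  proof (intro exI ballI)
    fix \<xi> assume x: "\<xi> \<in> ell2 J"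
    have "cnorm d (\<lambda>q. mat_op J e d M \<xi> (e q)) = cnorm d (act d M (\<lambda>q. \<xi> (e q)))"
      by (rule cnorm_cong) (simp add: mat_op_index x)
    then show "ell2_norm J (mat_op J e d M \<xi>) \<le> (\<Sum>i<d. \<Sum>k<d. cmod (M $$ (i, k))) * ell2_norm J \<xi>"
      unfolding ell2_norm_eq using cnorm_act_le_sum by simp
  qed
qed

lemma mat_op_one: "mat_op J e d (1\<^sub>m d) = id_op J"
proof
  fix \<xi>
  have *: "(1::complex) \<cdot>\<^sub>m 1\<^sub>m d = 1\<^sub>m d" by (intro eq_matI) auto
  show "mat_op J e d (1\<^sub>m d) \<xi> = id_op J \<xi>"
  proof (cases "\<xi> \<in> ell2 J")
    case True
    have "mat_op J e d (1\<^sub>m d) \<xi> = \<xi>"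
      by (rule ell2_eqI[OF mat_op_in_ell2 True])
        (use act_scalar[of _ d 1 "\<lambda>q. \<xi> (e q)"] in \<open>simp add: mat_op_index True *\<close>)
    then show ?thesis using True by (simp add: id_op_def)
  qed (simp add: mat_op_def id_op_def)
qed

lemma mat_op_mult:
  assumes "M \<in> carrier_mat d d" "M' \<in> carrier_mat d d"
  shows "mat_op J e d (M * M') = mat_op J e d M \<circ> mat_op J e d M'"
proof
  fix \<xi>
  show "mat_op J e d (M * M') \<xi> = (mat_op J e d M \<circ> mat_op J e d M') \<xi>"
  proof (cases "\<xi> \<in> ell2 J")
    case True
    have "mat_op J e d (M * M') \<xi> (e q) = mat_op J e d M (mat_op J e d M' \<xi>) (e q)" if q: "q < d" for q
    proof -
      have "act d M (act d M' (\<lambda>q. \<xi> (e q))) = act d M (\<lambda>q. mat_op J e d M' \<xi> (e q))"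
        by (rule act_cong) (simp add: mat_op_index True)
      then show ?thesis using q by (simp add: mat_op_index True mat_op_in_ell2 act_mult[OF assms])
    qed
    then show ?thesis using ell2_eqI[OF mat_op_in_ell2 mat_op_in_ell2] by simp
  next
    case False
    have "mat_op J e d M (\<lambda>y. 0) = (\<lambda>y. 0)"
      by (simp add: mat_op_def act_def fun_eq_iff)
    moreover have "mat_op J e d (M * M') \<xi> = (\<lambda>y. 0)" "mat_op J e d M' \<xi> = (\<lambda>y. 0)"
      using False by (simp_all add: mat_op_def)
    ultimately show ?thesis by simp
  qed
qed

end

text \<open>A unital complete contraction is completely positive: for positive \<open>X\<close> apply contractivity to \<open>r - X\<close>, of norm at
  most \<open>r\<close>, and to \<open>X + \<i> \<tau>\<close>, of norm at most \<open>(c\<^sup>2 + \<tau>\<^sup>2)\<^sup>1\<^sup>/\<^sup>2\<close>. The quadratic form \<open>z\<close> of the image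
  then satisfies the two bounds of \<open>nonneg_of_two_bounds\<close>, with \<open>n\<close> the square of the norm of
  the test vector.\<close>
lemma complete_contraction_ucp:
  fixes V :: "'a::unital_cstar_algebra set" and \<psi> :: "'a \<Rightarrow> complex mat"
  assumes bij: "bij_betw e {..<d} (J :: 'a set)"
    and V: "operator_system V"
    and add: "\<And>x y p q. x \<in> V \<Longrightarrow> y \<in> V \<Longrightarrow> p < d \<Longrightarrow> q < d \<Longrightarrow> \<psi> (x + y) $$ (p, q) = \<psi> x $$ (p, q) + \<psi> y $$ (p, q)"
    and sc: "\<And>c x p q. x \<in> V \<Longrightarrow> p < d \<Longrightarrow> q < d \<Longrightarrow> \<psi> (c *\<^sub>C x) $$ (p, q) = c * \<psi> x $$ (p, q)"
    and unit: "\<psi> 1 = 1\<^sub>m d"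
    and contr: "\<And>m X K \<xi> \<eta>. m \<ge> 1 \<Longrightarrow> \<forall>i<m. \<forall>j<m. X i j \<in> V \<Longrightarrow> mbound m X K \<Longrightarrow>
      cmod (bform m d (\<lambda>i j p q. \<psi> (X i j) $$ (p, q)) \<xi> \<eta>) \<le> K * (bnorm m d \<xi> * bnorm m d \<eta>)"
  shows "ucp_to_ops V J (\<lambda>x. mat_op J e d (\<psi> x))"
  unfolding ucp_to_ops_def
proof (intro conjI allI ballI impI)
  have Vs: "csubspace V" "1 \<in> V" using V by (auto simp: operator_system_def)
  have V1: "c *\<^sub>C 1 \<in> V" for c using Vs cvec.subspace_scale by blast
  show "linear_to_ops V J (\<lambda>x. mat_op J e d (\<psi> x))"
    unfolding linear_to_ops_def
  proof (intro conjI ballI allI)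
    show "mat_op J e d (\<psi> x) \<in> bounded_ops J" for x by (rule mat_op_bounded[OF bij])
    fix x y assume xy: "x \<in> V" "y \<in> V"
    show "mat_op J e d (\<psi> (x + y)) = (\<lambda>\<xi> k. mat_op J e d (\<psi> x) \<xi> k + mat_op J e d (\<psi> y) \<xi> k)"
      using add[OF xy] e_inv(2)[OF bij]
      by (auto simp: mat_op_def fun_eq_iff act_def distrib_right sum.distrib)
  next
    fix c x assume x: "x \<in> V"
    show "mat_op J e d (\<psi> (c *\<^sub>C x)) = (\<lambda>\<xi> k. c * mat_op J e d (\<psi> x) \<xi> k)"
      using sc[OF x] e_inv(2)[OF bij]
      by (auto simp: mat_op_def fun_eq_iff act_def sum_distrib_left mult.assoc)
  qed
  show "mat_op J e d (\<psi> 1) = id_op J" unfolding unit by (rule mat_op_one[OF bij])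
  fix n X assume X: "X \<in> mats_over n V" and pos: "positive_mat n X"
  obtain y where Xc: "X \<in> carrier_mat n n" and y: "\<And>i j. i < n \<Longrightarrow> j < n \<Longrightarrow> X $$ (i, j) = mm n (mstar y) y i j"
    using pos by (auto simp: positive_mat_iff)
  have XV: "X $$ (i, j) \<in> V" if "i < n" "j < n" for i j
    using X elements_matI[OF Xc that] by (auto simp: mats_over_def)
  show "positive_op_mat J (map_mat (\<lambda>x. mat_op J e d (\<psi> x)) X)"
    unfolding positive_op_mat_def
  proof
    fix \<xi> assume "\<xi> \<in> {..<dim_col (map_mat (\<lambda>x. mat_op J e d (\<psi> x)) X)} \<rightarrow> ell2 J"
    then have xi: "\<xi> j \<in> ell2 J" if "j < n" for j using that Xc by auto
    let ?\<zeta> = "\<lambda>j q. \<xi> j (e q)"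
    let ?z = "bform n d (\<lambda>i j p q. \<psi> (X $$ (i, j)) $$ (p, q)) ?\<zeta> ?\<zeta>"
    let ?n = "(bnorm n d ?\<zeta>)\<^sup>2"
    have "(\<Sum>i<dim_row (map_mat (\<lambda>x. mat_op J e d (\<psi> x)) X). \<Sum>j<dim_col (map_mat (\<lambda>x. mat_op J e d (\<psi> x)) X).
        ell2_inner J ((map_mat (\<lambda>x. mat_op J e d (\<psi> x)) X $$ (i, j)) (\<xi> j)) (\<xi> i))
      = (\<Sum>i<n. \<Sum>j<n. cip d (act d (\<psi> (X $$ (i, j))) (?\<zeta> j)) (?\<zeta> i))"
      using Xc xi by (auto simp: ell2_inner_eq[OF bij] mat_op_index[OF bij] intro!: sum.cong cip_cong)
    also have "\<dots> = ?z"
      unfolding bform_def cip_def act_def by (simp add: sum_distrib_right)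
    also have "?z \<in> \<real>\<^sub>\<ge>\<^sub>0"
    proof (cases "n = 0")
      case True
      then show ?thesis by (simp add: bform_def)
    next
      case False
      then have n1: "n \<ge> 1" by simp
      let ?X = "\<lambda>i j. X $$ (i, j)"
      obtain r :: real where r: "r \<ge> 0" "mbound n (\<lambda>i j. (if i = j then of_real r else 0) - mm n (mstar y) y i j) r"
        using mbound_scalar_minus_square by blast
      obtain c where c: "mbound n ?X c" using mbound_exists by blast
      have psum: "\<psi> (a *\<^sub>C ?X i j + (if i = j then b *\<^sub>C 1 else 0)) $$ (p, q)
          = a * \<psi> (?X i j) $$ (p, q) + b * (if i = j \<and> p = q then 1 else 0)"
        if "i < n" "j < n" "p < d" "q < d" for i j p q a b
      proof -
        have aV: "a *\<^sub>C ?X i j \<in> V" using XV[OF that(1,2)] Vs cvec.subspace_scale by blast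
        show ?thesis
          using add[OF aV V1[of b] that(3,4)] sc[OF XV[OF that(1,2)] that(3,4)] sc[OF Vs(2) that(3,4)] that unit
          by auto
      qed
      have inV: "\<forall>i<n. \<forall>j<n. a *\<^sub>C ?X i j + (if i = j then b *\<^sub>C 1 else 0) \<in> V" for a b
        using XV V1[of b] Vs(1) by (auto intro!: cvec.subspace_add cvec.subspace_scale)
      have form: "bform n d (\<lambda>i j p q. \<psi> (a *\<^sub>C ?X i j + (if i = j then b *\<^sub>C 1 else 0)) $$ (p, q)) ?\<zeta> ?\<zeta>
          = a * ?z + b * of_real ?n" for a b
      proof -
        have "bform n d (\<lambda>i j p q. \<psi> (a *\<^sub>C ?X i j + (if i = j then b *\<^sub>C 1 else 0)) $$ (p, q)) ?\<zeta> ?\<zeta>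
          = bform n d (\<lambda>i j p q. a * \<psi> (?X i j) $$ (p, q) + b * (if i = j \<and> p = q then 1 else 0)) ?\<zeta> ?\<zeta>"
          by (rule bform_cong) (rule psum)
        then show ?thesis by (simp only: bform_add bform_scale bform_delta)
      qed
      have "mbound n (\<lambda>i j. (-1) *\<^sub>C ?X i j + (if i = j then of_real r *\<^sub>C 1 else 0)) r"
      proof (subst mbound_cong)
        show "mbound n (\<lambda>i j. (if i = j then of_real r else 0) - mm n (mstar y) y i j) r" by (rule r(2))
        fix i j assume "i < n" "j < n"
        then show "(-1) *\<^sub>C ?X i j + (if i = j then of_real r *\<^sub>C 1 else 0) = (if i = j then of_real r else 0) - mm n (mstar y) y i j"
          using y by (auto simp: scaleC_of_real scaleR_conv_of_real)
      qed
      from contr[OF n1 inV this, of ?\<zeta> ?\<zeta>]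
      have 1: "cmod (of_real (r * ?n) - ?z) \<le> r * ?n"
        unfolding form by (simp add: power2_eq_square)
      have 2: "cmod (?z + \<i> * of_real (\<tau> * ?n)) \<le> sqrt (c\<^sup>2 + \<tau>\<^sup>2) * ?n" for \<tau>
      proof -
        have "mbound n (\<lambda>i j. ?X i j + (if i = j then (\<i> * of_real \<tau>) *\<^sub>C 1 else 0)) (sqrt (c\<^sup>2 + \<tau>\<^sup>2))"
          by (rule mbound_selfadjoint_plus_imaginary[OF c]) (simp add: y mm_def mstar_def adj_sum adj_mult adj_adj)
        then have "mbound n (\<lambda>i j. 1 *\<^sub>C ?X i j + (if i = j then (\<i> * of_real \<tau>) *\<^sub>C 1 else 0)) (sqrt (c\<^sup>2 + \<tau>\<^sup>2))"
          by simp
        from contr[OF n1 inV this, of ?\<zeta> ?\<zeta>] show ?thesis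
          unfolding form by (simp add: power2_eq_square mult.assoc)
      qed
      show ?thesis by (rule nonneg_of_two_bounds[OF 1 2]) simp
    qed
    finally show "(\<Sum>i<dim_row (map_mat (\<lambda>x. mat_op J e d (\<psi> x)) X). \<Sum>j<dim_col (map_mat (\<lambda>x. mat_op J e d (\<psi> x)) X).
        ell2_inner J ((map_mat (\<lambda>x. mat_op J e d (\<psi> x)) X $$ (i, j)) (\<xi> j)) (\<xi> i)) \<in> \<real>\<^sub>\<ge>\<^sub>0" .
  qed
qed

text \<open>The universal property extends \<open>G\<close> to a *-homomorphism \<open>\<pi>\<close> with \<open>\<pi>(t(\<iota>)) = t(G)\<close>. That \<open>\<pi>\<close> is contractive follows from
  \<open>\<parallel>b\<parallel>\<^sup>2 - b* b = r\<^sup>2\<close> with \<open>r\<close> self-adjoint: \<open>\<parallel>\<pi>(b) \<xi>\<parallel>\<^sup>2 = \<parallel>b\<parallel>\<^sup>2 \<parallel>\<xi>\<parallel>\<^sup>2 - \<parallel>\<pi>(r) \<xi>\<parallel>\<^sup>2\<close>.\<close>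
theorem op_norm_le_of_contractive:
  fixes V S :: "'a::unital_cstar_algebra set" and \<iota> :: "'a \<Rightarrow> 'b::unital_cstar_algebra"
  assumes V: "operator_system V" and one: "1 \<in> S" and span: "cspan S = V"
    and cmax: "is_cstar_max V \<iota>" and G: "contractive_on S d G" and t: "vars t \<subseteq> S"
  shows "op_norm (evm d G t) \<le> norm (ev \<iota> t)"
proof -
  obtain \<psi> where psi: "\<And>x. x \<in> V \<Longrightarrow> \<psi> x \<in> carrier_mat d d"
    "\<And>x y p q. x \<in> V \<Longrightarrow> y \<in> V \<Longrightarrow> p < d \<Longrightarrow> q < d \<Longrightarrow> \<psi> (x + y) $$ (p, q) = \<psi> x $$ (p, q) + \<psi> y $$ (p, q)"
    "\<And>c x p q. x \<in> V \<Longrightarrow> p < d \<Longrightarrow> q < d \<Longrightarrow> \<psi> (c *\<^sub>C x) $$ (p, q) = c * \<psi> x $$ (p, q)"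
    "\<And>s. s \<in> S \<Longrightarrow> \<psi> s = G s"
    "\<And>m X K \<xi> \<eta>. m \<ge> 1 \<Longrightarrow> \<forall>i<m. \<forall>j<m. X i j \<in> V \<Longrightarrow> mbound m X K \<Longrightarrow>
      cmod (bform m d (\<lambda>i j p q. \<psi> (X i j) $$ (p, q)) \<xi> \<eta>) \<le> K * (bnorm m d \<xi> * bnorm m d \<eta>)"
    using that by (rule contractive_linear_extension[OF G one span])
  \<comment> \<open>The test spaces are \<open>\<ell>\<^sup>2(J)\<close> with \<open>J\<close> a subset of the algebra; a nonzero real algebra has finite subsets of every size.\<close>
  have "infinite (UNIV :: 'a set)" by (rule infinite_UNIV_char_0)
  then obtain J :: "'a set" where J: "finite J" "card J = d"
    using infinite_arbitrarily_large by metis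
  obtain e where bij: "bij_betw e {..<d} J"
    using ex_bij_betw_nat_finite[OF J(1)] J(2) by (auto simp: lessThan_atLeast0)
  let ?op = "mat_op J e d"
  have G1: "G 1 = 1\<^sub>m d" and Gc: "G s \<in> carrier_mat d d" if "s \<in> S" for s
    using G that by (auto simp: contractive_on_def)
  have "ucp_to_ops V J (\<lambda>x. ?op (\<psi> x))"
    by (rule complete_contraction_ucp[OF bij V psi(2,3) _ psi(5)]) (use psi(4)[OF one] G1[OF one] in auto)
  then obtain \<pi> where pi: "star_hom_to_ops J \<pi>" and ext: "\<And>x. x \<in> V \<Longrightarrow> \<pi> (\<iota> x) = ?op (\<psi> x)"
    using cmax unfolding is_cstar_max_def by blast
  have SV: "s \<in> V" if "s \<in> S" for s using that span cvec.span_base by blast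
  have lin: "linear_to_ops UNIV J \<pi>" and mult: "\<And>x y. \<pi> (x * y) = \<pi> x \<circ> \<pi> y"
    and adjp: "\<And>x \<xi> \<eta>. \<xi> \<in> ell2 J \<Longrightarrow> \<eta> \<in> ell2 J \<Longrightarrow> ell2_inner J (\<pi> x \<xi>) \<eta> = ell2_inner J \<xi> (\<pi> (adj x) \<eta>)"
    using pi by (auto simp: star_hom_to_ops_def)
  have padd: "\<pi> (x + y) = (\<lambda>\<xi> k. \<pi> x \<xi> k + \<pi> y \<xi> k)" and psc: "\<pi> (c *\<^sub>C x) = (\<lambda>\<xi> k. c * \<pi> x \<xi> k)"
    and pbd: "\<pi> x \<in> bounded_ops J" for x y c
    using lin by (auto simp: linear_to_ops_def)
  have pe: "\<pi> x \<xi> \<in> ell2 J" if "\<xi> \<in> ell2 J" for x \<xi>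
    using pbd[of x] that by (simp add: bounded_ops_def)
  have p0: "\<pi> x \<xi> = (\<lambda>k. 0)" if "\<xi> \<notin> ell2 J" for x \<xi>
    using pbd[of x] that by (simp add: bounded_ops_def)
  have p1: "\<pi> 1 = id_op J"
  proof -
    have "\<iota> 1 = 1" using cmax by (simp add: is_cstar_max_def unital_complete_order_embedding_def)
    then have "\<pi> 1 = ?op (\<psi> 1)" using ext[of 1] SV[OF one] by simp
    then show ?thesis using psi(4)[OF one] G1[OF one] mat_op_one[OF bij] by simp
  qed
  have eval: "vars t \<subseteq> S \<Longrightarrow> \<pi> (ev \<iota> t) = ?op (evm d G t)" for t
  proof (induction t)
    case (Var s)
    then show ?case using ext[OF SV] psi(4) by simp
  next
    case (Var_adj s)
    then have s: "s \<in> S" by simp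
    show ?case
    proof
      fix \<xi>
      show "\<pi> (ev \<iota> (Var_adj s)) \<xi> = ?op (evm d G (Var_adj s)) \<xi>"
      proof (cases "\<xi> \<in> ell2 J")
        case True
        let ?w = "\<pi> (adj (\<iota> s)) \<xi>"
        have "?w = ?op (mat_adjoint (G s)) \<xi>"
        proof (rule ell2_eqI[OF bij pe[OF True] mat_op_in_ell2[OF bij]])
          fix q assume q: "q < d"
          \<comment> \<open>The adjoint of \<open>\<pi>(\<iota> s)\<close> is identified coordinatewise, by pairing with basis vectors.\<close>
          let ?u = "\<lambda>y. if y = e q then 1 else (0::complex)"
          have u: "?u \<in> ell2 J" using e_in[OF bij q] by (simp add: ell2_finite[OF J(1)])
          have coord: "ell2_inner J \<zeta> ?u = \<zeta> (e q)" for \<zeta>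
          proof -
            have "cip d (\<lambda>k. \<zeta> (e k)) (\<lambda>k. ?u (e k)) = (\<Sum>k<d. if k = q then \<zeta> (e q) else 0)"
              unfolding cip_def using inv_e[OF bij] q by (intro sum.cong) (auto, metis)
            then show ?thesis using q by (simp add: ell2_inner_eq[OF bij])
          qed
          have "?w (e q) = ell2_inner J ?w ?u" by (simp only: coord)
          also have "\<dots> = ell2_inner J \<xi> (\<pi> (\<iota> s) ?u)" using adjp[OF True u, of "adj (\<iota> s)"] by (simp add: adj_adj)
          also have "\<dots> = ell2_inner J \<xi> (?op (G s) ?u)" using ext[OF SV[OF s]] psi(4)[OF s] by simp
          also have "\<dots> = cip d (\<lambda>k. \<xi> (e k)) (act d (G s) (\<lambda>k. ?u (e k)))"
            unfolding ell2_inner_eq[OF bij] by (rule cip_cong) (simp_all add: mat_op_index[OF bij u])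
          also have "\<dots> = cip d (act d (mat_adjoint (G s)) (\<lambda>k. \<xi> (e k))) (\<lambda>k. ?u (e k))"
            using cip_act_adjoint[OF mat_adjoint_carrier[OF Gc[OF s]], of "\<lambda>k. \<xi> (e k)" "\<lambda>k. ?u (e k)"] by simp
          also have "\<dots> = ell2_inner J (?op (mat_adjoint (G s)) \<xi>) ?u"
            unfolding ell2_inner_eq[OF bij] by (rule cip_cong) (simp_all add: mat_op_index[OF bij True])
          also have "\<dots> = ?op (mat_adjoint (G s)) \<xi> (e q)" by (rule coord)
          finally show "?w (e q) = ?op (mat_adjoint (G s)) \<xi> (e q)" .
        qed
        then show ?thesis by simp
      qed (simp add: p0 mat_op_def)
    qed
  next
    case (Scal c)
    have "?op (c \<cdot>\<^sub>m 1\<^sub>m d) \<xi> = (\<lambda>k. c * id_op J \<xi> k)" for \<xi>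
    proof (cases "\<xi> \<in> ell2 J")
      case True
      have "?op (c \<cdot>\<^sub>m 1\<^sub>m d) \<xi> = (\<lambda>k. c * \<xi> k)"
      proof (rule ell2_eqI[OF bij mat_op_in_ell2[OF bij]])
        show "(\<lambda>k. c * \<xi> k) \<in> ell2 J" using True by (simp add: ell2_finite[OF J(1)])
      qed (simp add: mat_op_index[OF bij True] act_scalar)
      then show ?thesis using True by (simp add: id_op_def)
    qed (simp add: mat_op_def id_op_def)
    then show ?case by (simp add: psc p1 fun_eq_iff)
  next
    case (Plus s t)
    have c: "evm d G s \<in> carrier_mat d d" "evm d G t \<in> carrier_mat d d"
      using Plus.prems Gc by (auto intro!: evm_carrier)
    have "?op (evm d G s + evm d G t) \<xi> = (\<lambda>k. ?op (evm d G s) \<xi> k + ?op (evm d G t) \<xi> k)" for \<xi>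
      using act_plus[OF c e_inv(2)[OF bij]] by (auto simp: mat_op_def)
    then show ?case using Plus by (simp add: padd fun_eq_iff)
  next
    case (Times s t)
    have c: "evm d G s \<in> carrier_mat d d" "evm d G t \<in> carrier_mat d d"
      using Times.prems Gc by (auto intro!: evm_carrier)
    show ?case using Times mat_op_mult[OF bij c] by (simp add: mult)
  qed
  have Mc: "evm d G t \<in> carrier_mat d d" using t Gc by (intro evm_carrier) auto
  let ?b = "ev \<iota> t"
  obtain r where r: "cstar_pos r" "r * r = of_real ((norm ?b)\<^sup>2) - adj ?b * ?b"
    using cstar_pos_sqrt[OF cstar_pos_norm_bound[of ?b]] by blast
  show ?thesis
  proof (rule op_norm_le[OF Mc])
    fix u :: "nat \<Rightarrow> complex"
    let ?\<xi> = "\<lambda>y. if y \<in> J then u (inv_into {..<d} e y) else 0"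
    have xi: "?\<xi> \<in> ell2 J" by (simp add: ell2_finite[OF J(1)])
    have xe: "?\<xi> (e q) = u q" if "q < d" for q using e_in[OF bij that] inv_e[OF bij that] by simp
    have self: "ell2_inner J \<zeta> \<zeta> = of_real ((ell2_norm J \<zeta>)\<^sup>2)" for \<zeta>
      by (simp add: ell2_inner_eq[OF bij] ell2_norm_eq[OF bij] cip_self)
    have quad: "ell2_inner J (\<pi> x ?\<xi>) (\<pi> x ?\<xi>) = ell2_inner J ?\<xi> (\<pi> (adj x * x) ?\<xi>)" for x
      using adjp[OF xi pe[OF xi], of x x] by (simp add: mult)
    have bb: "adj ?b * ?b = of_real ((norm ?b)\<^sup>2) *\<^sub>C 1 + (-1) *\<^sub>C (r * r)"
      unfolding r(2) scaleC_of_real scaleR_conv_of_real by simp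
    have "ell2_inner J (\<pi> ?b ?\<xi>) (\<pi> ?b ?\<xi>) = ell2_inner J ?\<xi> (\<lambda>k. of_real ((norm ?b)\<^sup>2) * ?\<xi> k + (-1) * \<pi> (r * r) ?\<xi> k)"
      unfolding quad bb padd psc p1 using xi by (simp add: id_op_def)
    also have "\<dots> = of_real ((norm ?b)\<^sup>2) * ell2_inner J ?\<xi> ?\<xi> - ell2_inner J ?\<xi> (\<pi> (r * r) ?\<xi>)"
      by (simp add: ell2_inner_eq[OF bij] cip_def algebra_simps sum.distrib sum_subtractf sum_distrib_left)
    also have "ell2_inner J ?\<xi> (\<pi> (r * r) ?\<xi>) = ell2_inner J (\<pi> r ?\<xi>) (\<pi> r ?\<xi>)"
      using quad[of r] r(1) by (simp add: cstar_pos_selfadjoint)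
    finally have "(ell2_norm J (\<pi> ?b ?\<xi>))\<^sup>2 = (norm ?b)\<^sup>2 * (ell2_norm J ?\<xi>)\<^sup>2 - (ell2_norm J (\<pi> r ?\<xi>))\<^sup>2"
      unfolding self of_real_mult[symmetric] of_real_diff[symmetric] of_real_eq_iff .
    then have "(ell2_norm J (\<pi> ?b ?\<xi>))\<^sup>2 \<le> (norm ?b * ell2_norm J ?\<xi>)\<^sup>2"
      by (simp add: power_mult_distrib)
    then have "ell2_norm J (\<pi> ?b ?\<xi>) \<le> norm ?b * ell2_norm J ?\<xi>"
      by (rule power2_le_imp_le) (simp add: ell2_norm_eq[OF bij])
    moreover have "ell2_norm J ?\<xi> = cnorm d u"
      unfolding ell2_norm_eq[OF bij] by (rule cnorm_cong) (simp only: xe)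
    moreover have "ell2_norm J (\<pi> ?b ?\<xi>) = cnorm d (act d (evm d G t) u)"
      unfolding ell2_norm_eq[OF bij] eval[OF t]
    proof (rule cnorm_cong)
      fix i assume i: "i < d"
      have "act d (evm d G t) (\<lambda>q. ?\<xi> (e q)) = act d (evm d G t) u" by (rule act_cong) (simp only: xe)
      then show "?op (evm d G t) ?\<xi> (e i) = act d (evm d G t) u i"
        unfolding mat_op_index[OF bij xi i] by simp
    qed
    ultimately show "cnorm d (act d (evm d G t) u) \<le> norm ?b * cnorm d u" by simp
  qed simp
qed

section \<open>Operator system microstates in a fixed dimension\<close>

definition sys_params :: "'a set \<Rightarrow> (real \<times> (nat \<times> ('a \<Rightarrow> complex mat)) set) set" where
  "sys_params S = {0<..} \<times> {F. finite F \<and> F \<subseteq> matrix_tuples S}"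

abbreviation sys_states :: "'a::unital_cstar_algebra set \<Rightarrow> real \<times> (nat \<times> ('a \<Rightarrow> complex mat)) set \<Rightarrow> nat \<Rightarrow> ('a \<Rightarrow> complex mat) set" where
  "sys_states S \<theta> N \<equiv> system_microstates S (snd \<theta>) (fst \<theta>) N"

lemma sys_states_carrier: "A \<in> sys_states S \<theta> N \<Longrightarrow> x \<in> S \<Longrightarrow> A x \<in> carrier_mat N N"
  by (auto simp: system_microstates_def)

lemma sys_states_pencil:
  "A \<in> sys_states S \<theta> N \<Longrightarrow> (m, B) \<in> snd \<theta> \<Longrightarrow> op_norm (pencil_mat S m N B A) \<le> fst \<theta> + cstar_mat_norm (pencil_sys S m B)"
  by (auto simp: system_microstates_def)

lemma sys_states_antimono:
  "fst \<theta> \<le> fst \<theta>' \<Longrightarrow> snd \<theta>' \<subseteq> snd \<theta> \<Longrightarrow> sys_states S \<theta> N \<subseteq> sys_states S \<theta>' N"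
  by (fastforce simp: system_microstates_def)

lemma sys_states_directed:
  assumes "\<theta>1 \<in> sys_params S" "\<theta>2 \<in> sys_params S"
  shows "\<exists>\<theta>\<in>sys_params S. \<forall>N. sys_states S \<theta> N \<subseteq> sys_states S \<theta>1 N \<inter> sys_states S \<theta>2 N"
proof (intro bexI allI)
  let ?\<theta> = "(min (fst \<theta>1) (fst \<theta>2), snd \<theta>1 \<union> snd \<theta>2)"
  show "sys_states S ?\<theta> N \<subseteq> sys_states S \<theta>1 N \<inter> sys_states S \<theta>2 N" for N
    by (intro Int_greatest sys_states_antimono) auto
  show "?\<theta> \<in> sys_params S" using assms by (auto simp: sys_params_def)
qed

text \<open>The coefficient tuple of the \<open>1 \<times> 1\<close> pencil \<open>x\<close>. As a test it bounds the norm of the single matrix \<open>A\<^sub>x\<close>.\<close>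
definition unit_tuple :: "'a set \<Rightarrow> 'a \<Rightarrow> 'a \<Rightarrow> complex mat" where
  "unit_tuple S x = (\<lambda>y\<in>S. if y = x then 1\<^sub>m 1 else 0\<^sub>m 1 1)"

lemma unit_tuple_in: "(1, unit_tuple S x) \<in> matrix_tuples S"
proof -
  have "{y \<in> S. unit_tuple S x y \<noteq> 0\<^sub>m 1 1} \<subseteq> {x}" by (auto simp: unit_tuple_def)
  then have "finite {y \<in> S. unit_tuple S x y \<noteq> 0\<^sub>m 1 1}" by (rule finite_subset) simp
  moreover have "unit_tuple S x \<in> S \<rightarrow>\<^sub>E carrier_mat 1 1" by (auto simp: unit_tuple_def)
  ultimately show ?thesis by (simp add: matrix_tuples_def)
qed

lemma one_mat_1_neq_0: "1\<^sub>m (Suc 0) \<noteq> (0\<^sub>m (Suc 0) (Suc 0) :: complex mat)"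
proof
  assume "1\<^sub>m (Suc 0) = (0\<^sub>m (Suc 0) (Suc 0) :: complex mat)"
  then have "1\<^sub>m (Suc 0) $$ (0, 0) = (0\<^sub>m (Suc 0) (Suc 0) :: complex mat) $$ (0, 0)" by simp
  then show False by simp
qed

lemma unit_tuple_support:
  assumes "x \<in> S"
  shows "{y \<in> S - {1}. unit_tuple S x y \<noteq> 0\<^sub>m 1 1} = (if x = 1 then {} else {x})"
  using assms one_mat_1_neq_0 by (auto simp: unit_tuple_def)

lemma op_norm_sys_state_le:
  assumes A: "A \<in> sys_states S \<theta> N" and F: "(1, unit_tuple S x) \<in> snd \<theta>" and x: "x \<in> S" and one: "1 \<in> S"
    and pos: "0 \<le> fst \<theta>"
  shows "op_norm (A x) \<le> norm x + fst \<theta>"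
proof -
  let ?B = "unit_tuple S x"
  have B: "?B \<in> S \<rightarrow>\<^sub>E carrier_mat 1 1" using unit_tuple_in[of S x] by (simp add: matrix_tuples_def)
  have Ac: "\<forall>x\<in>S. A x \<in> carrier_mat N N" and A1: "A 1 = 1\<^sub>m N"
    using A by (auto simp: system_microstates_def)
  have ut: "?B 1 = (if x = 1 then 1\<^sub>m 1 else 0\<^sub>m 1 1)" "?B x = 1\<^sub>m 1"
    using one x by (auto simp: unit_tuple_def)
  have blk: "blk S 1 ?B A 0 0 p q = A x $$ (p, q)" if "p < N" "q < N" for p q
    unfolding blk_def unit_tuple_support[OF x] using that A1 ut by (cases "x = 1") simp_all
  have ps: "pencil_sys S 1 ?B $$ (0, 0) = x"
    unfolding pencil_sys_def unit_tuple_support[OF x] using ut by (cases "x = 1") simp_all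
  have m1: "mnorm 1 b = norm (b 0)" for b :: "nat \<Rightarrow> 'a"
    by (simp add: mnorm_def mip_def lessThan_Suc cstar_identity)
  have "cstar_mat_norm (pencil_sys S 1 ?B) \<le> norm x"
  proof (rule cstar_mat_norm_le)
    show "pencil_sys S 1 ?B \<in> carrier_mat 1 1" by (simp add: pencil_sys_def)
    have "mnorm 1 (mv 1 (\<lambda>i j. pencil_sys S 1 ?B $$ (i, j)) b) = norm (x * b 0)" for b
      unfolding m1 using ps by (simp add: mv_def lessThan_Suc)
    then show "mbound 1 (\<lambda>i j. pencil_sys S 1 ?B $$ (i, j)) (norm x)"
      by (simp only: mbound_def m1) (simp add: norm_mult_ineq)
  qed
  then have op: "op_norm (pencil_mat S 1 N ?B A) \<le> norm x + fst \<theta>"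
    using sys_states_pencil[OF A F] by simp
  show ?thesis
  proof (rule op_norm_le_form[where n = N])
    fix u v :: "nat \<Rightarrow> complex"
    have b1: "bnorm 1 N (\<lambda>_. w) = cnorm N w" for w by (simp add: bnorm_def lessThan_Suc)
    have "cip N (act N (A x) u) v = bform 1 N (blk S 1 ?B A) (\<lambda>_. u) (\<lambda>_. v)"
      unfolding bform_1 cip_def act_def sum_distrib_right by (intro sum.cong refl) (simp only: blk lessThan_iff)
    then have "cmod (cip N (act N (A x) u) v) \<le> op_norm (pencil_mat S 1 N ?B A) * (cnorm N u * cnorm N v)"
      using bform_pencil_le[OF B Ac one, of "\<lambda>_. u" "\<lambda>_. v"] unfolding b1 by simp
    also have "\<dots> \<le> (norm x + fst \<theta>) * (cnorm N u * cnorm N v)"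
      using op by (intro mult_right_mono) auto
    finally show "cmod (cip N (act N (A x) u) v) \<le> (norm x + fst \<theta>) * (cnorm N u * cnorm N v)" .
  qed (use Ac x pos in auto)
qed

lemma op_norm_le_diff:
  assumes "A \<in> carrier_mat n n" "B \<in> carrier_mat n n"
  shows "op_norm A \<le> op_norm (A - B) + op_norm B"
proof -
  have "A = (A - B) + B" using assms by (intro eq_matI) auto
  then show ?thesis using op_norm_plus[OF minus_carrier_mat[OF assms(2)] assms(2), of A] by simp
qed

lemma tendsto_bform_blk:
  assumes "\<And>x p q. x \<in> {x \<in> S - {1}. B x \<noteq> 0\<^sub>m m m} \<Longrightarrow> p < N \<Longrightarrow> q < N \<Longrightarrow> (\<lambda>n. A n x $$ (p, q)) \<longlonglongrightarrow> G x $$ (p, q)"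
  shows "(\<lambda>n. bform m N (blk S m B (A n)) \<xi> \<eta>) \<longlonglongrightarrow> bform m N (blk S m B G) \<xi> \<eta>"
  unfolding bform_def blk_def using assms by (intro tendsto_intros) auto

text \<open>Each condition on \<open>G\<close> concerns finitely many entries, where \<open>G\<close> is a limit of microstates that satisfy this condition
  up to \<open>1/n\<close>.\<close>
lemma cluster_contractive:
  fixes S :: "'a::unital_cstar_algebra set" and T :: "_ \<Rightarrow> ('a \<Rightarrow> complex mat) set"
  assumes one: "1 \<in> S" and T: "\<And>\<theta>. T \<theta> \<subseteq> sys_states S \<theta> d"
    and g: "\<And>\<theta> K e. \<theta> \<in> sys_params S \<Longrightarrow> finite K \<Longrightarrow> K \<subseteq> S \<times> {..<d} \<times> {..<d} \<Longrightarrow> e > 0 \<Longrightarrow>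
      \<exists>A\<in>T \<theta>. \<forall>(x, p, q)\<in>K. cmod (A x $$ (p, q) - g (x, p, q)) < e"
  shows "contractive_on S d (\<lambda>x. mat d d (\<lambda>(p, q). g (x, p, q)))"
  unfolding contractive_on_def
proof (intro conjI ballI)
  let ?G = "\<lambda>x. mat d d (\<lambda>(p, q). g (x, p, q))"
  show "?G x \<in> carrier_mat d d" for x by simp
  have "g (1, p, q) = (if p = q then 1 else 0)" if pq: "p < d" "q < d" for p q
  proof (rule ccontr)
    assume ne: "g (1, p, q) \<noteq> (if p = q then 1 else 0)"
    let ?e = "cmod ((if p = q then 1 else 0) - g (1, p, q))"
    have "?e > 0" using ne by auto
    have "(1, {}) \<in> sys_params S" by (simp add: sys_params_def)
    then obtain A where A: "A \<in> T (1, {})" and "\<forall>(x, p, q)\<in>{(1, p, q)}. cmod (A x $$ (p, q) - g (x, p, q)) < ?e"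
      using g[of "(1, {})" "{(1, p, q)}" ?e] one pq \<open>?e > 0\<close> by blast
    then have "cmod (A 1 $$ (p, q) - g (1, p, q)) < ?e" by simp
    moreover have "A 1 = 1\<^sub>m d" using A T[of "(1, {})"] by (auto simp: system_microstates_def)
    ultimately show False using pq by simp
  qed
  then show "?G 1 = 1\<^sub>m d" by (intro eq_matI) auto
  fix mB assume mB: "mB \<in> matrix_tuples S"
  obtain m B where mB': "mB = (m, B)" by (cases mB)
  have mt: "(m, B) \<in> matrix_tuples S" using mB mB' by simp
  let ?c = "cstar_mat_norm (pencil_sys S m B)"
  let ?K = "{x \<in> S - {1}. B x \<noteq> 0\<^sub>m m m} \<times> {..<d} \<times> {..<d}"
  have "cmod (bform m d (blk S m B ?G) \<xi> \<eta>) \<le> ?c * (bnorm m d \<xi> * bnorm m d \<eta>)" for \<xi> \<eta>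
  proof -
    have "\<exists>A\<in>T (1 / real (Suc n), {(m, B)}). \<forall>(x, p, q)\<in>?K. cmod (A x $$ (p, q) - g (x, p, q)) < 1 / real (Suc n)" for n
      by (rule g) (use mt finite_matrix_tuples_support[OF mt] in \<open>auto simp: sys_params_def\<close>)
    then have "\<forall>n. \<exists>A. A \<in> T (1 / real (Suc n), {(m, B)}) \<and> (\<forall>(x, p, q)\<in>?K. cmod (A x $$ (p, q) - g (x, p, q)) < 1 / real (Suc n))"
      by (simp only: Bex_def simp_thms)
    from choice[OF this] obtain A where AA: "\<forall>n. A n \<in> T (1 / real (Suc n), {(m, B)}) \<and> (\<forall>(x, p, q)\<in>?K. cmod (A n x $$ (p, q) - g (x, p, q)) < 1 / real (Suc n))"
      by (elim exE)
    have A: "A n \<in> T (1 / real (Suc n), {(m, B)})" for n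
      using AA[THEN spec, of n] by (rule conjunct1)
    have cl: "\<forall>(x, p, q)\<in>?K. cmod (A n x $$ (p, q) - g (x, p, q)) < 1 / real (Suc n)" for n
      using AA[THEN spec, of n] by (rule conjunct2)
    have A': "A n \<in> sys_states S (1 / real (Suc n), {(m, B)}) d" for n by (rule subsetD[OF T A])
    have lim: "(\<lambda>n. bform m d (blk S m B (A n)) \<xi> \<eta>) \<longlonglongrightarrow> bform m d (blk S m B ?G) \<xi> \<eta>"
    proof (rule tendsto_bform_blk)
      fix x p q assume x: "x \<in> {x \<in> S - {1}. B x \<noteq> 0\<^sub>m m m}" "p < d" "q < d"
      have "(\<lambda>n. A n x $$ (p, q) - g (x, p, q)) \<longlonglongrightarrow> 0"
      proof (rule Lim_null_comparison[OF _ LIMSEQ_Suc[OF lim_1_over_n]])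
        show "\<forall>\<^sub>F n in sequentially. cmod (A n x $$ (p, q) - g (x, p, q)) \<le> 1 / real (Suc n)"
          using cl x by (intro always_eventually allI less_imp_le) blast
      qed
      then show "(\<lambda>n. A n x $$ (p, q)) \<longlonglongrightarrow> ?G x $$ (p, q)" using x by (simp add: LIM_zero_iff)
    qed
    have le: "cmod (bform m d (blk S m B (A n)) \<xi> \<eta>) \<le> (1 / real (Suc n) + ?c) * (bnorm m d \<xi> * bnorm m d \<eta>)" for n
    proof -
      have B: "B \<in> S \<rightarrow>\<^sub>E carrier_mat m m" using mt by (simp add: matrix_tuples_def)
      have Ac: "\<forall>x\<in>S. A n x \<in> carrier_mat d d" using sys_states_carrier[OF A'] by blast
      have "op_norm (pencil_mat S m d B (A n)) \<le> 1 / real (Suc n) + ?c"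
        using sys_states_pencil[OF A', of m B n] by simp
      then have "op_norm (pencil_mat S m d B (A n)) * (bnorm m d \<xi> * bnorm m d \<eta>) \<le> (1 / real (Suc n) + ?c) * (bnorm m d \<xi> * bnorm m d \<eta>)"
        by (intro mult_right_mono) auto
      then show ?thesis using bform_pencil_le[OF B Ac one, of \<xi> \<eta>] by linarith
    qed
    have "(\<lambda>n. (1 / real (Suc n) + ?c) * (bnorm m d \<xi> * bnorm m d \<eta>)) \<longlonglongrightarrow> (0 + ?c) * (bnorm m d \<xi> * bnorm m d \<eta>)"
      by (intro tendsto_intros LIMSEQ_Suc[OF lim_1_over_n])
    from LIMSEQ_le[OF tendsto_norm[OF lim] this] show ?thesis using le by auto
  qed
  then show "case mB of (m, B) \<Rightarrow> \<forall>\<xi> \<eta>. cmod (bform m d (blk S m B ?G) \<xi> \<eta>) \<le> cstar_mat_norm (pencil_sys S m B) * (bnorm m d \<xi> * bnorm m d \<eta>)"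
    by (simp add: mB')
qed

text \<open>By contradiction: the violating microstates form a filter base with bounded entries, and a cluster point \<open>G\<close> is
  contractive, so \<open>\<parallel>t(G)\<parallel> \<le> \<parallel>t(\<iota>)\<parallel>\<close>. A violating microstate that is close to \<open>G\<close> in the finitely many
  letters of \<open>t\<close> contradicts the continuity of \<open>t\<close>.\<close>
lemma sys_state_bound_fixed_dimension:
  fixes V S :: "'a::unital_cstar_algebra set" and \<iota> :: "'a \<Rightarrow> 'b::unital_cstar_algebra"
  assumes V: "operator_system V" and one: "1 \<in> S" and span: "cspan S = V"
    and cmax: "is_cstar_max V \<iota>" and t: "vars t \<subseteq> S" and eta: "\<eta> > 0"
  shows "\<exists>\<theta>\<in>sys_params S. \<forall>A\<in>sys_states S \<theta> d. op_norm (evm d A t) \<le> norm (ev \<iota> t) + \<eta>"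
proof (rule ccontr)
  assume neg: "\<not> ?thesis"
  define T where "T = (\<lambda>\<theta>. {A \<in> sys_states S \<theta> d. op_norm (evm d A t) > norm (ev \<iota> t) + \<eta>})"
  have ne: "T \<theta> \<noteq> {}" if "\<theta> \<in> sys_params S" for \<theta>
  proof -
    have "\<exists>A\<in>sys_states S \<theta> d. \<not> op_norm (evm d A t) \<le> norm (ev \<iota> t) + \<eta>" using neg that by blast
    then show ?thesis by (auto simp: T_def not_le)
  qed
  have dir: "\<exists>\<theta>\<in>sys_params S. T \<theta> \<subseteq> T \<theta>1 \<inter> T \<theta>2" if th: "\<theta>1 \<in> sys_params S" "\<theta>2 \<in> sys_params S" for \<theta>1 \<theta>2
  proof -
    obtain \<theta> where "\<theta> \<in> sys_params S" "\<forall>N. sys_states S \<theta> N \<subseteq> sys_states S \<theta>1 N \<inter> sys_states S \<theta>2 N"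
      using sys_states_directed[OF th] by (elim bexE)
    then show ?thesis by (intro bexI[of _ \<theta>]) (auto simp: T_def)
  qed
  have ne0: "sys_params S \<noteq> {}" by (auto simp: sys_params_def intro!: exI[of _ 1] exI[of _ "{}"])
  have xin: "(1, {(1, unit_tuple S x)}) \<in> sys_params S" for x
    using unit_tuple_in[of S x] by (simp add: sys_params_def)
  have bdd: "\<exists>\<theta>\<in>sys_params S. \<exists>R. \<forall>A\<in>T \<theta>. cmod ((\<lambda>A (x, p, q). A x $$ (p, q)) A z) \<le> R"
    if z: "z \<in> S \<times> {..<d} \<times> {..<d}" for z
  proof -
    obtain x p q where z': "z = (x, p, q)" "x \<in> S" "p < d" "q < d" using z by auto
    show ?thesis
    proof (rule bexI[OF _ xin[of x]], intro exI ballI)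
      fix A assume "A \<in> T (1, {(1, unit_tuple S x)})"
      then have A: "A \<in> sys_states S (1, {(1, unit_tuple S x)}) d" by (simp add: T_def)
      have "cmod (A x $$ (p, q)) \<le> op_norm (A x)"
        by (rule cmod_entry_le_op_norm[OF sys_states_carrier[OF A z'(2)] z'(3,4)])
      also have "\<dots> \<le> norm x + 1" using op_norm_sys_state_le[OF A _ z'(2) one] by simp
      finally show "cmod ((\<lambda>A (x, p, q). A x $$ (p, q)) A z) \<le> norm x + 1" by (simp add: z')
    qed
  qed
  have "\<exists>g. \<forall>\<theta>\<in>sys_params S. \<forall>K e. finite K \<longrightarrow> K \<subseteq> S \<times> {..<d} \<times> {..<d} \<longrightarrow> e > 0 \<longrightarrow>
      (\<exists>A\<in>T \<theta>. \<forall>z\<in>K. cmod ((\<lambda>A (x, p, q). A x $$ (p, q)) A z - g z) < e)"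
    by (rule exists_cluster_point[OF ne0 ne dir bdd])
  then obtain g where "\<forall>\<theta>\<in>sys_params S. \<forall>K e. finite K \<longrightarrow> K \<subseteq> S \<times> {..<d} \<times> {..<d} \<longrightarrow> e > 0 \<longrightarrow>
      (\<exists>A\<in>T \<theta>. \<forall>z\<in>K. cmod ((\<lambda>A (x, p, q). A x $$ (p, q)) A z - g z) < e)"
    by (elim exE)
  then have g: "\<exists>A\<in>T \<theta>. \<forall>(x, p, q)\<in>K. cmod (A x $$ (p, q) - g (x, p, q)) < e"
    if "\<theta> \<in> sys_params S" "finite K" "K \<subseteq> S \<times> {..<d} \<times> {..<d}" "e > 0" for \<theta> K e
    using that by (fastforce simp: case_prod_unfold)
  define G where "G = (\<lambda>x. mat d d (\<lambda>(p, q). g (x, p, q)))"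
  have Gc: "G x \<in> carrier_mat d d" for x by (simp add: G_def)
  have "contractive_on S d G"
    unfolding G_def by (rule cluster_contractive[OF one _ g]) (auto simp: T_def)
  then have Gt: "op_norm (evm d G t) \<le> norm (ev \<iota> t)"
    by (rule op_norm_le_of_contractive[OF V one span cmax _ t])
  define R where "R = 2 + (\<Sum>x\<in>vars t. norm x)"
  have R: "norm x + 2 \<le> R" if "x \<in> vars t" for x
    using member_le_sum[OF that, of norm] by (simp add: R_def)
  have R0: "R \<ge> 0" by (simp add: R_def add_nonneg_nonneg sum_nonneg)
  define L where "L = lip R t"
  have L0: "L \<ge> 0" using R0 by (simp add: L_def lip_nonneg)
  define \<rho> where "\<rho> = min 1 (\<eta> / (2 * (L + 1)))"
  have rho: "\<rho> > 0" "\<rho> \<le> 1" "\<rho> \<le> \<eta> / (2 * (L + 1))" using eta L0 by (auto simp: \<rho>_def)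
  define e where "e = \<rho> / (real d * real d + 1)"
  have e0: "e > 0" using rho by (simp add: e_def add_nonneg_pos)
  have de: "real d * (real d * e) \<le> \<rho>"
  proof -
    have "real d * (real d * e) = (real d * real d / (real d * real d + 1)) * \<rho>" by (simp add: e_def)
    also have "\<dots> \<le> 1 * \<rho>" using rho by (intro mult_right_mono) (auto simp: divide_le_eq add_nonneg_pos)
    finally show ?thesis by simp
  qed
  let ?F = "(\<lambda>x. (1::nat, unit_tuple S x)) ` vars t"
  have th: "(1, ?F) \<in> sys_params S" using unit_tuple_in[of S] by (auto simp: sys_params_def)
  obtain A where A: "A \<in> T (1, ?F)" and cl: "\<forall>(x, p, q)\<in>vars t \<times> {..<d} \<times> {..<d}. cmod (A x $$ (p, q) - g (x, p, q)) < e"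
    using g[OF th _ _ e0, of "vars t \<times> {..<d} \<times> {..<d}"] t by auto
  have As: "A \<in> sys_states S (1, ?F) d" and big: "op_norm (evm d A t) > norm (ev \<iota> t) + \<eta>"
    using A by (auto simp: T_def)
  have Ac: "A x \<in> carrier_mat d d" if "x \<in> vars t" for x using sys_states_carrier[OF As] t that by auto
  have close: "op_norm (A x - G x) \<le> \<rho>" if x: "x \<in> vars t" for x
  proof -
    have "op_norm (A x - G x) \<le> (\<Sum>p<d. \<Sum>q<d. cmod ((A x - G x) $$ (p, q)))"
      using Gc by (intro op_norm_le_sum minus_carrier_mat)
    also have "\<dots> \<le> (\<Sum>p<d. \<Sum>q<d. e)"
      using cl x Ac[OF x] by (intro sum_mono) (auto simp: G_def intro!: less_imp_le)
    also have "\<dots> = real d * (real d * e)" by simp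
    finally show ?thesis using de by simp
  qed
  have "op_norm (evm d A t - evm d G t) \<le> lip R t * \<rho>"
  proof (rule op_norm_evm_diff_le[OF R0])
    fix x assume x: "x \<in> vars t"
    have Ax: "op_norm (A x) \<le> norm x + 1"
      using op_norm_sys_state_le[OF As _ _ one, of x] x t by auto
    have "op_norm (G x) \<le> op_norm (G x - A x) + op_norm (A x)"
      using Ac[OF x] Gc by (intro op_norm_le_diff)
    also have "op_norm (G x - A x) = op_norm (A x - G x)"
      using Ac[OF x] Gc by (intro op_norm_minus_commute)
    finally show "A x \<in> carrier_mat d d \<and> G x \<in> carrier_mat d d \<and> op_norm (A x) \<le> R \<and> op_norm (G x) \<le> R \<and> op_norm (A x - G x) \<le> \<rho>"
      using Ac[OF x] Gc[of x] close[OF x] Ax R[OF x] rho by auto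
  qed (use rho in simp)
  also have "\<dots> \<le> L * (\<eta> / (2 * (L + 1)))" unfolding L_def[symmetric] using rho L0 by (intro mult_left_mono) auto
  also have "\<dots> = (L / (L + 1)) * (\<eta> / 2)" by simp
  also have "\<dots> \<le> 1 * (\<eta> / 2)" using L0 eta by (intro mult_right_mono) auto
  finally have "op_norm (evm d A t - evm d G t) \<le> \<eta> / 2" by simp
  moreover have "op_norm (evm d A t) \<le> op_norm (evm d A t - evm d G t) + op_norm (evm d G t)"
    using Ac Gc by (intro op_norm_le_diff[where n = d] evm_carrier)
  ultimately show False using big Gt eta by simp
qed

section \<open>Compression of operator system microstates\<close>

lemma cip_add_left: "cip N (\<lambda>p. u p + v p) w = cip N u w + cip N v w"
  by (simp add: cip_def distrib_right sum.distrib)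

lemma cip_scale_left: "cip N (\<lambda>p. c * u p) w = c * cip N u w"
  by (simp add: cip_def sum_distrib_left mult.assoc)

lemma cip_sum_left: "cip N (\<lambda>p. \<Sum>i\<in>I. c i * u i p) w = (\<Sum>i\<in>I. c i * cip N (u i) w)"
  unfolding cip_def sum_distrib_right by (subst sum.swap) (simp add: sum_distrib_left mult.assoc)

lemma cip_sum_right: "cip N w (\<lambda>p. \<Sum>i\<in>I. c i * u i p) = (\<Sum>i\<in>I. cnj (c i) * cip N w (u i))"
  unfolding cip_def cnj_sum sum_distrib_left by (subst sum.swap) (simp add: sum_distrib_left ac_simps)

definition orthonormal :: "nat \<Rightarrow> nat \<Rightarrow> (nat \<Rightarrow> nat \<Rightarrow> complex) \<Rightarrow> bool" where
  "orthonormal N d f \<longleftrightarrow> (\<forall>i<d. \<forall>j<d. cip N (f i) (f j) = (if i = j then 1 else 0))"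

text \<open>\<open>lift\<close> is the isometry \<open>\<complex>\<^sup>d \<rightarrow> \<complex>\<^sup>N\<close> given by an orthonormal family \<open>f\<close>, and \<open>coords\<close> is its adjoint.\<close>
definition lift :: "nat \<Rightarrow> (nat \<Rightarrow> nat \<Rightarrow> complex) \<Rightarrow> (nat \<Rightarrow> complex) \<Rightarrow> nat \<Rightarrow> complex" where
  "lift d f u = (\<lambda>p. \<Sum>q<d. u q * f q p)"

definition coords :: "nat \<Rightarrow> (nat \<Rightarrow> nat \<Rightarrow> complex) \<Rightarrow> (nat \<Rightarrow> complex) \<Rightarrow> nat \<Rightarrow> complex" where
  "coords N f w = (\<lambda>i. cip N w (f i))"

definition in_span :: "nat \<Rightarrow> nat \<Rightarrow> (nat \<Rightarrow> nat \<Rightarrow> complex) \<Rightarrow> (nat \<Rightarrow> complex) \<Rightarrow> bool" where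
  "in_span N d f w \<longleftrightarrow> (\<forall>p<N. w p = lift d f (coords N f w) p)"

text \<open>Gram--Schmidt.\<close>
lemma exists_orthonormal_spanning:
  assumes "finite W"
  shows "\<exists>d f. d \<le> card W \<and> orthonormal N d f \<and> (\<forall>w\<in>W. in_span N d f w)"
  using assms
proof (induction W rule: finite_induct)
  case empty
  show ?case by (auto simp: orthonormal_def)
next
  case (insert w W)
  then obtain d f where d: "d \<le> card W" and f: "orthonormal N d f" and W: "\<And>v. v \<in> W \<Longrightarrow> in_span N d f v" by blast
  define r where "r = (\<lambda>p. w p - lift d f (coords N f w) p)"
  have req: "r = (\<lambda>p. w p + (\<Sum>i<d. - coords N f w i * f i p))"
    by (simp add: r_def lift_def sum_negf fun_eq_iff)
  have rf: "cip N r (f j) = 0" if "j < d" for j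
  proof -
    have "cip N r (f j) = cip N w (f j) + (\<Sum>i<d. - coords N f w i * cip N (f i) (f j))"
      by (subst req) (simp only: cip_add_left cip_sum_left)
    also have "(\<Sum>i<d. - coords N f w i * cip N (f i) (f j)) = (\<Sum>i<d. if i = j then - coords N f w j else 0)"
      using f that by (intro sum.cong) (auto simp: orthonormal_def)
    finally show ?thesis using that by (simp add: coords_def)
  qed
  show ?case
  proof (cases "cnorm N r = 0")
    case True
    then have "in_span N d f w" using cnorm_eq_0[of N r] by (auto simp: in_span_def r_def)
    then show ?thesis using d f W insert.hyps by (intro exI[of _ d] exI[of _ f]) auto
  next
    case False
    let ?a = "cnorm N r"
    let ?e = "\<lambda>p. of_real (1 / ?a) * r p :: complex"
    let ?f = "f(d := ?e)"
    have rr: "cip N r r = of_real (?a\<^sup>2)" by (rule cip_self)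
    have ee: "cip N ?e ?e = 1"
    proof -
      have 1: "cip N ?e ?e = of_real (1 / ?a) * cip N r ?e" by (rule cip_scale_left)
      have 2: "cip N r ?e = cnj (cip N ?e r)" by (rule cip_commute)
      have 3: "cip N ?e r = of_real (1 / ?a) * of_real (?a\<^sup>2)" by (simp only: cip_scale_left rr)
      show ?thesis unfolding 1 2 3 using False by (simp add: power2_eq_square)
    qed
    have ef: "cip N ?e (f j) = 0" if "j < d" for j unfolding cip_scale_left using rf[OF that] by simp
    have fe: "cip N (f j) ?e = 0" if "j < d" for j using ef[OF that] cip_commute[of N "f j" ?e] by simp
    have orth: "orthonormal N (Suc d) ?f"
      using f ee ef fe by (auto simp: orthonormal_def less_Suc_eq)
    have old: "in_span N (Suc d) ?f v" if v: "v \<in> W" for v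
    proof -
      have vl: "v p = lift d f (coords N f v) p" if "p < N" for p using W[OF v] that by (simp add: in_span_def)
      have "cip N v ?e = cip N (lift d f (coords N f v)) ?e" by (rule cip_cong) (simp_all add: vl)
      also have "\<dots> = (\<Sum>i<d. coords N f v i * cip N (f i) ?e)" unfolding lift_def by (rule cip_sum_left)
      also have "\<dots> = 0" using fe by simp
      finally have "coords N ?f v d = 0" by (simp add: coords_def)
      then have "lift (Suc d) ?f (coords N ?f v) p = lift d f (coords N f v) p" for p
        by (simp add: lift_def coords_def)
      then show ?thesis using vl by (simp add: in_span_def)
    qed
    have new: "in_span N (Suc d) ?f w"
    proof -
      have "cip N r w = cnj (cip N w r)" by (rule cip_commute)
      have "cip N r ?e = cnj (cip N ?e r)" by (rule cip_commute)
      have wr: "cip N w r = of_real (?a\<^sup>2)"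
      proof -
        have "w = (\<lambda>p. r p + (\<Sum>i<d. coords N f w i * f i p))" by (simp add: r_def lift_def)
        then have "cip N w r = cip N r r + (\<Sum>i<d. coords N f w i * cip N (f i) r)"
          by (metis cip_add_left cip_sum_left)
        also have "(\<Sum>i<d. coords N f w i * cip N (f i) r) = 0"
          using rf cip_commute[of N _ r] by (intro sum.neutral) (metis complex_cnj_zero lessThan_iff mult_zero_right)
        finally show ?thesis using rr by simp
      qed
      have "cip N w ?e = of_real (1 / ?a) * cip N w r"
      proof -
        have "cip N w ?e = cnj (of_real (1 / ?a) * cip N r w)"
          by (subst cip_commute) (simp only: cip_scale_left)
        also have "\<dots> = of_real (1 / ?a) * cnj (cip N r w)" by simp
        also have "cnj (cip N r w) = cip N w r" by (rule cip_commute[symmetric])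
        finally show ?thesis .
      qed
      then have "coords N ?f w d = of_real ?a"
        using False by (simp add: coords_def wr power2_eq_square)
      then have "lift (Suc d) ?f (coords N ?f w) p = lift d f (coords N f w) p + r p" for p
        using False by (simp add: lift_def coords_def)
      then show ?thesis by (simp add: in_span_def r_def)
    qed
    have "Suc d \<le> card (insert w W)" using d insert.hyps by simp
    moreover have "\<forall>v\<in>insert w W. in_span N (Suc d) ?f v" using old new by blast
    ultimately show ?thesis using orth by blast
  qed
qed

definition compress :: "nat \<Rightarrow> nat \<Rightarrow> (nat \<Rightarrow> nat \<Rightarrow> complex) \<Rightarrow> complex mat \<Rightarrow> complex mat" where
  "compress N d f M = mat d d (\<lambda>(i, j). cip N (act N M (f j)) (f i))"

lemma compress_carrier [simp]: "compress N d f M \<in> carrier_mat d d"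
  by (simp add: compress_def)

lemma act_lift: "act N M (lift d f u) = (\<lambda>p. \<Sum>q<d. u q * act N M (f q) p)"
  unfolding act_def lift_def sum_distrib_left by (subst sum.swap) (simp add: sum_distrib_left ac_simps)

lemma cip_lift:
  assumes "orthonormal N d f"
  shows "cip N (lift d f u) (lift d f v) = cip d u v"
proof -
  have "cip N (lift d f u) (lift d f v) = (\<Sum>q<d. u q * (\<Sum>i<d. cnj (v i) * cip N (f q) (f i)))"
    unfolding lift_def cip_sum_left cip_sum_right ..
  also have "\<dots> = (\<Sum>q<d. u q * (\<Sum>i<d. if i = q then cnj (v q) else 0))"
    using assms by (intro sum.cong refl arg_cong2[where f = "(*)"]) (auto simp: orthonormal_def)
  finally show ?thesis by (simp add: cip_def)
qed

lemma cnorm_lift: "orthonormal N d f \<Longrightarrow> cnorm N (lift d f u) = cnorm d u"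
proof -
  assume "orthonormal N d f"
  then have "complex_of_real ((cnorm N (lift d f u))\<^sup>2) = of_real ((cnorm d u)\<^sup>2)"
    using cip_lift[of N d f u u] by (simp only: cip_self)
  then show ?thesis by (simp only: of_real_eq_iff) (simp add: power2_eq_iff_nonneg)
qed

lemma act_compress:
  assumes "i < d"
  shows "act d (compress N d f M) u i = cip N (act N M (lift d f u)) (f i)"
  unfolding act_lift cip_sum_left act_def[of d]
  by (rule sum.cong) (use assms in \<open>simp_all add: compress_def\<close>)

lemma cip_act_compress:
  "cip d (act d (compress N d f M) u) v = cip N (act N M (lift d f u)) (lift d f v)"
proof -
  have "cip d (act d (compress N d f M) u) v = (\<Sum>i<d. cip N (act N M (lift d f u)) (f i) * cnj (v i))"
    unfolding cip_def[of d] by (rule sum.cong) (simp_all add: act_compress)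
  also have "\<dots> = cip N (act N M (lift d f u)) (lift d f v)"
    unfolding lift_def[of d f v] cip_sum_right by (simp add: mult.commute)
  finally show ?thesis .
qed

lemma bform_blk:
  "bform m N (blk S m B A) \<xi> \<eta> = (\<Sum>i<m. \<Sum>j<m. B 1 $$ (i, j) * cip N (\<xi> j) (\<eta> i)
     + (\<Sum>x\<in>{x \<in> S - {1}. B x \<noteq> 0\<^sub>m m m}. B x $$ (i, j) * cip N (act N (A x) (\<xi> j)) (\<eta> i)))"
  unfolding bform_def
proof (intro sum.cong refl)
  fix i j
  let ?D = "{x \<in> S - {1}. B x \<noteq> 0\<^sub>m m m}"
  have "(\<Sum>p<N. \<Sum>q<N. blk S m B A i j p q * \<xi> j q * cnj (\<eta> i p))
    = (\<Sum>p<N. \<Sum>q<N. B 1 $$ (i, j) * (if p = q then 1 else 0) * \<xi> j q * cnj (\<eta> i p))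
      + (\<Sum>p<N. \<Sum>q<N. \<Sum>x\<in>?D. B x $$ (i, j) * A x $$ (p, q) * \<xi> j q * cnj (\<eta> i p))"
    by (simp add: blk_def distrib_right sum.distrib sum_distrib_right)
  also have "(\<Sum>p<N. \<Sum>q<N. B 1 $$ (i, j) * (if p = q then 1 else 0) * \<xi> j q * cnj (\<eta> i p))
      = (\<Sum>p<N. \<Sum>q<N. if q = p then B 1 $$ (i, j) * (\<xi> j p * cnj (\<eta> i p)) else 0)"
    by (intro sum.cong) auto
  also have "\<dots> = B 1 $$ (i, j) * cip N (\<xi> j) (\<eta> i)" by (simp add: cip_def sum_distrib_left)
  also have "(\<Sum>p<N. \<Sum>q<N. \<Sum>x\<in>?D. B x $$ (i, j) * A x $$ (p, q) * \<xi> j q * cnj (\<eta> i p))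
      = (\<Sum>p<N. \<Sum>x\<in>?D. \<Sum>q<N. B x $$ (i, j) * A x $$ (p, q) * \<xi> j q * cnj (\<eta> i p))"
    by (rule sum.cong[OF refl], rule sum.swap)
  also have "\<dots> = (\<Sum>x\<in>?D. \<Sum>p<N. \<Sum>q<N. B x $$ (i, j) * A x $$ (p, q) * \<xi> j q * cnj (\<eta> i p))"
    by (rule sum.swap)
  also have "\<dots> = (\<Sum>x\<in>?D. B x $$ (i, j) * cip N (act N (A x) (\<xi> j)) (\<eta> i))"
    by (simp add: cip_def act_def sum_distrib_left sum_distrib_right mult.assoc)
  finally show "(\<Sum>p<N. \<Sum>q<N. blk S m B A i j p q * \<xi> j q * cnj (\<eta> i p))
    = B 1 $$ (i, j) * cip N (\<xi> j) (\<eta> i) + (\<Sum>x\<in>?D. B x $$ (i, j) * cip N (act N (A x) (\<xi> j)) (\<eta> i))" .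
qed

text \<open>Compression by an isometry \<open>v\<close> multiplies a pencil by \<open>1 \<otimes> v*\<close> and \<open>1 \<otimes> v\<close>, so the norms of all pencils decrease
  while the unit stays the unit. The constraints of a C*-algebra microstate have no such
  property, since they involve products.\<close>
lemma compress_sys_state:
  assumes A: "A \<in> sys_states S \<theta> N" and th: "\<theta> \<in> sys_params S" and one: "1 \<in> S" and f: "orthonormal N d f"
  shows "(\<lambda>x\<in>S. compress N d f (A x)) \<in> sys_states S \<theta> d"
proof -
  let ?A = "\<lambda>x\<in>S. compress N d f (A x)"
  have Ac: "\<forall>x\<in>S. A x \<in> carrier_mat N N" using sys_states_carrier[OF A] by blast
  have A1: "A 1 = 1\<^sub>m N" using A by (simp add: system_microstates_def)
  have pen: "op_norm (pencil_mat S m d B ?A) \<le> fst \<theta> + cstar_mat_norm (pencil_sys S m B)" if mB: "(m, B) \<in> snd \<theta>" for m B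
  proof (rule op_norm_pencil_le)
    have mt: "(m, B) \<in> matrix_tuples S" using th mB by (auto simp: sys_params_def)
    then show B: "B \<in> S \<rightarrow>\<^sub>E carrier_mat m m" by (simp add: matrix_tuples_def)
    show "\<forall>x\<in>S. ?A x \<in> carrier_mat d d" by simp
    show "1 \<in> S" by (rule one)
    note le = sys_states_pencil[OF A mB]
    show "0 \<le> fst \<theta> + cstar_mat_norm (pencil_sys S m B)"
      using le op_norm_nonneg[OF pencil_mat_carrier, of S m N B A] by linarith
    fix \<xi> \<eta>
    let ?l = "\<lambda>\<xi> j. lift d f (\<xi> j)"
    have eq: "bform m d (blk S m B ?A) \<xi> \<eta> = bform m N (blk S m B A) (?l \<xi>) (?l \<eta>)"
      unfolding bform_blk
      by (intro sum.cong refl arg_cong2[where f = "(+)"]) (auto simp: cip_lift[OF f] cip_act_compress)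
    have bn: "bnorm m N (?l \<zeta>) = bnorm m d \<zeta>" for \<zeta>
      by (simp add: bnorm_def cnorm_lift[OF f])
    have "cmod (bform m N (blk S m B A) (?l \<xi>) (?l \<eta>)) \<le> op_norm (pencil_mat S m N B A) * (bnorm m d \<xi> * bnorm m d \<eta>)"
      using bform_pencil_le[OF B Ac one, of "?l \<xi>" "?l \<eta>"] unfolding bn .
    moreover have "op_norm (pencil_mat S m N B A) * (bnorm m d \<xi> * bnorm m d \<eta>)
        \<le> (fst \<theta> + cstar_mat_norm (pencil_sys S m B)) * (bnorm m d \<xi> * bnorm m d \<eta>)"
      by (rule mult_right_mono[OF le]) simp
    ultimately show "cmod (bform m d (blk S m B ?A) \<xi> \<eta>) \<le> (fst \<theta> + cstar_mat_norm (pencil_sys S m B)) * (bnorm m d \<xi> * bnorm m d \<eta>)"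
      unfolding eq by (rule order_trans)
  qed
  have "compress N d f (1\<^sub>m N) = 1\<^sub>m d"
  proof (rule eq_matI)
    fix i j assume "i < dim_row (1\<^sub>m d :: complex mat)" "j < dim_col (1\<^sub>m d :: complex mat)"
    then have ij: "i < d" "j < d" by auto
    have *: "(1::complex) \<cdot>\<^sub>m 1\<^sub>m N = 1\<^sub>m N" by (intro eq_matI) auto
    have "cip N (act N (1\<^sub>m N) (f j)) (f i) = cip N (f j) (f i)"
      by (rule cip_cong) (use act_scalar[of _ N 1 "f j"] * in simp_all)
    then show "compress N d f (1\<^sub>m N) $$ (i, j) = 1\<^sub>m d $$ (i, j)"
      using f ij by (auto simp: compress_def orthonormal_def)
  qed (simp_all add: compress_def)
  then have "?A 1 = 1\<^sub>m d" using one A1 by simp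
  moreover have "?A \<in> S \<rightarrow>\<^sub>E carrier_mat d d" by auto
  ultimately show ?thesis using pen by (auto simp: system_microstates_def)
qed

text \<open>The vectors to which a letter is applied in the computation of \<open>t(A) u\<close>, the rightmost factor acting first.\<close>
primrec visited :: "nat \<Rightarrow> ('i \<Rightarrow> complex mat) \<Rightarrow> 'i star_expr \<Rightarrow> (nat \<Rightarrow> complex) \<Rightarrow> (nat \<Rightarrow> complex) set" where
  "visited N A (Var i) u = {u}"
| "visited N A (Var_adj i) u = {u}"
| "visited N A (Scal c) u = {}"
| "visited N A (Plus s t) u = visited N A s u \<union> visited N A t u"
| "visited N A (Times s t) u = visited N A t u \<union> visited N A s (act N (evm N A t) u)"

lemma finite_visited: "finite (visited N A t u)"
  by (induction t arbitrary: u) auto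

lemma card_visited_le: "card (visited N A t u) \<le> size t"
proof (induction t arbitrary: u)
  case (Plus s t)
  show ?case using card_Un_le[of "visited N A s u" "visited N A t u"] Plus(1)[of u] Plus(2)[of u] by simp
next
  case (Times s t)
  show ?case
    using card_Un_le[of "visited N A t u" "visited N A s (act N (evm N A t) u)"] Times(1)[of "act N (evm N A t) u"] Times(2)[of u] by simp
qed auto

lemma compress_adjoint:
  assumes M: "M \<in> carrier_mat N N"
  shows "mat_adjoint (compress N d f M) = compress N d f (mat_adjoint M)"
proof (rule eq_matI)
  fix i j assume "i < dim_row (compress N d f (mat_adjoint M))" "j < dim_col (compress N d f (mat_adjoint M))"
  then have ij: "i < d" "j < d" by (auto simp: compress_def)
  have "cnj (cip N (act N M (f i)) (f j)) = cip N (f j) (act N M (f i))" by (rule cip_commute[symmetric])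
  also have "\<dots> = cip N (act N (mat_adjoint M) (f j)) (f i)"
    using cip_act_adjoint[OF mat_adjoint_carrier[OF M], of "f j" "f i"] by simp
  finally show "mat_adjoint (compress N d f M) $$ (i, j) = compress N d f (mat_adjoint M) $$ (i, j)"
    using ij by (simp add: compress_def)
qed (simp_all add: compress_def)

text \<open>On a vector of the subspace a compressed letter acts as the letter followed by the projection. If all intermediate
  vectors of the computation of \<open>t(A) u\<close> lie in the subspace, the projections do not alter them.\<close>
lemma evm_compress:
  assumes A: "\<And>x. x \<in> S \<Longrightarrow> A x \<in> carrier_mat N N"
  shows "vars t \<subseteq> S \<Longrightarrow> (\<And>w. w \<in> visited N A t u \<Longrightarrow> in_span N d f w) \<Longrightarrow> i < d \<Longrightarrow>
    act d (evm d (\<lambda>x\<in>S. compress N d f (A x)) t) (coords N f u) i = coords N f (act N (evm N A t) u) i"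
proof (induction t arbitrary: u i)
  case (Var x)
  have "act N (A x) (lift d f (coords N f u)) = act N (A x) u"
    by (rule act_cong) (use Var(2)[of u] in \<open>simp add: in_span_def\<close>)
  then show ?case using Var by (simp add: act_compress) (simp add: coords_def)
next
  case (Var_adj x)
  have "act N (mat_adjoint (A x)) (lift d f (coords N f u)) = act N (mat_adjoint (A x)) u"
    by (rule act_cong) (use Var_adj(2)[of u] in \<open>simp add: in_span_def\<close>)
  then show ?case using Var_adj A[of x] by (simp add: act_compress compress_adjoint) (simp add: coords_def)
next
  case (Scal c)
  have "coords N f (act N (c \<cdot>\<^sub>m 1\<^sub>m N) u) i = cip N (\<lambda>p. c * u p) (f i)"
    unfolding coords_def by (rule cip_cong) (simp_all add: act_scalar)
  then show ?case using Scal by (simp add: act_scalar cip_scale_left) (simp add: coords_def)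
next
  case (Plus s t)
  let ?A = "\<lambda>x\<in>S. compress N d f (A x)"
  have c: "evm N A s \<in> carrier_mat N N" "evm N A t \<in> carrier_mat N N"
    "evm d ?A s \<in> carrier_mat d d" "evm d ?A t \<in> carrier_mat d d"
    using Plus.prems A by (auto intro!: evm_carrier)
  have "coords N f (act N (evm N A s + evm N A t) u) i = cip N (\<lambda>p. act N (evm N A s) u p + act N (evm N A t) u p) (f i)"
    unfolding coords_def by (rule cip_cong) (simp_all add: act_plus[OF c(1,2)])
  moreover have "act d (evm d ?A s) (coords N f u) i = coords N f (act N (evm N A s) u) i"
    by (rule Plus.IH(1)) (use Plus.prems in auto)
  moreover have "act d (evm d ?A t) (coords N f u) i = coords N f (act N (evm N A t) u) i"
    by (rule Plus.IH(2)) (use Plus.prems in auto)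
  ultimately show ?case
    by (simp only: evm.simps act_plus[OF c(3,4) Plus.prems(3)] cip_add_left) (simp only: coords_def)
next
  case (Times s t)
  let ?A = "\<lambda>x\<in>S. compress N d f (A x)"
  have c: "evm N A s \<in> carrier_mat N N" "evm N A t \<in> carrier_mat N N"
    "evm d ?A s \<in> carrier_mat d d" "evm d ?A t \<in> carrier_mat d d"
    using Times.prems A by (auto intro!: evm_carrier)
  let ?v = "act N (evm N A t) u"
  have "act d (evm d ?A s * evm d ?A t) (coords N f u) i = act d (evm d ?A s) (act d (evm d ?A t) (coords N f u)) i"
    by (rule act_mult[OF c(3,4) Times.prems(3)])
  also have "act d (evm d ?A s) (act d (evm d ?A t) (coords N f u)) = act d (evm d ?A s) (coords N f ?v)"
    by (rule act_cong, rule Times.IH(2)) (use Times.prems in auto)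
  also have "act d (evm d ?A s) (coords N f ?v) i = coords N f (act N (evm N A s) ?v) i"
    by (rule Times.IH(1)) (use Times.prems in auto)
  also have "\<dots> = coords N f (act N (evm N A s * evm N A t) u) i"
    unfolding coords_def by (rule cip_cong) (simp_all add: act_mult[OF c(1,2)])
  finally show ?case by simp
qed

lemma cnorm_coords:
  assumes f: "orthonormal N d f" and w: "in_span N d f w"
  shows "cnorm d (coords N f w) = cnorm N w"
proof -
  have "cnorm N w = cnorm N (lift d f (coords N f w))"
    by (rule cnorm_cong) (use w in \<open>simp add: in_span_def\<close>)
  then show ?thesis by (simp add: cnorm_lift[OF f])
qed

text \<open>The compression to the span of \<open>u\<close>, \<open>t(A) u\<close> and the vectors visited in between is a microstate of dimension at most
  \<open>size t + 2\<close>, and good parameters for these finitely many dimensions exist by compactness.\<close>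
theorem sys_state_bound:
  fixes V S :: "'a::unital_cstar_algebra set" and \<iota> :: "'a \<Rightarrow> 'b::unital_cstar_algebra"
  assumes V: "operator_system V" and one: "1 \<in> S" and span: "cspan S = V"
    and cmax: "is_cstar_max V \<iota>" and t: "vars t \<subseteq> S" and eta: "\<eta> > 0"
  shows "\<exists>\<theta>\<in>sys_params S. \<forall>N. \<forall>A\<in>sys_states S \<theta> N. op_norm (evm N A t) \<le> norm (ev \<iota> t) + \<eta>"
proof -
  let ?K = "size t + 2"
  have "\<exists>\<theta>\<in>sys_params S. \<forall>d<k. \<forall>A\<in>sys_states S \<theta> d. op_norm (evm d A t) \<le> norm (ev \<iota> t) + \<eta>" for k
  proof (induction k)
    case 0
    have "(1, {}) \<in> sys_params S" by (simp add: sys_params_def)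
    then show ?case by blast
  next
    case (Suc k)
    then obtain \<theta>1 where 1: "\<theta>1 \<in> sys_params S" "\<forall>d<k. \<forall>A\<in>sys_states S \<theta>1 d. op_norm (evm d A t) \<le> norm (ev \<iota> t) + \<eta>"
      by (elim bexE)
    obtain \<theta>2 where 2: "\<theta>2 \<in> sys_params S" "\<forall>A\<in>sys_states S \<theta>2 k. op_norm (evm k A t) \<le> norm (ev \<iota> t) + \<eta>"
      using sys_state_bound_fixed_dimension[OF V one span cmax t eta, of k] by (elim bexE)
    obtain \<theta> where th: "\<theta> \<in> sys_params S" "\<forall>N. sys_states S \<theta> N \<subseteq> sys_states S \<theta>1 N \<inter> sys_states S \<theta>2 N"
      using sys_states_directed[OF 1(1) 2(1)] by (elim bexE)
    have "op_norm (evm d A t) \<le> norm (ev \<iota> t) + \<eta>" if "d < Suc k" "A \<in> sys_states S \<theta> d" for d A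
    proof -
      have "A \<in> sys_states S \<theta>1 d" "A \<in> sys_states S \<theta>2 d" using th(2)[THEN spec, of d] that(2) by auto
      then show ?thesis using that(1) 1(2) 2(2) by (cases "d = k") auto
    qed
    then show ?case using th(1) by blast
  qed
  then obtain \<theta> where th: "\<theta> \<in> sys_params S"
    and small: "\<forall>d<Suc ?K. \<forall>A\<in>sys_states S \<theta> d. op_norm (evm d A t) \<le> norm (ev \<iota> t) + \<eta>"
    by (elim meta_allE bexE)
  have "op_norm (evm N A t) \<le> norm (ev \<iota> t) + \<eta>" if A: "A \<in> sys_states S \<theta> N" for N A
  proof (rule op_norm_le)
    have Ac: "A x \<in> carrier_mat N N" if "x \<in> S" for x using sys_states_carrier[OF A that] .
    then show "evm N A t \<in> carrier_mat N N" using t by (intro evm_carrier) auto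
    show "0 \<le> norm (ev \<iota> t) + \<eta>" using eta by simp
    fix u
    let ?v = "act N (evm N A t) u"
    let ?W = "insert u (insert ?v (visited N A t u))"
    have "card ?W \<le> ?K"
      using card_visited_le[of N A t u] finite_visited[of N A t u] by (simp add: card_insert_if)
    moreover obtain d f where d: "d \<le> card ?W" and f: "orthonormal N d f" and W: "\<forall>w\<in>?W. in_span N d f w"
      using exists_orthonormal_spanning[of ?W N] finite_visited[of N A t u] by auto
    ultimately have "d < Suc ?K" by simp
    let ?A = "\<lambda>x\<in>S. compress N d f (A x)"
    have cs: "?A \<in> sys_states S \<theta> d" by (rule compress_sys_state[OF A th one f])
    have cc: "evm d ?A t \<in> carrier_mat d d" using t by (intro evm_carrier) auto
    have "cnorm N ?v = cnorm d (coords N f ?v)" using cnorm_coords[OF f] W by simp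
    also have "\<dots> = cnorm d (act d (evm d ?A t) (coords N f u))"
      by (rule cnorm_cong) (use evm_compress[of S A N t u d f] Ac t W in simp)
    also have "\<dots> \<le> op_norm (evm d ?A t) * cnorm d (coords N f u)" by (rule cnorm_act_le[OF cc])
    also have "\<dots> \<le> (norm (ev \<iota> t) + \<eta>) * cnorm d (coords N f u)"
      using small \<open>d < Suc ?K\<close> cs by (intro mult_right_mono) auto
    also have "cnorm d (coords N f u) = cnorm N u" using cnorm_coords[OF f] W by simp
    finally show "cnorm N ?v \<le> (norm (ev \<iota> t) + \<eta>) * cnorm N u" .
  qed
  then show ?thesis using th by blast
qed

section \<open>Microstates of a C*-algebra as targets\<close>

definition poly_params :: "'i set \<Rightarrow> (real \<times> 'i star_poly set) set" where
  "poly_params I = {0<..} \<times> {Q. finite Q \<and> Q \<subseteq> star_polys I}"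

abbreviation poly_states :: "'i set \<Rightarrow> ('i \<Rightarrow> 'b::unital_cstar_algebra) \<Rightarrow> real \<Rightarrow> real \<times> 'i star_poly set \<Rightarrow> nat \<Rightarrow> ('i \<Rightarrow> complex mat) set" where
  "poly_states I a C \<theta> N \<equiv> microstates I a C (snd \<theta>) (fst \<theta>) N"

lemma poly_states_antimono:
  "fst \<theta> \<le> fst \<theta>' \<Longrightarrow> snd \<theta>' \<subseteq> snd \<theta> \<Longrightarrow> poly_states I a C \<theta> N \<subseteq> poly_states I a C \<theta>' N"
  by (fastforce simp: microstates_def)

lemma norm_controlled_poly_states:
  fixes a :: "'i \<Rightarrow> 'b::unital_cstar_algebra"
  shows "norm_controlled I a (poly_params I) (poly_states I a C)"
  unfolding norm_controlled_def
proof (intro conjI ballI allI impI)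
  show "poly_params I \<noteq> ({} :: (real \<times> 'i star_poly set) set)"
    by (auto simp: poly_params_def intro!: exI[of _ 1] exI[of _ "{}"])
  show "A x \<in> carrier_mat N N" if "A \<in> poly_states I a C \<theta> N" "x \<in> I" for \<theta> N A x
    using that by (auto simp: microstates_def)
next
  fix \<theta>1 \<theta>2 :: "real \<times> 'i star_poly set" assume th: "\<theta>1 \<in> poly_params I" "\<theta>2 \<in> poly_params I"
  let ?\<theta> = "(min (fst \<theta>1) (fst \<theta>2), snd \<theta>1 \<union> snd \<theta>2)"
  show "\<exists>\<theta>\<in>poly_params I. \<forall>N. poly_states I a C \<theta> N \<subseteq> poly_states I a C \<theta>1 N \<inter> poly_states I a C \<theta>2 N"
  proof (intro bexI[of _ ?\<theta>] allI Int_greatest poly_states_antimono)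
    show "?\<theta> \<in> poly_params I" using th by (auto simp: poly_params_def)
  qed auto
next
  fix t :: "'i star_expr" and \<eta> :: real assume t: "vars t \<subseteq> I" and eta: "\<eta> > 0"
  obtain P where P: "P \<in> star_polys I" "\<forall>a :: 'i \<Rightarrow> 'b. eval_poly a P = ev a t"
    "\<forall>N A. (\<forall>i\<in>I. A i \<in> carrier_mat N N) \<longrightarrow> eval_poly_mat N A P = evm N A t"
    using star_expr_to_poly[OF t, where 'b = 'b] by (elim bexE conjE)
  show "\<exists>\<theta>\<in>poly_params I. \<forall>N. \<forall>A\<in>poly_states I a C \<theta> N. op_norm (evm N A t) \<le> norm (ev a t) + \<eta>"
  proof (intro bexI[of _ "(\<eta>, {P})"] allI ballI)
    show "(\<eta>, {P}) \<in> poly_params I" using P(1) eta by (simp add: poly_params_def)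
    fix N A assume A: "A \<in> poly_states I a C (\<eta>, {P}) N"
    then have "\<forall>i\<in>I. A i \<in> carrier_mat N N" by (auto simp: microstates_def)
    then have "eval_poly_mat N A P = evm N A t" using P(3) by blast
    moreover have "op_norm (eval_poly_mat N A P) \<le> norm (eval_poly a P) + \<eta>" using A by (simp add: microstates_def)
    ultimately show "op_norm (evm N A t) \<le> norm (ev a t) + \<eta>" using P(2) by simp
  qed
qed

lemma norm_controlled_sys_states:
  fixes V S :: "'a::unital_cstar_algebra set" and \<iota> :: "'a \<Rightarrow> 'b::unital_cstar_algebra"
  assumes "operator_system V" "1 \<in> S" "cspan S = V" "is_cstar_max V \<iota>"
  shows "norm_controlled S \<iota> (sys_params S) (sys_states S)"
  unfolding norm_controlled_def
proof (intro conjI ballI allI impI)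
  show "sys_params S \<noteq> {}" by (auto simp: sys_params_def intro!: exI[of _ 1] exI[of _ "{}"])
  show "A x \<in> carrier_mat N N" if "A \<in> sys_states S \<theta> N" "x \<in> S" for \<theta> N A x
    using that by (rule sys_states_carrier)
qed (intro sys_states_directed sys_state_bound[OF assms]; assumption)+

text \<open>Microstates obey the cutoff \<open>C\<close> exactly, so approximants are scaled to have norm strictly below \<open>C\<close>; the gap absorbs
  the error in the norms of their values at matrices. For \<open>C \<le> 0\<close> only the zero expression
  qualifies.\<close>
lemma bounded_approximant:
  fixes c :: "'s \<Rightarrow> 'b::unital_cstar_algebra"
  assumes dense: "\<And>x e. e > 0 \<Longrightarrow> \<exists>t. vars t \<subseteq> S \<and> norm (ev c t - x) < e"
    and x: "norm x \<le> C" and e: "e > 0"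
  shows "\<exists>t. vars t \<subseteq> S \<and> norm (ev c t - x) < e \<and> (t = Scal 0 \<or> norm (ev c t) < C)"
proof (cases "C \<le> 0")
  case True
  then have "norm x = 0" using x norm_ge_zero[of x] by linarith
  then show ?thesis using e by (intro exI[of _ "Scal 0"]) simp
next
  case False
  then have C: "C > 0" by simp
  define e' where "e' = e / 4"
  have e': "e' > 0" using e by (simp add: e'_def)
  obtain t where t: "vars t \<subseteq> S" "norm (ev c t - x) < e'" using dense[OF e'] by blast
  \<comment> \<open>\<open>\<parallel>t\<parallel> < C + e'\<close>, so scaling by \<open>s\<close> brings the norm below \<open>C\<close> and moves \<open>t\<close> by at most \<open>2 e'\<close>.\<close>
  define s where "s = C / (C + 2 * e')"
  have s: "s > 0" "s < 1" using C e' by (auto simp: s_def)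
  have nt: "norm (ev c t) < C + e'" using norm_triangle_sub[of "ev c t" x] t x by linarith
  let ?t = "Times (Scal (of_real s)) t"
  have evt: "ev c ?t = s *\<^sub>R ev c t" by (simp add: scaleC_mult_left scaleC_of_real)
  have "s * norm (ev c t) < s * (C + 2 * e')" using s nt e' by (intro mult_strict_left_mono) auto
  also have "\<dots> = C" using C e' by (simp add: s_def)
  finally have "norm (ev c ?t) < C" unfolding evt using s by simp
  moreover have "norm (ev c ?t - x) < e"
  proof -
    have eq: "ev c ?t - x = (ev c t - x) - (1 - s) *\<^sub>R ev c t" unfolding evt by (simp add: algebra_simps)
    have "norm (ev c ?t - x) \<le> norm (ev c t - x) + (1 - s) * norm (ev c t)"
      unfolding eq using norm_triangle_ineq4[of "ev c t - x" "(1 - s) *\<^sub>R ev c t"] s by simp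
    moreover have "(1 - s) * norm (ev c t) \<le> (1 - s) * (C + 2 * e')" using s nt e' by (intro mult_left_mono) auto
    moreover have "(1 - s) * (C + 2 * e') = 2 * e'" using C e' by (simp add: s_def field_simps)
    ultimately show ?thesis using t(2) e unfolding e'_def by linarith
  qed
  ultimately show ?thesis using t(1) by (intro exI[of _ ?t]) simp
qed

text \<open>Evaluating a polynomial constraint at \<open>p(A)\<close> is evaluating the composed polynomial at \<open>A\<close>, whose norm is controlled by its norm at \<open>c\<close>;
  this norm is close to that of the original polynomial at \<open>a\<close>. Only the letters in \<open>J\<close> and in the
  finitely many constraints are approximated, all others are sent to \<open>0\<close>.\<close>
lemma poly_states_target:
  fixes a :: "'i \<Rightarrow> 'b::unital_cstar_algebra" and c :: "'s \<Rightarrow> 'b"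
  assumes nc: "norm_controlled S c \<Theta> \<Omega>"
    and dense: "\<And>x e. e > 0 \<Longrightarrow> \<exists>t. vars t \<subseteq> S \<and> norm (ev c t - x) < e"
    and aC: "\<forall>i\<in>I. norm (a i) \<le> C"
    and th': "\<theta>' \<in> poly_params I" and J: "finite J" "J \<subseteq> I" and eta: "\<eta> > 0"
  shows "\<exists>p. \<exists>\<theta>\<in>\<Theta>. (\<forall>j\<in>J. vars (p j) \<subseteq> S \<and> norm (ev c (p j) - a j) < \<eta>) \<and>
        (\<forall>N\<ge>1. \<forall>A\<in>\<Omega> \<theta> N. \<exists>A'\<in>poly_states I a C \<theta>' N. \<forall>j\<in>J. A' j = evm N A (p j))"
proof -
  define \<delta> Q where "\<delta> = fst \<theta>'" and "Q = snd \<theta>'"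
  have d: "\<delta> > 0" and Q: "finite Q" "Q \<subseteq> star_polys I" using th' by (auto simp: poly_params_def \<delta>_def Q_def)
  have "\<forall>P. \<exists>t. P \<in> Q \<longrightarrow> vars t \<subseteq> I \<and> (\<forall>a :: 'i \<Rightarrow> 'b. eval_poly a P = ev a t) \<and>
    (\<forall>N A. (\<forall>i\<in>I. A i \<in> carrier_mat N N) \<longrightarrow> eval_poly_mat N A P = evm N A t)"
    using Q(2) star_poly_to_expr[where 'b = 'b] by blast
  from choice[OF this] obtain \<tau> where tau: "\<forall>P. P \<in> Q \<longrightarrow> vars (\<tau> P) \<subseteq> I \<and> (\<forall>a :: 'i \<Rightarrow> 'b. eval_poly a P = ev a (\<tau> P)) \<and>
    (\<forall>N A. (\<forall>i\<in>I. A i \<in> carrier_mat N N) \<longrightarrow> eval_poly_mat N A P = evm N A (\<tau> P))"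
    by (elim exE)
  define J0 where "J0 = J \<union> (\<Union>P\<in>Q. vars (\<tau> P))"
  have J0: "finite J0" "J0 \<subseteq> I" using J Q tau by (auto simp: J0_def)
  define R where "R = \<bar>C\<bar> + 1"
  define L where "L = 1 + (\<Sum>P\<in>Q. lip R (\<tau> P))"
  have R0: "R \<ge> 0" by (simp add: R_def)
  have L: "lip R (\<tau> P) \<le> L" if "P \<in> Q" for P
    using member_le_sum[OF that, of "\<lambda>P. lip R (\<tau> P)"] Q R0 by (auto simp: L_def lip_nonneg)
  have L1: "L \<ge> 1" using R0 by (simp add: L_def sum_nonneg lip_nonneg)
  define e where "e = min (min \<eta> 1) (\<delta> / (2 * L))"
  have e: "e > 0" "e \<le> \<eta>" "e \<le> 1" "e \<le> \<delta> / (2 * L)" using eta d L1 by (auto simp: e_def)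
  have "\<forall>i. \<exists>t. i \<in> J0 \<longrightarrow> vars t \<subseteq> S \<and> norm (ev c t - a i) < e \<and> (t = Scal 0 \<or> norm (ev c t) < C)"
    using bounded_approximant[OF dense _ e(1)] aC J0(2) by blast
  from choice[OF this] obtain p0 where p0: "\<forall>i. i \<in> J0 \<longrightarrow> vars (p0 i) \<subseteq> S \<and> norm (ev c (p0 i) - a i) < e \<and> (p0 i = Scal 0 \<or> norm (ev c (p0 i)) < C)"
    by (elim exE)
  define p where "p = (\<lambda>i. if i \<in> J0 then p0 i else Scal 0)"
  have pv: "vars (p i) \<subseteq> S" for i using p0 by (auto simp: p_def)
  have pa: "norm (ev c (p i) - a i) < e" if "i \<in> J0" for i using p0 that by (simp add: p_def)
  have pC: "p i = Scal 0 \<or> (i \<in> J0 \<and> norm (ev c (p i)) < C)" for i using p0 by (auto simp: p_def)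
  define X where "X = (\<lambda>i. (p i, C - norm (ev c (p i)))) ` {i \<in> J0. norm (ev c (p i)) < C} \<union> (\<lambda>P. (subst p (\<tau> P), \<delta> / 2)) ` Q"
  have Xf: "finite X" using J0(1) Q(1) by (simp add: X_def)
  have "vars (subst p t) \<subseteq> S" for t using vars_subst[of p t] pv by auto
  then have Xv: "\<forall>(t, \<zeta>)\<in>X. vars t \<subseteq> S \<and> \<zeta> > 0"
    using d pv unfolding X_def by auto
  obtain \<theta> where th: "\<theta> \<in> \<Theta>" and bd: "\<forall>N. \<forall>A\<in>\<Omega> \<theta> N. \<forall>(t, \<zeta>)\<in>X. op_norm (evm N A t) \<le> norm (ev c t) + \<zeta>"
    using norm_controlled_finite[OF nc Xf Xv] by (elim bexE)
  have "\<exists>A'\<in>poly_states I a C \<theta>' N. \<forall>j\<in>J. A' j = evm N A (p j)" if A: "A \<in> \<Omega> \<theta> N" for N A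
  proof -
    let ?A = "\<lambda>i\<in>I. evm N A (p i)"
    have Ac: "A x \<in> carrier_mat N N" if "x \<in> S" for x
      using nc th A that unfolding norm_controlled_def by blast
    have pc: "evm N A (p i) \<in> carrier_mat N N" for i using pv Ac by (intro evm_carrier) auto
    have bdA: "op_norm (evm N A t) \<le> norm (ev c t) + \<zeta>" if "(t, \<zeta>) \<in> X" for t \<zeta>
      using bd A that by blast
    have "op_norm (?A i) \<le> C" if i: "i \<in> I" for i
    proof -
      consider "p i = Scal 0" | "i \<in> J0" "norm (ev c (p i)) < C" using pC by blast
      then show ?thesis
      proof cases
        case 1
        have "op_norm (?A i) \<le> 0" using 1 i op_norm_scalar[of 0 N] by simp
        also have "0 \<le> C" using aC i norm_ge_zero order_trans by blast
        finally show ?thesis .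
      next
        case 2
        then have "(p i, C - norm (ev c (p i))) \<in> X" by (auto simp: X_def)
        from bdA[OF this] show ?thesis using i by simp
      qed
    qed
    moreover have "op_norm (eval_poly_mat N ?A P) \<le> norm (eval_poly a P) + \<delta>" if P: "P \<in> Q" for P
    proof -
      have tP: "vars (\<tau> P) \<subseteq> I" "eval_poly a P = ev a (\<tau> P)" using tau P by auto
      have vJ: "vars (\<tau> P) \<subseteq> J0" using P by (auto simp: J0_def)
      have "eval_poly_mat N ?A P = evm N ?A (\<tau> P)" using tau P pc by simp
      also have "\<dots> = evm N (\<lambda>i. evm N A (p i)) (\<tau> P)" using tP(1) by (intro evm_cong) auto
      also have "\<dots> = evm N A (subst p (\<tau> P))"
        by (rule evm_subst[symmetric]) (use pv Ac in blast)
      finally have "op_norm (eval_poly_mat N ?A P) \<le> norm (ev c (subst p (\<tau> P))) + \<delta> / 2"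
        using bdA[of "subst p (\<tau> P)" "\<delta> / 2"] P by (auto simp: X_def)
      moreover have "norm (ev (\<lambda>i. ev c (p i)) (\<tau> P) - ev a (\<tau> P)) \<le> lip R (\<tau> P) * e"
      proof (rule norm_ev_diff_le[OF R0])
        fix i assume "i \<in> vars (\<tau> P)"
        then have i: "i \<in> J0" "i \<in> I" using vJ J0(2) by auto
        have "norm (ev c (p i)) \<le> norm (a i) + norm (ev c (p i) - a i)" by (rule norm_triangle_sub)
        then show "norm (ev c (p i)) \<le> R \<and> norm (a i) \<le> R \<and> norm (ev c (p i) - a i) \<le> e"
          using pa[OF i(1)] aC i(2) e by (force simp: R_def)
      qed (use e in simp)
      moreover have "lip R (\<tau> P) * e \<le> L * (\<delta> / (2 * L))" using L[OF P] e L1 by (intro mult_mono) auto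
      moreover have "L * (\<delta> / (2 * L)) = \<delta> / 2" using L1 by simp
      moreover have "norm (ev c (subst p (\<tau> P))) \<le> norm (ev a (\<tau> P)) + norm (ev (\<lambda>i. ev c (p i)) (\<tau> P) - ev a (\<tau> P))"
        unfolding ev_subst by (rule norm_triangle_sub)
      ultimately show ?thesis unfolding tP(2) by linarith
    qed
    moreover have "?A \<in> I \<rightarrow>\<^sub>E carrier_mat N N" using pc by auto
    ultimately have "?A \<in> poly_states I a C \<theta>' N" by (auto simp: microstates_def \<delta>_def Q_def)
    moreover have "\<forall>j\<in>J. ?A j = evm N A (p j)" using J(2) by auto
    ultimately show ?thesis by blast
  qed
  moreover have "\<forall>j\<in>J. vars (p j) \<subseteq> S \<and> norm (ev c (p j) - a j) < \<eta>"
  proof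
    fix j assume "j \<in> J"
    then have "norm (ev c (p j) - a j) < e" by (intro pa) (simp add: J0_def)
    then show "vars (p j) \<subseteq> S \<and> norm (ev c (p j) - a j) < \<eta>" using pv e by simp
  qed
  ultimately show ?thesis using th by blast
qed

section \<open>Operator system microstates as targets\<close>

text \<open>The choice \<open>r = y/x\<close>. If \<open>x = 0\<close> or \<open>y = 0\<close>, then large or small \<open>r\<close> show \<open>s \<le> 0\<close>.\<close>
lemma le_mult_of_quadratic:
  fixes s x y K :: real
  assumes le: "\<And>r. r > 0 \<Longrightarrow> 2 * r * s \<le> K * (r\<^sup>2 * x\<^sup>2 + y\<^sup>2)" and nn: "x \<ge> 0" "y \<ge> 0" "K \<ge> 0"
  shows "s \<le> K * (x * y)"
proof (cases "s \<le> 0")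
  case True
  then show ?thesis using nn by (meson mult_nonneg_nonneg order_trans)
next
  case False
  then have s: "s > 0" by simp
  have x: "x > 0"
  proof (rule ccontr)
    assume "\<not> x > 0"
    then have "x = 0" using nn by simp
    moreover have "(K * y\<^sup>2 + 1) / (2 * s) > 0" using s nn by (intro divide_pos_pos add_nonneg_pos) auto
    ultimately show False using le[of "(K * y\<^sup>2 + 1) / (2 * s)"] s by simp
  qed
  have y: "y > 0"
  proof (rule ccontr)
    assume "\<not> y > 0"
    then have y0: "y = 0" using nn by simp
    let ?d = "K * x\<^sup>2 + 1"
    have d: "?d > 0" using nn by (intro add_nonneg_pos) auto
    define w where "w = s / ?d"
    have w: "w > 0" using s d by (simp add: w_def)
    have "2 * w * s \<le> K * (w\<^sup>2 * x\<^sup>2 + y\<^sup>2)" by (rule le[OF w])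
    also have "\<dots> = w * (s * (K * x\<^sup>2 / ?d))" by (simp add: y0 w_def power2_eq_square)
    also have "\<dots> \<le> w * (s * 1)"
      using w s d by (intro mult_left_mono) (auto simp: divide_le_eq)
    finally show False using w s mult_pos_pos[OF w s] by simp
  qed
  have "2 * (y / x) * s \<le> K * ((y / x)\<^sup>2 * x\<^sup>2 + y\<^sup>2)" by (rule le) (use x y in simp)
  also have "\<dots> = 2 * K * y\<^sup>2" using x by (simp add: power_divide)
  finally have "2 * y * s \<le> 2 * K * y\<^sup>2 * x" using x by (simp add: field_simps)
  then have "(2 * y) * s \<le> (2 * y) * (K * (x * y))" by (simp add: power2_eq_square ac_simps)
  then show ?thesis using y by (simp add: mult_le_cancel_left_pos)
qed

lemma cip_diff_left: "cip N (\<lambda>p. u p - v p) w = cip N u w - cip N v w"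
  by (simp add: cip_def left_diff_distrib sum_subtractf)

lemma cip_act_Minus:
  assumes "evm N A s \<in> carrier_mat N N" "evm N A t \<in> carrier_mat N N"
  shows "cip N (act N (evm N A (Minus s t)) u) v = cip N (act N (evm N A s) u) v - cip N (act N (evm N A t) u) v"
proof -
  have "cip N (act N (evm N A (Minus s t)) u) v = cip N (\<lambda>p. act N (evm N A s) u p - act N (evm N A t) u p) v"
    by (rule cip_cong) (simp_all add: evm_Minus[OF assms] act_minus[OF assms])
  then show ?thesis by (simp add: cip_diff_left)
qed

lemma star_expr_sum_cip:
  fixes f :: "'k \<Rightarrow> 'i star_expr"
  assumes K: "finite K"
  obtains t where "vars t \<subseteq> (\<Union>k\<in>K. vars (f k))"
    "\<And>a :: 'i \<Rightarrow> 'b::unital_cstar_algebra. ev a t = (\<Sum>k\<in>K. ev a (f k))"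
    "\<And>N A u v. (\<forall>k\<in>K. \<forall>x\<in>vars (f k). A x \<in> carrier_mat N N) \<Longrightarrow>
       cip N (act N (evm N A t) u) v = (\<Sum>k\<in>K. cip N (act N (evm N A (f k)) u) v)"
proof (rule star_expr_sum[OF K, where f = f and 'b = 'b])
  fix t
  assume t: "vars t \<subseteq> (\<Union>k\<in>K. vars (f k))"
    "\<And>a :: 'i \<Rightarrow> 'b. ev a t = (\<Sum>k\<in>K. ev a (f k))"
    "\<And>N A i j. (\<forall>k\<in>K. \<forall>x\<in>vars (f k). A x \<in> carrier_mat N N) \<Longrightarrow> i < N \<Longrightarrow> j < N \<Longrightarrow>
       evm N A t $$ (i, j) = (\<Sum>k\<in>K. evm N A (f k) $$ (i, j))"
  show thesis
  proof (rule that[of t])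
    show "vars t \<subseteq> (\<Union>k\<in>K. vars (f k))" by (rule t(1))
    show "ev a t = (\<Sum>k\<in>K. ev a (f k))" for a :: "'i \<Rightarrow> 'b" by (rule t(2))
    fix N and A :: "'i \<Rightarrow> complex mat" and u v :: "nat \<Rightarrow> complex"
    assume A: "\<forall>k\<in>K. \<forall>x\<in>vars (f k). A x \<in> carrier_mat N N"
    have "act N (evm N A t) u p = (\<Sum>k\<in>K. 1 * act N (evm N A (f k)) u p)" if p: "p < N" for p
    proof -
      have "act N (evm N A t) u p = (\<Sum>q<N. \<Sum>k\<in>K. evm N A (f k) $$ (p, q) * u q)"
        unfolding act_def using t(3)[OF A p] by (simp add: sum_distrib_right)
      also have "\<dots> = (\<Sum>k\<in>K. \<Sum>q<N. evm N A (f k) $$ (p, q) * u q)" by (rule sum.swap)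
      finally show ?thesis by (simp add: act_def)
    qed
    then have "cip N (act N (evm N A t) u) v = cip N (\<lambda>p. \<Sum>k\<in>K. 1 * act N (evm N A (f k)) u p) v"
      by (intro cip_cong) simp_all
    then show "cip N (act N (evm N A t) u) v = (\<Sum>k\<in>K. cip N (act N (evm N A (f k)) u) v)"
      unfolding cip_sum_left by simp
  qed
qed

lemma sum_double_le_square:
  fixes x :: "nat \<Rightarrow> real"
  shows "(\<Sum>l<n. x l)\<^sup>2 \<le> real n * (\<Sum>l<n. (x l)\<^sup>2)"
  using Cauchy_Schwarz_ineq_sum[of "\<lambda>_. 1" x "{..<n}"] by simp

text \<open>If the blocks \<open>Z\<close> agree with those of \<open>Y* Y\<close> up to \<open>\<kappa>\<close>, the block matrix \<open>Z\<close> is bounded below by \<open>- n \<kappa>\<close>.\<close>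
lemma approximate_gram_positive:
  fixes Y Z :: "nat \<Rightarrow> nat \<Rightarrow> complex mat"
  assumes Y: "\<And>k l. Y k l \<in> carrier_mat N N"
    and close: "\<And>l l' u v. l < n \<Longrightarrow> l' < n \<Longrightarrow>
      cmod ((\<Sum>k<n. cip N (act N (mat_adjoint (Y k l) * Y k l') u) v) - cip N (act N (Z l l') u) v)
        \<le> \<kappa> * (cnorm N u * cnorm N v)"
    and kap: "\<kappa> \<ge> 0"
  shows "- Re (\<Sum>l<n. \<Sum>l'<n. cip N (act N (Z l l') (u l')) (u l)) \<le> \<kappa> * real n * (\<Sum>l<n. (cnorm N (u l))\<^sup>2)"
proof -
  let ?G = "\<lambda>l l'. \<Sum>k<n. cip N (act N (mat_adjoint (Y k l) * Y k l') (u l')) (u l)"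
  let ?H = "\<lambda>l l'. cip N (act N (Z l l') (u l')) (u l)"
  have gram: "(\<Sum>l<n. \<Sum>l'<n. ?G l l') = (\<Sum>k<n. of_real ((cnorm N (\<lambda>p. \<Sum>l<n. act N (Y k l) (u l) p))\<^sup>2))"
  proof -
    have 1: "cip N (act N (mat_adjoint (Y k l) * Y k l') (u l')) (u l) = cip N (act N (Y k l') (u l')) (act N (Y k l) (u l))" for k l l'
    proof -
      have "cip N (act N (mat_adjoint (Y k l) * Y k l') (u l')) (u l) = cip N (act N (mat_adjoint (Y k l)) (act N (Y k l') (u l'))) (u l)"
        by (rule cip_cong) (simp_all add: act_mult[OF mat_adjoint_carrier[OF Y] Y])
      also have "\<dots> = cip N (act N (Y k l') (u l')) (act N (Y k l) (u l))"
        using cip_act_adjoint[OF mat_adjoint_carrier[OF Y]] by simp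
      finally show ?thesis .
    qed
    have 2: "of_real ((cnorm N (\<lambda>p. \<Sum>l<n. act N (Y k l) (u l) p))\<^sup>2)
        = (\<Sum>l'<n. \<Sum>l<n. cip N (act N (Y k l') (u l')) (act N (Y k l) (u l)))" for k
    proof -
      have "of_real ((cnorm N (\<lambda>p. \<Sum>l<n. act N (Y k l) (u l) p))\<^sup>2)
        = cip N (\<lambda>p. \<Sum>l<n. 1 * act N (Y k l) (u l) p) (\<lambda>p. \<Sum>l<n. 1 * act N (Y k l) (u l) p)"
        by (simp only: cip_self[symmetric] mult_1_left)
      then show ?thesis unfolding cip_sum_left cip_sum_right by simp
    qed
    have "(\<Sum>l<n. \<Sum>l'<n. ?G l l') = (\<Sum>l<n. \<Sum>k<n. \<Sum>l'<n. cip N (act N (Y k l') (u l')) (act N (Y k l) (u l)))"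
      unfolding 1 by (rule sum.cong[OF refl], rule sum.swap)
    also have "\<dots> = (\<Sum>k<n. \<Sum>l<n. \<Sum>l'<n. cip N (act N (Y k l') (u l')) (act N (Y k l) (u l)))"
      by (rule sum.swap)
    also have "\<dots> = (\<Sum>k<n. \<Sum>l'<n. \<Sum>l<n. cip N (act N (Y k l') (u l')) (act N (Y k l) (u l)))"
      by (rule sum.cong[OF refl], rule sum.swap)
    finally show ?thesis unfolding 2 .
  qed
  have "0 \<le> Re (\<Sum>l<n. \<Sum>l'<n. ?G l l')"
    unfolding gram by (simp add: sum_nonneg)
  moreover have "cmod ((\<Sum>l<n. \<Sum>l'<n. ?G l l') - (\<Sum>l<n. \<Sum>l'<n. ?H l l')) \<le> \<kappa> * real n * (\<Sum>l<n. (cnorm N (u l))\<^sup>2)"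
  proof -
    have eq: "(\<Sum>l<n. \<Sum>l'<n. ?G l l') - (\<Sum>l<n. \<Sum>l'<n. ?H l l') = (\<Sum>l<n. \<Sum>l'<n. ?G l l' - ?H l l')"
      by (simp only: sum_subtractf)
    have "cmod (\<Sum>l<n. \<Sum>l'<n. ?G l l' - ?H l l') \<le> (\<Sum>l<n. \<Sum>l'<n. cmod (?G l l' - ?H l l'))"
      by (intro order_trans[OF norm_sum] sum_mono norm_sum)
    also have "\<dots> \<le> (\<Sum>l<n. \<Sum>l'<n. \<kappa> * (cnorm N (u l') * cnorm N (u l)))"
      by (rule sum_mono, rule sum_mono, rule close) auto
    also have "\<dots> = \<kappa> * (\<Sum>l<n. cnorm N (u l))\<^sup>2"
      unfolding power2_eq_square sum_product by (simp add: sum_distrib_left mult.commute)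
    also have "\<dots> \<le> \<kappa> * (real n * (\<Sum>l<n. (cnorm N (u l))\<^sup>2))"
      by (intro mult_left_mono sum_double_le_square kap)
    finally show ?thesis unfolding eq by (simp only: mult.assoc)
  qed
  ultimately show ?thesis
    using abs_Re_le_cmod[of "(\<Sum>l<n. \<Sum>l'<n. ?G l l') - (\<Sum>l<n. \<Sum>l'<n. ?H l l')"] by simp
qed

lemma embedding_sum:
  assumes coe: "unital_complete_order_embedding V \<iota>" and V: "operator_system V" and D: "finite D" "D \<subseteq> V"
  shows "\<iota> (\<Sum>x\<in>D. r x *\<^sub>C x) = (\<Sum>x\<in>D. r x *\<^sub>C \<iota> x) \<and> (\<Sum>x\<in>D. r x *\<^sub>C x) \<in> V"
proof -
  have Vs: "csubspace V" using V by (simp add: operator_system_def)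
  have add: "\<iota> (x + y) = \<iota> x + \<iota> y" and sc: "\<iota> (k *\<^sub>C x) = k *\<^sub>C \<iota> x" if "x \<in> V" "y \<in> V" for x y k
    using coe that by (auto simp: unital_complete_order_embedding_def)
  show ?thesis
    using D
  proof (induction D rule: finite_induct)
    case empty
    have "0 \<in> V" using Vs by (rule cvec.subspace_0)
    then have "\<iota> 0 = 0" using add[of 0 0] by simp
    then show ?case using \<open>0 \<in> V\<close> by simp
  next
    case (insert x D)
    have xV: "r x *\<^sub>C x \<in> V" using insert.prems cvec.subspace_scale[OF Vs] by blast
    have IH: "\<iota> (\<Sum>x\<in>D. r x *\<^sub>C x) = (\<Sum>x\<in>D. r x *\<^sub>C \<iota> x)" "(\<Sum>x\<in>D. r x *\<^sub>C x) \<in> V"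
      using insert by auto
    show ?case
      using insert.hyps insert.prems add[OF xV IH(2)] sc[of x x "r x"] IH cvec.subspace_add[OF Vs xV IH(2)] by simp
  qed
qed

lemma norm_adj_mult_diff_le:
  fixes u v :: "'b::unital_cstar_algebra"
  assumes "norm (u - u') \<le> e" "norm (v - v') \<le> e" "norm v \<le> R" "norm u' \<le> R"
  shows "norm (adj u * v - adj u' * v') \<le> 2 * R * e"
proof -
  have R: "R \<ge> 0" "e \<ge> 0" using assms norm_ge_zero order_trans by blast+
  have eq: "adj u * v - adj u' * v' = adj (u - u') * v + adj u' * (v - v')"
    by (simp add: adj_diff algebra_simps)
  have "norm (adj (u - u') * v) \<le> e * R"
    using assms R by (intro order_trans[OF norm_mult_ineq] mult_mono) auto
  moreover have "norm (adj u' * (v - v')) \<le> R * e"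
    using assms R by (intro order_trans[OF norm_mult_ineq] mult_mono) auto
  ultimately have "norm (adj u * v - adj u' * v') \<le> e * R + R * e"
    unfolding eq by (rule norm_triangle_mono)
  also have "e * R + R * e = 2 * R * e" by (simp add: algebra_simps)
  finally show ?thesis .
qed

lemma bform_scale_left: "bform m N W (\<lambda>j q. c * \<xi> j q) \<eta> = c * bform m N W \<xi> \<eta>"
  by (simp add: bform_def sum_distrib_left ac_simps)

text \<open>The converse of the two-by-two trick for complex matrices: if the block matrix with rows \<open>(c, X)\<close> and \<open>(X*, c)\<close> is
  bounded below by \<open>- \<kappa>'\<close>, then \<open>\<parallel>X\<parallel> \<le> c + \<kappa>'\<close>. Test it with the vector \<open>(\<eta>, \<alpha> \<xi>)\<close>, where the phase of \<open>\<alpha>\<close> makes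
  the cross term real and negative and \<open>r = \<bar>\<alpha>\<bar>\<close> balances the two components.\<close>
lemma block_positive_form_bound:
  fixes X :: "nat \<Rightarrow> nat \<Rightarrow> complex mat"
  assumes X: "\<And>i j. i < m \<Longrightarrow> j < m \<Longrightarrow> X i j \<in> carrier_mat N N"
    and W: "\<And>\<xi> \<eta>. bform m N W \<xi> \<eta> = (\<Sum>i<m. \<Sum>j<m. cip N (act N (X i j) (\<xi> j)) (\<eta> i))"
    and c: "c \<ge> 0" and kap: "\<kappa> \<ge> 0"
    and pos: "\<And>u. - Re (\<Sum>l<2*m. \<Sum>l'<2*m. cip N (act N
        (if l < m then (if l' < m then (if l = l' then of_real c else 0) \<cdot>\<^sub>m 1\<^sub>m N else X l (l' - m))
         else (if l' < m then mat_adjoint (X l' (l - m)) else (if l = l' then of_real c else 0) \<cdot>\<^sub>m 1\<^sub>m N)) (u l')) (u l))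
      \<le> \<kappa> * real (2 * m) * (\<Sum>l<2*m. (cnorm N (u l))\<^sup>2)"
  shows "cmod (bform m N W \<xi> \<eta>) \<le> (c + \<kappa> * real (2 * m)) * (bnorm m N \<xi> * bnorm m N \<eta>)"
proof (cases "bform m N W \<xi> \<eta> = 0")
  case True
  then show ?thesis using c kap by simp
next
  case False
  let ?S = "bform m N W \<xi> \<eta>" and ?K = "c + \<kappa> * real (2 * m)"
  show ?thesis
  proof (rule le_mult_of_quadratic)
    fix r :: real assume r: "r > 0"
    define \<alpha> where "\<alpha> = - of_real r * cnj ?S / of_real (cmod ?S)"
    have aS: "\<alpha> * ?S = - of_real (r * cmod ?S)"
    proof -
      have "cnj ?S * ?S = of_real ((cmod ?S)\<^sup>2)" using complex_norm_square[of ?S] by (simp only: mult.commute[of "cnj ?S"] of_real_power)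
      then show ?thesis using False by (simp add: \<alpha>_def power2_eq_square mult.assoc)
    qed
    have am: "cmod \<alpha> = r" using False r by (simp add: \<alpha>_def norm_mult norm_divide)
    let ?x = "\<lambda>j p. \<alpha> * \<xi> j p"
    define u where "u = (\<lambda>l. if l < m then \<eta> l else ?x (l - m))"
    let ?Z = "\<lambda>l l'. if l < m then (if l' < m then (if l = l' then of_real c else 0) \<cdot>\<^sub>m 1\<^sub>m N else X l (l' - m))
         else (if l' < m then mat_adjoint (X l' (l - m)) else (if l = l' then of_real c else 0) \<cdot>\<^sub>m 1\<^sub>m N)"
    have diag: "(\<Sum>i<m. \<Sum>j<m. cip N (act N ((if i = j then of_real c else 0) \<cdot>\<^sub>m 1\<^sub>m N) (w j)) (w i)) = of_real (c * (\<Sum>i<m. (cnorm N (w i))\<^sup>2))" for w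
    proof -
      have "cip N (act N ((if i = j then of_real c else 0) \<cdot>\<^sub>m 1\<^sub>m N) (w j)) (w i) = (if j = i then of_real (c * (cnorm N (w i))\<^sup>2) else 0)" for i j
      proof -
        have "cip N (act N ((if i = j then of_real c else 0) \<cdot>\<^sub>m 1\<^sub>m N) (w j)) (w i) = cip N (\<lambda>p. (if i = j then of_real c else 0) * w j p) (w i)"
          by (rule cip_cong) (simp_all only: act_scalar)
        then show ?thesis unfolding cip_scale_left by (auto simp: cip_self)
      qed
      then show ?thesis by (simp add: sum_distrib_left)
    qed
    have off: "(\<Sum>i<m. \<Sum>j<m. cip N (act N (X i j) (?x j)) (\<eta> i)) = \<alpha> * ?S"
      unfolding W[symmetric] by (rule bform_scale_left)
    have off': "(\<Sum>i<m. \<Sum>j<m. cip N (act N (mat_adjoint (X j i)) (\<eta> j)) (?x i)) = cnj (\<alpha> * ?S)"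
    proof -
      have "(\<Sum>i<m. \<Sum>j<m. cip N (act N (mat_adjoint (X j i)) (\<eta> j)) (?x i)) = (\<Sum>i<m. \<Sum>j<m. cnj (cip N (act N (X j i) (?x i)) (\<eta> j)))"
      proof (intro sum.cong refl)
        fix i j assume "i \<in> {..<m}" "j \<in> {..<m}"
        then have "cip N (act N (X j i) (?x i)) (\<eta> j) = cip N (?x i) (act N (mat_adjoint (X j i)) (\<eta> j))"
          by (intro cip_act_adjoint X) auto
        then show "cip N (act N (mat_adjoint (X j i)) (\<eta> j)) (?x i) = cnj (cip N (act N (X j i) (?x i)) (\<eta> j))"
          using cip_commute[of N "act N (mat_adjoint (X j i)) (\<eta> j)" "?x i"] by simp
      qed
      also have "\<dots> = cnj (\<Sum>j<m. \<Sum>i<m. cip N (act N (X j i) (?x i)) (\<eta> j))"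
        unfolding cnj_sum by (rule sum.swap)
      finally show ?thesis unfolding off .
    qed
    have nu: "(\<Sum>l<2*m. (cnorm N (u l))\<^sup>2) = (bnorm m N \<eta>)\<^sup>2 + r\<^sup>2 * (bnorm m N \<xi>)\<^sup>2"
      unfolding sum_two_halves bnorm_square
      by (simp add: u_def cnorm_scale am power_mult_distrib sum_distrib_left)
    have "(\<Sum>l<2*m. \<Sum>l'<2*m. cip N (act N (?Z l l') (u l')) (u l))
      = (\<Sum>i<m. \<Sum>j<m. cip N (act N ((if i = j then of_real c else 0) \<cdot>\<^sub>m 1\<^sub>m N) (\<eta> j)) (\<eta> i))
        + (\<Sum>i<m. \<Sum>j<m. cip N (act N (X i j) (?x j)) (\<eta> i))
        + ((\<Sum>i<m. \<Sum>j<m. cip N (act N (mat_adjoint (X j i)) (\<eta> j)) (?x i))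
        + (\<Sum>i<m. \<Sum>j<m. cip N (act N ((if i = j then of_real c else 0) \<cdot>\<^sub>m 1\<^sub>m N) (?x j)) (?x i)))"
      unfolding sum_two_halves sum.distrib by (simp add: u_def)
    also have "\<dots> = of_real (c * (bnorm m N \<eta>)\<^sup>2) + \<alpha> * ?S + (cnj (\<alpha> * ?S) + of_real (c * (r\<^sup>2 * (bnorm m N \<xi>)\<^sup>2)))"
      unfolding diag off off' bnorm_square
      by (simp only: cnorm_scale am power_mult_distrib sum_distrib_left)
    finally have "Re (\<Sum>l<2*m. \<Sum>l'<2*m. cip N (act N (?Z l l') (u l')) (u l))
      = c * (bnorm m N \<eta>)\<^sup>2 + c * (r\<^sup>2 * (bnorm m N \<xi>)\<^sup>2) - 2 * (r * cmod ?S)"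
      unfolding aS by simp
    then have "2 * (r * cmod ?S) - c * (bnorm m N \<eta>)\<^sup>2 - c * (r\<^sup>2 * (bnorm m N \<xi>)\<^sup>2)
      \<le> \<kappa> * real (2 * m) * ((bnorm m N \<eta>)\<^sup>2 + r\<^sup>2 * (bnorm m N \<xi>)\<^sup>2)"
      using pos[of u] unfolding nu by linarith
    then show "2 * r * cmod ?S \<le> ?K * (r\<^sup>2 * (bnorm m N \<xi>)\<^sup>2 + (bnorm m N \<eta>)\<^sup>2)"
      by (simp add: distrib_left distrib_right)
  qed (use c kap in auto)
qed

text \<open>The block matrix of the pencil over \<open>V\<close> with \<open>c = c\<^sub>0 + \<delta>/2\<close>, \<open>c\<^sub>0\<close> its norm, is positive, so its image under \<open>\<iota>\<close>
  is \<open>y* y\<close>. Let \<open>Y\<close> approximate \<open>y\<close> and let \<open>Zt\<close> be the block matrix with \<open>p x\<close> in place of \<open>\<iota> x\<close>. The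
  entries of \<open>Y* Y - Zt\<close> have norm at most \<open>\<kappa>/2\<close> at \<open>a\<close>; they are the finitely many polynomials to be
  controlled. The tolerance \<open>e\<close> is fixed before \<open>p\<close>, since a single \<open>p\<close> has to serve several pencils.\<close>
lemma pencil_approximation:
  fixes V S :: "'a::unital_cstar_algebra set" and \<iota> :: "'a \<Rightarrow> 'b::unital_cstar_algebra" and a :: "'i \<Rightarrow> 'b"
  assumes V: "operator_system V" and one: "1 \<in> S" and SV: "S \<subseteq> V"
    and coe: "unital_complete_order_embedding V \<iota>"
    and dense: "\<And>x e. e > 0 \<Longrightarrow> \<exists>t. vars t \<subseteq> I \<and> norm (ev a t - x) < e"
    and mB: "(m, B) \<in> matrix_tuples S" and d: "\<delta> > 0"
  shows "\<exists>e>0. \<forall>p. p 1 = Scal 1 \<longrightarrow> (\<forall>x\<in>S. vars (p x) \<subseteq> I) \<longrightarrow>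
      (\<forall>x\<in>{x \<in> S - {1}. B x \<noteq> 0\<^sub>m m m}. norm (ev a (p x) - \<iota> x) \<le> e) \<longrightarrow>
      (\<exists>X. finite X \<and> (\<forall>(t, \<zeta>)\<in>X. vars t \<subseteq> I \<and> \<zeta> > 0) \<and>
        (\<forall>N A. (\<forall>i\<in>I. A i \<in> carrier_mat N N) \<longrightarrow> (\<forall>(t, \<zeta>)\<in>X. op_norm (evm N A t) \<le> norm (ev a t) + \<zeta>) \<longrightarrow>
          op_norm (pencil_mat S m N B (\<lambda>x\<in>S. evm N A (p x))) \<le> \<delta> + cstar_mat_norm (pencil_sys S m B)))"
proof -
  let ?D = "{x \<in> S - {1}. B x \<noteq> 0\<^sub>m m m}"
  have D: "finite ?D" "?D \<subseteq> V" using finite_matrix_tuples_support[OF mB] SV by auto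
  have B: "B \<in> S \<rightarrow>\<^sub>E carrier_mat m m" using mB by (simp add: matrix_tuples_def)
  have Vs: "csubspace V" "1 \<in> V" and Va: "\<And>x. x \<in> V \<Longrightarrow> adj x \<in> V" using V by (auto simp: operator_system_def)
  have i1: "\<iota> 1 = 1" and isc: "\<iota> (k *\<^sub>C x) = k *\<^sub>C \<iota> x" and iadd: "\<iota> (x + y) = \<iota> x + \<iota> y" if "x \<in> V" "y \<in> V" for k x y
    using coe that by (auto simp: unital_complete_order_embedding_def)
  define P where "P = pencil_sys S m B"
  define c0 where "c0 = cstar_mat_norm P"
  have Pc: "P \<in> carrier_mat m m" by (simp add: P_def pencil_sys_def)
  have Pij: "P $$ (i, j) = B 1 $$ (i, j) *\<^sub>C 1 + (\<Sum>x\<in>?D. B x $$ (i, j) *\<^sub>C x)" if "i < m" "j < m" for i j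
    using that by (simp add: P_def pencil_sys_def)
  have one_s: "k *\<^sub>C 1 \<in> V" for k using Vs cvec.subspace_scale by blast
  have PV: "P $$ (i, j) \<in> V" and iP: "\<iota> (P $$ (i, j)) = B 1 $$ (i, j) *\<^sub>C 1 + (\<Sum>x\<in>?D. B x $$ (i, j) *\<^sub>C \<iota> x)"
    if "i < m" "j < m" for i j
    using Pij[OF that] embedding_sum[OF coe V D, of "\<lambda>x. B x $$ (i, j)"] one_s[of "B 1 $$ (i, j)"] Vs
      iadd[of "B 1 $$ (i, j) *\<^sub>C 1" "\<Sum>x\<in>?D. B x $$ (i, j) *\<^sub>C x"] isc[OF Vs(2,2)] i1[OF Vs(2,2)]
    by (auto intro: cvec.subspace_add)
  have bP: "mbound m (\<lambda>i j. P $$ (i, j)) c0" unfolding c0_def by (rule mbound_cstar_mat_norm[OF Pc])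
  have c00: "c0 \<ge> 0" using bP by (rule mbound_nonneg)
  define c where "c = c0 + \<delta> / 2"
  have c: "c > 0" using c00 d by (simp add: c_def)
  have bPc: "mbound m (\<lambda>i j. P $$ (i, j)) c" by (rule mbound_mono[OF bP]) (use d in \<open>simp add: c_def\<close>)
  let ?z = "\<lambda>(i, j). if i < m then (if j < m then (if i = j then of_real c else 0) else P $$ (i, j - m))
     else (if j < m then adj (P $$ (j, i - m)) else (if i = j then of_real c else 0))"
  let ?Z = "mat (2 * m) (2 * m) ?z"
  have cV: "(of_real c :: 'a) \<in> V" "(0::'a) \<in> V"
    using one_s[of "of_real c"] one_s[of 0] by (simp_all add: scaleC_of_real scaleR_conv_of_real)
  have zV: "?z (i, j) \<in> V" if "i < 2 * m" "j < 2 * m" for i j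
    using that cV PV Va by auto
  have "?Z \<in> mats_over (2 * m) V"
    using zV by (auto simp: mats_over_def dest!: elements_matD)
  moreover have "positive_mat (2 * m) ?Z" by (rule positive_mat_two_by_two[OF bPc c])
  ultimately have "positive_mat (2 * m) (map_mat \<iota> ?Z)"
    using coe by (simp add: unital_complete_order_embedding_def)
  then obtain y where y: "\<And>l l'. l < 2 * m \<Longrightarrow> l' < 2 * m \<Longrightarrow> \<iota> (?z (l, l')) = mm (2 * m) (mstar y) y l l'"
    unfolding positive_mat_iff by force
  define n where "n = 2 * m"
  define M where "M = mm n (mstar y) y"
  have Madj: "adj (M l l') = M l' l" for l l'
    by (simp add: M_def mm_def mstar_def adj_sum adj_mult adj_adj)
  have Mdiag: "M l l' = (if l = l' then of_real c else 0)" if "l < n" "l' < n" "l < m \<longleftrightarrow> l' < m" for l l'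
  proof -
    have "\<iota> (of_real c) = of_real c" "\<iota> 0 = 0"
      using isc[OF Vs(2,2), of "of_real c"] isc[OF Vs(2,2), of 0] i1[OF Vs(2,2)] by (simp_all add: scaleC_of_real scaleR_conv_of_real)
    then show ?thesis using y[of l l'] that by (auto simp: M_def n_def split: if_splits)
  qed
  have Moff: "M i (m + j) = \<iota> (P $$ (i, j))" if "i < m" "j < m" for i j
    using y[of i "m + j"] that by (simp add: M_def n_def)
  \<comment> \<open>Almost positivity loses \<open>n \<kappa>\<close>, which has to stay below the remaining \<open>\<delta>/2\<close>.\<close>
  define \<kappa> where "\<kappa> = \<delta> / (2 * (real n + 1))"
  have kap: "\<kappa> > 0" using d by (simp add: \<kappa>_def add_nonneg_pos)
  have kn: "\<kappa> * real n \<le> \<delta> / 2"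
  proof -
    have "\<kappa> * real n = (real n / (real n + 1)) * (\<delta> / 2)" by (simp add: \<kappa>_def field_simps)
    also have "\<dots> \<le> 1 * (\<delta> / 2)" using d by (intro mult_right_mono) auto
    finally show ?thesis by simp
  qed
  define R where "R = 1 + (\<Sum>k<n. \<Sum>l<n. norm (y k l))"
  have R: "norm (y k l) + 1 \<le> R" if "k < n" "l < n" for k l
  proof -
    have "norm (y k l) \<le> (\<Sum>l<n. norm (y k l))" using that by (intro member_le_sum) auto
    also have "\<dots> \<le> (\<Sum>k<n. \<Sum>l<n. norm (y k l))" using that by (intro member_le_sum[of k "{..<n}" "\<lambda>k. \<Sum>l<n. norm (y k l)"]) (auto intro: sum_nonneg)
    finally show ?thesis by (simp add: R_def)
  qed
  have R1: "R \<ge> 1" by (simp add: R_def sum_nonneg)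
  \<comment> \<open>\<open>n\<close> products with factors of norm at most \<open>R\<close> contribute at most \<open>2 n R e1 \<le> \<kappa>/4\<close>.\<close>
  define e1 where "e1 = min 1 (\<kappa> / (8 * (real n + 1) * R))"
  have e1: "e1 > 0" "e1 \<le> 1" "e1 \<le> \<kappa> / (8 * (real n + 1) * R)"
    using kap R1 by (auto simp: e1_def intro!: divide_pos_pos mult_pos_pos add_nonneg_pos)
  have "\<forall>k. \<exists>f. \<forall>l. vars (f l) \<subseteq> I \<and> norm (ev a (f l) - y k l) < e1"
    by (intro allI choice dense e1(1))
  from choice[OF this] obtain Y where Y: "\<forall>k l. vars (Y k l) \<subseteq> I \<and> norm (ev a (Y k l) - y k l) < e1" by (elim exE)
  \<comment> \<open>A bound for the sum of the coefficients of any entry of the pencil.\<close>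
  define \<beta> where "\<beta> = 1 + (\<Sum>i<m. \<Sum>j<m. \<Sum>x\<in>?D. cmod (B x $$ (i, j)))"
  have beta: "(\<Sum>x\<in>?D. cmod (B x $$ (i, j))) \<le> \<beta>" if "i < m" "j < m" for i j
  proof -
    have "(\<Sum>x\<in>?D. cmod (B x $$ (i, j))) \<le> (\<Sum>j<m. \<Sum>x\<in>?D. cmod (B x $$ (i, j)))"
      using that by (intro member_le_sum[of j "{..<m}" "\<lambda>j. \<Sum>x\<in>?D. cmod (B x $$ (i, j))"]) (auto intro: sum_nonneg)
    also have "\<dots> \<le> (\<Sum>i<m. \<Sum>j<m. \<Sum>x\<in>?D. cmod (B x $$ (i, j)))"
      using that by (intro member_le_sum[of i "{..<m}" "\<lambda>i. \<Sum>j<m. \<Sum>x\<in>?D. cmod (B x $$ (i, j))"]) (auto intro!: sum_nonneg)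
    finally show ?thesis by (simp add: \<beta>_def)
  qed
  have beta1: "\<beta> \<ge> 1" by (simp add: \<beta>_def sum_nonneg)
  define e where "e = \<kappa> / (4 * \<beta>)"
  have e0: "e > 0" using kap beta1 by (simp add: e_def)
  show ?thesis
  proof (intro exI[of _ e] conjI allI impI e0)
    fix p :: "'a \<Rightarrow> 'i star_expr"
    assume p1: "p 1 = Scal 1" and pv: "\<forall>x\<in>S. vars (p x) \<subseteq> I"
      and pa: "\<forall>x\<in>?D. norm (ev a (p x) - \<iota> x) \<le> e"
    have fin1: "finite (insert 1 ?D)" using D by simp
    have "\<exists>t. vars t \<subseteq> I \<and> ev a t = B 1 $$ (i, j) *\<^sub>C 1 + (\<Sum>x\<in>?D. B x $$ (i, j) *\<^sub>C ev a (p x)) \<and>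
        (\<forall>N A u v. (\<forall>i\<in>I. A i \<in> carrier_mat N N) \<longrightarrow> cip N (act N (evm N A t) u) v
          = B 1 $$ (i, j) * cip N u v + (\<Sum>x\<in>?D. B x $$ (i, j) * cip N (act N (evm N A (p x)) u) v))" for i j
    proof (rule star_expr_sum_cip[OF fin1, where f = "\<lambda>x. Times (Scal (B x $$ (i, j))) (p x)" and 'b = 'b])
      fix t
      assume t: "vars t \<subseteq> (\<Union>k\<in>insert 1 ?D. vars (Times (Scal (B k $$ (i, j))) (p k)))"
        "\<And>a :: 'i \<Rightarrow> 'b. ev a t = (\<Sum>k\<in>insert 1 ?D. ev a (Times (Scal (B k $$ (i, j))) (p k)))"
        "\<And>N A u v. (\<forall>k\<in>insert 1 ?D. \<forall>x\<in>vars (Times (Scal (B k $$ (i, j))) (p k)). A x \<in> carrier_mat N N) \<Longrightarrow>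
          cip N (act N (evm N A t) u) v = (\<Sum>k\<in>insert 1 ?D. cip N (act N (evm N A (Times (Scal (B k $$ (i, j))) (p k))) u) v)"
      have "vars t \<subseteq> I" using t(1) pv one by auto
      moreover have "ev a t = B 1 $$ (i, j) *\<^sub>C 1 + (\<Sum>x\<in>?D. B x $$ (i, j) *\<^sub>C ev a (p x))"
        unfolding t(2) using D(1) by (simp add: p1 scaleC_mult_left)
      moreover have "cip N (act N (evm N A t) u) v
          = B 1 $$ (i, j) * cip N u v + (\<Sum>x\<in>?D. B x $$ (i, j) * cip N (act N (evm N A (p x)) u) v)"
        if A: "\<forall>i\<in>I. A i \<in> carrier_mat N N" for N A u v
      proof -
        have sc: "cip N (act N (evm N A (Times (Scal k) s)) u) v = k * cip N (act N (evm N A s) u) v"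
          if "vars s \<subseteq> I" for k s
        proof -
          have s: "evm N A s \<in> carrier_mat N N" using A that by (intro evm_carrier) auto
          have k: "k \<cdot>\<^sub>m 1\<^sub>m N \<in> carrier_mat N N" by simp
          have "cip N (act N (evm N A (Times (Scal k) s)) u) v = cip N (\<lambda>p. k * act N (evm N A s) u p) v"
            by (rule cip_cong) (simp_all add: act_mult[OF k s] act_scalar)
          then show ?thesis by (simp only: cip_scale_left)
        qed
        have "cip N (act N (evm N A t) u) v = (\<Sum>k\<in>insert 1 ?D. cip N (act N (evm N A (Times (Scal (B k $$ (i, j))) (p k))) u) v)"
          by (rule t(3)) (use A pv one in auto)
        also have "\<dots> = (\<Sum>k\<in>insert 1 ?D. B k $$ (i, j) * cip N (act N (evm N A (p k)) u) v)"
          by (rule sum.cong[OF refl], rule sc) (use pv one in auto)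
        also have "\<dots> = B 1 $$ (i, j) * cip N (act N (evm N A (p 1)) u) v + (\<Sum>x\<in>?D. B x $$ (i, j) * cip N (act N (evm N A (p x)) u) v)"
          using D(1) by simp
        also have "cip N (act N (evm N A (p 1)) u) v = cip N u v"
          by (rule cip_cong) (simp_all add: p1 act_scalar del: smult_one)
        finally show ?thesis .
      qed
      ultimately show ?thesis by blast
    qed
    then have "\<forall>i. \<exists>f. \<forall>j. vars (f j) \<subseteq> I \<and> ev a (f j) = B 1 $$ (i, j) *\<^sub>C 1 + (\<Sum>x\<in>?D. B x $$ (i, j) *\<^sub>C ev a (p x)) \<and>
        (\<forall>N A u v. (\<forall>i\<in>I. A i \<in> carrier_mat N N) \<longrightarrow> cip N (act N (evm N A (f j)) u) v
          = B 1 $$ (i, j) * cip N u v + (\<Sum>x\<in>?D. B x $$ (i, j) * cip N (act N (evm N A (p x)) u) v))"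
      by (intro allI choice)
    from choice[OF this] obtain T where T: "\<forall>i j. vars (T i j) \<subseteq> I \<and> ev a (T i j) = B 1 $$ (i, j) *\<^sub>C 1 + (\<Sum>x\<in>?D. B x $$ (i, j) *\<^sub>C ev a (p x)) \<and>
        (\<forall>N A u v. (\<forall>i\<in>I. A i \<in> carrier_mat N N) \<longrightarrow> cip N (act N (evm N A (T i j)) u) v
          = B 1 $$ (i, j) * cip N u v + (\<Sum>x\<in>?D. B x $$ (i, j) * cip N (act N (evm N A (p x)) u) v))"
      by (elim exE)
    have Tv: "vars (T i j) \<subseteq> I" for i j using T by blast
    have Te: "norm (ev a (T i j) - \<iota> (P $$ (i, j))) \<le> \<kappa> / 4" if ij: "i < m" "j < m" for i j
    proof -
      have "ev a (T i j) - \<iota> (P $$ (i, j)) = (\<Sum>x\<in>?D. B x $$ (i, j) *\<^sub>C (ev a (p x) - \<iota> x))"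
        using T iP[OF ij] by (simp add: cvec.scale_right_diff_distrib sum_subtractf)
      also have "norm \<dots> \<le> (\<Sum>x\<in>?D. cmod (B x $$ (i, j)) * e)"
        by (rule order_trans[OF norm_sum], rule sum_mono) (use pa in \<open>simp add: norm_scaleC mult_left_mono\<close>)
      also have "\<dots> \<le> \<beta> * e" unfolding sum_distrib_right[symmetric] using beta[OF ij] e0 by (intro mult_right_mono) auto
      also have "\<dots> = \<kappa> / 4" using beta1 by (simp add: e_def)
      finally show ?thesis .
    qed
    define Zt where "Zt = (\<lambda>l l'. if l < m then (if l' < m then Scal (if l = l' then of_real c else 0) else T l (l' - m))
         else (if l' < m then star (T l' (l - m)) else Scal (if l = l' then of_real c else 0)))"
    have Ztv: "vars (Zt l l') \<subseteq> I" for l l' using Tv by (simp add: Zt_def)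
    have Ze: "norm (ev a (Zt l l') - M l l') \<le> \<kappa> / 4" if ll: "l < n" "l' < n" for l l'
    proof -
      have half: "l - m < m" if "l < n" "\<not> l < m" for l using that by (simp add: n_def)
      consider "l < m \<longleftrightarrow> l' < m" | "l < m" "\<not> l' < m" | "\<not> l < m" "l' < m" by blast
      then show ?thesis
      proof cases
        case 1
        have "ev a (Zt l l') = M l l'"
          using Mdiag[OF ll 1] 1 by (auto simp: Zt_def scaleC_of_real scaleR_conv_of_real)
        then show ?thesis using kap by simp
      next
        case 2
        have h: "l' - m < m" by (rule half[OF ll(2) 2(2)])
        have "M l l' = \<iota> (P $$ (l, l' - m))" using Moff[OF 2(1) h] 2(2) by simp
        then show ?thesis using Te[OF 2(1) h] 2 by (simp add: Zt_def)
      next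
        case 3
        have h: "l - m < m" by (rule half[OF ll(1) 3(1)])
        have "M l l' = adj (\<iota> (P $$ (l', l - m)))" using Moff[OF 3(2) h] 3(1) Madj[of l' l] by simp
        moreover have "ev a (Zt l l') = adj (ev a (T l' (l - m)))" using 3 by (simp add: Zt_def ev_star)
        ultimately have "ev a (Zt l l') - M l l' = adj (ev a (T l' (l - m)) - \<iota> (P $$ (l', l - m)))" by (simp add: adj_diff)
        then show ?thesis using Te[OF 3(2) h] by simp
      qed
    qed
    have "\<exists>g. vars g \<subseteq> I \<and> ev a g = (\<Sum>k<n. adj (ev a (Y k l)) * ev a (Y k l')) \<and>
        (\<forall>N A u v. (\<forall>i\<in>I. A i \<in> carrier_mat N N) \<longrightarrow> cip N (act N (evm N A g) u) v
          = (\<Sum>k<n. cip N (act N (mat_adjoint (evm N A (Y k l)) * evm N A (Y k l')) u) v))" for l l'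
    proof (rule star_expr_sum_cip[OF finite_lessThan[of n], where f = "\<lambda>k. Times (star (Y k l)) (Y k l')" and 'b = 'b])
      fix t
      assume t: "vars t \<subseteq> (\<Union>k<n. vars (Times (star (Y k l)) (Y k l')))"
        "\<And>a :: 'i \<Rightarrow> 'b. ev a t = (\<Sum>k<n. ev a (Times (star (Y k l)) (Y k l')))"
        "\<And>N A u v. (\<forall>k\<in>{..<n}. \<forall>x\<in>vars (Times (star (Y k l)) (Y k l')). A x \<in> carrier_mat N N) \<Longrightarrow>
          cip N (act N (evm N A t) u) v = (\<Sum>k<n. cip N (act N (evm N A (Times (star (Y k l)) (Y k l'))) u) v)"
      have "vars t \<subseteq> I" using t(1) Y by fastforce
      moreover have "ev a t = (\<Sum>k<n. adj (ev a (Y k l)) * ev a (Y k l'))" unfolding t(2) by (simp add: ev_star)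
      moreover have "cip N (act N (evm N A t) u) v = (\<Sum>k<n. cip N (act N (mat_adjoint (evm N A (Y k l)) * evm N A (Y k l')) u) v)"
        if A: "\<forall>i\<in>I. A i \<in> carrier_mat N N" for N A u v
      proof -
        have "evm N A (star (Y k l)) = mat_adjoint (evm N A (Y k l))" for k
          by (rule evm_star) (use A Y in blast)
        moreover have "cip N (act N (evm N A t) u) v = (\<Sum>k<n. cip N (act N (evm N A (Times (star (Y k l)) (Y k l'))) u) v)"
          by (rule t(3)) (use A Y in fastforce)
        ultimately show ?thesis by simp
      qed
      ultimately show ?thesis by blast
    qed
    then have "\<forall>l. \<exists>g. \<forall>l'. vars (g l') \<subseteq> I \<and> ev a (g l') = (\<Sum>k<n. adj (ev a (Y k l)) * ev a (Y k l')) \<and>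
        (\<forall>N A u v. (\<forall>i\<in>I. A i \<in> carrier_mat N N) \<longrightarrow> cip N (act N (evm N A (g l')) u) v
          = (\<Sum>k<n. cip N (act N (mat_adjoint (evm N A (Y k l)) * evm N A (Y k l')) u) v))"
      by (intro allI choice)
    from choice[OF this] obtain g where g: "\<forall>l l'. vars (g l l') \<subseteq> I \<and> ev a (g l l') = (\<Sum>k<n. adj (ev a (Y k l)) * ev a (Y k l')) \<and>
        (\<forall>N A u v. (\<forall>i\<in>I. A i \<in> carrier_mat N N) \<longrightarrow> cip N (act N (evm N A (g l l')) u) v
          = (\<Sum>k<n. cip N (act N (mat_adjoint (evm N A (Y k l)) * evm N A (Y k l')) u) v))"
      by (elim exE)
    have gv: "vars (g l l') \<subseteq> I" for l l' using g by blast
    have ge: "norm (ev a (g l l') - M l l') \<le> \<kappa> / 4" if ll: "l < n" "l' < n" for l l'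
    proof -
      have "ev a (g l l') - M l l' = (\<Sum>k<n. adj (ev a (Y k l)) * ev a (Y k l') - adj (y k l) * y k l')"
        using g by (simp add: M_def mm_def mstar_def sum_subtractf)
      also have "norm \<dots> \<le> (\<Sum>k<n. 2 * R * e1)"
      proof (rule order_trans[OF norm_sum], rule sum_mono)
        fix k assume "k \<in> {..<n}"
        then have k: "k < n" by simp
        have "norm (ev a (Y k l')) \<le> norm (y k l') + norm (ev a (Y k l') - y k l')" by (rule norm_triangle_sub)
        then have "norm (ev a (Y k l')) \<le> R" using Y[rule_format, of k l'] R[OF k ll(2)] e1 by linarith
        then show "norm (adj (ev a (Y k l)) * ev a (Y k l') - adj (y k l) * y k l') \<le> 2 * R * e1"
          using Y[rule_format, of k l] Y[rule_format, of k l'] R[OF k ll(1)] by (intro norm_adj_mult_diff_le) auto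
      qed
      also have "\<dots> = real n * (2 * R * e1)" by simp
      also have "\<dots> \<le> (real n + 1) * (2 * R * (\<kappa> / (8 * (real n + 1) * R)))"
        using e1 R1 kap by (intro mult_mono mult_left_mono) auto
      also have "\<dots> = \<kappa> / 4"
      proof -
        have gen: "x * (2 * R * (\<kappa> / (8 * x * R))) = \<kappa> / 4" if "x > 0" for x :: real
          using that R1 by (simp add: field_simps)
        show ?thesis by (rule gen) (simp add: add_nonneg_pos)
      qed
      finally show ?thesis .
    qed
    \<comment> \<open>The polynomials to be controlled: the entries of \<open>Y* Y - Zt\<close>.\<close>
    define E where "E = (\<lambda>l l'. Minus (g l l') (Zt l l'))"
    have Ev: "vars (E l l') \<subseteq> I" for l l' using gv Ztv by (simp add: E_def)
    have Ee: "norm (ev a (E l l')) \<le> \<kappa> / 2" if ll: "l < n" "l' < n" for l l'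
    proof -
      have "ev a (E l l') = (ev a (g l l') - M l l') - (ev a (Zt l l') - M l l')" by (simp add: E_def)
      then show ?thesis using ge[OF ll] Ze[OF ll] norm_triangle_ineq4[of "ev a (g l l') - M l l'" "ev a (Zt l l') - M l l'"] by simp
    qed
    define X where "X = (\<lambda>(l, l'). (E l l', \<kappa> / 2)) ` ({..<n} \<times> {..<n})"
    have "op_norm (pencil_mat S m N B (\<lambda>x\<in>S. evm N A (p x))) \<le> \<delta> + cstar_mat_norm (pencil_sys S m B)"
      if A: "\<forall>i\<in>I. A i \<in> carrier_mat N N" and bd: "\<forall>(t, \<zeta>)\<in>X. op_norm (evm N A t) \<le> norm (ev a t) + \<zeta>" for N A
    proof -
      have ec: "evm N A t \<in> carrier_mat N N" if "vars t \<subseteq> I" for t using A that by (intro evm_carrier) auto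
      have Eop: "op_norm (evm N A (E l l')) \<le> \<kappa>" if "l < n" "l' < n" for l l'
      proof -
        have "(E l l', \<kappa> / 2) \<in> X" using that by (auto simp: X_def)
        then have "op_norm (evm N A (E l l')) \<le> norm (ev a (E l l')) + \<kappa> / 2" using bd by blast
        then show ?thesis using Ee[OF that] by simp
      qed
      have gram: "- Re (\<Sum>l<n. \<Sum>l'<n. cip N (act N (evm N A (Zt l l')) (u l')) (u l)) \<le> \<kappa> * real n * (\<Sum>l<n. (cnorm N (u l))\<^sup>2)" for u
      proof (rule approximate_gram_positive[where Y = "\<lambda>k l. evm N A (Y k l)"])
        show "evm N A (Y k l) \<in> carrier_mat N N" for k l using Y by (intro ec) blast
        show "\<kappa> \<ge> 0" using kap by simp
        fix l l' :: nat and u v :: "nat \<Rightarrow> complex" assume ll: "l < n" "l' < n"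
        have "(\<Sum>k<n. cip N (act N (mat_adjoint (evm N A (Y k l)) * evm N A (Y k l')) u) v) = cip N (act N (evm N A (g l l')) u) v"
          using g A by simp
        then have "(\<Sum>k<n. cip N (act N (mat_adjoint (evm N A (Y k l)) * evm N A (Y k l')) u) v) - cip N (act N (evm N A (Zt l l')) u) v
          = cip N (act N (evm N A (E l l')) u) v"
          unfolding E_def by (simp only: cip_act_Minus[OF ec[OF gv] ec[OF Ztv]])
        moreover have "cmod (cip N (act N (evm N A (E l l')) u) v) \<le> \<kappa> * (cnorm N u * cnorm N v)"
          using cmod_cip_act_le[OF ec[OF Ev], of l l' u v] mult_right_mono[OF Eop[OF ll], of "cnorm N u * cnorm N v"] by simp
        ultimately show "cmod ((\<Sum>k<n. cip N (act N (mat_adjoint (evm N A (Y k l)) * evm N A (Y k l')) u) v) - cip N (act N (evm N A (Zt l l')) u) v)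
          \<le> \<kappa> * (cnorm N u * cnorm N v)" by simp
      qed
      have Zm: "evm N A (Zt l l') = (if l < m then (if l' < m then (if l = l' then of_real c else 0) \<cdot>\<^sub>m 1\<^sub>m N else evm N A (T l (l' - m)))
         else (if l' < m then mat_adjoint (evm N A (T l' (l - m))) else (if l = l' then of_real c else 0) \<cdot>\<^sub>m 1\<^sub>m N))" for l l'
      proof -
        have "evm N A (star (T l' (l - m))) = mat_adjoint (evm N A (T l' (l - m)))"
          by (rule evm_star) (use A Tv in blast)
        then show ?thesis by (simp add: Zt_def)
      qed
      let ?A = "\<lambda>x\<in>S. evm N A (p x)"
      have form: "bform m N (blk S m B ?A) \<xi> \<eta> = (\<Sum>i<m. \<Sum>j<m. cip N (act N (evm N A (T i j)) (\<xi> j)) (\<eta> i))" for \<xi> \<eta>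
        unfolding bform_blk using T A by (intro sum.cong refl) (auto intro!: sum.cong)
      have bound: "cmod (bform m N (blk S m B ?A) \<xi> \<eta>) \<le> (c + \<kappa> * real (2 * m)) * (bnorm m N \<xi> * bnorm m N \<eta>)" for \<xi> \<eta>
        by (rule block_positive_form_bound[where X = "\<lambda>i j. evm N A (T i j)", OF _ form])
          (use c kap gram ec[OF Tv] in \<open>simp_all add: Zm n_def\<close>)
      have "op_norm (pencil_mat S m N B ?A) \<le> c + \<kappa> * real (2 * m)"
        by (rule op_norm_pencil_le[OF B _ one _ bound]) (use ec pv c kap in auto)
      also have "\<dots> \<le> c0 + \<delta>" using kn by (simp add: c_def n_def)
      finally show ?thesis by (simp add: c0_def P_def)
    qed
    note op_bound = this
    show "\<exists>X. finite X \<and> (\<forall>(t, \<zeta>)\<in>X. vars t \<subseteq> I \<and> \<zeta> > 0) \<and>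
        (\<forall>N A. (\<forall>i\<in>I. A i \<in> carrier_mat N N) \<longrightarrow> (\<forall>(t, \<zeta>)\<in>X. op_norm (evm N A t) \<le> norm (ev a t) + \<zeta>) \<longrightarrow>
          op_norm (pencil_mat S m N B (\<lambda>x\<in>S. evm N A (p x))) \<le> \<delta> + cstar_mat_norm (pencil_sys S m B))"
    proof (intro exI[of _ X] conjI allI impI)
      show "finite X" by (simp add: X_def)
      show "\<forall>(t, \<zeta>)\<in>X. vars t \<subseteq> I \<and> \<zeta> > 0" using Ev kap by (auto simp: X_def)
    qed (rule op_bound; assumption)
  qed
qed

text \<open>Apply \<open>pencil_approximation\<close> to the finitely many pencils in the parameter, with \<open>p 1 = 1\<close> because microstates
  are exactly unital.\<close>
lemma sys_states_target:
  fixes V S :: "'a::unital_cstar_algebra set" and \<iota> :: "'a \<Rightarrow> 'b::unital_cstar_algebra" and a :: "'i \<Rightarrow> 'b"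
  assumes nc: "norm_controlled I a \<Theta> \<Omega>"
    and V: "operator_system V" and one: "1 \<in> S" and SV: "S \<subseteq> V"
    and coe: "unital_complete_order_embedding V \<iota>"
    and dense: "\<And>x e. e > 0 \<Longrightarrow> \<exists>t. vars t \<subseteq> I \<and> norm (ev a t - x) < e"
    and th': "\<theta>' \<in> sys_params S" and J: "J \<subseteq> S" and eta: "\<eta> > 0"
  shows "\<exists>p. \<exists>\<theta>\<in>\<Theta>. (\<forall>x\<in>J. vars (p x) \<subseteq> I \<and> norm (ev a (p x) - \<iota> x) < \<eta>) \<and>
        (\<forall>N\<ge>1. \<forall>A\<in>\<Omega> \<theta> N. \<exists>A'\<in>sys_states S \<theta>' N. \<forall>x\<in>J. A' x = evm N A (p x))"
proof -
  define \<delta> F where "\<delta> = fst \<theta>'" and "F = snd \<theta>'"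
  have d: "\<delta> > 0" and F: "finite F" "F \<subseteq> matrix_tuples S" using th' by (auto simp: sys_params_def \<delta>_def F_def)
  define G where "G = (\<lambda>f p X. finite X \<and> (\<forall>(t, \<zeta>)\<in>X. vars t \<subseteq> I \<and> \<zeta> > 0) \<and>
    (\<forall>N A. (\<forall>i\<in>I. A i \<in> carrier_mat N N) \<longrightarrow> (\<forall>(t, \<zeta>)\<in>X. op_norm (evm N A t) \<le> norm (ev a t) + \<zeta>) \<longrightarrow>
      op_norm (pencil_mat S (fst f) N (snd f) (\<lambda>x\<in>S. evm N A (p x))) \<le> \<delta> + cstar_mat_norm (pencil_sys S (fst f) (snd f))))"
  define H where "H = (\<lambda>f e p. p 1 = Scal 1 \<longrightarrow> (\<forall>x\<in>S. vars (p x) \<subseteq> I) \<longrightarrow>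
    (\<forall>x\<in>{x \<in> S - {1}. snd f x \<noteq> 0\<^sub>m (fst f) (fst f)}. norm (ev a (p x) - \<iota> x) \<le> e) \<longrightarrow> (\<exists>X. G f p X))"
  have "\<forall>f. \<exists>e. f \<in> F \<longrightarrow> e > 0 \<and> (\<forall>p. H f e p)"
  proof (intro allI)
    fix f
    show "\<exists>e. f \<in> F \<longrightarrow> e > 0 \<and> (\<forall>p. H f e p)"
    proof (cases "f \<in> F")
      case True
      then have f: "(fst f, snd f) \<in> matrix_tuples S" using F by auto
      have "\<exists>e>0. \<forall>p. H f e p"
        unfolding H_def G_def by (rule pencil_approximation[OF V one SV coe dense f d])
      then show ?thesis by (elim exE) (intro exI impI)
    qed simp
  qed
  from choice[OF this] obtain e where e: "\<forall>f. f \<in> F \<longrightarrow> e f > 0 \<and> (\<forall>p. H f (e f) p)" by (elim exE)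
  define e0 where "e0 = Min (insert \<eta> (e ` F))"
  have "0 < e f" if "f \<in> F" for f using e that by blast
  then have e0: "e0 > 0" using F eta by (simp add: e0_def)
  have e0_le: "e0 \<le> \<eta>" "f \<in> F \<Longrightarrow> e0 \<le> e f" for f using F by (simp_all add: e0_def)
  have "\<forall>x. \<exists>t. vars t \<subseteq> I \<and> norm (ev a t - \<iota> x) < e0" using dense[OF e0] by (intro allI)
  from choice[OF this] obtain q where q: "\<forall>x. vars (q x) \<subseteq> I \<and> norm (ev a (q x) - \<iota> x) < e0" by (elim exE)
  define p where "p = (\<lambda>x. if x = 1 then Scal 1 else q x)"
  have "\<iota> 1 = 1" using coe by (simp add: unital_complete_order_embedding_def)
  then have pd: "norm (ev a (p x) - \<iota> x) < e0" for x using q e0 by (simp add: p_def)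
  have pv: "vars (p x) \<subseteq> I" for x using q by (simp add: p_def)
  have p1: "p 1 = Scal 1" by (simp add: p_def)
  have "\<forall>f. \<exists>X. f \<in> F \<longrightarrow> G f p X"
  proof (intro allI)
    fix f
    show "\<exists>X. f \<in> F \<longrightarrow> G f p X"
    proof (cases "f \<in> F")
      case True
      then have h: "H f (e f) p" using e by blast
      have "norm (ev a (p x) - \<iota> x) \<le> e f" for x using pd[of x] e0_le(2)[OF True] by simp
      then have "\<exists>X. G f p X" using h p1 pv unfolding H_def by blast
      then show ?thesis by (elim exE) (intro exI impI)
    qed simp
  qed
  from choice[OF this] obtain X where X: "\<forall>f. f \<in> F \<longrightarrow> G f p (X f)" by (elim exE)
  have "\<exists>\<theta>\<in>\<Theta>. \<forall>N. \<forall>A\<in>\<Omega> \<theta> N. \<forall>(t, \<zeta>)\<in>(\<Union>f\<in>F. X f). op_norm (evm N A t) \<le> norm (ev a t) + \<zeta>"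
  proof (rule norm_controlled_finite[OF nc])
    show "finite (\<Union>f\<in>F. X f)" using F X unfolding G_def by (intro finite_UN_I) blast+
    show "\<forall>(t, \<zeta>)\<in>(\<Union>f\<in>F. X f). vars t \<subseteq> I \<and> \<zeta> > 0" using X unfolding G_def by blast
  qed
  then obtain \<theta> where th: "\<theta> \<in> \<Theta>"
    and bd: "\<forall>N. \<forall>A\<in>\<Omega> \<theta> N. \<forall>(t, \<zeta>)\<in>(\<Union>f\<in>F. X f). op_norm (evm N A t) \<le> norm (ev a t) + \<zeta>"
    by (elim bexE)
  have state: "(\<lambda>x\<in>S. evm N A (p x)) \<in> sys_states S \<theta>' N" if A: "A \<in> \<Omega> \<theta> N" for N A
  proof -
    have Ac: "\<forall>i\<in>I. A i \<in> carrier_mat N N" using nc th A unfolding norm_controlled_def by blast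
    have "op_norm (pencil_mat S (fst f) N (snd f) (\<lambda>x\<in>S. evm N A (p x))) \<le> \<delta> + cstar_mat_norm (pencil_sys S (fst f) (snd f))"
      if "f \<in> F" for f
    proof -
      have "\<forall>(t, \<zeta>)\<in>X f. op_norm (evm N A t) \<le> norm (ev a t) + \<zeta>" using bd A that by blast
      moreover have "G f p (X f)" using X that by blast
      ultimately show ?thesis using Ac unfolding G_def by blast
    qed
    moreover have "evm N A (p x) \<in> carrier_mat N N" for x using Ac pv[of x] by (intro evm_carrier) blast
    moreover have "(1::complex) \<cdot>\<^sub>m 1\<^sub>m N = 1\<^sub>m N" by (intro eq_matI) auto
    ultimately show ?thesis using one p1
      by (auto simp: system_microstates_def \<delta>_def F_def split_beta)
  qed
  show ?thesis
  proof (intro exI[of _ p] bexI[OF _ th] conjI ballI allI impI)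
    fix x assume "x \<in> J"
    show "vars (p x) \<subseteq> I" by (rule pv)
    show "norm (ev a (p x) - \<iota> x) < \<eta>" using pd[of x] e0_le(1) by simp
  next
    fix N A assume "A \<in> \<Omega> \<theta> N"
    then show "\<exists>A'\<in>sys_states S \<theta>' N. \<forall>x\<in>J. A' x = evm N A (p x)"
      using J by (intro bexI[OF _ state]) auto
  qed
qed

section \<open>The entropy of an operator system\<close>

text \<open>A C*-subalgebra is a linear subspace, so with \<open>\<iota> ` S\<close> it contains the image of the span.\<close>
lemma cstar_generates_spanning_set:
  fixes V S :: "'a::unital_cstar_algebra set" and \<iota> :: "'a \<Rightarrow> 'b::unital_cstar_algebra"
  assumes V: "operator_system V" and span: "cspan S = V"
    and coe: "unital_complete_order_embedding V \<iota>" and gen: "cstar_generates (\<iota> ` V)"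
  shows "cstar_generates (\<iota> ` S)"
proof -
  have Vs: "csubspace V" using V by (simp add: operator_system_def)
  have V0: "0 \<in> V" using Vs by (rule cvec.subspace_0)
  have add: "\<iota> (x + y) = \<iota> x + \<iota> y" and sc: "\<iota> (k *\<^sub>C x) = k *\<^sub>C \<iota> x" if "x \<in> V" "y \<in> V" for x y k
    using coe that by (auto simp: unital_complete_order_embedding_def)
  have i0: "\<iota> 0 = 0" using add[OF V0 V0] by simp
  have "\<iota> ` V \<subseteq> B" if B: "cstar_subalgebra B" "\<iota> ` S \<subseteq> B" for B
  proof -
    have Bs: "csubspace B" using B by (simp add: cstar_subalgebra_def)
    have "csubspace {x \<in> V. \<iota> x \<in> B}"
    proof (rule cvec.subspaceI)
      show "0 \<in> {x \<in> V. \<iota> x \<in> B}" using V0 i0 cvec.subspace_0[OF Bs] by simp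
    next
      fix x y assume "x \<in> {x \<in> V. \<iota> x \<in> B}" "y \<in> {x \<in> V. \<iota> x \<in> B}"
      then show "x + y \<in> {x \<in> V. \<iota> x \<in> B}"
        using add cvec.subspace_add[OF Vs] cvec.subspace_add[OF Bs] by simp
    next
      fix k x assume "x \<in> {x \<in> V. \<iota> x \<in> B}"
      then show "k *\<^sub>C x \<in> {x \<in> V. \<iota> x \<in> B}"
        using sc[of x x k] cvec.subspace_scale[OF Vs] cvec.subspace_scale[OF Bs] by simp
    qed
    moreover have "S \<subseteq> {x \<in> V. \<iota> x \<in> B}" using B(2) span cvec.span_superset[of S] by auto
    ultimately have "cspan S \<subseteq> {x \<in> V. \<iota> x \<in> B}" by (intro cvec.span_minimal)
    then show ?thesis using span by auto
  qed
  then have "cstar_subalgebra hull (\<iota> ` V) \<subseteq> cstar_subalgebra hull (\<iota> ` S)"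
    by (auto simp: hull_def)
  then show ?thesis using gen by (auto simp: cstar_generates_def)
qed

theorem theorem9p1:
  fixes V0 S :: "'a::unital_cstar_algebra set"
    and \<iota> :: "'a \<Rightarrow> 'b::unital_cstar_algebra"
    and I :: "'i set" and a :: "'i \<Rightarrow> 'b" and C :: real
  assumes "operator_system V0"
    and "adj ` S = S" and "1 \<in> S" and "cspan S = V0"
    and "is_cstar_max V0 \<iota>"
    and "cstar_generates (a ` I)" and "\<forall>i\<in>I. norm (a i) \<le> C"
  shows "htop I a C =
    (SUP (\<epsilon>, E) \<in> {0<..} \<times> {E. finite E \<and> E \<subseteq> S}.
     INF (\<delta>, F) \<in> {0<..} \<times> {F. finite F \<and> F \<subseteq> matrix_tuples S}.
       orbit_entropy_rate E \<epsilon> (system_microstates S F \<delta>))"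
proof -
  have coe: "unital_complete_order_embedding V0 \<iota>" and gen: "cstar_generates (\<iota> ` V0)"
    using assms(5) by (simp_all add: is_cstar_max_def)
  have SV: "S \<subseteq> V0" using assms(4) cvec.span_superset[of S] by auto
  have dense_a: "\<exists>t. vars t \<subseteq> I \<and> norm (ev a t - x) < e" if "e > 0" for x e
    using assms(6) that by (rule star_expr_dense)
  have dense_S: "\<exists>t. vars t \<subseteq> S \<and> norm (ev \<iota> t - x) < e" if "e > 0" for x e
    using cstar_generates_spanning_set[OF assms(1,4) coe gen] that by (rule star_expr_dense)
  have nc_a: "norm_controlled I a (poly_params I) (poly_states I a C)"
    by (rule norm_controlled_poly_states)
  have nc_S: "norm_controlled S \<iota> (sys_params S) (sys_states S)"
    by (rule norm_controlled_sys_states[OF assms(1,3,4,5)])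
  let ?ha = "SUP (\<epsilon>, E) \<in> {0<..} \<times> {E. finite E \<and> E \<subseteq> I}. INF \<theta>\<in>poly_params I. orbit_entropy_rate E \<epsilon> (poly_states I a C \<theta>)"
  let ?hS = "SUP (\<epsilon>, E) \<in> {0<..} \<times> {E. finite E \<and> E \<subseteq> S}. INF \<theta>\<in>sys_params S. orbit_entropy_rate E \<epsilon> (sys_states S \<theta>)"
  have "?ha \<le> ?hS"
  proof (rule entropy_le_of_approximants[OF nc_a _ dense_S])
    show "A x \<in> carrier_mat N N" if "\<theta> \<in> sys_params S" "A \<in> sys_states S \<theta> N" "x \<in> S" for \<theta> N A x
      using that(2,3) by (rule sys_states_carrier)
  qed (assumption | rule sys_states_target[OF nc_a assms(1,3) SV coe dense_a])+
  moreover have "?hS \<le> ?ha"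
  proof (rule entropy_le_of_approximants[OF nc_S _ dense_a])
    show "A i \<in> carrier_mat N N" if "\<theta> \<in> poly_params I" "A \<in> poly_states I a C \<theta> N" "i \<in> I" for \<theta> N A i
      using that by (auto simp: microstates_def)
  qed (assumption | rule poly_states_target[OF nc_S dense_S assms(7)])+
  ultimately show ?thesis
    by (simp add: htop_def poly_params_def sys_params_def split_beta)
qed

end
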